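(* Let $\Bbbk$ be a field, let $\mathscr A=\bigoplus_{n\ge0}A_n$ be a nice tower of algebras over $\Bbbk$, and let $P\in A_p\text{-pmod}$ and $N\in A_n\text{-fmod}$. Let $r_{[P]}^*$ denote the adjoint of right multiplication by $[P]$, i.e. the operator on $\mathcal G^f(\mathscr A)$ determined by $\langle x,r_{[P]}^*(y)\rangle=\langle x[P],y\rangle$ for all $x\in\mathcal K(\mathscr A)$, $y\in\mathcal G^f(\mathscr A)$. Then $$r_{[P]}^*([N])=\begin{cases}0&\text{if }p>n,\\ [\mathsf{TR}_P(N)]&\text{if }p\le n,\end{cases}$$ where $\mathsf{TR}_P(N)=P^\psi\otimes_{A_p}\mathrm{Res}^{A_n}_{A_{n-p}\otimes A_p}N\in A_{n-p}\text{-fmod}$.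
   Context: **Nice graded algebra.** A $\mathbb Z$-graded $\Bbbk$-algebra $R=\bigoplus_{i\in\mathbb Z}R_i$ is *nice* if (1) there is a positively (respectively negatively) graded ideal $I\subseteq\bigoplus_{i>0}R_i$ (respectively $I\subseteq\bigoplus_{i<0}R_i$) such that all graded simple $R$-modules are annihilated by $I$, and (2) $R/I$ is a finite-dimensional algebra. **Nice tower of algebras.** A graded $\Bbbk$-algebra $\mathscr A=\bigoplus_{n\ge0}A_n$ such that for all $m,n$: (TA1) $A_n$ is a nice graded algebra, and $A_0=\Bbbk$; (TA2) there is a unital algebra morphism $A_n\otimes A_m\to A_{n+m}$; (TA3) $A_{m+n}$ is a two-sided projective $A_n\otimes A_m$-module; (TA4) there exists an anti-automorphism $\psi$ of $A_n$. **Notation.** $\boxtimes=\otimes_\Bbbk$. $A_n\text{-fmod}$ and $A_n\text{-pmod}$ are the categories of graded finite-dimensional, respectively graded finitely generated projective, left $A_n$-modules. $\mathcal G^f(\mathscr A)=\bigoplus_nK_0(A_n\text{-fmod})$ and $\mathcal K(\mathscr A)=\bigoplus_nK_0(A_n\text{-pmod})$, which are $\mathbb Z[q,q^{-1}]$-modules with $q$ acting by grading shift; $\mathrm{gdim}_\Bbbk$ is the graded dimension. For a left module $P$, $P^\psi$ is the right module on the same space with $m\cdot a:=\psi(a)m$. The product on $\mathcal K(\mathscr A)$ is $[P][P']=[A_{n+m}\otimes_{A_n\otimes A_m}(P\boxtimes P')]$ for $P\in A_n\text{-pmod}$, $P'\in A_m\text{-pmod}$. **Pairing.** $\langle-,-\rangle:\mathcal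 K(\mathscr A)\times\mathcal G^f(\mathscr A)\to\mathbb Z[q,q^{-1}]$ is the bilinear pairing with $\langle[P],[M]\rangle=\mathrm{gdim}_\Bbbk(P^\psi\otimes_{A_n}M)$ if $P\in A_n\text{-pmod}$ and $M\in A_n\text{-fmod}$ (same $n$), and $0$ otherwise. For a nice tower this pairing is non-degenerate. **The module $\mathsf{TR}_P(N)$.** In $P^\psi\otimes_{A_p}\mathrm{Res}^{A_n}_{A_{n-p}\otimes A_p}N$, $A_p$ acts on $N$ via $a\mapsto1\otimes a\in A_{n-p}\otimes A_p$, and $A_{n-p}$ acts on the tensor product by $a\cdot(x\otimes y)=x\otimes((a\otimes1)\cdot y)$.
   Formalization: The anti-automorphisms ψ of the A_n are additionally assumed compatible with the tower product, ψ(a⊗b) ↦ ψ(a)ψ(b) under A_n⊗A_m → A_{n+m}; with unrelated ψ for each n the formula fails, e.g. for A_n=(k×k)^{⊗n}. *)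

theory Defs
  imports
    "HOL-Algebra.QuotRing"
    "HOL-Algebra.Generated_Groups"
    "HOL-Algebra.Free_Abelian_Groups"
    "Jordan_Normal_Form.Missing_VectorSpace"
begin

section \<open>Graded algebras and graded modules\<close>

text \<open>
  A left module over a not necessarily commutative ring \<open>A\<close> is encoded in the record of
  HOL-Algebra modules, whose fields \<open>mult\<close> and \<open>one\<close> are then ignored; a right module is a left
  module over the opposite ring, i.e. \<open>smult X a x\<close> stands for \<open>x \<cdot> a\<close>.
  The extra field \<open>gr M i\<close> is the homogeneous part of degree \<open>i\<close>. A graded \<open>K\<close>-algebra lives in
  the same record: there \<open>mult\<close> and \<open>one\<close> are the ring structure and \<open>smult\<close> is the action of \<open>K\<close>.
\<close>

record ('r, 'm) gr_module = "('r, 'm) module" +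
  gr :: "int \<Rightarrow> 'm set"

type_synonym ('k, 'a) gr_algebra = "('k, 'a) gr_module"

definition hdecomp :: "('r, 'm) gr_module \<Rightarrow> 'm \<Rightarrow> (int \<Rightarrow> 'm) \<Rightarrow> bool" where
  "hdecomp M x d \<longleftrightarrow> (\<forall>i. d i \<in> gr M i) \<and> finite {i. d i \<noteq> \<zero>\<^bsub>M\<^esub>} \<and>
     x = (\<Oplus>\<^bsub>M\<^esub> i \<in> {i. d i \<noteq> \<zero>\<^bsub>M\<^esub>}. d i)"

definition hcomp :: "('r, 'm) gr_module \<Rightarrow> int \<Rightarrow> 'm \<Rightarrow> 'm" where
  "hcomp M i x = (THE d. hdecomp M x d) i"

definition graded_group :: "('r, 'm) gr_module \<Rightarrow> bool" where
  "graded_group M \<longleftrightarrow> abelian_group M \<and> (\<forall>i. additive_subgroup (gr M i) M) \<and>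
     (\<forall>x \<in> carrier M. \<exists>!d. hdecomp M x d)"

definition graded_algebra :: "'k ring \<Rightarrow> ('k, 'a) gr_algebra \<Rightarrow> bool" where
  "graded_algebra K A \<longleftrightarrow> field K \<and> ring A \<and> module K A \<and> graded_group A \<and>
     (\<forall>c \<in> carrier K. \<forall>x \<in> carrier A. \<forall>y \<in> carrier A.
        c \<odot>\<^bsub>A\<^esub> (x \<otimes>\<^bsub>A\<^esub> y) = (c \<odot>\<^bsub>A\<^esub> x) \<otimes>\<^bsub>A\<^esub> y \<and>
        c \<odot>\<^bsub>A\<^esub> (x \<otimes>\<^bsub>A\<^esub> y) = x \<otimes>\<^bsub>A\<^esub> (c \<odot>\<^bsub>A\<^esub> y)) \<and>
     (\<forall>i. \<forall>c \<in> carrier K. \<forall>x \<in> gr A i. c \<odot>\<^bsub>A\<^esub> x \<in> gr A i) \<and>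
     (\<forall>i j. \<forall>x \<in> gr A i. \<forall>y \<in> gr A j. x \<otimes>\<^bsub>A\<^esub> y \<in> gr A (i + j))"

definition left_module :: "('a, 'z) ring_scheme \<Rightarrow> ('a, 'm, 'w) module_scheme \<Rightarrow> bool" where
  "left_module A M \<longleftrightarrow> ring A \<and> abelian_group M \<and>
     (\<forall>a \<in> carrier A. \<forall>x \<in> carrier M. a \<odot>\<^bsub>M\<^esub> x \<in> carrier M) \<and>
     (\<forall>a \<in> carrier A. \<forall>b \<in> carrier A. \<forall>x \<in> carrier M.
        (a \<oplus>\<^bsub>A\<^esub> b) \<odot>\<^bsub>M\<^esub> x = (a \<odot>\<^bsub>M\<^esub> x) \<oplus>\<^bsub>M\<^esub> (b \<odot>\<^bsub>M\<^esub> x)) \<and>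
     (\<forall>a \<in> carrier A. \<forall>x \<in> carrier M. \<forall>y \<in> carrier M.
        a \<odot>\<^bsub>M\<^esub> (x \<oplus>\<^bsub>M\<^esub> y) = (a \<odot>\<^bsub>M\<^esub> x) \<oplus>\<^bsub>M\<^esub> (a \<odot>\<^bsub>M\<^esub> y)) \<and>
     (\<forall>a \<in> carrier A. \<forall>b \<in> carrier A. \<forall>x \<in> carrier M.
        (a \<otimes>\<^bsub>A\<^esub> b) \<odot>\<^bsub>M\<^esub> x = a \<odot>\<^bsub>M\<^esub> (b \<odot>\<^bsub>M\<^esub> x)) \<and>
     (\<forall>x \<in> carrier M. \<one>\<^bsub>A\<^esub> \<odot>\<^bsub>M\<^esub> x = x)"

definition gr_left_module :: "('k, 'a) gr_algebra \<Rightarrow> ('a, 'm) gr_module \<Rightarrow> bool" where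
  "gr_left_module A M \<longleftrightarrow> left_module A M \<and> graded_group M \<and>
     (\<forall>i j. \<forall>a \<in> gr A i. \<forall>x \<in> gr M j. a \<odot>\<^bsub>M\<^esub> x \<in> gr M (i + j))"

definition opp :: "('a, 'z) ring_scheme \<Rightarrow> ('a, 'z) ring_scheme" where
  "opp A = A\<lparr>monoid.mult := (\<lambda>x y. y \<otimes>\<^bsub>A\<^esub> x)\<rparr>"

definition regular :: "('k, 'a) gr_algebra \<Rightarrow> ('a, 'a) gr_module" where
  "regular A = \<lparr>carrier = carrier A, monoid.mult = monoid.mult A, monoid.one = \<one>\<^bsub>A\<^esub>, ring.zero = \<zero>\<^bsub>A\<^esub>, ring.add = ring.add A,
     smult = monoid.mult A, gr = gr A\<rparr>"

definition restrict_scalars :: "('b \<Rightarrow> 'a) \<Rightarrow> ('a, 'm) gr_module \<Rightarrow> ('b, 'm) gr_module" where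
  "restrict_scalars f M = \<lparr>carrier = carrier M, monoid.mult = monoid.mult M, monoid.one = \<one>\<^bsub>M\<^esub>, ring.zero = \<zero>\<^bsub>M\<^esub>,
     ring.add = ring.add M, smult = (\<lambda>b x. f b \<odot>\<^bsub>M\<^esub> x), gr = gr M\<rparr>"

definition kspace :: "('k, 'a) gr_algebra \<Rightarrow> ('a, 'm) gr_module \<Rightarrow> ('k, 'm) gr_module" where
  "kspace A M = restrict_scalars (\<lambda>c. c \<odot>\<^bsub>A\<^esub> \<one>\<^bsub>A\<^esub>) M"

definition gr_hom :: "('k, 'a) gr_algebra \<Rightarrow> ('a, 'm) gr_module \<Rightarrow> ('a, 'n) gr_module \<Rightarrow> ('m \<Rightarrow> 'n) set"
  where "gr_hom A M N = {f \<in> module_hom A M N. \<forall>i. f ` gr M i \<subseteq> gr N i}"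

definition gr_iso :: "('k, 'a) gr_algebra \<Rightarrow> ('a, 'm) gr_module \<Rightarrow> ('a, 'n) gr_module \<Rightarrow> bool" where
  "gr_iso A M N \<longleftrightarrow> (\<exists>f \<in> gr_hom A M N. bij_betw f (carrier M) (carrier N))"

definition gr_alg_hom :: "'k ring \<Rightarrow> ('k, 'a) gr_algebra \<Rightarrow> ('k, 'b) gr_algebra \<Rightarrow> ('a \<Rightarrow> 'b) set" where
  "gr_alg_hom K A B = {f \<in> ring_hom A B. f \<in> module_hom K A B \<and> (\<forall>i. f ` gr A i \<subseteq> gr B i)}"


section \<open>Finite-dimensional and projective modules\<close>

definition fmod :: "'k ring \<Rightarrow> ('k, 'a) gr_algebra \<Rightarrow> ('a, 'm) gr_module \<Rightarrow> bool" where
  "fmod K A M \<longleftrightarrow> gr_left_module A M \<and> vectorspace.fin_dim K (kspace A M)"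

definition fin_gen :: "('a, 'z) ring_scheme \<Rightarrow> ('a, 'm, 'w) module_scheme \<Rightarrow> bool" where
  "fin_gen A M \<longleftrightarrow> (\<exists>S. finite S \<and> S \<subseteq> carrier M \<and>
     (\<forall>x \<in> carrier M. \<exists>c \<in> S \<rightarrow> carrier A. x = (\<Oplus>\<^bsub>M\<^esub> s \<in> S. c s \<odot>\<^bsub>M\<^esub> s)))"

definition free_module :: "('a, 'z) ring_scheme \<Rightarrow> 's set \<Rightarrow> ('a, 's \<Rightarrow> 'a) module" where
  "free_module A S = \<lparr>carrier = {f. (\<forall>s \<in> S. f s \<in> carrier A) \<and> (\<forall>s. s \<notin> S \<longrightarrow> f s = \<zero>\<^bsub>A\<^esub>) \<and>
        finite {s. f s \<noteq> \<zero>\<^bsub>A\<^esub>}},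
     monoid.mult = (\<lambda>f g s. \<zero>\<^bsub>A\<^esub>), monoid.one = (\<lambda>s. \<zero>\<^bsub>A\<^esub>), ring.zero = (\<lambda>s. \<zero>\<^bsub>A\<^esub>),
     ring.add = (\<lambda>f g s. f s \<oplus>\<^bsub>A\<^esub> g s), smult = (\<lambda>a f s. a \<otimes>\<^bsub>A\<^esub> f s)\<rparr>"

text \<open>
  Projective means direct summand of a free module. Free modules on subsets of the
  type of \<open>M\<close> suffice: a summand of any free module is a summand of the free module on its own
  underlying set.
\<close>

definition projective :: "('a, 'z) ring_scheme \<Rightarrow> ('a, 'm, 'w) module_scheme \<Rightarrow> bool" where
  "projective A M \<longleftrightarrow> left_module A M \<and>
     (\<exists>S :: 'm set. \<exists>\<iota> \<in> module_hom A M (free_module A S). \<exists>\<pi> \<in> module_hom A (free_module A S) M.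
        \<forall>x \<in> carrier M. \<pi> (\<iota> x) = x)"

definition pmod :: "('k, 'a) gr_algebra \<Rightarrow> ('a, 'm) gr_module \<Rightarrow> bool" where
  "pmod A M \<longleftrightarrow> gr_left_module A M \<and> fin_gen A M \<and> projective A M"


section \<open>Nice graded algebras\<close>

definition gr_submodule :: "('k, 'a) gr_algebra \<Rightarrow> ('a, 'm) gr_module \<Rightarrow> 'm set \<Rightarrow> bool" where
  "gr_submodule A M N \<longleftrightarrow> additive_subgroup N M \<and>
     (\<forall>a \<in> carrier A. \<forall>x \<in> N. a \<odot>\<^bsub>M\<^esub> x \<in> N) \<and> (\<forall>x \<in> N. \<forall>i. hcomp M i x \<in> N)"

definition gr_simple :: "('k, 'a) gr_algebra \<Rightarrow> ('a, 'm) gr_module \<Rightarrow> bool" where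
  "gr_simple A M \<longleftrightarrow> gr_left_module A M \<and> carrier M \<noteq> {\<zero>\<^bsub>M\<^esub>} \<and>
     (\<forall>N. gr_submodule A M N \<longrightarrow> N = {\<zero>\<^bsub>M\<^esub>} \<or> N = carrier M)"

definition gr_ideal :: "('k, 'a) gr_algebra \<Rightarrow> 'a set \<Rightarrow> bool" where
  "gr_ideal A I \<longleftrightarrow> ideal I A \<and> (\<forall>x \<in> I. \<forall>i. hcomp A i x \<in> I)"

definition quot_space :: "('k, 'a) gr_algebra \<Rightarrow> 'a set \<Rightarrow> ('k, 'a set) module" where
  "quot_space A I = \<lparr>carrier = carrier (A Quot I), monoid.mult = monoid.mult (A Quot I), monoid.one = \<one>\<^bsub>A Quot I\<^esub>,
     ring.zero = \<zero>\<^bsub>A Quot I\<^esub>, ring.add = ring.add (A Quot I),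
     smult = (\<lambda>c X. I +>\<^bsub>A\<^esub> (c \<odot>\<^bsub>A\<^esub> (SOME x. x \<in> X)))\<rparr>"

text \<open>
  Quantifying over the simple modules carried by sets of lists is no restriction: a graded simple
  module is cyclic, so its underlying set injects into that of \<open>A\<close>.
\<close>

definition nice :: "'k ring \<Rightarrow> ('k, 'a) gr_algebra \<Rightarrow> bool" where
  "nice K A \<longleftrightarrow> graded_algebra K A \<and>
     (\<exists>I. gr_ideal A I \<and>
        ((\<forall>x \<in> I. \<forall>i \<le> 0. hcomp A i x = \<zero>\<^bsub>A\<^esub>) \<or> (\<forall>x \<in> I. \<forall>i \<ge> 0. hcomp A i x = \<zero>\<^bsub>A\<^esub>)) \<and>
        (\<forall>M :: ('a, 'a list) gr_module. gr_simple A M \<longrightarrow>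
           (\<forall>x \<in> I. \<forall>m \<in> carrier M. x \<odot>\<^bsub>M\<^esub> m = \<zero>\<^bsub>M\<^esub>)) \<and>
        vectorspace.fin_dim K (quot_space A I))"


section \<open>Tensor products\<close>

text \<open>
  \<open>X \<otimes>\<^sub>R Y\<close> for a right \<open>R\<close>-module \<open>X\<close> and a left \<open>R\<close>-module \<open>Y\<close>: the free abelian group on pairs
  modulo biadditivity and balancedness.
\<close>

abbreviation pairs_group ::
  "('r, 'x, 'z) module_scheme \<Rightarrow> ('r, 'y, 'w) module_scheme \<Rightarrow> ('x \<times> 'y \<Rightarrow>\<^sub>0 int) monoid" where
  "pairs_group X Y \<equiv> free_Abelian_group (carrier X \<times> carrier Y)"

definition tensor_rels :: "('r, 'u) ring_scheme \<Rightarrow> ('r, 'x, 'z) module_scheme \<Rightarrow>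
    ('r, 'y, 'w) module_scheme \<Rightarrow> ('x \<times> 'y \<Rightarrow>\<^sub>0 int) set" where
  "tensor_rels R X Y = generate (pairs_group X Y)
     ({frag_of (x \<oplus>\<^bsub>X\<^esub> x', y) - frag_of (x, y) - frag_of (x', y) | x x' y.
         x \<in> carrier X \<and> x' \<in> carrier X \<and> y \<in> carrier Y} \<union>
      {frag_of (x, y \<oplus>\<^bsub>Y\<^esub> y') - frag_of (x, y) - frag_of (x, y') | x y y'.
         x \<in> carrier X \<and> y \<in> carrier Y \<and> y' \<in> carrier Y} \<union>
      {frag_of (r \<odot>\<^bsub>X\<^esub> x, y) - frag_of (x, r \<odot>\<^bsub>Y\<^esub> y) | r x y.
         r \<in> carrier R \<and> x \<in> carrier X \<and> y \<in> carrier Y})"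

definition tensor_class :: "('r, 'u) ring_scheme \<Rightarrow> ('r, 'x, 'z) module_scheme \<Rightarrow>
    ('r, 'y, 'w) module_scheme \<Rightarrow> ('x \<times> 'y \<Rightarrow>\<^sub>0 int) \<Rightarrow> ('x \<times> 'y \<Rightarrow>\<^sub>0 int) set" where
  "tensor_class R X Y u = tensor_rels R X Y #>\<^bsub>pairs_group X Y\<^esub> u"

definition pure_tensor :: "('r, 'u) ring_scheme \<Rightarrow> ('r, 'x, 'z) module_scheme \<Rightarrow>
    ('r, 'y, 'w) module_scheme \<Rightarrow> 'x \<Rightarrow> 'y \<Rightarrow> ('x \<times> 'y \<Rightarrow>\<^sub>0 int) set" where
  "pure_tensor R X Y x y = tensor_class R X Y (frag_of (x, y))"

definition rep :: "'c set \<Rightarrow> 'c" where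
  "rep U = (SOME u. u \<in> U)"

text \<open>
  \<open>tensor R X Y act\<close> is \<open>X \<otimes>\<^sub>R Y\<close> with the total grading and with scalars acting by
  \<open>b \<cdot> (x \<otimes> y) = \<close> the class of \<open>act b (x, y)\<close>, extended additively.
\<close>

definition tensor :: "('r, 'u) ring_scheme \<Rightarrow> ('r, 'x) gr_module \<Rightarrow> ('r, 'y) gr_module \<Rightarrow>
    ('b \<Rightarrow> 'x \<times> 'y \<Rightarrow> ('x \<times> 'y \<Rightarrow>\<^sub>0 int)) \<Rightarrow> ('b, ('x \<times> 'y \<Rightarrow>\<^sub>0 int) set) gr_module" where
  "tensor R X Y act =
     (let G = pairs_group X Y Mod tensor_rels R X Y in
      \<lparr>carrier = carrier G, monoid.mult = (\<lambda>U V. \<one>\<^bsub>G\<^esub>), monoid.one = \<one>\<^bsub>G\<^esub>, ring.zero = \<one>\<^bsub>G\<^esub>, ring.add = monoid.mult G,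
       smult = (\<lambda>b U. tensor_class R X Y (frag_extend (act b) (rep U))),
       gr = (\<lambda>i. generate G {pure_tensor R X Y x y | x y j k. x \<in> gr X j \<and> y \<in> gr Y k \<and> j + k = i})\<rparr>)"

definition alg_tensor ::
  "'k ring \<Rightarrow> ('k, 'a) gr_algebra \<Rightarrow> ('k, 'b) gr_algebra \<Rightarrow> ('k, ('a \<times> 'b \<Rightarrow>\<^sub>0 int) set) gr_algebra" where
  "alg_tensor K A B = (tensor K A B (\<lambda>c (a, b). frag_of (c \<odot>\<^bsub>A\<^esub> a, b)))
     \<lparr>monoid.mult := (\<lambda>S T. tensor_class K A B
         (frag_extend (\<lambda>(a, b). frag_extend (\<lambda>(a', b'). frag_of (a \<otimes>\<^bsub>A\<^esub> a', b \<otimes>\<^bsub>B\<^esub> b')) (rep T)) (rep S))),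
      monoid.one := pure_tensor K A B \<one>\<^bsub>A\<^esub> \<one>\<^bsub>B\<^esub>\<rparr>"

text \<open>\<open>P \<boxtimes> P'\<close> as a module over \<open>A \<otimes> B\<close>.\<close>

definition outer_tensor :: "'k ring \<Rightarrow> ('k, 'a) gr_algebra \<Rightarrow> ('k, 'b) gr_algebra \<Rightarrow>
    ('a, 'm) gr_module \<Rightarrow> ('b, 'n) gr_module \<Rightarrow>
    (('a \<times> 'b \<Rightarrow>\<^sub>0 int) set, ('m \<times> 'n \<Rightarrow>\<^sub>0 int) set) gr_module" where
  "outer_tensor K A B M N = tensor K (kspace A M) (kspace B N)
     (\<lambda>T (x, y). frag_extend (\<lambda>(a, b). frag_of (a \<odot>\<^bsub>M\<^esub> x, b \<odot>\<^bsub>N\<^esub> y)) (rep T))"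


section \<open>Nice towers\<close>

text \<open>\<open>xmul \<A> n m\<close> is the morphism from the tensor product of the \<open>n\<close>-th and the \<open>m\<close>-th algebra to
  the \<open>(n + m)\<close>-th; \<open>anti \<A> n\<close> is the anti-automorphism \<open>\<psi>\<close> of the \<open>n\<close>-th algebra.\<close>

record ('k, 'a) tower =
  alg :: "nat \<Rightarrow> ('k, 'a) gr_algebra"
  xmul :: "nat \<Rightarrow> nat \<Rightarrow> ('a \<times> 'a \<Rightarrow>\<^sub>0 int) set \<Rightarrow> 'a"
  anti :: "nat \<Rightarrow> 'a \<Rightarrow> 'a"

abbreviation tensor_alg ::
  "'k ring \<Rightarrow> ('k, 'a) tower \<Rightarrow> nat \<Rightarrow> nat \<Rightarrow> ('k, ('a \<times> 'a \<Rightarrow>\<^sub>0 int) set) gr_algebra" where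
  "tensor_alg K \<A> n m \<equiv> alg_tensor K (alg \<A> n) (alg \<A> m)"

abbreviation tpair ::
  "'k ring \<Rightarrow> ('k, 'a) tower \<Rightarrow> nat \<Rightarrow> nat \<Rightarrow> 'a \<Rightarrow> 'a \<Rightarrow> ('a \<times> 'a \<Rightarrow>\<^sub>0 int) set" where
  "tpair K \<A> n m a b \<equiv> pure_tensor K (alg \<A> n) (alg \<A> m) a b"

definition xprod :: "'k ring \<Rightarrow> ('k, 'a) tower \<Rightarrow> nat \<Rightarrow> nat \<Rightarrow> 'a \<Rightarrow> 'a \<Rightarrow> 'a" where
  "xprod K \<A> n m a b = xmul \<A> n m (tpair K \<A> n m a b)"

text \<open>
  The first clauses say that the direct sum of the \<open>alg \<A> n\<close> is an associative unital algebra
  under \<open>xprod\<close>. The last clause, that the anti-automorphisms are compatible with the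
  multiplication of the tower, makes \<open>\<psi>\<close> an operation on the tower rather than an unrelated choice
  for each \<open>n\<close>; without it induction does not commute with twisting by \<open>\<psi>\<close>.
\<close>

definition nice_tower :: "'k ring \<Rightarrow> ('k, 'a) tower \<Rightarrow> bool" where
  "nice_tower K \<A> \<longleftrightarrow>
     (\<forall>l m n. \<forall>a \<in> carrier (alg \<A> l). \<forall>b \<in> carrier (alg \<A> m). \<forall>c \<in> carrier (alg \<A> n).
        xprod K \<A> (l + m) n (xprod K \<A> l m a b) c = xprod K \<A> l (m + n) a (xprod K \<A> m n b c)) \<and>
     (\<forall>n. \<forall>a \<in> carrier (alg \<A> n). xprod K \<A> 0 n \<one>\<^bsub>alg \<A> 0\<^esub> a = a \<and> xprod K \<A> n 0 a \<one>\<^bsub>alg \<A> 0\<^esub> = a) \<and>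
     (\<forall>n. nice K (alg \<A> n)) \<and>
     bij_betw (\<lambda>c. c \<odot>\<^bsub>alg \<A> 0\<^esub> \<one>\<^bsub>alg \<A> 0\<^esub>) (carrier K) (carrier (alg \<A> 0)) \<and>
     (\<forall>n m. xmul \<A> n m \<in> gr_alg_hom K (tensor_alg K \<A> n m) (alg \<A> (n + m))) \<and>
     (\<forall>n m. projective (tensor_alg K \<A> n m)
        (restrict_scalars (xmul \<A> n m) (regular (alg \<A> (n + m))))) \<and>
     (\<forall>n m. projective (opp (tensor_alg K \<A> n m))
        (restrict_scalars (xmul \<A> n m) (regular (opp (alg \<A> (n + m)))))) \<and>
     (\<forall>n. anti \<A> n \<in> gr_alg_hom K (alg \<A> n) (opp (alg \<A> n)) \<and>
        bij_betw (anti \<A> n) (carrier (alg \<A> n)) (carrier (alg \<A> n))) \<and>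
     (\<forall>n m. \<forall>a \<in> carrier (alg \<A> n). \<forall>b \<in> carrier (alg \<A> m).
        anti \<A> (n + m) (xprod K \<A> n m a b) = xprod K \<A> n m (anti \<A> n a) (anti \<A> m b))"

definition twist :: "('k, 'a) tower \<Rightarrow> nat \<Rightarrow> ('a, 'm) gr_module \<Rightarrow> ('a, 'm) gr_module" where
  "twist \<A> n P = restrict_scalars (anti \<A> n) P"

definition induce :: "'k ring \<Rightarrow> ('k, 'a) tower \<Rightarrow> nat \<Rightarrow> nat \<Rightarrow>
    (('a \<times> 'a \<Rightarrow>\<^sub>0 int) set, 'm) gr_module \<Rightarrow> ('a, ('a \<times> 'm \<Rightarrow>\<^sub>0 int) set) gr_module" where
  "induce K \<A> n m M = tensor (tensor_alg K \<A> n m)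
     (restrict_scalars (xmul \<A> n m) (regular (opp (alg \<A> (n + m))))) M
     (\<lambda>a (x, y). frag_of (a \<otimes>\<^bsub>alg \<A> (n + m)\<^esub> x, y))"

definition Res :: "('k, 'a) tower \<Rightarrow> nat \<Rightarrow> nat \<Rightarrow> ('a, 'm) gr_module \<Rightarrow>
    (('a \<times> 'a \<Rightarrow>\<^sub>0 int) set, 'm) gr_module" where
  "Res \<A> n m N = restrict_scalars (xmul \<A> n m) N"

text \<open>\<open>TR K \<A> p n P N\<close> is meant for \<open>p \<le> n\<close>.\<close>

definition TR :: "'k ring \<Rightarrow> ('k, 'a) tower \<Rightarrow> nat \<Rightarrow> nat \<Rightarrow> ('a, 'p) gr_module \<Rightarrow> ('a, 'n) gr_module \<Rightarrow>
    ('a, ('p \<times> 'n \<Rightarrow>\<^sub>0 int) set) gr_module" where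
  "TR K \<A> p n P N =
     (let R = Res \<A> (n - p) p N in
      tensor (alg \<A> p) (twist \<A> p P)
        (restrict_scalars (\<lambda>a. tpair K \<A> (n - p) p \<one>\<^bsub>alg \<A> (n - p)\<^esub> a) R)
        (\<lambda>a (x, y). frag_of (x, tpair K \<A> (n - p) p a \<one>\<^bsub>alg \<A> p\<^esub> \<odot>\<^bsub>R\<^esub> y)))"


section \<open>Grothendieck groups\<close>

definition short_exact :: "('k, 'a) gr_algebra \<Rightarrow> ('a, 'l) gr_module \<Rightarrow> ('a, 'm) gr_module \<Rightarrow>
    ('a, 'n) gr_module \<Rightarrow> bool" where
  "short_exact A M' M M'' \<longleftrightarrow> (\<exists>f \<in> gr_hom A M' M. \<exists>g \<in> gr_hom A M M''.
     inj_on f (carrier M') \<and> f ` carrier M' = {x \<in> carrier M. g x = \<zero>\<^bsub>M''\<^esub>} \<and>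
     g ` carrier M = carrier M'')"

text \<open>
  The modules generating the Grothendieck group are those carried by sets of lists over \<open>A\<close>. This is
  a small essentially dense subcategory of the finitely generated graded modules: such a module is
  a quotient of some \<open>A\<^sup>k\<close>, so its underlying set injects into the lists of length \<open>k\<close>.
  \<open>copy A M\<close> is a representative in this subcategory of the isomorphism class of \<open>M\<close>.
\<close>

definition copy :: "('k, 'a) gr_algebra \<Rightarrow> ('a, 'm) gr_module \<Rightarrow> ('a, 'a list) gr_module" where
  "copy A M = (SOME M'. gr_left_module A M' \<and> gr_iso A M' M)"

definition K0_rels :: "('k, 'a) gr_algebra \<Rightarrow> ('a, 'm) gr_module set \<Rightarrow> (('a, 'm) gr_module \<Rightarrow>\<^sub>0 int) set"
  where "K0_rels A C = generate (free_Abelian_group C)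
     {frag_of M - frag_of M' - frag_of M'' | M M' M''.
        M \<in> C \<and> M' \<in> C \<and> M'' \<in> C \<and> short_exact A M' M M''}"

definition K0 :: "('k, 'a) gr_algebra \<Rightarrow> ('a, 'm) gr_module set \<Rightarrow>
    (('a, 'm) gr_module \<Rightarrow>\<^sub>0 int) set monoid" where
  "K0 A C = free_Abelian_group C Mod K0_rels A C"

definition K0_class :: "('k, 'a) gr_algebra \<Rightarrow> ('a, 'm) gr_module set \<Rightarrow>
    (('a, 'm) gr_module \<Rightarrow>\<^sub>0 int) \<Rightarrow> (('a, 'm) gr_module \<Rightarrow>\<^sub>0 int) set" where
  "K0_class A C u = K0_rels A C #>\<^bsub>free_Abelian_group C\<^esub> u"

definition pmods :: "('k, 'a) gr_algebra \<Rightarrow> ('a, 'a list) gr_module set" where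
  "pmods A = {M. pmod A M}"

definition fmods :: "'k ring \<Rightarrow> ('k, 'a) gr_algebra \<Rightarrow> ('a, 'a list) gr_module set" where
  "fmods K A = {M. fmod K A M}"

type_synonym 'a k_elem = "nat \<Rightarrow> (('a, 'a list) gr_module \<Rightarrow>\<^sub>0 int) set"

text \<open>The groups \<open>\<K>(\<A>)\<close> and \<open>\<G>\<^sup>f(\<A>)\<close>, written multiplicatively as all groups of HOL-Algebra.\<close>

definition KP :: "('k, 'a) tower \<Rightarrow> 'a k_elem monoid" where
  "KP \<A> = sum_group UNIV (\<lambda>n. K0 (alg \<A> n) (pmods (alg \<A> n)))"

definition GF :: "'k ring \<Rightarrow> ('k, 'a) tower \<Rightarrow> 'a k_elem monoid" where
  "GF K \<A> = sum_group UNIV (\<lambda>n. K0 (alg \<A> n) (fmods K (alg \<A> n)))"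

definition pclass :: "('k, 'a) tower \<Rightarrow> nat \<Rightarrow> ('a, 'm) gr_module \<Rightarrow> 'a k_elem" where
  "pclass \<A> n P = (\<one>\<^bsub>KP \<A>\<^esub>)(n := K0_class (alg \<A> n) (pmods (alg \<A> n)) (frag_of (copy (alg \<A> n) P)))"

definition fclass :: "'k ring \<Rightarrow> ('k, 'a) tower \<Rightarrow> nat \<Rightarrow> ('a, 'm) gr_module \<Rightarrow> 'a k_elem" where
  "fclass K \<A> n M =
     (\<one>\<^bsub>GF K \<A>\<^esub>)(n := K0_class (alg \<A> n) (fmods K (alg \<A> n)) (frag_of (copy (alg \<A> n) M)))"

text \<open>The product on \<open>\<K>(\<A>)\<close>: biadditive extension of \<open>[P][P'] = [Ind (P \<boxtimes> P')]\<close>.\<close>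

definition K0_prod :: "'k ring \<Rightarrow> ('k, 'a) tower \<Rightarrow> nat \<Rightarrow> nat \<Rightarrow>
    (('a, 'a list) gr_module \<Rightarrow>\<^sub>0 int) set \<Rightarrow> (('a, 'a list) gr_module \<Rightarrow>\<^sub>0 int) set \<Rightarrow>
    (('a, 'a list) gr_module \<Rightarrow>\<^sub>0 int) set" where
  "K0_prod K \<A> n m U V = K0_class (alg \<A> (n + m)) (pmods (alg \<A> (n + m)))
     (frag_extend (\<lambda>P. frag_extend (\<lambda>P'. frag_of (copy (alg \<A> (n + m))
        (induce K \<A> n m (outer_tensor K (alg \<A> n) (alg \<A> m) P P')))) (rep V)) (rep U))"

definition KP_mult :: "'k ring \<Rightarrow> ('k, 'a) tower \<Rightarrow> 'a k_elem \<Rightarrow> 'a k_elem \<Rightarrow> 'a k_elem" where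
  "KP_mult K \<A> x y = (\<lambda>k. finprod (K0 (alg \<A> k) (pmods (alg \<A> k)))
     (\<lambda>n. K0_prod K \<A> n (k - n) (x n) (y (k - n))) {..k})"


section \<open>The pairing and adjoints of right multiplications\<close>

text \<open>\<open>\<int>[q, q\<^sup>-\<^sup>1]\<close> is the group ring of \<open>\<int>\<close>, with \<open>q\<^sup>i = Poly_Mapping.single i 1\<close>.\<close>

type_synonym laurent = "int \<Rightarrow>\<^sub>0 int"

definition gdim :: "'k ring \<Rightarrow> ('k, 'm) gr_module \<Rightarrow> laurent" where
  "gdim K V = (\<Sum>i | gr V i \<noteq> {\<zero>\<^bsub>V\<^esub>}.
     Poly_Mapping.single i (int (vectorspace.dim K (V\<lparr>carrier := gr V i\<rparr>))))"

definition module_pairing :: "'k ring \<Rightarrow> ('k, 'a) tower \<Rightarrow> nat \<Rightarrow>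
    ('a, 'm) gr_module \<Rightarrow> ('a, 'n) gr_module \<Rightarrow> laurent" where
  "module_pairing K \<A> n P M = gdim K (tensor (alg \<A> n) (twist \<A> n P) M
     (\<lambda>c (x, y). frag_of (x, (c \<odot>\<^bsub>alg \<A> n\<^esub> \<one>\<^bsub>alg \<A> n\<^esub>) \<odot>\<^bsub>M\<^esub> y)))"

definition K0_pairing :: "'k ring \<Rightarrow> ('k, 'a) tower \<Rightarrow> nat \<Rightarrow>
    (('a, 'a list) gr_module \<Rightarrow>\<^sub>0 int) set \<Rightarrow> (('a, 'a list) gr_module \<Rightarrow>\<^sub>0 int) set \<Rightarrow> laurent" where
  "K0_pairing K \<A> n U V =
     (\<Sum>P \<in> Poly_Mapping.keys (rep U). \<Sum>M \<in> Poly_Mapping.keys (rep V).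
        of_int (Poly_Mapping.lookup (rep U) P * Poly_Mapping.lookup (rep V) M) *
        module_pairing K \<A> n P M)"

definition pairing :: "'k ring \<Rightarrow> ('k, 'a) tower \<Rightarrow> 'a k_elem \<Rightarrow> 'a k_elem \<Rightarrow> laurent" where
  "pairing K \<A> x y = (\<Sum>n | x n \<noteq> \<one>\<^bsub>KP \<A>\<^esub> n. K0_pairing K \<A> n (x n) (y n))"

definition right_mult_adjoint :: "'k ring \<Rightarrow> ('k, 'a) tower \<Rightarrow> 'a k_elem \<Rightarrow> 'a k_elem \<Rightarrow> 'a k_elem" where
  "right_mult_adjoint K \<A> a = (THE r. r \<in> carrier (GF K \<A>) \<rightarrow>\<^sub>E carrier (GF K \<A>) \<and>
     (\<forall>x \<in> carrier (KP \<A>). \<forall>y \<in> carrier (GF K \<A>).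
        pairing K \<A> x (r y) = pairing K \<A> (KP_mult K \<A> x a) y))"

end

(*
  Tensoring with P' over A_p gives Ind(P x P')^psi (x)_{A_n} N = P^psi (x)_{A_(n-p)} TR_{P'}(N): both
  sides are spanned by triples (x, x', y), because the anti-automorphisms are compatible with the
  multiplication of the tower and move every algebra element onto y. So TR is adjoint to right
  multiplication on classes of modules. Pairing and product descend to the Grothendieck groups because
  short exact sequences of projective modules split and finitely generated projective modules are flat.

  That r is determined by the adjunction formula needs nondegeneracy in the second argument. A class in
  G^f is represented by a combination of pairwise non-isomorphic graded simple modules. As A/I is finite
  dimensional and I has no degree zero part, A_0 is finite dimensional, and it contains, for a simple S
  with S_i nonzero, an idempotent e acting as zero in degree i on every other simple module but not
  on S. Pairing with the projective module A psi(e) isolates the coefficient of S.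
*)
theory Submission
  imports Defs
begin

text \<open>The adjoint is a definite description, so besides the identity on classes of modules two
  things are owed: an operator on all of G^f satisfying the formula for every pair of classes, and
  its uniqueness. Products and pairings of classes are computed on arbitrarily chosen formal sums of
  modules carried by lists; each of them must therefore be shown to respect the relations of the
  Grothendieck groups and isomorphism of modules.

  Finitely generated projective modules are handled throughout by dual bases. These pass through
  twisting, exterior tensor products, induction and isomorphism by explicit formulas, and they yield
  finite dimension, flatness and splittings alike.

  The base field is arbitrary, so the space that detects a simple module may have dimension greater
  than one; what counts is that it is nonzero, because the coefficients to be killed are integers.
  Shifts of a simple module are separate generators of G^f, which is why the idempotent works in one
  fixed degree and a single coefficient of the Laurent polynomial is read.\<close>

abbreviation "keys \<equiv> Poly_Mapping.keys"

section \<open>Additive maps\<close>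

text \<open>Additivity alone, so that source and target may be modules over different rings, or
  rings themselves; linearity over a ring is added by \<open>module_hom\<close>.\<close>

definition addhom :: "('a, 'm) ring_scheme => ('b, 'n) ring_scheme => ('a => 'b) => bool" where
 "addhom M H f \<longleftrightarrow> (\<forall>x \<in> carrier M. f x : carrier H) \<and>
   (\<forall>x \<in> carrier M. \<forall>y \<in> carrier M. f (x \<oplus>\<^bsub>M\<^esub> y) = f x \<oplus>\<^bsub>H\<^esub> f y)"

lemma addhomI:
 "[|!!x. x : carrier M ==> f x : carrier H;
  !!x y. [|x : carrier M; y : carrier M|] ==> f (x \<oplus>\<^bsub>M\<^esub> y) = f x \<oplus>\<^bsub>H\<^esub> f y|] ==> addhom M H f"
 by (simp add: addhom_def)

lemma addhom_closed: "addhom M H f ==> x : carrier M ==> f x : carrier H"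
 by (simp add: addhom_def)

lemma addhom_add:
 "[|addhom M H f; x : carrier M; y : carrier M|] ==> f (x \<oplus>\<^bsub>M\<^esub> y) = f x \<oplus>\<^bsub>H\<^esub> f y"
 by (simp add: addhom_def)

lemma addhom_zero:
 assumes "abelian_group M" "abelian_group H" "addhom M H f"
 shows "f \<zero>\<^bsub>M\<^esub> = \<zero>\<^bsub>H\<^esub>"
proof -
 interpret M: abelian_group M by fact
 interpret H: abelian_group H by fact
 have "f \<zero>\<^bsub>M\<^esub> \<oplus>\<^bsub>H\<^esub> f \<zero>\<^bsub>M\<^esub> = f \<zero>\<^bsub>M\<^esub>"
  using addhom_add[OF assms(3), of "\<zero>\<^bsub>M\<^esub>" "\<zero>\<^bsub>M\<^esub>"] by simp
 then show ?thesis using addhom_closed[OF assms(3), of "\<zero>\<^bsub>M\<^esub>"]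
  by (metis H.add.r_cancel_one M.zero_closed)
qed

lemma addhom_minus:
 assumes "abelian_group M" "abelian_group H" "addhom M H f" "x : carrier M"
 shows "f (\<ominus>\<^bsub>M\<^esub> x) = \<ominus>\<^bsub>H\<^esub> f x"
proof -
 interpret M: abelian_group M by fact
 interpret H: abelian_group H by fact
 have "f (\<ominus>\<^bsub>M\<^esub> x) \<oplus>\<^bsub>H\<^esub> f x = \<zero>\<^bsub>H\<^esub>"
  using addhom_add[OF assms(3), of "\<ominus>\<^bsub>M\<^esub> x" x] addhom_zero[OF assms(1-3)] assms(4)
  by (simp add: M.l_neg)
 then show ?thesis using addhom_closed[OF assms(3)] assms(4)
  by (metis H.minus_equality M.a_inv_closed)
qed

lemma addhom_diff:
 assumes "abelian_group M" "abelian_group H" "addhom M H f" "x : carrier M" "y : carrier M"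
 shows "f (x \<ominus>\<^bsub>M\<^esub> y) = f x \<ominus>\<^bsub>H\<^esub> f y"
 using assms addhom_minus[OF assms(1-3,5)]
 by (simp add: a_minus_def addhom_add abelian_group.a_inv_closed)

lemma addhom_finsum:
 assumes "abelian_group M" "abelian_group H" "addhom M H f" "g : A \<rightarrow> carrier M"
 shows "f (\<Oplus>\<^bsub>M\<^esub> i\<in>A. g i) = (\<Oplus>\<^bsub>H\<^esub> i\<in>A. f (g i))"
proof -
 interpret M: abelian_group M by fact
 interpret H: abelian_group H by fact
 show ?thesis
 proof (cases "finite A")
  case True
  then show ?thesis using assms(4)
  proof (induction rule: finite_induct)
   case empty
   then show ?case using addhom_zero[OF assms(1-3)] by simp
  next
   case (insert a B)
   then have "g : B \<rightarrow> carrier M" "g a : carrier M" by auto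
   moreover from this have "(%i. f (g i)) : B \<rightarrow> carrier H" "f (g a) : carrier H"
    using addhom_closed[OF assms(3)] by auto
   ultimately show ?case using insert
    by (simp add: addhom_add[OF assms(3)])
  qed
 next
  case False
  then show ?thesis using addhom_zero[OF assms(1-3)]
   by (simp add: M.finsum_infinite H.finsum_infinite)
 qed
qed

lemma addhom_comp: "addhom L M f ==> addhom M N g ==> addhom L N (%x. g (f x))"
 by (simp add: addhom_def)

lemma addhom_id: "addhom M M (%x. x)"
 by (simp add: addhom_def)

lemma addhom_sum:
 assumes "abelian_group H" "!!s. s : S ==> addhom M H (f s)"
 shows "addhom M H (%x. \<Oplus>\<^bsub>H\<^esub> s\<in>S. f s x)"
proof -
 interpret H: abelian_group H by fact
 show ?thesis
 proof (rule addhomI)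
  fix x assume x: "x : carrier M"
  show "(\<Oplus>\<^bsub>H\<^esub> s\<in>S. f s x) : carrier H"
   using x assms(2) by (intro H.finsum_closed) (auto dest: addhom_closed)
  fix y assume y: "y : carrier M"
  have "(\<Oplus>\<^bsub>H\<^esub> s\<in>S. f s (x \<oplus>\<^bsub>M\<^esub> y)) = (\<Oplus>\<^bsub>H\<^esub> s\<in>S. f s x \<oplus>\<^bsub>H\<^esub> f s y)"
   using x y assms(2) by (intro H.finsum_cong') (auto simp: addhom_def)
  also have "\<dots> = (\<Oplus>\<^bsub>H\<^esub> s\<in>S. f s x) \<oplus>\<^bsub>H\<^esub> (\<Oplus>\<^bsub>H\<^esub> s\<in>S. f s y)"
   using x y assms(2) by (intro H.finsum_addf) (auto dest: addhom_closed)
  finally show "(\<Oplus>\<^bsub>H\<^esub> s\<in>S. f s (x \<oplus>\<^bsub>M\<^esub> y)) = \<dots>" .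
 qed
qed

lemma module_homI:
 "[|addhom M N f; !!r x. [|r : carrier R; x : carrier M|] ==> f (r \<odot>\<^bsub>M\<^esub> x) = r \<odot>\<^bsub>N\<^esub> f x|]
  ==> f : module_hom R M N"
 by (auto simp: addhom_def module_hom_def)

lemma module_hom_addhom: "f : module_hom R M N ==> addhom M N f"
 by (auto simp: addhom_def module_hom_def)

section \<open>Graded groups\<close>

lemma additive_subgroupD:
 assumes "additive_subgroup H M"
 shows "!!x. x : H ==> x : carrier M" "\<zero>\<^bsub>M\<^esub> : H"
  "!!x y. [|x : H; y : H|] ==> x \<oplus>\<^bsub>M\<^esub> y : H"
  "!!x. x : H ==> \<ominus>\<^bsub>M\<^esub> x : H"
proof -
 interpret H: subgroup H "add_monoid M" using assms by (simp add: additive_subgroup_def)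
 show "!!x. x : H ==> x : carrier M" "\<zero>\<^bsub>M\<^esub> : H"
  "!!x y. [|x : H; y : H|] ==> x \<oplus>\<^bsub>M\<^esub> y : H"
  "!!x. x : H ==> \<ominus>\<^bsub>M\<^esub> x : H"
  using H.subset H.one_closed H.m_closed H.m_inv_closed by (auto simp: a_inv_def)
qed

lemma additive_subgroup_diff:
 assumes "additive_subgroup H M" "x : H" "y : H"
 shows "x \<ominus>\<^bsub>M\<^esub> y : H"
 using additive_subgroupD[OF assms(1)] assms(2,3) by (simp add: a_minus_def)

lemma additive_subgroupI':
 assumes "abelian_group M" "H <= carrier M" "\<zero>\<^bsub>M\<^esub> : H"
  "!!x y. [|x : H; y : H|] ==> x \<oplus>\<^bsub>M\<^esub> y : H" "!!x. x : H ==> \<ominus>\<^bsub>M\<^esub> x : H"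
 shows "additive_subgroup H M"
proof -
 interpret M: abelian_group M by fact
 show ?thesis unfolding additive_subgroup_def
  using assms(2-5) by (intro M.add.subgroupI) (auto simp: a_inv_def)
qed

lemma additive_subgroup_finsum:
 assumes "abelian_group M" "additive_subgroup H M" "!!i. i : A ==> g i : H"
 shows "(\<Oplus>\<^bsub>M\<^esub> i\<in>A. g i) : H"
proof -
 interpret M: abelian_group M by fact
 note H = additive_subgroupD[OF assms(2)]
 show ?thesis
 proof (cases "finite A")
  case True
  then show ?thesis using assms(3)
  proof (induction rule: finite_induct)
   case (insert a B)
   then have "g : B \<rightarrow> carrier M" "g a : carrier M" using H(1) by auto
   then show ?case using insert by (simp add: H)
  qed (simp add: H)
 qed (simp add: H M.finsum_infinite)
qed

text \<open>The sum in \<open>hdecomp\<close> runs over the exact support. Admitting any finite set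
  that contains it makes it possible to decompose two elements over a common index set.\<close>

lemma hdecompI:
 assumes "abelian_group M" "!!i. d i : gr M i" "!!i. gr M i <= carrier M"
  "finite F" "!!i. i \<notin> F ==> d i = \<zero>\<^bsub>M\<^esub>"
  "x = (\<Oplus>\<^bsub>M\<^esub> i\<in>F. d i)"
 shows "hdecomp M x d"
proof -
 interpret M: abelian_group M by fact
 have sub: "{i. d i ~= \<zero>\<^bsub>M\<^esub>} <= F" using assms(5) by auto
 have "(\<Oplus>\<^bsub>M\<^esub> i\<in>{i. d i ~= \<zero>\<^bsub>M\<^esub>}. d i) = (\<Oplus>\<^bsub>M\<^esub> i\<in>F. d i)"
  using assms sub by (intro M.add.finprod_mono_neutral_cong_left) auto
 then show ?thesis
  using assms finite_subset[OF sub] by (auto simp: hdecomp_def)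
qed

locale graded =
 fixes M :: "('r, 'm) gr_module" (structure)
 assumes gg: "graded_group M"
begin

sublocale abelian_group M
 using gg by (simp add: graded_group_def)

lemma ab: "abelian_group M" by (rule abelian_group_axioms)

lemma gr_sub: "additive_subgroup (gr M i) M"
 using gg by (simp add: graded_group_def)

lemmas gr_closed = additive_subgroupD[OF gr_sub]

lemma hdecomp_hcomp: "x : carrier M ==> hdecomp M x (%i. hcomp M i x)"
proof -
 assume x: "x : carrier M"
 then have "\<exists>!d. hdecomp M x d" using gg by (simp add: graded_group_def)
 from theI'[OF this] show ?thesis by (simp add: hcomp_def)
qed

lemma hcomp_eqI: "x : carrier M ==> hdecomp M x d ==> hcomp M i x = d i"
 using hdecomp_hcomp gg unfolding graded_group_def by metis

lemma hcomp_gr: "x : carrier M ==> hcomp M i x : gr M i"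
 using hdecomp_hcomp by (auto simp: hdecomp_def)

lemma hcomp_closed: "x : carrier M ==> hcomp M i x : carrier M"
 using hcomp_gr gr_closed(1) by blast

lemma hcomp_finite: "x : carrier M ==> finite {i. hcomp M i x ~= \<zero>}"
 using hdecomp_hcomp by (auto simp: hdecomp_def)

lemma hcomp_sum:
 assumes "x : carrier M" "finite F" "!!i. i \<notin> F ==> hcomp M i x = \<zero>"
 shows "(\<Oplus>i\<in>F. hcomp M i x) = x"
proof -
 have "x = (\<Oplus>i\<in>{i. hcomp M i x ~= \<zero>}. hcomp M i x)"
  using hdecomp_hcomp[OF assms(1)] by (simp add: hdecomp_def)
 also have "\<dots> = (\<Oplus>i\<in>F. hcomp M i x)"
  using assms hcomp_closed by (intro add.finprod_mono_neutral_cong_left) auto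
 finally show ?thesis ..
qed

lemma hcomp_homog:
 assumes "x : gr M i"
 shows "hcomp M j x = (if j = i then x else \<zero>)"
proof -
 have "hdecomp M x (%j. if j = i then x else \<zero>)"
 proof (rule hdecompI[OF ab, where F = "{i}"])
  show "x = (\<Oplus>k\<in>{i}. if k = i then x else \<zero>)"
   using assms gr_closed(1) by (simp add: finsum_insert)
 qed (use assms gr_closed in auto)
 then show ?thesis using hcomp_eqI gr_closed(1)[OF assms] by simp
qed

lemma hcomp_addhom: "addhom M M (hcomp M i)"
proof (rule addhomI)
 fix x y assume xy: "x : carrier M" "y : carrier M"
 let ?F = "{i. hcomp M i x ~= \<zero>} \<union> {i. hcomp M i y ~= \<zero>}"
 have F: "finite ?F" using hcomp_finite xy by blast
 have "hdecomp M (x \<oplus> y) (%i. hcomp M i x \<oplus> hcomp M i y)"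
 proof (rule hdecompI[OF ab _ _ F])
  have "x \<oplus> y = (\<Oplus>i\<in>?F. hcomp M i x) \<oplus> (\<Oplus>i\<in>?F. hcomp M i y)"
   using hcomp_sum[OF xy(1) F] hcomp_sum[OF xy(2) F] by simp
  also have "\<dots> = (\<Oplus>i\<in>?F. hcomp M i x \<oplus> hcomp M i y)"
   using xy hcomp_closed by (intro finsum_addf[symmetric]) auto
  finally show "x \<oplus> y = \<dots>" .
 qed (use xy hcomp_gr gr_closed in auto)
 then show "hcomp M i (x \<oplus> y) = hcomp M i x \<oplus> hcomp M i y"
  using hcomp_eqI xy by auto
qed (rule hcomp_closed)

lemma graded_induct [consumes 1, case_names zero add homog]:
 assumes "x : carrier M" "P \<zero>"
  "!!x y. [|x : carrier M; y : carrier M; P x; P y|] ==> P (x \<oplus> y)"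
  "!!i x. x : gr M i ==> P x"
 shows "P x"
proof -
 have "finite F ==> P (\<Oplus>i\<in>F. hcomp M i x)" for F
 proof (induction rule: finite_induct)
  case (insert a F)
  have "(%i. hcomp M i x) : F \<rightarrow> carrier M" "hcomp M a x : carrier M"
   using hcomp_closed assms(1) by auto
  moreover from this have "P (hcomp M a x \<oplus> (\<Oplus>i\<in>F. hcomp M i x))"
   using insert assms(4)[OF hcomp_gr[OF assms(1)]] by (intro assms(3) finsum_closed) auto
  ultimately show ?case using insert by simp
 qed (simp add: assms(2))
 from this[OF hcomp_finite[OF assms(1)]] show ?thesis
  using hcomp_sum[OF assms(1) hcomp_finite[OF assms(1)]] by simp
qed

lemma addhom_eqI:
 assumes "abelian_group H" "addhom M H f" "addhom M H g"
  "!!i x. x : gr M i ==> f x = g x" "x : carrier M"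
 shows "f x = g x"
 using assms(5)
proof (induction rule: graded_induct)
 case zero
 then show ?case using addhom_zero[OF ab assms(1)] assms(2,3) by metis
next
 case (add x y)
 then show ?case using assms(2,3) by (simp add: addhom_add)
qed (rule assms(4))

lemma hcomp_eq_zeroD:
 assumes "x : carrier M" "!!i. hcomp M i x = \<zero>"
 shows "x = \<zero>"
 using hcomp_sum[OF assms(1), of "{}"] assms(2) by simp

end

text \<open>Both sides are additive in x and agree on homogeneous elements, where a component is
  either the element itself or zero.\<close>

lemma graded_hom_hcomp:
 assumes "graded_group M" "graded_group N" "addhom M N f" "!!i. f ` gr M i <= gr N i"
  "x : carrier M"
 shows "f (hcomp M i x) = hcomp N i (f x)"
proof -
 interpret M: graded M using assms by unfold_locales
 interpret N: graded N using assms by unfold_locales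
 show ?thesis
 proof (rule M.addhom_eqI[OF N.ab _ _ _ assms(5), of "%x. f (hcomp M i x)" "%x. hcomp N i (f x)"])
  show "addhom M N (%x. f (hcomp M i x))"
   by (rule addhom_comp[OF M.hcomp_addhom assms(3)])
  show "addhom M N (%x. hcomp N i (f x))"
   by (rule addhom_comp[OF assms(3) N.hcomp_addhom])
  fix j x assume x: "x : gr M j"
  then have "f x : gr N j" using assms(4) by auto
  then show "f (hcomp M i x) = hcomp N i (f x)"
   using x by (simp add: M.hcomp_homog N.hcomp_homog addhom_zero[OF M.ab N.ab assms(3)])
 qed
qed

text \<open>A grading amounts to a family of commuting projections; in applications the projections
  \<open>\<pi> i\<close> come from a universal property.\<close>

lemma graded_groupI:
 assumes ab: "abelian_group M" and sub: "!!i. additive_subgroup (gr M i) M"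
  and add: "!!i. addhom M M (\<pi> i)"
  and same: "!!i x. x : gr M i ==> \<pi> i x = x"
  and diff: "!!i j x. [|x : gr M j; j ~= i|] ==> \<pi> i x = \<zero>\<^bsub>M\<^esub>"
  and gen: "!!H. [|additive_subgroup H M; !!i. gr M i <= H|] ==> carrier M <= H"
 shows "graded_group M"
proof -
 interpret abelian_group M by fact
 note grD = additive_subgroupD[OF sub]
 \<comment> \<open>The decomposable elements form a subgroup containing every homogeneous part, so
   by generation every element is decomposable.\<close>
 let ?H = "{x \<in> carrier M. \<exists>d. hdecomp M x d}"
 have "additive_subgroup ?H M"
 proof (rule additive_subgroupI'[OF ab])
  have "hdecomp M \<zero>\<^bsub>M\<^esub> (%i. \<zero>\<^bsub>M\<^esub>)"
   by (rule hdecompI[OF ab, where F = "{}"]) (auto simp: grD)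
  then show "\<zero>\<^bsub>M\<^esub> : ?H" by auto
 next
  fix x y assume "x : ?H" "y : ?H"
  then obtain d e where d: "hdecomp M x d" "x : carrier M" and e: "hdecomp M y e" "y : carrier M"
   by auto
  let ?F = "{i. d i ~= \<zero>\<^bsub>M\<^esub>} \<union> {i. e i ~= \<zero>\<^bsub>M\<^esub>}"
  have cd: "!!i. d i : carrier M" and ce: "!!i. e i : carrier M"
   using d e grD(1) by (auto simp: hdecomp_def)
  have F: "finite ?F" using d e by (auto simp: hdecomp_def)
  have "x = (\<Oplus>\<^bsub>M\<^esub>i\<in>{i. d i ~= \<zero>\<^bsub>M\<^esub>}. d i)" using d by (simp add: hdecomp_def)
  also have "\<dots> = (\<Oplus>\<^bsub>M\<^esub>i\<in>?F. d i)"
   using F cd by (intro add.finprod_mono_neutral_cong_left) auto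
  finally have 1: "x = \<dots>" .
  have "y = (\<Oplus>\<^bsub>M\<^esub>i\<in>{i. e i ~= \<zero>\<^bsub>M\<^esub>}. e i)" using e by (simp add: hdecomp_def)
  also have "\<dots> = (\<Oplus>\<^bsub>M\<^esub>i\<in>?F. e i)"
   using F ce by (intro add.finprod_mono_neutral_cong_left) auto
  finally have 2: "y = \<dots>" .
  have "hdecomp M (x \<oplus>\<^bsub>M\<^esub> y) (%i. d i \<oplus>\<^bsub>M\<^esub> e i)"
  proof (rule hdecompI[OF ab _ _ F])
   show "x \<oplus>\<^bsub>M\<^esub> y = (\<Oplus>\<^bsub>M\<^esub>i\<in>?F. d i \<oplus>\<^bsub>M\<^esub> e i)"
    using cd ce by (subst finsum_addf) (auto simp: 1[symmetric] 2[symmetric])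
  qed (use d e grD in \<open>auto simp: hdecomp_def\<close>)
  then show "x \<oplus>\<^bsub>M\<^esub> y : ?H" using d e by auto
 next
  fix x assume "x : ?H"
  then obtain d where d: "hdecomp M x d" "x : carrier M" by auto
  have cd: "!!i. d i : carrier M" using d grD(1) by (auto simp: hdecomp_def)
  have neg: "addhom M M (%x. \<ominus>\<^bsub>M\<^esub> x)" by (rule addhomI) (auto simp: minus_add)
  have "hdecomp M (\<ominus>\<^bsub>M\<^esub> x) (%i. \<ominus>\<^bsub>M\<^esub> d i)"
  proof (rule hdecompI[OF ab, where F = "{i. d i ~= \<zero>\<^bsub>M\<^esub>}"])
   have "\<ominus>\<^bsub>M\<^esub> x = \<ominus>\<^bsub>M\<^esub> (\<Oplus>\<^bsub>M\<^esub>i\<in>{i. d i ~= \<zero>\<^bsub>M\<^esub>}. d i)"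
    using d by (simp add: hdecomp_def)
   then show "\<ominus>\<^bsub>M\<^esub> x = (\<Oplus>\<^bsub>M\<^esub>i\<in>{i. d i ~= \<zero>\<^bsub>M\<^esub>}. \<ominus>\<^bsub>M\<^esub> d i)"
    using addhom_finsum[OF ab ab neg, of d] cd by auto
  qed (use d grD in \<open>auto simp: hdecomp_def\<close>)
  then show "\<ominus>\<^bsub>M\<^esub> x : ?H" using d by auto
 qed auto
 moreover have "gr M i <= ?H" for i
 proof
  fix x assume x: "x : gr M i"
  have "hdecomp M x (%j. if j = i then x else \<zero>\<^bsub>M\<^esub>)"
  proof (rule hdecompI[OF ab, where F = "{i}"])
   show "x = (\<Oplus>\<^bsub>M\<^esub>k\<in>{i}. if k = i then x else \<zero>\<^bsub>M\<^esub>)"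
    using x grD(1) by (simp add: finsum_insert)
  qed (use x grD in auto)
  then show "x : ?H" using grD(1)[OF x] by auto
 qed
 ultimately have ex: "\<exists>d. hdecomp M x d" if "x : carrier M" for x using gen that by blast
 \<comment> \<open>Applying \<pi> i to a decomposition leaves its summand in degree i, so x alone
   determines d.\<close>
 have uniq: "d i = \<pi> i x" if d: "hdecomp M x d" and x: "x : carrier M" for x d i
 proof -
  have cd: "!!i. d i : carrier M" using d grD(1) by (auto simp: hdecomp_def)
  let ?F = "insert i {i. d i ~= \<zero>\<^bsub>M\<^esub>}"
  have F: "finite ?F" using d by (auto simp: hdecomp_def)
  have "x = (\<Oplus>\<^bsub>M\<^esub>i\<in>{i. d i ~= \<zero>\<^bsub>M\<^esub>}. d i)" using d by (simp add: hdecomp_def)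
  also have "\<dots> = (\<Oplus>\<^bsub>M\<^esub>i\<in>?F. d i)"
   using F cd by (intro add.finprod_mono_neutral_cong_left) auto
  finally have "\<pi> i x = \<pi> i (\<Oplus>\<^bsub>M\<^esub>i\<in>?F. d i)" by simp
  also have "\<dots> = (\<Oplus>\<^bsub>M\<^esub>j\<in>?F. \<pi> i (d j))"
   using cd by (intro addhom_finsum[OF ab ab add]) auto
  also have "\<dots> = (\<Oplus>\<^bsub>M\<^esub>j\<in>?F. if j = i then d j else \<zero>\<^bsub>M\<^esub>)"
   using d cd by (intro finsum_cong') (auto simp: hdecomp_def same intro: diff)
  also have "\<dots> = d i"
   using F cd add.finprod_singleton[of i ?F d] by (simp add: eq_commute[of i])
  finally show ?thesis ..
 qed
 show ?thesis unfolding graded_group_def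
  using ab sub ex uniq by (metis (full_types) ext)
qed

section \<open>Tensor products\<close>

lemmas frag_induct [consumes 1, case_names zero diff frag] = free_Abelian_group_induct

lemma free_generate:
 assumes "S <= carrier (free_Abelian_group C)"
 shows "0 : generate (free_Abelian_group C) S"
  and "!!a b. [|a : generate (free_Abelian_group C) S; b : generate (free_Abelian_group C) S|]
   ==> a + b : generate (free_Abelian_group C) S"
  and "!!a. a : generate (free_Abelian_group C) S ==> - a : generate (free_Abelian_group C) S"
  and "!!a b. [|a : generate (free_Abelian_group C) S; b : generate (free_Abelian_group C) S|]
   ==> a - b : generate (free_Abelian_group C) S"
  and "!!a. a : generate (free_Abelian_group C) S ==> keys a <= C"
proof -
 let ?G = "free_Abelian_group C" and ?N = "generate (free_Abelian_group C) S"
 interpret N: subgroup ?N ?G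
  by (rule group.generate_is_subgroup) (use assms in auto)
 show 0: "0 : ?N" using N.one_closed by simp
 show keys: "keys a <= C" if "a : ?N" for a
  using subsetD[OF N.subset that] by simp
 show add: "a + b : ?N" if "a : ?N" "b : ?N" for a b
  using N.m_closed[OF that] by simp
 show neg: "- a : ?N" if "a : ?N" for a
  using N.m_inv_closed[OF that] keys[OF that] by simp
 show "a - b : ?N" if "a : ?N" "b : ?N" for a b
  using add[OF that(1) neg[OF that(2)]] by simp
qed

lemma free_generate_coset:
 assumes "S <= carrier (free_Abelian_group C)"
 shows "generate (free_Abelian_group C) S #>\<^bsub>free_Abelian_group C\<^esub> u =
   {v. v - u : generate (free_Abelian_group C) S}"
proof -
 have "u' + u : {v. v - u : generate (free_Abelian_group C) S}"
  if "u' : generate (free_Abelian_group C) S" for u'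
  using that by simp
 moreover have "v = (v - u) + u" for v by simp
 ultimately show ?thesis unfolding r_coset_def mult_free_Abelian_group by blast
qed

lemma free_generate_coset_eq:
 assumes "S <= carrier (free_Abelian_group C)"
 shows "generate (free_Abelian_group C) S #>\<^bsub>free_Abelian_group C\<^esub> u =
   generate (free_Abelian_group C) S #>\<^bsub>free_Abelian_group C\<^esub> v \<longleftrightarrow>
   u - v : generate (free_Abelian_group C) S" (is "?L = ?R \<longleftrightarrow> _ : ?N")
proof
 note N = free_generate[OF assms] and co = free_generate_coset[OF assms]
 assume "?L = ?R"
 moreover have "u : ?L" using N(1) by (simp add: co)
 ultimately show "u - v : ?N" by (simp add: co)
next
 note N = free_generate[OF assms] and co = free_generate_coset[OF assms]
 assume uv: "u - v : ?N"
 have "w - u : ?N \<longleftrightarrow> w - v : ?N" for w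
  using N(2)[OF _ uv, of "w - u"] N(4)[OF _ uv, of "w - v"] by auto
 then show "?L = ?R" by (auto simp: co)
qed

text \<open>A homomorphism that is trivial on the generating relations is trivial on everything they
  generate; this is how maps descend to tensor products.\<close>

lemma free_generate_kill:
 assumes "S <= carrier (free_Abelian_group C)" "group H" "h : hom (free_Abelian_group C) H"
  "!!s. s : S ==> h s = \<one>\<^bsub>H\<^esub>" "u : generate (free_Abelian_group C) S"
 shows "h u = \<one>\<^bsub>H\<^esub>"
proof -
 interpret h: group_hom "free_Abelian_group C" H h
  using assms by (simp add: group_hom_def group_hom_axioms_def)
 show ?thesis using assms(5)
 proof (induction rule: generate.induct)
  case (inv s)
  then have "s : carrier (free_Abelian_group C)" using assms(1) by blast
  then show ?case using inv assms(4) h.hom_inv[of s] by (simp del: inv_free_Abelian_group)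
 next
  case (eng a b)
  then have "a : carrier (free_Abelian_group C)" "b : carrier (free_Abelian_group C)"
   using free_generate(5)[OF assms(1)] by auto
  then show ?case using eng h.hom_mult[of a b] by (simp del: mult_free_Abelian_group)
 qed (use assms(4) h.hom_one in auto)
qed

lemma free_hom_diff:
 assumes "group H" "h : hom (free_Abelian_group S) H"
  "keys u <= S" "keys v <= S"
 shows "h (u - v) = h u \<otimes>\<^bsub>H\<^esub> inv\<^bsub>H\<^esub> h v"
proof -
 interpret h: group_hom "free_Abelian_group S" H h
  using assms by (simp add: group_hom_def group_hom_axioms_def)
 have "h (u + - v) = h u \<otimes>\<^bsub>H\<^esub> h (- v)"
  using h.hom_mult[of u "- v"] assms(3,4) by simp
 moreover have "h (- v) = inv\<^bsub>H\<^esub> h v"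
  using h.hom_inv[of v] assms(4) by simp
 ultimately show ?thesis by simp
qed

lemma free_Abelian_group_hom_eqI:
 assumes "group H" "f : hom (free_Abelian_group S) H" "g : hom (free_Abelian_group S) H"
  "!!s. s : S ==> f (frag_of s) = g (frag_of s)" "keys u <= S"
 shows "f u = g u"
proof -
 interpret f: group_hom "free_Abelian_group S" H f
  using assms by (simp add: group_hom_def group_hom_axioms_def)
 interpret g: group_hom "free_Abelian_group S" H g
  using assms by (simp add: group_hom_def group_hom_axioms_def)
 show ?thesis using assms(5)
 proof (induction rule: frag_induct)
  case zero
  then show ?case using f.hom_one g.hom_one by simp
 next
  case (diff x y)
  then show ?case using free_hom_diff[OF assms(1,2)] free_hom_diff[OF assms(1,3)] by simp
 qed (use assms(4) in auto)
qed

text \<open>The biadditive maps that factor through the tensor product. The scalar of a right module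
  is also written on the left, so the usual condition \<phi> (x r, y) = \<phi> (x, r y) takes the
  displayed form.\<close>

definition balanced :: "('r, 'u) ring_scheme => ('r, 'x) gr_module => ('r, 'y) gr_module =>
  ('h, 'v) ring_scheme => ('x => 'y => 'h) => bool" where
 "balanced R X Y H \<phi> \<longleftrightarrow>
   (\<forall>x \<in> carrier X. addhom Y H (\<phi> x)) \<and> (\<forall>y \<in> carrier Y. addhom X H (%x. \<phi> x y)) \<and>
   (\<forall>r \<in> carrier R. \<forall>x \<in> carrier X. \<forall>y \<in> carrier Y. \<phi> (r \<odot>\<^bsub>X\<^esub> x) y = \<phi> x (r \<odot>\<^bsub>Y\<^esub> y))"

lemma balancedI:
 assumes "!!x y. [|x : carrier X; y : carrier Y|] ==> \<phi> x y : carrier H"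
  and "!!x x' y. [|x : carrier X; x' : carrier X; y : carrier Y|]
   ==> \<phi> (x \<oplus>\<^bsub>X\<^esub> x') y = \<phi> x y \<oplus>\<^bsub>H\<^esub> \<phi> x' y"
  and "!!x y y'. [|x : carrier X; y : carrier Y; y' : carrier Y|]
   ==> \<phi> x (y \<oplus>\<^bsub>Y\<^esub> y') = \<phi> x y \<oplus>\<^bsub>H\<^esub> \<phi> x y'"
  and "!!r x y. [|r : carrier R; x : carrier X; y : carrier Y|]
   ==> \<phi> (r \<odot>\<^bsub>X\<^esub> x) y = \<phi> x (r \<odot>\<^bsub>Y\<^esub> y)"
 shows "balanced R X Y H \<phi>"
 using assms by (simp add: balanced_def addhom_def)

lemma balancedD:
 assumes "balanced R X Y H \<phi>"
 shows "!!x y. [|x : carrier X; y : carrier Y|] ==> \<phi> x y : carrier H"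
  and "!!x x' y. [|x : carrier X; x' : carrier X; y : carrier Y|]
   ==> \<phi> (x \<oplus>\<^bsub>X\<^esub> x') y = \<phi> x y \<oplus>\<^bsub>H\<^esub> \<phi> x' y"
  and "!!x y y'. [|x : carrier X; y : carrier Y; y' : carrier Y|]
   ==> \<phi> x (y \<oplus>\<^bsub>Y\<^esub> y') = \<phi> x y \<oplus>\<^bsub>H\<^esub> \<phi> x y'"
  and "!!r x y. [|r : carrier R; x : carrier X; y : carrier Y|]
   ==> \<phi> (r \<odot>\<^bsub>X\<^esub> x) y = \<phi> x (r \<odot>\<^bsub>Y\<^esub> y)"
  and "!!x. x : carrier X ==> addhom Y H (\<phi> x)"
  and "!!y. y : carrier Y ==> addhom X H (%x. \<phi> x y)"
 using assms by (simp_all add: balanced_def addhom_def)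

text \<open>Setting for the additive group of a tensor product. Module laws enter in
  \<open>mtensor\<close>, gradings in \<open>gtensor\<close>.\<close>

locale tensor_pair =
 fixes R :: "('r, 'u) ring_scheme" and X :: "('r, 'x) gr_module" and Y :: "('r, 'y) gr_module"
 assumes X_group: "abelian_group X" and Y_group: "abelian_group Y"
  and X_smult: "!!r x. [|r : carrier R; x : carrier X|] ==> r \<odot>\<^bsub>X\<^esub> x : carrier X"
  and Y_smult: "!!r y. [|r : carrier R; y : carrier Y|] ==> r \<odot>\<^bsub>Y\<^esub> y : carrier Y"
begin

interpretation X: abelian_group X by (rule X_group)
interpretation Y: abelian_group Y by (rule Y_group)

abbreviation "XY \<equiv> carrier X \<times> carrier Y"
abbreviation "N \<equiv> tensor_rels R X Y"
abbreviation "cl \<equiv> tensor_class R X Y"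
abbreviation "pt \<equiv> pure_tensor R X Y"
abbreviation "Q \<equiv> pairs_group X Y Mod N"

definition "gens = {frag_of (x \<oplus>\<^bsub>X\<^esub> x', y) - frag_of (x, y) - frag_of (x', y) | x x' y.
     x : carrier X \<and> x' : carrier X \<and> y : carrier Y} \<union>
   {frag_of (x, y \<oplus>\<^bsub>Y\<^esub> y') - frag_of (x, y) - frag_of (x, y') | x y y'.
     x : carrier X \<and> y : carrier Y \<and> y' : carrier Y} \<union>
   {frag_of (r \<odot>\<^bsub>X\<^esub> x, y) - frag_of (x, r \<odot>\<^bsub>Y\<^esub> y) | r x y.
     r : carrier R \<and> x : carrier X \<and> y : carrier Y}"

lemma N_def: "N = generate (pairs_group X Y) gens"
 unfolding tensor_rels_def gens_def ..

lemma gens_carrier: "gens <= carrier (pairs_group X Y)"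
 unfolding gens_def using X_smult Y_smult
 by (auto dest!: subsetD[OF keys_diff] simp: keys_frag_of)

lemmas N_closed = free_generate[OF gens_carrier, folded N_def]
lemmas cl_eq_iff = free_generate_coset_eq[OF gens_carrier, folded N_def, folded tensor_class_def]
lemmas cl_set = free_generate_coset[OF gens_carrier, folded N_def, folded tensor_class_def]

lemma cl_cong: "u - v : N ==> cl u = cl v"
 by (simp add: cl_eq_iff)

lemma N_normal: "N \<lhd> pairs_group X Y"
proof (rule comm_group.subgroup_imp_normal[OF abelian_free_Abelian_group])
 show "subgroup N (pairs_group X Y)" unfolding N_def
  by (rule group.generate_is_subgroup) (use gens_carrier in auto)
qed

interpretation Nn: normal N "pairs_group X Y" by (rule N_normal)
interpretation Qc: comm_group Q
 by (rule comm_group.abelian_FactGroup[OF abelian_free_Abelian_group Nn.subgroup_axioms])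

lemma Q_group: "group Q" ..

declare mult_FactGroup [simp del] one_FactGroup [simp del]

lemma Q_carrier: "carrier Q = cl ` {u. keys u <= XY}"
 unfolding FactGroup_def RCOSETS_def tensor_class_def by auto

lemma Q_mult:
 "[|keys u <= XY; keys v <= XY|] ==> cl u \<otimes>\<^bsub>Q\<^esub> cl v = cl (u + v)"
 unfolding tensor_class_def using Nn.rcos_sum[of u v] by (simp add: mult_FactGroup)

lemma Q_one: "\<one>\<^bsub>Q\<^esub> = cl 0"
 by (simp add: cl_set one_FactGroup)

lemma tensor_sel:
 "carrier (tensor R X Y act) = carrier Q"
 "add (tensor R X Y act) = monoid.mult Q"
 "\<zero>\<^bsub>tensor R X Y act\<^esub> = \<one>\<^bsub>Q\<^esub>"
 by (simp_all add: tensor_def Let_def)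

lemma tensor_abelian: "abelian_group (tensor R X Y act)"
proof (rule abelian_groupI)
 fix U assume "U : carrier (tensor R X Y act)"
 then show "\<exists>V\<in>carrier (tensor R X Y act).
   V \<oplus>\<^bsub>tensor R X Y act\<^esub> U = \<zero>\<^bsub>tensor R X Y act\<^esub>"
  unfolding tensor_sel by (intro bexI[of _ "inv\<^bsub>Q\<^esub> U"]) (auto intro: Qc.l_inv)
qed (simp_all add: tensor_sel Qc.m_ac)

lemma tensor_a_inv:
 assumes "U : carrier (tensor R X Y act)"
 shows "inv\<^bsub>Q\<^esub> U = \<ominus>\<^bsub>tensor R X Y act\<^esub> U"
proof -
 interpret T: abelian_group "tensor R X Y act" by (rule tensor_abelian)
 have "inv\<^bsub>Q\<^esub> U \<oplus>\<^bsub>tensor R X Y act\<^esub> U = \<zero>\<^bsub>tensor R X Y act\<^esub>"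
  using assms unfolding tensor_sel by (rule Qc.l_inv)
 then show ?thesis using assms Qc.inv_closed T.minus_equality unfolding tensor_sel by metis
qed

lemma cl_carrier: "keys u <= XY ==> cl u : carrier (tensor R X Y act)"
 by (auto simp: tensor_sel Q_carrier)

lemma carrierE:
 assumes "U : carrier (tensor R X Y act)"
 obtains u where "U = cl u" "keys u <= XY"
 using assms by (auto simp: tensor_sel Q_carrier)

lemma cl_add:
 "[|keys u <= XY; keys v <= XY|]
  ==> cl u \<oplus>\<^bsub>tensor R X Y act\<^esub> cl v = cl (u + v)"
 by (simp add: tensor_sel Q_mult)

lemma pt_carrier [intro, simp]:
 "[|x : carrier X; y : carrier Y|] ==> pt x y : carrier (tensor R X Y act)"
 by (simp add: pure_tensor_def cl_carrier)

lemma rep_cl: "rep (cl u) - u : N"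
proof -
 have "u : cl u" using N_closed(1) by (simp add: cl_set)
 then have "rep (cl u) : cl u" unfolding rep_def by (rule someI)
 then show ?thesis by (simp add: cl_set)
qed

lemma rep_keys: "U : carrier (tensor R X Y act) ==> keys (rep U) <= XY"
proof (erule carrierE)
 fix u assume u: "U = cl u" "keys u <= XY"
 then have "keys (rep U - u + u) <= XY"
  using N_closed(5)[OF rep_cl[of u]] keys_add[of "rep U - u" u] by blast
 then show ?thesis by simp
qed

lemma cl_rep: "U : carrier (tensor R X Y act) ==> cl (rep U) = U"
 using rep_cl cl_cong by (auto elim!: carrierE)

lemma pt_balanced: "balanced R X Y (tensor R X Y act) pt"
proof (rule balancedI)
 let ?T = "tensor R X Y act"
 fix x x' y assume A: "x : carrier X" "x' : carrier X" "y : carrier Y"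
 then have "frag_of (x \<oplus>\<^bsub>X\<^esub> x', y) - frag_of (x, y) - frag_of (x', y) : gens"
  unfolding gens_def by blast
 then have "frag_of (x \<oplus>\<^bsub>X\<^esub> x', y) - (frag_of (x, y) + frag_of (x', y)) : N"
  unfolding N_def by (auto intro: generate.incl simp: diff_diff_eq)
 then show "pt (x \<oplus>\<^bsub>X\<^esub> x') y = pt x y \<oplus>\<^bsub>?T\<^esub> pt x' y"
  using A by (simp add: pure_tensor_def cl_add cl_cong keys_frag_of)
next
 let ?T = "tensor R X Y act"
 fix x y y' assume A: "x : carrier X" "y : carrier Y" "y' : carrier Y"
 then have "frag_of (x, y \<oplus>\<^bsub>Y\<^esub> y') - frag_of (x, y) - frag_of (x, y') : gens"
  unfolding gens_def by blast
 then have "frag_of (x, y \<oplus>\<^bsub>Y\<^esub> y') - (frag_of (x, y) + frag_of (x, y')) : N"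
  unfolding N_def by (auto intro: generate.incl simp: diff_diff_eq)
 then show "pt x (y \<oplus>\<^bsub>Y\<^esub> y') = pt x y \<oplus>\<^bsub>?T\<^esub> pt x y'"
  using A by (simp add: pure_tensor_def cl_add cl_cong keys_frag_of)
next
 fix r x y assume A: "r : carrier R" "x : carrier X" "y : carrier Y"
 then have "frag_of (r \<odot>\<^bsub>X\<^esub> x, y) - frag_of (x, r \<odot>\<^bsub>Y\<^esub> y) : gens"
  unfolding gens_def by blast
 then show "pt (r \<odot>\<^bsub>X\<^esub> x) y = pt x (r \<odot>\<^bsub>Y\<^esub> y)"
  unfolding pure_tensor_def N_def by (intro cl_cong) (auto simp: N_def intro: generate.incl)
qed auto

lemmas pt_add_left = balancedD(2)[OF pt_balanced]
lemmas pt_add_right = balancedD(3)[OF pt_balanced]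
lemmas pt_smult = balancedD(4)[OF pt_balanced]
lemmas pt_addhom_right = balancedD(5)[OF pt_balanced]
lemmas pt_addhom_left = balancedD(6)[OF pt_balanced]

lemma tensor_induct [consumes 1, case_names zero diff pure]:
 assumes "U : carrier (tensor R X Y act)" "P \<zero>\<^bsub>tensor R X Y act\<^esub>"
  "!!U V. [|U : carrier (tensor R X Y act); V : carrier (tensor R X Y act); P U; P V|]
    ==> P (U \<ominus>\<^bsub>tensor R X Y act\<^esub> V)"
  "!!x y. [|x : carrier X; y : carrier Y|] ==> P (pt x y)"
 shows "P U"
proof -
 let ?T = "tensor R X Y act"
 interpret T: abelian_group ?T by (rule tensor_abelian)
 have "P (cl u)" if "keys u <= XY" for u
  using that
 proof (induction rule: frag_induct)
  case zero
  then show ?case using assms(2) by (simp only: tensor_sel Q_one)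
 next
  case (diff u v)
  have k: "keys (u - v) <= XY" using diff keys_diff[of u v] by blast
  have "cl (u - v) \<oplus>\<^bsub>?T\<^esub> cl v = cl u" using diff k by (simp add: cl_add)
  then have "cl (u - v) = cl u \<ominus>\<^bsub>?T\<^esub> cl v"
   using diff k cl_carrier by (metis T.add.inv_solve_right' a_inv_def a_minus_def)
  then show ?case using assms(3)[OF cl_carrier cl_carrier] diff by simp
 qed (use assms(4) in \<open>auto simp: pure_tensor_def\<close>)
 then show ?thesis using assms(1) by (auto elim: carrierE)
qed

lemma tensor_hom_eqI:
 assumes "abelian_group H" "addhom (tensor R X Y act) H f" "addhom (tensor R X Y act) H g"
  "!!x y. [|x : carrier X; y : carrier Y|] ==> f (pt x y) = g (pt x y)"
  "U : carrier (tensor R X Y act)"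
 shows "f U = g U"
 using assms(5)
proof (induction rule: tensor_induct)
 case zero
 then show ?case using addhom_zero[OF tensor_abelian assms(1)] assms(2,3) by metis
next
 case (diff U V)
 then show ?case using addhom_diff[OF tensor_abelian assms(1)] assms(2,3) by metis
qed (rule assms(4))

text \<open>The universal property. The lift evaluates the homomorphism on the free group at the
  chosen representative \<open>rep U\<close>; the choice is immaterial because balancedness kills
  each of the three kinds of generators of \<open>N\<close>.\<close>

lemma tensor_lift:
 assumes "abelian_group H" "balanced R X Y H \<phi>"
 obtains \<Phi> where "addhom (tensor R X Y act) H \<Phi>"
  "!!x y. [|x : carrier X; y : carrier Y|] ==> \<Phi> (pt x y) = \<phi> x y"
proof -
 interpret H: abelian_group H by fact
 note bal = balancedD[OF assms(2)]
 obtain h where h: "h : hom (pairs_group X Y) (add_monoid H)"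
  and h_of: "!!z. z : XY ==> h (frag_of z) = (case z of (x, y) => \<phi> x y)"
  by (rule H.add.free_Abelian_group_universal[of "%(x, y). \<phi> x y" XY])
   (use bal(1) in auto)
 interpret h: group_hom "pairs_group X Y" "add_monoid H" h
  using h H.a_group by (simp add: group_hom_def group_hom_axioms_def)
 have hd: "h (u - v) = h u \<ominus>\<^bsub>H\<^esub> h v"
  if "keys u <= XY" "keys v <= XY" for u v
  using free_hom_diff[OF H.a_group h that] by (simp add: a_minus_def a_inv_def)
 have hc: "h u : carrier H" if "keys u <= XY" for u
  using h.hom_closed that by simp
 have kill: "h u = \<zero>\<^bsub>H\<^esub>" if "u : N" for u
 proof -
  have "h s = \<one>\<^bsub>add_monoid H\<^esub>" if sg: "s : gens" for s
  proof -
   consider x x' y where "s = frag_of (x \<oplus>\<^bsub>X\<^esub> x', y) - frag_of (x, y) - frag_of (x', y)"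
     "x : carrier X" "x' : carrier X" "y : carrier Y"
    | x y y' where "s = frag_of (x, y \<oplus>\<^bsub>Y\<^esub> y') - frag_of (x, y) - frag_of (x, y')"
     "x : carrier X" "y : carrier Y" "y' : carrier Y"
    | r x y where "s = frag_of (r \<odot>\<^bsub>X\<^esub> x, y) - frag_of (x, r \<odot>\<^bsub>Y\<^esub> y)"
     "r : carrier R" "x : carrier X" "y : carrier Y"
    using sg unfolding gens_def by blast
   then show ?thesis
   proof cases
    case 1
    have s: "s = frag_of (x \<oplus>\<^bsub>X\<^esub> x', y) - (frag_of (x, y) + frag_of (x', y))"
     using 1 by (simp add: diff_diff_eq)
    have "h (frag_of (x, y) + frag_of (x', y)) = \<phi> x y \<oplus>\<^bsub>H\<^esub> \<phi> x' y"
     using h.hom_mult[of "frag_of (x, y)" "frag_of (x', y)"] 1 by (simp add: h_of)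
    then have "h s = \<phi> (x \<oplus>\<^bsub>X\<^esub> x') y \<ominus>\<^bsub>H\<^esub> (\<phi> x y \<oplus>\<^bsub>H\<^esub> \<phi> x' y)"
     unfolding s using 1 subset_trans[OF keys_add]
     by (subst hd) (auto simp: h_of keys_frag_of dest!: subsetD[OF keys_add])
    then show ?thesis using 1 bal by (simp add: a_minus_def H.r_neg)
   next
    case 2
    have s: "s = frag_of (x, y \<oplus>\<^bsub>Y\<^esub> y') - (frag_of (x, y) + frag_of (x, y'))"
     using 2 by (simp add: diff_diff_eq)
    have "h (frag_of (x, y) + frag_of (x, y')) = \<phi> x y \<oplus>\<^bsub>H\<^esub> \<phi> x y'"
     using h.hom_mult[of "frag_of (x, y)" "frag_of (x, y')"] 2 by (simp add: h_of)
    then have "h s = \<phi> x (y \<oplus>\<^bsub>Y\<^esub> y') \<ominus>\<^bsub>H\<^esub> (\<phi> x y \<oplus>\<^bsub>H\<^esub> \<phi> x y')"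
     unfolding s using 2
     by (subst hd) (auto simp: h_of keys_frag_of dest!: subsetD[OF keys_add])
    then show ?thesis using 2 bal by (simp add: a_minus_def H.r_neg)
   next
    case 3
    then show ?thesis using X_smult Y_smult bal
     by (simp add: hd h_of a_minus_def H.r_neg)
   qed
  qed
  from free_generate_kill[OF gens_carrier H.a_group h this, of u] that show ?thesis
   by (simp add: N_def)
 qed
 have h_eq: "h u = h v" if "u - v : N" "keys u <= XY" "keys v <= XY" for u v
 proof -
  have "h u \<ominus>\<^bsub>H\<^esub> h v = \<zero>\<^bsub>H\<^esub>" using kill[OF that(1)] hd that by simp
  then show ?thesis using hc that by simp
 qed
 show thesis
 proof
  have rc: "h (rep (cl u)) = h u" if "keys u <= XY" for u
   using that by (intro h_eq rep_cl rep_keys[OF cl_carrier])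
  show "addhom (tensor R X Y act) H (%U. h (rep U))"
  proof (rule addhomI)
   fix U V assume "U : carrier (tensor R X Y act)" "V : carrier (tensor R X Y act)"
   then obtain u v where u: "U = cl u" "keys u <= XY"
    and v: "V = cl v" "keys v <= XY"
    by (metis carrierE)
   have "keys (u + v) <= XY" using u v keys_add[of u v] by blast
   then show "h (rep (U \<oplus>\<^bsub>tensor R X Y act\<^esub> V)) = h (rep U) \<oplus>\<^bsub>H\<^esub> h (rep V)"
    using u v h.hom_mult[of u v] by (simp add: cl_add rc)
  qed (use hc rep_keys in auto)
  show "h (rep (pt x y)) = \<phi> x y" if "x : carrier X" "y : carrier Y" for x y
   using that by (simp add: pure_tensor_def rc h_of)
 qed
qed

text \<open>The scalar action is defined through a chosen representative of the class. If
  \<open>act b\<close> is balanced on pure tensors, its lift by the universal property agrees with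
  this recipe on every class, so the action is additive and does not depend on the choice.\<close>

lemma tensor_smult_class:
 assumes keys: "!!x y. [|x : carrier X; y : carrier Y|] ==> keys (act b (x, y)) <= XY"
  and bal: "balanced R X Y (tensor R X Y act) (%x y. cl (act b (x, y)))"
  and u: "keys u <= XY"
 shows "b \<odot>\<^bsub>tensor R X Y act\<^esub> cl u = cl (frag_extend (act b) u)"
  and "addhom (tensor R X Y act) (tensor R X Y act) (smult (tensor R X Y act) b)"
  and "!!x y. [|x : carrier X; y : carrier Y|]
   ==> b \<odot>\<^bsub>tensor R X Y act\<^esub> pt x y = cl (act b (x, y))"
proof -
 let ?T = "tensor R X Y act"
 interpret T: abelian_group ?T by (rule tensor_abelian)
 obtain \<Phi> where \<Phi>: "addhom ?T ?T \<Phi>"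
  "!!x y. [|x : carrier X; y : carrier Y|] ==> \<Phi> (pt x y) = cl (act b (x, y))"
  using tensor_lift[OF tensor_abelian bal] by blast
 have ke: "keys (frag_extend (act b) u) <= XY" if "keys u <= XY" for u
 proof
  fix z assume "z : keys (frag_extend (act b) u)"
  with keys_frag_extend[of "act b" u]
  have "z : (\<Union>w\<in>keys u. keys (act b w))" by (rule subsetD)
  then obtain w where w: "w : keys u" "z : keys (act b w)" by blast
  obtain x y where xy: "w = (x, y)" by (cases w)
  with w(1) that have "x : carrier X" "y : carrier Y" by auto
  from subsetD[OF keys[OF this]] show "z : XY" using w(2) xy by simp
 qed
 have *: "\<Phi> (cl u) = cl (frag_extend (act b) u)" if "keys u <= XY" for u
 proof (rule free_Abelian_group_hom_eqI[OF T.a_group, where S = XY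
    and f = "%u. \<Phi> (cl u)" and g = "%u. cl (frag_extend (act b) u)"])
  show "(%u. \<Phi> (cl u)) : hom (pairs_group X Y) (add_monoid ?T)"
  proof (rule homI)
   fix u v assume "u : carrier (pairs_group X Y)" "v : carrier (pairs_group X Y)"
   then have uv: "keys u <= XY" "keys v <= XY" by simp_all
   then show "\<Phi> (cl (u \<otimes>\<^bsub>pairs_group X Y\<^esub> v)) = \<Phi> (cl u) \<otimes>\<^bsub>add_monoid ?T\<^esub> \<Phi> (cl v)"
    using addhom_add[OF \<Phi>(1) cl_carrier[OF uv(1)] cl_carrier[OF uv(2)]] by (simp add: cl_add)
  qed (use \<Phi>(1) cl_carrier in \<open>auto simp: addhom_def\<close>)
  show "(%u. cl (frag_extend (act b) u)) : hom (pairs_group X Y) (add_monoid ?T)"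
   using ke by (intro homI) (auto simp: cl_add frag_extend_add cl_carrier)
  fix s assume "s : XY"
  then show "\<Phi> (cl (frag_of s)) = cl (frag_extend (act b) (frag_of s))"
   using \<Phi>(2) by (auto simp: pure_tensor_def)
 qed (use that in auto)
 have sm: "b \<odot>\<^bsub>?T\<^esub> U = cl (frag_extend (act b) (rep U))" for U
  by (simp add: tensor_def Let_def)
 have eq: "b \<odot>\<^bsub>?T\<^esub> U = \<Phi> U" if "U : carrier ?T" for U
  using that rep_keys[OF that] by (simp add: sm *[symmetric] cl_rep)
 show "b \<odot>\<^bsub>?T\<^esub> cl u = cl (frag_extend (act b) u)"
  using u by (simp add: eq * cl_carrier)
 show "addhom ?T ?T (smult ?T b)"
  using \<Phi>(1) eq by (simp add: addhom_def)
 show "!!x y. [|x : carrier X; y : carrier Y|] ==> b \<odot>\<^bsub>?T\<^esub> pt x y = cl (act b (x, y))"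
  by (simp add: eq \<Phi>(2))
qed

lemma tensor_gr: "gr (tensor R X Y act) i =
  generate Q {pt x y | x y j k. x : gr X j \<and> y : gr Y k \<and> j + k = i}"
 by (simp add: tensor_def Let_def)

end

section \<open>Modules and gradings on tensor products\<close>

lemma opp_sel [simp]:
 "carrier (opp A) = carrier A" "add (opp A) = add A" "\<zero>\<^bsub>opp A\<^esub> = \<zero>\<^bsub>A\<^esub>" "\<one>\<^bsub>opp A\<^esub> = \<one>\<^bsub>A\<^esub>"
 "monoid.mult (opp A) = (%x y. y \<otimes>\<^bsub>A\<^esub> x)"
 by (simp_all add: opp_def)

lemma opp_abelian_group [simp]: "abelian_group (opp A) \<longleftrightarrow> abelian_group A"
 by (auto simp: abelian_group_def abelian_monoid_def abelian_group_axioms_def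
   comm_group_def comm_monoid_def comm_monoid_axioms_def monoid_def group_def group_axioms_def
   Units_def)

lemma ring_opp: "ring A ==> ring (opp A)"
proof -
 assume "ring A"
 then interpret ring A .
 show ?thesis
  by (rule ringI) (auto simp: is_abelian_group m_assoc r_distr l_distr intro!: monoidI)
qed

lemma left_moduleD:
 assumes "left_module A M"
 shows "ring A" "abelian_group M"
  "!!a x. [|a : carrier A; x : carrier M|] ==> a \<odot>\<^bsub>M\<^esub> x : carrier M"
  "!!a b x. [|a : carrier A; b : carrier A; x : carrier M|]
   ==> (a \<oplus>\<^bsub>A\<^esub> b) \<odot>\<^bsub>M\<^esub> x = (a \<odot>\<^bsub>M\<^esub> x) \<oplus>\<^bsub>M\<^esub> (b \<odot>\<^bsub>M\<^esub> x)"
  "!!a x y. [|a : carrier A; x : carrier M; y : carrier M|]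
   ==> a \<odot>\<^bsub>M\<^esub> (x \<oplus>\<^bsub>M\<^esub> y) = (a \<odot>\<^bsub>M\<^esub> x) \<oplus>\<^bsub>M\<^esub> (a \<odot>\<^bsub>M\<^esub> y)"
  "!!a b x. [|a : carrier A; b : carrier A; x : carrier M|]
   ==> (a \<otimes>\<^bsub>A\<^esub> b) \<odot>\<^bsub>M\<^esub> x = a \<odot>\<^bsub>M\<^esub> (b \<odot>\<^bsub>M\<^esub> x)"
  "!!x. x : carrier M ==> \<one>\<^bsub>A\<^esub> \<odot>\<^bsub>M\<^esub> x = x"
 using assms by (simp_all add: left_module_def)

lemma left_module_addhom:
 assumes "left_module A M"
 shows "a : carrier A ==> addhom M M (%x. a \<odot>\<^bsub>M\<^esub> x)"
  and "x : carrier M ==> addhom A M (%a. a \<odot>\<^bsub>M\<^esub> x)"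
 using left_moduleD[OF assms] by (auto intro!: addhomI)

lemma left_module_zero:
 assumes "left_module A M"
 shows "a : carrier A ==> a \<odot>\<^bsub>M\<^esub> \<zero>\<^bsub>M\<^esub> = \<zero>\<^bsub>M\<^esub>"
  and "x : carrier M ==> \<zero>\<^bsub>A\<^esub> \<odot>\<^bsub>M\<^esub> x = \<zero>\<^bsub>M\<^esub>"
 using addhom_zero[OF _ _ left_module_addhom(1)[OF assms]]
  addhom_zero[OF _ _ left_module_addhom(2)[OF assms]]
  left_moduleD(1,2)[OF assms] ring.is_abelian_group by blast+

section \<open>Module structures on tensor products\<close>

locale mtensor =
 fixes R :: "('r, 'u) ring_scheme" and X :: "('r, 'x) gr_module" and Y :: "('r, 'y) gr_module"
 assumes X_mod: "left_module (opp R) X" and Y_mod: "left_module R Y"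
begin

sublocale tensor_pair R X Y
 using left_moduleD[OF X_mod] left_moduleD[OF Y_mod] by (intro tensor_pair.intro) auto

lemma R_ring: "ring R" using left_moduleD[OF Y_mod] by simp

lemma smult_right:
 assumes act: "!!x y. act b (x, y) = frag_of (x, \<beta> y)"
  and \<beta>: "\<beta> : module_hom R Y Y"
 shows "addhom (tensor R X Y act) (tensor R X Y act) (smult (tensor R X Y act) b)"
  and "!!x y. [|x : carrier X; y : carrier Y|] ==> b \<odot>\<^bsub>tensor R X Y act\<^esub> pt x y = pt x (\<beta> y)"
proof -
 let ?T = "tensor R X Y act"
 have \<beta>c: "!!y. y : carrier Y ==> \<beta> y : carrier Y" and
  \<beta>s: "!!r y. [|r : carrier R; y : carrier Y|] ==> \<beta> (r \<odot>\<^bsub>Y\<^esub> y) = r \<odot>\<^bsub>Y\<^esub> \<beta> y"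
  and \<beta>a: "!!y y'. [|y : carrier Y; y' : carrier Y|] ==> \<beta> (y \<oplus>\<^bsub>Y\<^esub> y') = \<beta> y \<oplus>\<^bsub>Y\<^esub> \<beta> y'"
  using \<beta> by (auto simp: module_hom_def)
 have bal: "balanced R X Y ?T (%x y. cl (act b (x, y)))"
  unfolding act pure_tensor_def[symmetric]
  by (rule balancedI) (auto simp: \<beta>c \<beta>s \<beta>a pt_add_left pt_add_right pt_smult)
 have keys: "keys (act b (x, y)) <= XY" if "x : carrier X" "y : carrier Y" for x y
  using that \<beta>c by (simp add: act keys_frag_of)
 note * = tensor_smult_class[OF keys bal, of 0, simplified]
 show "addhom ?T ?T (smult ?T b)" by (rule *)
 show "b \<odot>\<^bsub>?T\<^esub> pt x y = pt x (\<beta> y)" if "x : carrier X" "y : carrier Y" for x y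
  using *(3)[OF that] by (simp add: act pure_tensor_def)
qed

lemma smult_left:
 assumes act: "!!x y. act b (x, y) = frag_of (\<alpha> x, y)"
  and \<alpha>: "\<alpha> : module_hom R X X"
 shows "addhom (tensor R X Y act) (tensor R X Y act) (smult (tensor R X Y act) b)"
  and "!!x y. [|x : carrier X; y : carrier Y|] ==> b \<odot>\<^bsub>tensor R X Y act\<^esub> pt x y = pt (\<alpha> x) y"
proof -
 let ?T = "tensor R X Y act"
 have \<alpha>c: "!!y. y : carrier X ==> \<alpha> y : carrier X" and
  \<alpha>s: "!!r y. [|r : carrier R; y : carrier X|] ==> \<alpha> (r \<odot>\<^bsub>X\<^esub> y) = r \<odot>\<^bsub>X\<^esub> \<alpha> y"
  and \<alpha>a: "!!y y'. [|y : carrier X; y' : carrier X|] ==> \<alpha> (y \<oplus>\<^bsub>X\<^esub> y') = \<alpha> y \<oplus>\<^bsub>X\<^esub> \<alpha> y'"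
  using \<alpha> by (auto simp: module_hom_def)
 have bal: "balanced R X Y ?T (%x y. cl (act b (x, y)))"
  unfolding act pure_tensor_def[symmetric]
  by (rule balancedI) (auto simp: \<alpha>c \<alpha>s \<alpha>a pt_add_left pt_add_right pt_smult)
 have keys: "keys (act b (x, y)) <= XY" if "x : carrier X" "y : carrier Y" for x y
  using that \<alpha>c by (simp add: act keys_frag_of)
 note * = tensor_smult_class[OF keys bal, of 0, simplified]
 show "addhom ?T ?T (smult ?T b)" by (rule *)
 show "b \<odot>\<^bsub>?T\<^esub> pt x y = pt (\<alpha> x) y" if "x : carrier X" "y : carrier Y" for x y
  using *(3)[OF that] by (simp add: act pure_tensor_def)
qed

text \<open>Each module law compares two additive maps, so pure tensors decide it.\<close>

lemma tensor_left_module: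
 assumes "ring B"
  and sm: "!!b. b : carrier B ==>
   addhom (tensor R X Y act) (tensor R X Y act) (smult (tensor R X Y act) b)"
  and add: "!!a b x y. [|a : carrier B; b : carrier B; x : carrier X; y : carrier Y|] ==>
   (a \<oplus>\<^bsub>B\<^esub> b) \<odot>\<^bsub>tensor R X Y act\<^esub> pt x y =
    (a \<odot>\<^bsub>tensor R X Y act\<^esub> pt x y) \<oplus>\<^bsub>tensor R X Y act\<^esub> (b \<odot>\<^bsub>tensor R X Y act\<^esub> pt x y)"
  and mult: "!!a b x y. [|a : carrier B; b : carrier B; x : carrier X; y : carrier Y|] ==>
   (a \<otimes>\<^bsub>B\<^esub> b) \<odot>\<^bsub>tensor R X Y act\<^esub> pt x y =
    a \<odot>\<^bsub>tensor R X Y act\<^esub> (b \<odot>\<^bsub>tensor R X Y act\<^esub> pt x y)"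
  and one: "!!x y. [|x : carrier X; y : carrier Y|] ==> \<one>\<^bsub>B\<^esub> \<odot>\<^bsub>tensor R X Y act\<^esub> pt x y = pt x y"
 shows "left_module B (tensor R X Y act)"
proof -
 let ?T = "tensor R X Y act"
 interpret T: abelian_group ?T by (rule tensor_abelian)
 interpret B: ring B by fact
 have "(a \<oplus>\<^bsub>B\<^esub> b) \<odot>\<^bsub>?T\<^esub> U = (a \<odot>\<^bsub>?T\<^esub> U) \<oplus>\<^bsub>?T\<^esub> (b \<odot>\<^bsub>?T\<^esub> U)"
  if "a : carrier B" "b : carrier B" "U : carrier ?T" for a b U
  using _ _ _ _ that(3)
 proof (rule tensor_hom_eqI)
  show "addhom ?T ?T (%U. (a \<odot>\<^bsub>?T\<^esub> U) \<oplus>\<^bsub>?T\<^esub> (b \<odot>\<^bsub>?T\<^esub> U))"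
   using sm[OF that(1)] sm[OF that(2)] by (auto simp: addhom_def T.a_ac)
 qed (use that add sm tensor_abelian in auto)
 moreover have "(a \<otimes>\<^bsub>B\<^esub> b) \<odot>\<^bsub>?T\<^esub> U = a \<odot>\<^bsub>?T\<^esub> (b \<odot>\<^bsub>?T\<^esub> U)"
  if "a : carrier B" "b : carrier B" "U : carrier ?T" for a b U
  using _ _ _ _ that(3)
 proof (rule tensor_hom_eqI)
  show "addhom ?T ?T (%U. a \<odot>\<^bsub>?T\<^esub> (b \<odot>\<^bsub>?T\<^esub> U))"
   using addhom_comp[OF sm[OF that(2)] sm[OF that(1)]] .
 qed (use that mult sm tensor_abelian in auto)
 moreover have "\<one>\<^bsub>B\<^esub> \<odot>\<^bsub>?T\<^esub> U = U" if "U : carrier ?T" for U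
  using _ _ _ _ that
 proof (rule tensor_hom_eqI)
  show "addhom ?T ?T (%U. U)" by (rule addhom_id)
 qed (use one sm tensor_abelian in auto)
 ultimately show ?thesis unfolding left_module_def
  using assms(1) tensor_abelian sm by (auto simp: addhom_def)
qed

end

text \<open>The sets \<open>rg i\<close> stand for the homogeneous scalars and only have to generate
  R additively. This covers a graded algebra as well as the base field placed in degree
  zero.\<close>

locale gtensor = mtensor R X Y
 for R :: "('r, 'u) ring_scheme" and X :: "('r, 'x) gr_module" and Y :: "('r, 'y) gr_module" +
 fixes rg :: "int => 'r set"
 assumes gX: "graded_group X" and gY: "graded_group Y"
  and rg_gen: "!!H. [|additive_subgroup H R; !!i. rg i <= H|] ==> carrier R <= H"
  and rg_carrier: "!!i. rg i <= carrier R"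
  and X_gr: "!!i j r x. [|r : rg i; x : gr X j|] ==> r \<odot>\<^bsub>X\<^esub> x : gr X (i + j)"
  and Y_gr: "!!i j r x. [|r : rg i; x : gr Y j|] ==> r \<odot>\<^bsub>Y\<^esub> x : gr Y (i + j)"
begin

interpretation X: graded X by (unfold_locales) (rule gX)
interpretation Y: graded Y by (unfold_locales) (rule gY)

lemma pt_gr:
 assumes "x : gr X j" "y : gr Y k" "j + k = i"
 shows "pt x y : gr (tensor R X Y act) i"
 unfolding tensor_gr using assms by (blast intro: generate.incl)

lemma gr_gens: "{pt x y | x y j k. x : gr X j \<and> y : gr Y k \<and> j + k = i} <= carrier (tensor R X Y act)"
 using X.gr_closed(1) Y.gr_closed(1) by auto

lemma gr_closed:
 shows "U : gr (tensor R X Y act) i ==> U : carrier (tensor R X Y act)"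
  and "\<zero>\<^bsub>tensor R X Y act\<^esub> : gr (tensor R X Y act) i"
  and "[|U : gr (tensor R X Y act) i; V : gr (tensor R X Y act) i|]
   ==> U \<oplus>\<^bsub>tensor R X Y act\<^esub> V : gr (tensor R X Y act) i"
  and "U : gr (tensor R X Y act) i ==> \<ominus>\<^bsub>tensor R X Y act\<^esub> U : gr (tensor R X Y act) i"
proof -
 let ?S = "{pt x y | x y j k. x : gr X j \<and> y : gr Y k \<and> j + k = i}"
 let ?T = "tensor R X Y act"
 have S: "?S <= carrier Q" using gr_gens[of i act] by (simp add: tensor_sel)
 note sub = group.generate_is_subgroup[OF Q_group S]
 show *: "U : carrier ?T" if "U : gr ?T i" for U
  using that subgroup.subset[OF sub] by (auto simp: tensor_gr tensor_sel)
 show "\<zero>\<^bsub>?T\<^esub> : gr ?T i"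
  using subgroup.one_closed[OF sub] by (simp add: tensor_gr tensor_sel)
 show "U \<oplus>\<^bsub>?T\<^esub> V : gr ?T i" if "U : gr ?T i" "V : gr ?T i"
  using subgroup.m_closed[OF sub] that by (simp add: tensor_gr tensor_sel)
 show "\<ominus>\<^bsub>?T\<^esub> U : gr ?T i" if "U : gr ?T i"
  using subgroup.m_inv_closed[OF sub, of U] that *[OF that] by (simp add: tensor_gr tensor_a_inv[of _ act])
qed

lemma gr_subgroup: "additive_subgroup (gr (tensor R X Y act) i) (tensor R X Y act)"
 by (rule additive_subgroupI'[OF tensor_abelian]) (auto intro: gr_closed)

lemma gr_induct [consumes 1, case_names zero pure neg add]:
 assumes "U : gr (tensor R X Y act) i"
  and zero: "P \<zero>\<^bsub>tensor R X Y act\<^esub>"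
  and pure: "!!x y j k. [|x : gr X j; y : gr Y k; j + k = i|] ==> P (pt x y)"
  and neg: "!!U. U : carrier (tensor R X Y act) ==> P U ==> P (\<ominus>\<^bsub>tensor R X Y act\<^esub> U)"
  and add: "!!U V. [|U : carrier (tensor R X Y act); V : carrier (tensor R X Y act); P U; P V|]
    ==> P (U \<oplus>\<^bsub>tensor R X Y act\<^esub> V)"
 shows "P U"
 using assms(1) unfolding tensor_gr
proof (induction rule: generate.induct)
 case one
 then show ?case using zero by (simp add: tensor_sel)
next
 case (incl h)
 then show ?case using pure by blast
next
 case (inv h)
 then have "h : carrier (tensor R X Y act)" using gr_gens[of i act] by blast
 then show ?case using inv pure neg tensor_a_inv[of h act] by auto
next
 case (eng a b)
 then have "a : carrier (tensor R X Y act)" "b : carrier (tensor R X Y act)"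
  using gr_closed(1)[of _ act i] unfolding tensor_gr by auto
 then show ?case using add eng by (simp add: tensor_sel)
qed

text \<open>A homogeneous part of a tensor product is generated by the pure tensors of matching
  total degree, so these decide where it is sent.\<close>

lemma gr_addhom_image:
 assumes "addhom (tensor R X Y act) H f" "abelian_group H" "additive_subgroup G H"
  "!!x y j k. [|x : gr X j; y : gr Y k; j + k = i|] ==> f (pt x y) : G"
 shows "f ` gr (tensor R X Y act) i <= G"
proof
 fix z assume "z : f ` gr (tensor R X Y act) i"
 then obtain U where U: "U : gr (tensor R X Y act) i" "z = f U" by auto
 note G = additive_subgroupD[OF assms(3)]
 from U(1) have "f U : G"
  by (induction rule: gr_induct)
   (use assms addhom_zero[OF tensor_abelian assms(2,1)] addhom_minus[OF tensor_abelian assms(2,1)] G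
    in \<open>auto simp: addhom_add\<close>)
 then show "z : G" using U by simp
qed

text \<open>The degree i component of x \<otimes> y, namely the sum of x_j \<otimes> y_(i-j) over j.
  The additive group is the same for every scalar action; the dummy action by \<open>unit\<close>
  merely names it.\<close>

definition proj :: "int => 'x => 'y => ('x \<times> 'y \<Rightarrow>\<^sub>0 int) set" where
 "proj i x y = (\<Oplus>\<^bsub>tensor R X Y (%_::unit. frag_of)\<^esub> j \<in> {j. hcomp X j x ~= \<zero>\<^bsub>X\<^esub>}.
   pt (hcomp X j x) (hcomp Y (i - j) y))"

lemma pt_zero_left: "y : carrier Y ==> pt \<zero>\<^bsub>X\<^esub> y = \<zero>\<^bsub>tensor R X Y act\<^esub>"
 using addhom_zero[OF X.ab tensor_abelian pt_addhom_left] by blast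

lemma pt_zero_right: "x : carrier X ==> pt x \<zero>\<^bsub>Y\<^esub> = \<zero>\<^bsub>tensor R X Y act\<^esub>"
 using addhom_zero[OF Y.ab tensor_abelian pt_addhom_right] by blast

lemma proj_eq:
 assumes "finite J" "{j. hcomp X j x ~= \<zero>\<^bsub>X\<^esub>} <= J" "x : carrier X" "y : carrier Y"
 shows "proj i x y = (\<Oplus>\<^bsub>tensor R X Y (%_::unit. frag_of)\<^esub> j \<in> J.
   pt (hcomp X j x) (hcomp Y (i - j) y))"
proof -
 let ?T = "tensor R X Y (%_::unit. frag_of)"
 interpret T: abelian_group ?T by (rule tensor_abelian)
 have c: "pt (hcomp X j x) (hcomp Y (i - j) y) : carrier ?T" for j
  using assms X.hcomp_closed Y.hcomp_closed by auto
 show ?thesis unfolding proj_def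
  by (rule T.add.finprod_mono_neutral_cong_left)
   (use assms c in \<open>auto simp: pt_zero_left[where act = "%_::unit. frag_of"] Y.hcomp_closed\<close>)
qed

lemma proj_homog:
 assumes "x : gr X j" "y : gr Y k"
 shows "proj i x y = (if j + k = i then pt x y else \<zero>\<^bsub>tensor R X Y (%_::unit. frag_of)\<^esub>)"
proof -
 let ?T = "tensor R X Y (%_::unit. frag_of)"
 interpret T: abelian_group ?T by (rule tensor_abelian)
 have c: "x : carrier X" "y : carrier Y" using assms X.gr_closed Y.gr_closed by auto
 have "proj i x y = (\<Oplus>\<^bsub>?T\<^esub> l \<in> {j}. pt (hcomp X l x) (hcomp Y (i - l) y))"
  by (rule proj_eq) (use assms c in \<open>auto simp: X.hcomp_homog split: if_splits\<close>)
 also have "\<dots> = pt x (hcomp Y (i - j) y)"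
  using assms c Y.hcomp_closed by (simp add: X.hcomp_homog T.finsum_insert)
 finally show ?thesis using assms c
  by (auto simp: Y.hcomp_homog pt_zero_right[where act = "%_::unit. frag_of"])
qed

text \<open>Biadditivity holds componentwise. A homogeneous scalar raises the total degree by the
  same amount on either side, which settles balancedness for homogeneous arguments; additivity
  extends it to all x and y, and to all scalars because the sets \<open>rg\<close> generate
  R.\<close>

lemma proj_balanced: "balanced R X Y (tensor R X Y (%_::unit. frag_of)) (proj i)"
proof (rule balancedI)
 let ?T = "tensor R X Y (%_::unit. frag_of)"
 interpret T: abelian_group ?T by (rule tensor_abelian)
 interpret R: ring R by (rule R_ring)
 have c: "pt (hcomp X j x) (hcomp Y k y) : carrier ?T" if "x : carrier X" "y : carrier Y" for x y j k
  using that X.hcomp_closed Y.hcomp_closed by auto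
 show pc: "proj i x y : carrier ?T" if "x : carrier X" "y : carrier Y" for x y
  using c[OF that] unfolding proj_def by (intro T.finsum_closed) auto
 show left: "proj i (x \<oplus>\<^bsub>X\<^esub> x') y = proj i x y \<oplus>\<^bsub>?T\<^esub> proj i x' y"
  if "x : carrier X" "x' : carrier X" "y : carrier Y" for x x' y
 proof -
  let ?J = "{j. hcomp X j x ~= \<zero>\<^bsub>X\<^esub>} \<union> {j. hcomp X j x' ~= \<zero>\<^bsub>X\<^esub>}"
  have J: "finite ?J" using X.hcomp_finite that by blast
  have ha: "hcomp X j (x \<oplus>\<^bsub>X\<^esub> x') = hcomp X j x \<oplus>\<^bsub>X\<^esub> hcomp X j x'" for j
   using addhom_add[OF X.hcomp_addhom] that by blast
  have "proj i (x \<oplus>\<^bsub>X\<^esub> x') y = (\<Oplus>\<^bsub>?T\<^esub> j \<in> ?J. pt (hcomp X j (x \<oplus>\<^bsub>X\<^esub> x')) (hcomp Y (i - j) y))"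
   by (rule proj_eq[OF J]) (use that ha in auto)
  also have "\<dots> = (\<Oplus>\<^bsub>?T\<^esub> j \<in> ?J. pt (hcomp X j x) (hcomp Y (i - j) y) \<oplus>\<^bsub>?T\<^esub>
    pt (hcomp X j x') (hcomp Y (i - j) y))"
   using that c X.hcomp_closed Y.hcomp_closed
   by (intro T.finsum_cong') (auto simp: ha pt_add_left)
  also have "\<dots> = proj i x y \<oplus>\<^bsub>?T\<^esub> proj i x' y"
   using that c by (subst T.finsum_addf) (auto simp: proj_eq[OF J])
  finally show ?thesis .
 qed
 show right: "proj i x (y \<oplus>\<^bsub>Y\<^esub> y') = proj i x y \<oplus>\<^bsub>?T\<^esub> proj i x y'"
  if "x : carrier X" "y : carrier Y" "y' : carrier Y" for x y y'
 proof -
  have ha: "hcomp Y j (y \<oplus>\<^bsub>Y\<^esub> y') = hcomp Y j y \<oplus>\<^bsub>Y\<^esub> hcomp Y j y'" for j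
   using addhom_add[OF Y.hcomp_addhom] that by blast
  have "proj i x (y \<oplus>\<^bsub>Y\<^esub> y') = (\<Oplus>\<^bsub>?T\<^esub> j \<in> {j. hcomp X j x ~= \<zero>\<^bsub>X\<^esub>}.
    pt (hcomp X j x) (hcomp Y (i - j) y) \<oplus>\<^bsub>?T\<^esub> pt (hcomp X j x) (hcomp Y (i - j) y'))"
   unfolding proj_def using that c X.hcomp_closed Y.hcomp_closed
   by (intro T.finsum_cong') (auto simp: ha pt_add_right)
  also have "\<dots> = proj i x y \<oplus>\<^bsub>?T\<^esub> proj i x y'"
   unfolding proj_def using that c by (subst T.finsum_addf) auto
  finally show ?thesis .
 qed
 have addx: "addhom X ?T (%x. proj i x y)" if "y : carrier Y" for y
  using that by (intro addhomI) (simp_all add: pc left)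
 have addy: "addhom Y ?T (%y. proj i x y)" if "x : carrier X" for x
  using that by (intro addhomI) (simp_all add: pc right)
 note Xop = left_module_addhom[OF X_mod, simplified] and Yop = left_module_addhom[OF Y_mod, simplified]
 have homog: "proj i (r \<odot>\<^bsub>X\<^esub> x) y = proj i x (r \<odot>\<^bsub>Y\<^esub> y)"
  if r: "r : rg d" and x: "x : carrier X" and y: "y : carrier Y" for r d x y
 proof -
  have rc: "r : carrier R" using r rg_carrier by auto
  have 1: "proj i (r \<odot>\<^bsub>X\<^esub> x) y = proj i x (r \<odot>\<^bsub>Y\<^esub> y)"
   if x: "x : gr X j" and y: "y : carrier Y" for x j y
  proof (rule Y.addhom_eqI[OF T.abelian_group_axioms _ _ _ y,
     of "%y. proj i (r \<odot>\<^bsub>X\<^esub> x) y" "%y. proj i x (r \<odot>\<^bsub>Y\<^esub> y)"])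
   have xc: "x : carrier X" using x X.gr_closed by blast
   show "addhom Y ?T (%y. proj i (r \<odot>\<^bsub>X\<^esub> x) y)"
    by (rule addy) (use X_smult rc xc in blast)
   show "addhom Y ?T (%y. proj i x (r \<odot>\<^bsub>Y\<^esub> y))"
    by (rule addhom_comp[OF Yop(1)[OF rc] addy[OF xc]])
   fix k y assume y: "y : gr Y k"
   have "proj i (r \<odot>\<^bsub>X\<^esub> x) y =
     (if (d + j) + k = i then pt (r \<odot>\<^bsub>X\<^esub> x) y else \<zero>\<^bsub>?T\<^esub>)"
    by (rule proj_homog[OF X_gr[OF r x] y])
   moreover have "proj i x (r \<odot>\<^bsub>Y\<^esub> y) = (if j + (d + k) = i then pt x (r \<odot>\<^bsub>Y\<^esub> y) else \<zero>\<^bsub>?T\<^esub>)"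
    by (rule proj_homog[OF x Y_gr[OF r y]])
   ultimately show "proj i (r \<odot>\<^bsub>X\<^esub> x) y = proj i x (r \<odot>\<^bsub>Y\<^esub> y)"
    using pt_smult[OF rc xc Y.gr_closed(1)[OF y]] by (simp add: algebra_simps)
  qed
  show ?thesis
  proof (rule X.addhom_eqI[OF T.abelian_group_axioms _ _ _ x,
     of "%x. proj i (r \<odot>\<^bsub>X\<^esub> x) y" "%x. proj i x (r \<odot>\<^bsub>Y\<^esub> y)"])
   show "addhom X ?T (%x. proj i (r \<odot>\<^bsub>X\<^esub> x) y)"
    by (rule addhom_comp[OF Xop(1)[OF rc] addx[OF y]])
   show "addhom X ?T (%x. proj i x (r \<odot>\<^bsub>Y\<^esub> y))"
    by (rule addx) (use Y_smult rc y in blast)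
  qed (use 1 y in blast)
 qed
 let ?H = "{r \<in> carrier R. \<forall>x\<in>carrier X. \<forall>y\<in>carrier Y.
   proj i (r \<odot>\<^bsub>X\<^esub> x) y = proj i x (r \<odot>\<^bsub>Y\<^esub> y)}"
 have "carrier R <= ?H"
 proof (rule rg_gen)
  have fx: "addhom R ?T (%r. proj i (r \<odot>\<^bsub>X\<^esub> x) y)" and fy: "addhom R ?T (%r. proj i x (r \<odot>\<^bsub>Y\<^esub> y))"
   if "x : carrier X" "y : carrier Y" for x y
   using addhom_comp[OF Xop(2)[OF that(1)] addx[OF that(2)]]
    addhom_comp[OF Yop(2)[OF that(2)] addy[OF that(1)]] by (simp_all add: addhom_def)
  show "additive_subgroup ?H R"
   by (rule additive_subgroupI'[OF R.abelian_group_axioms])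
    (auto simp: addhom_add[OF fx] addhom_add[OF fy] addhom_zero[OF R.abelian_group_axioms tensor_abelian fx]
     addhom_zero[OF R.abelian_group_axioms tensor_abelian fy]
     addhom_minus[OF R.abelian_group_axioms tensor_abelian fx]
     addhom_minus[OF R.abelian_group_axioms tensor_abelian fy])
  show "rg d <= ?H" for d using homog rg_carrier by blast
 qed
 then show "proj i (r \<odot>\<^bsub>X\<^esub> x) y = proj i x (r \<odot>\<^bsub>Y\<^esub> y)"
  if "r : carrier R" "x : carrier X" "y : carrier Y" for r x y
  using that by blast
qed

text \<open>The lifts of \<open>proj i\<close> are the projections that \<open>graded_groupI\<close>
  asks for; generation holds because every pure tensor is a sum of pure tensors of homogeneous
  elements.\<close>

lemma tensor_graded: "graded_group (tensor R X Y act)"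
proof -
 let ?T = "tensor R X Y act" and ?Tu = "tensor R X Y (%_::unit. frag_of)"
 interpret T: abelian_group ?T by (rule tensor_abelian)
 have z0: "\<zero>\<^bsub>?T\<^esub> = \<zero>\<^bsub>?Tu\<^esub>" by (simp add: tensor_sel)
 have "\<exists>\<pi>. addhom ?T ?T \<pi> \<and> (\<forall>x\<in>carrier X. \<forall>y\<in>carrier Y. \<pi> (pt x y) = proj i x y)" for i
 proof -
  have "balanced R X Y ?T (proj i)"
   using proj_balanced[of i] by (simp add: balanced_def addhom_def tensor_sel)
  then obtain \<Phi> where "addhom ?T ?T \<Phi>"
   "!!x y. [|x : carrier X; y : carrier Y|] ==> \<Phi> (pt x y) = proj i x y"
   by (rule tensor_lift[OF tensor_abelian, where act = act]) blast
  then show ?thesis by blast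
 qed
 then obtain \<pi> where \<pi>: "!!i. addhom ?T ?T (\<pi> i)"
  "!!i x y. [|x : carrier X; y : carrier Y|] ==> \<pi> i (pt x y) = proj i x y"
  by metis
 note pz = addhom_zero[OF tensor_abelian tensor_abelian \<pi>(1)]
  and pm = addhom_minus[OF tensor_abelian tensor_abelian \<pi>(1)]
 show ?thesis
 proof (rule graded_groupI[OF tensor_abelian gr_subgroup \<pi>(1)])
  fix i U assume "U : gr ?T i"
  then show "\<pi> i U = U"
   by (induction rule: gr_induct)
    (auto simp: pz pm \<pi>(2) X.gr_closed(1) Y.gr_closed(1) proj_homog addhom_add[OF \<pi>(1)])
 next
  fix i j U assume "U : gr ?T j" "j ~= i"
  then show "\<pi> i U = \<zero>\<^bsub>?T\<^esub>"
   by (induction rule: gr_induct)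
    (auto simp: pz pm \<pi>(2) X.gr_closed(1) Y.gr_closed(1) proj_homog addhom_add[OF \<pi>(1)] z0[symmetric])
 next
  fix H assume H: "additive_subgroup H ?T" "!!i. gr ?T i <= H"
  note Hc = additive_subgroupD[OF H(1)]
  show "carrier ?T <= H"
  proof
   fix U assume "U : carrier ?T"
   then show "U : H"
   proof (induction rule: tensor_induct)
    case zero
    then show ?case by (rule Hc)
   next
    case (diff U V)
    then show ?case using Hc by (simp add: a_minus_def)
   next
    case (pure x y)
    show "pt x y : H"
     using pure(1)
    proof (induction rule: X.graded_induct)
     case zero
     then show ?case using Hc(2) by (simp add: pt_zero_left[OF pure(2), of act])
    next
     case (add x x')
     then show ?case using Hc(3) pure(2) by (simp add: pt_add_left[where act = act])
    next
     case (homog j x)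
     have x: "x : carrier X" using homog by (rule X.gr_closed)
     show ?case using pure(2)
     proof (induction rule: Y.graded_induct)
      case zero
      then show ?case using Hc(2) by (simp add: pt_zero_right[OF x, of act])
     next
      case (add y y')
      then show ?case using Hc(3) x by (simp add: pt_add_right[where act = act])
     next
      case (homog k y)
      then show ?case using pt_gr[OF \<open>x : gr X j\<close> homog refl] H(2) by blast
     qed
    qed
   qed
  qed
 qed
qed

end

section \<open>Functoriality, projectivity and exactness\<close>

lemma tensor_map:
 assumes XY: "mtensor R X Y" and XY': "mtensor R X' Y'"
  and f: "f : module_hom R X X'" and g: "g : module_hom R Y Y'"
 obtains F where "addhom (tensor R X Y act) (tensor R X' Y' act') F"
  "!!x y. [|x : carrier X; y : carrier Y|] ==>
   F (pure_tensor R X Y x y) = pure_tensor R X' Y' (f x) (g y)"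
proof -
 interpret A: mtensor R X Y by fact
 interpret B: mtensor R X' Y' by fact
 let ?T = "tensor R X' Y' act'"
 have fD: "!!x. x : carrier X ==> f x : carrier X'"
  "!!x y. [|x : carrier X; y : carrier X|] ==> f (x \<oplus>\<^bsub>X\<^esub> y) = f x \<oplus>\<^bsub>X'\<^esub> f y"
  "!!r x. [|r : carrier R; x : carrier X|] ==> f (r \<odot>\<^bsub>X\<^esub> x) = r \<odot>\<^bsub>X'\<^esub> f x"
  using f by (auto simp: module_hom_def)
 have gD: "!!x. x : carrier Y ==> g x : carrier Y'"
  "!!x y. [|x : carrier Y; y : carrier Y|] ==> g (x \<oplus>\<^bsub>Y\<^esub> y) = g x \<oplus>\<^bsub>Y'\<^esub> g y"
  "!!r x. [|r : carrier R; x : carrier Y|] ==> g (r \<odot>\<^bsub>Y\<^esub> x) = r \<odot>\<^bsub>Y'\<^esub> g x"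
  using g by (auto simp: module_hom_def)
 have "balanced R X Y ?T (%x y. pure_tensor R X' Y' (f x) (g y))"
  by (rule balancedI) (simp_all add: fD gD B.pt_add_left B.pt_add_right B.pt_smult B.pt_carrier)
 then show thesis
  by (rule A.tensor_lift[OF B.tensor_abelian, where act = act]) (rule that)
qed

text \<open>The data of the dual basis lemma, characterising finitely generated projective modules.
  The index type is free, so that the exterior product of two modules can be indexed by a product of
  index sets.\<close>

definition dual_basis :: "('a, 'z) ring_scheme => ('a, 'm, 'w) module_scheme => 'i set =>
  ('i => 'm) => ('i => 'm => 'a) => bool" where
 "dual_basis A M I e f \<longleftrightarrow> finite I \<and> e : I \<rightarrow> carrier M \<and> (\<forall>i \<in> I. addhom M A (f i)) \<and>
   (\<forall>i \<in> I. \<forall>a \<in> carrier A. \<forall>x \<in> carrier M. f i (a \<odot>\<^bsub>M\<^esub> x) = a \<otimes>\<^bsub>A\<^esub> f i x) \<and>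
   (\<forall>x \<in> carrier M. x = (\<Oplus>\<^bsub>M\<^esub> i \<in> I. f i x \<odot>\<^bsub>M\<^esub> e i))"

lemma dual_basisD:
 assumes "dual_basis A M I e f"
 shows "finite I" "!!i. i : I ==> e i : carrier M" "!!i. i : I ==> addhom M A (f i)"
  "!!i x. [|i : I; x : carrier M|] ==> f i x : carrier A"
  "!!i a x. [|i : I; a : carrier A; x : carrier M|] ==> f i (a \<odot>\<^bsub>M\<^esub> x) = a \<otimes>\<^bsub>A\<^esub> f i x"
  "!!x. x : carrier M ==> (\<Oplus>\<^bsub>M\<^esub> i \<in> I. f i x \<odot>\<^bsub>M\<^esub> e i) = x"
 using assms by (auto simp: dual_basis_def addhom_def)

lemma free_module_sel:
 "carrier (free_module A S) = {f. (\<forall>s \<in> S. f s : carrier A) \<and> (\<forall>s. s \<notin> S \<longrightarrow> f s = \<zero>\<^bsub>A\<^esub>) \<and>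
    finite {s. f s ~= \<zero>\<^bsub>A\<^esub>}}"
 "f \<oplus>\<^bsub>free_module A S\<^esub> g = (%s. f s \<oplus>\<^bsub>A\<^esub> g s)"
 "\<zero>\<^bsub>free_module A S\<^esub> = (%s. \<zero>\<^bsub>A\<^esub>)"
 "a \<odot>\<^bsub>free_module A S\<^esub> f = (%s. a \<otimes>\<^bsub>A\<^esub> f s)"
 by (simp_all add: free_module_def)

lemma free_module_closed:
 assumes "f : carrier (free_module A S)" "abelian_group A"
 shows "f s : carrier A"
 using assms abelian_group.axioms(1)[OF assms(2)] abelian_monoid.zero_closed[of A]
 by (cases "s : S") (auto simp: free_module_sel)

lemma free_module_abelian:
 assumes "abelian_group A"
 shows "abelian_group (free_module A S)"
proof -
 interpret abelian_group A by fact
 note c = free_module_closed[OF _ assms]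
 show ?thesis
 proof (rule abelian_groupI)
  fix f g assume f: "f : carrier (free_module A S)" and g: "g : carrier (free_module A S)"
  have "{s. f s \<oplus>\<^bsub>A\<^esub> g s ~= \<zero>\<^bsub>A\<^esub>} <= {s. f s ~= \<zero>\<^bsub>A\<^esub>} \<union> {s. g s ~= \<zero>\<^bsub>A\<^esub>}" by auto
  then have "finite {s. f s \<oplus>\<^bsub>A\<^esub> g s ~= \<zero>\<^bsub>A\<^esub>}"
   using f g by (auto simp: free_module_sel intro: finite_subset)
  then show "f \<oplus>\<^bsub>free_module A S\<^esub> g : carrier (free_module A S)"
   using f g by (auto simp: free_module_sel)
  show "f \<oplus>\<^bsub>free_module A S\<^esub> g = g \<oplus>\<^bsub>free_module A S\<^esub> f"
   using c[OF f] c[OF g] by (auto simp: free_module_sel a_comm)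
  fix h assume h: "h : carrier (free_module A S)"
  show "f \<oplus>\<^bsub>free_module A S\<^esub> g \<oplus>\<^bsub>free_module A S\<^esub> h = f \<oplus>\<^bsub>free_module A S\<^esub> (g \<oplus>\<^bsub>free_module A S\<^esub> h)"
   using c[OF f] c[OF g] c[OF h] by (auto simp: free_module_sel a_assoc)
 next
  fix f assume f: "f : carrier (free_module A S)"
  show "\<zero>\<^bsub>free_module A S\<^esub> \<oplus>\<^bsub>free_module A S\<^esub> f = f"
   using c[OF f] by (auto simp: free_module_sel)
  have "{s. \<ominus>\<^bsub>A\<^esub> f s ~= \<zero>\<^bsub>A\<^esub>} <= {s. f s ~= \<zero>\<^bsub>A\<^esub>}" by auto
  then have "(%s. \<ominus>\<^bsub>A\<^esub> f s) : carrier (free_module A S)"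
   using f by (auto simp: free_module_sel intro: finite_subset)
  then show "\<exists>g\<in>carrier (free_module A S). g \<oplus>\<^bsub>free_module A S\<^esub> f = \<zero>\<^bsub>free_module A S\<^esub>"
   using c[OF f] by (intro bexI[of _ "%s. \<ominus>\<^bsub>A\<^esub> f s"]) (auto simp: free_module_sel l_neg)
 qed (auto simp: free_module_sel)
qed

text \<open>M is a retract of a free module by \<open>\<iota>\<close> and \<open>\<pi>\<close>. The
  functionals are the coordinates of \<open>\<iota>\<close>, the elements are the images under
  \<open>\<pi>\<close> of the unit vectors; finite generation makes finitely many of them
  enough.\<close>

lemma projective_dual_basis:
 assumes "fin_gen A M" "projective A M"
 obtains I :: "'m set" and e f where "dual_basis A (M :: ('a, 'm, 'w) module_scheme) I e f"
proof -
 have M: "left_module A M" using assms(2) by (simp add: projective_def)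
 note MD = left_moduleD[OF M]
 interpret A: ring A by (rule MD(1))
 interpret M: abelian_group M by (rule MD(2))
 obtain S \<iota> \<pi> where i: "\<iota> : module_hom A M (free_module A (S :: 'm set))"
  and p: "\<pi> : module_hom A (free_module A S) M" and ip: "!!x. x : carrier M ==> \<pi> (\<iota> x) = x"
  using assms(2) by (auto simp: projective_def)
 let ?F = "free_module A S"
 interpret F: abelian_group ?F by (rule free_module_abelian) (rule A.abelian_group_axioms)
 note Fc = free_module_closed[OF _ A.abelian_group_axioms, of _ S]
 obtain G where G: "finite G" "G <= carrier M"
  and gen: "!!x. x : carrier M ==> \<exists>c \<in> G \<rightarrow> carrier A. x = (\<Oplus>\<^bsub>M\<^esub> s \<in> G. c s \<odot>\<^bsub>M\<^esub> s)"
  using assms(1) unfolding fin_gen_def by blast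
 have ic: "\<iota> x : carrier ?F" if "x : carrier M" for x using i that by (auto simp: module_hom_def)
 have ia: "addhom M ?F \<iota>" and pa: "addhom ?F M \<pi>" using i p by (auto intro: module_hom_addhom)
 have i_smult: "\<iota> (a \<odot>\<^bsub>M\<^esub> x) = a \<odot>\<^bsub>?F\<^esub> \<iota> x" if "a : carrier A" "x : carrier M" for a x
  using i that by (auto simp: module_hom_def)
 \<comment> \<open>Only finitely many coordinates occur in the images of the generators, and
   linearity of \<open>\<iota>\<close> confines the coordinates of every element of M to this
   set.\<close>
 define W where "W = (\<Union>s\<in>G. {w. \<iota> s w ~= \<zero>\<^bsub>A\<^esub>})"
 have W: "finite W" unfolding W_def using G ic by (auto simp: free_module_sel)
 have WS: "W <= S" unfolding W_def using G ic by (auto simp: free_module_sel)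
 let ?H = "{x \<in> carrier M. \<forall>w. w \<notin> W \<longrightarrow> \<iota> x w = \<zero>\<^bsub>A\<^esub>}"
 have iev: "addhom M A (%x. \<iota> x w)" for w
  using ia Fc ic by (auto simp: addhom_def free_module_sel(2))
 have H: "additive_subgroup ?H M"
  by (rule additive_subgroupI'[OF MD(2)])
   (auto simp: addhom_add[OF iev] addhom_zero[OF MD(2) A.abelian_group_axioms iev]
    addhom_minus[OF MD(2) A.abelian_group_axioms iev])
 have supp: "\<iota> x w = \<zero>\<^bsub>A\<^esub>" if "x : carrier M" "w \<notin> W" for x w
 proof -
  obtain c where c: "c : G \<rightarrow> carrier A" "x = (\<Oplus>\<^bsub>M\<^esub> s \<in> G. c s \<odot>\<^bsub>M\<^esub> s)" using gen \<open>x : carrier M\<close> by blast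
  have "c s \<odot>\<^bsub>M\<^esub> s : ?H" if "s : G" for s
  proof -
   have s: "c s : carrier A" "s : carrier M" using c G that by auto
   have "\<iota> s w = \<zero>\<^bsub>A\<^esub>" if "w \<notin> W" for w using that \<open>s : G\<close> unfolding W_def by blast
   then show ?thesis using s MD(3) by (simp add: i_smult free_module_sel(4))
  qed
  then have "x : ?H" unfolding c(2) by (rule additive_subgroup_finsum[OF MD(2) H])
  then show ?thesis using that by blast
 qed
 define \<delta> where "\<delta> w = (%s. if s = w then \<one>\<^bsub>A\<^esub> else \<zero>\<^bsub>A\<^esub>)" for w :: 'm
 have \<delta>: "\<delta> w : carrier ?F" if "w : W" for w
 proof -
  have "{s. \<delta> w s ~= \<zero>\<^bsub>A\<^esub>} <= {w}" by (auto simp: \<delta>_def)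
  then show ?thesis using that WS finite_subset by (auto simp: free_module_sel \<delta>_def)
 qed
 have Fsm: "a \<odot>\<^bsub>?F\<^esub> h : carrier ?F" if "a : carrier A" "h : carrier ?F" for a h
 proof -
  have "{s. a \<otimes>\<^bsub>A\<^esub> h s ~= \<zero>\<^bsub>A\<^esub>} <= {s. h s ~= \<zero>\<^bsub>A\<^esub>}" using that by auto
  then show ?thesis using that by (auto simp: free_module_sel intro: finite_subset)
 qed
 have expand: "\<iota> x = (\<Oplus>\<^bsub>?F\<^esub> w \<in> W. \<iota> x w \<odot>\<^bsub>?F\<^esub> \<delta> w)" if x: "x : carrier M" for x
 proof
  fix t
  have sc: "(%w. \<iota> x w \<odot>\<^bsub>?F\<^esub> \<delta> w) : W \<rightarrow> carrier ?F"
   using Fsm \<delta> Fc[OF ic[OF x]] by blast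
  have ev: "addhom ?F A (%h. h t)"
   by (rule addhomI) (use Fc in \<open>auto simp: free_module_sel(2)\<close>)
  have "(\<Oplus>\<^bsub>?F\<^esub> w \<in> W. \<iota> x w \<odot>\<^bsub>?F\<^esub> \<delta> w) t = (\<Oplus>\<^bsub>A\<^esub> w \<in> W. (\<iota> x w \<odot>\<^bsub>?F\<^esub> \<delta> w) t)"
   by (rule addhom_finsum[OF F.abelian_group_axioms A.abelian_group_axioms ev sc])
  also have "\<dots> = (\<Oplus>\<^bsub>A\<^esub> w \<in> W. if t = w then \<iota> x w else \<zero>\<^bsub>A\<^esub>)"
   using Fc[OF ic[OF x]] by (intro A.finsum_cong') (auto simp: free_module_sel(4) \<delta>_def)
  also have "\<dots> = \<iota> x t"
  proof (cases "t : W")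
   case True
   then show ?thesis using A.add.finprod_singleton[OF True W, of "\<iota> x"] Fc[OF ic[OF x]] by simp
  next
   case False
   then have "(\<Oplus>\<^bsub>A\<^esub> w \<in> W. if t = w then \<iota> x w else \<zero>\<^bsub>A\<^esub>) = (\<Oplus>\<^bsub>A\<^esub> w \<in> W. \<zero>\<^bsub>A\<^esub>)"
    by (intro A.finsum_cong') auto
   then show ?thesis using supp[OF x False] by simp
  qed
  finally show "\<iota> x t = (\<Oplus>\<^bsub>?F\<^esub> w \<in> W. \<iota> x w \<odot>\<^bsub>?F\<^esub> \<delta> w) t" ..
 qed
 show thesis
 proof (rule that)
  show "dual_basis A M W (%w. \<pi> (\<delta> w)) (%w x. \<iota> x w)"
   unfolding dual_basis_def
  proof (intro conjI ballI)
   show "(%w. \<pi> (\<delta> w)) : W \<rightarrow> carrier M" using addhom_closed[OF pa] \<delta> by auto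
   show "!!w a x. [|w : W; a : carrier A; x : carrier M|] ==> \<iota> (a \<odot>\<^bsub>M\<^esub> x) w = a \<otimes>\<^bsub>A\<^esub> \<iota> x w"
    by (simp add: i_smult free_module_sel(4))
   fix x assume x: "x : carrier M"
   have sc: "(%w. \<iota> x w \<odot>\<^bsub>?F\<^esub> \<delta> w) : W \<rightarrow> carrier ?F"
    using Fsm \<delta> Fc[OF ic[OF x]] by blast
   have "x = \<pi> (\<iota> x)" using ip x by simp
   also have "\<dots> = (\<Oplus>\<^bsub>M\<^esub> w \<in> W. \<pi> (\<iota> x w \<odot>\<^bsub>?F\<^esub> \<delta> w))"
    by (subst expand[OF x]) (rule addhom_finsum[OF F.abelian_group_axioms MD(2) pa sc])
   also have "\<dots> = (\<Oplus>\<^bsub>M\<^esub> w \<in> W. \<iota> x w \<odot>\<^bsub>M\<^esub> \<pi> (\<delta> w))"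
    using p \<delta> Fc[OF ic[OF x]] addhom_closed[OF pa] MD(3)
    by (intro M.finsum_cong') (auto simp: module_hom_def)
   finally show "x = (\<Oplus>\<^bsub>M\<^esub> w \<in> W. \<iota> x w \<odot>\<^bsub>M\<^esub> \<pi> (\<delta> w))" .
  qed (use W iev in auto)
 qed
qed

text \<open>A dual basis is an indexed family and may repeat elements. Adding up the functionals
  that belong to one element turns it into an expansion over a set, the form in which
  \<open>fin_gen\<close> and \<open>projective\<close> are stated.\<close>

lemma dual_basis_collect:
 assumes M: "left_module A M" and d: "dual_basis A M I e f" and x: "x : carrier M"
 shows "(\<Oplus>\<^bsub>M\<^esub> s \<in> e ` I. (\<Oplus>\<^bsub>A\<^esub> i \<in> {i \<in> I. e i = s}. f i x) \<odot>\<^bsub>M\<^esub> s) = x"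
proof -
 note MD = left_moduleD[OF M] and dD = dual_basisD[OF d]
 interpret A: ring A by (rule MD(1))
 interpret M: abelian_group M by (rule MD(2))
 have c: "f i x \<odot>\<^bsub>M\<^esub> e i : carrier M" if "i : I" for i using that MD dD x by auto
 have "(\<Oplus>\<^bsub>A\<^esub> i \<in> {i \<in> I. e i = s}. f i x) \<odot>\<^bsub>M\<^esub> s = (\<Oplus>\<^bsub>M\<^esub> i \<in> {i \<in> I. e i = s}. f i x \<odot>\<^bsub>M\<^esub> e i)"
  if "s : e ` I" for s
 proof -
  have s: "s : carrier M" using that dD by auto
  have "(\<Oplus>\<^bsub>A\<^esub> i \<in> {i \<in> I. e i = s}. f i x) \<odot>\<^bsub>M\<^esub> s = (\<Oplus>\<^bsub>M\<^esub> i \<in> {i \<in> I. e i = s}. f i x \<odot>\<^bsub>M\<^esub> s)"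
   using addhom_finsum[OF A.abelian_group_axioms MD(2) left_module_addhom(2)[OF M s],
     of "%i. f i x" "{i \<in> I. e i = s}"] dD(4) x by auto
  also have "\<dots> = (\<Oplus>\<^bsub>M\<^esub> i \<in> {i \<in> I. e i = s}. f i x \<odot>\<^bsub>M\<^esub> e i)"
   using c by (intro M.finsum_cong') auto
  finally show ?thesis .
 qed
 then have "(\<Oplus>\<^bsub>M\<^esub> s \<in> e ` I. (\<Oplus>\<^bsub>A\<^esub> i \<in> {i \<in> I. e i = s}. f i x) \<odot>\<^bsub>M\<^esub> s) =
   (\<Oplus>\<^bsub>M\<^esub> s \<in> e ` I. \<Oplus>\<^bsub>M\<^esub> i \<in> {i \<in> I. e i = s}. f i x \<odot>\<^bsub>M\<^esub> e i)"
  using c by (intro M.finsum_cong') (auto intro!: M.finsum_closed)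
 also have "\<dots> = (\<Oplus>\<^bsub>M\<^esub> i \<in> (\<Union>s\<in>e ` I. {i \<in> I. e i = s}). f i x \<odot>\<^bsub>M\<^esub> e i)"
  using c dD(1) by (intro M.add.finprod_UN_disjoint[symmetric]) (auto simp: disjnt_def pairwise_def)
 also have "(\<Union>s\<in>e ` I. {i \<in> I. e i = s}) = I" by auto
 finally show ?thesis using dD(6)[OF x] by simp
qed

lemma dual_basis_fin_gen:
 assumes M: "left_module A M" and d: "dual_basis A M I e f"
 shows "fin_gen A M"
 unfolding fin_gen_def
proof (intro exI[of _ "e ` I"] conjI ballI)
 note MD = left_moduleD[OF M] and dD = dual_basisD[OF d]
 interpret A: ring A by (rule MD(1))
 show "finite (e ` I)" "e ` I <= carrier M" using dD by auto
 fix x assume x: "x : carrier M"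
 show "\<exists>c\<in>e ` I \<rightarrow> carrier A. x = (\<Oplus>\<^bsub>M\<^esub>s\<in>e ` I. c s \<odot>\<^bsub>M\<^esub> s)"
  using dual_basis_collect[OF M d x] dD(4) x
  by (intro bexI[of _ "%s. \<Oplus>\<^bsub>A\<^esub> i \<in> {i \<in> I. e i = s}. f i x"])
   (auto intro!: A.finsum_closed)
qed

lemma dual_basis_projective:
 assumes M: "left_module A M" and d: "dual_basis A M I e f"
 shows "projective A M"
proof -
 note MD = left_moduleD[OF M] and dD = dual_basisD[OF d]
 interpret A: ring A by (rule MD(1))
 interpret M: abelian_group M by (rule MD(2))
 let ?S = "e ` I"
 let ?F = "free_module A ?S"
 note Fc = free_module_closed[OF _ A.abelian_group_axioms, of _ ?S]
 define \<iota> where "\<iota> x = (%s. if s : ?S then \<Oplus>\<^bsub>A\<^esub> i \<in> {i \<in> I. e i = s}. f i x else \<zero>\<^bsub>A\<^esub>)" for x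
 define \<pi> where "\<pi> h = (\<Oplus>\<^bsub>M\<^esub> s \<in> ?S. h s \<odot>\<^bsub>M\<^esub> s)" for h
 have S: "finite ?S" "?S <= carrier M" using dD by auto
 have fa: "addhom M A (%x. \<Oplus>\<^bsub>A\<^esub> i \<in> {i \<in> I. e i = s}. f i x)" for s
  by (rule addhom_sum[OF A.abelian_group_axioms]) (use dD in auto)
 have "\<iota> : module_hom A M ?F"
 proof (rule module_homI)
  show "addhom M ?F \<iota>"
  proof (rule addhomI)
   fix x assume x: "x : carrier M"
   have "{s. \<iota> x s ~= \<zero>\<^bsub>A\<^esub>} <= ?S" by (auto simp: \<iota>_def)
   then have "finite {s. \<iota> x s ~= \<zero>\<^bsub>A\<^esub>}" using S(1) finite_subset by blast
   then show "\<iota> x : carrier ?F"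
    using addhom_closed[OF fa x] by (auto simp: free_module_sel \<iota>_def)
  qed (auto simp: \<iota>_def free_module_sel(2) addhom_add[OF fa])
  fix a x assume ax: "a : carrier A" "x : carrier M"
  have am: "addhom A A (%b. a \<otimes>\<^bsub>A\<^esub> b)" using ax by (auto intro!: addhomI simp: A.r_distr)
  have "(\<Oplus>\<^bsub>A\<^esub> i \<in> {i \<in> I. e i = s}. f i (a \<odot>\<^bsub>M\<^esub> x)) = a \<otimes>\<^bsub>A\<^esub> (\<Oplus>\<^bsub>A\<^esub> i \<in> {i \<in> I. e i = s}. f i x)" for s
  proof -
   have "(\<Oplus>\<^bsub>A\<^esub> i \<in> {i \<in> I. e i = s}. f i (a \<odot>\<^bsub>M\<^esub> x)) = (\<Oplus>\<^bsub>A\<^esub> i \<in> {i \<in> I. e i = s}. a \<otimes>\<^bsub>A\<^esub> f i x)"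
    using dD ax by (intro A.finsum_cong') auto
   then show ?thesis
    using addhom_finsum[OF A.abelian_group_axioms A.abelian_group_axioms am,
      of "%i. f i x" "{i \<in> I. e i = s}"] dD ax by auto
  qed
  then show "\<iota> (a \<odot>\<^bsub>M\<^esub> x) = a \<odot>\<^bsub>?F\<^esub> \<iota> x"
   using ax by (auto simp: \<iota>_def free_module_sel(4))
 qed
 moreover have "\<pi> : module_hom A ?F M"
 proof (rule module_homI)
  show "addhom ?F M \<pi>" unfolding \<pi>_def
  proof (rule addhom_sum[OF MD(2)])
   fix s assume s: "s : ?S"
   have "addhom ?F A (%h. h s)"
    by (rule addhomI) (use Fc in \<open>auto simp: free_module_sel(2)\<close>)
   from addhom_comp[OF this left_module_addhom(2)[OF M]] show "addhom ?F M (%h. h s \<odot>\<^bsub>M\<^esub> s)"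
    using s S by blast
  qed
  fix a h assume ah: "a : carrier A" "h : carrier ?F"
  have "\<pi> (a \<odot>\<^bsub>?F\<^esub> h) = (\<Oplus>\<^bsub>M\<^esub> s \<in> ?S. a \<odot>\<^bsub>M\<^esub> (h s \<odot>\<^bsub>M\<^esub> s))"
   unfolding \<pi>_def using S MD Fc[OF ah(2)] ah
   by (intro M.finsum_cong') (auto simp: free_module_sel(4))
  also have "\<dots> = a \<odot>\<^bsub>M\<^esub> \<pi> h"
   unfolding \<pi>_def using S Fc[OF ah(2)] MD(3)
   by (intro addhom_finsum[OF MD(2) MD(2) left_module_addhom(1)[OF M ah(1)], symmetric]) blast
  finally show "\<pi> (a \<odot>\<^bsub>?F\<^esub> h) = a \<odot>\<^bsub>M\<^esub> \<pi> h" .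
 qed
 moreover have "\<pi> (\<iota> x) = x" if x: "x : carrier M" for x
 proof -
  have "\<pi> (\<iota> x) = (\<Oplus>\<^bsub>M\<^esub> s \<in> ?S. (\<Oplus>\<^bsub>A\<^esub> i \<in> {i \<in> I. e i = s}. f i x) \<odot>\<^bsub>M\<^esub> s)"
   unfolding \<pi>_def \<iota>_def using S addhom_closed[OF fa x] MD(3)
   by (intro M.finsum_cong') auto
  then show ?thesis using dual_basis_collect[OF M d x] by simp
 qed
 ultimately show ?thesis unfolding projective_def using M by blast
qed

section \<open>Exact and split exact sequences of additive groups\<close>

definition exact_pair :: "('l, 'u) ring_scheme => ('m, 'v) ring_scheme => ('n, 'w) ring_scheme =>
  ('l => 'm) => ('m => 'n) => bool" where
 "exact_pair L M N f g \<longleftrightarrow> addhom L M f \<and> addhom M N g \<and> inj_on f (carrier L) \<and>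
   f ` carrier L = {x \<in> carrier M. g x = \<zero>\<^bsub>N\<^esub>} \<and> g ` carrier M = carrier N"

text \<open>Unlike exactness, a splitting consists of equations between additive maps (section
  \<open>\<sigma>\<close>, retraction \<open>\<rho>\<close>), and equations survive every additive
  functor.\<close>

definition split_pair :: "('l, 'u) ring_scheme => ('m, 'v) ring_scheme => ('n, 'w) ring_scheme =>
  ('l => 'm) => ('m => 'n) => ('n => 'm) => ('m => 'l) => bool" where
 "split_pair L M N f g \<sigma> \<rho> \<longleftrightarrow> addhom L M f \<and> addhom M N g \<and> addhom N M \<sigma> \<and> addhom M L \<rho> \<and>
   (\<forall>x \<in> carrier L. \<rho> (f x) = x \<and> g (f x) = \<zero>\<^bsub>N\<^esub>) \<and> (\<forall>z \<in> carrier N. g (\<sigma> z) = z) \<and>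
   (\<forall>y \<in> carrier M. f (\<rho> y) \<oplus>\<^bsub>M\<^esub> \<sigma> (g y) = y)"

lemma split_pair_exact:
 assumes "split_pair L M N f g \<sigma> \<rho>" "abelian_group M" "abelian_group N"
 shows "exact_pair L M N f g"
proof -
 interpret M: abelian_group M by fact
 have f: "addhom L M f" and g: "addhom M N g" and \<sigma>: "addhom N M \<sigma>" and \<rho>: "addhom M L \<rho>"
  and \<rho>f: "!!x. x : carrier L ==> \<rho> (f x) = x" and gf: "!!x. x : carrier L ==> g (f x) = \<zero>\<^bsub>N\<^esub>"
  and g\<sigma>: "!!z. z : carrier N ==> g (\<sigma> z) = z"
  and dec: "!!y. y : carrier M ==> f (\<rho> y) \<oplus>\<^bsub>M\<^esub> \<sigma> (g y) = y"
  using assms(1) by (simp_all add: split_pair_def)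
 have inj: "inj_on f (carrier L)"
  by (rule inj_on_inverseI[of _ \<rho>]) (rule \<rho>f)
 have im: "f ` carrier L = {y \<in> carrier M. g y = \<zero>\<^bsub>N\<^esub>}"
 proof (intro subset_antisym subsetI)
  fix y assume y: "y : {y \<in> carrier M. g y = \<zero>\<^bsub>N\<^esub>}"
  then have r: "\<rho> y : carrier L" using \<rho> by (simp add: addhom_closed)
  have "f (\<rho> y) = y"
   using dec[of y] y addhom_zero[OF assms(3,2) \<sigma>] addhom_closed[OF f r] by simp
  then show "y : f ` carrier L" using r by (metis imageI)
 next
  fix y assume "y : f ` carrier L"
  then show "y : {y \<in> carrier M. g y = \<zero>\<^bsub>N\<^esub>}" using gf addhom_closed[OF f] by auto
 qed
 have surj: "g ` carrier M = carrier N"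
 proof (intro subset_antisym subsetI)
  fix z assume z: "z : carrier N"
  show "z : g ` carrier M" using g\<sigma>[OF z] addhom_closed[OF \<sigma> z] by (metis imageI)
 qed (use addhom_closed[OF g] in auto)
 show ?thesis unfolding exact_pair_def using f g inj im surj by simp
qed

text \<open>With m_i lifting the basis elements e_i of N, the section is z \<mapsto> \<Sum> h_i(z)
  m_i. The retraction takes y to the preimage under f of y - \<sigma> (g y), which lies in the
  kernel of g.\<close>

lemma exact_pair_split:
 assumes N: "left_module A N" and M: "left_module A M" and L: "left_module A L"
  and f: "f : module_hom A L M" and g: "g : module_hom A M N" and ex: "exact_pair L M N f g"
  and d: "dual_basis A N I e h"
 obtains \<sigma> \<rho> where "\<sigma> : module_hom A N M" "\<rho> : module_hom A M L" "split_pair L M N f g \<sigma> \<rho>"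
proof -
 note ND = left_moduleD[OF N] and MD = left_moduleD[OF M] and LD = left_moduleD[OF L]
  and dD = dual_basisD[OF d] and exD = ex[unfolded exact_pair_def]
 interpret A: ring A by (rule MD(1))
 interpret M: abelian_group M by (rule MD(2))
 interpret N: abelian_group N by (rule ND(2))
 have fa: "addhom L M f" and ga: "addhom M N g" using exD by simp_all
 have "\<exists>y \<in> carrier M. g y = e i" if "i : I" for i
 proof -
  have "e i : g ` carrier M" using exD dD(2)[OF that] by simp
  then show ?thesis by auto
 qed
 then obtain m where m: "!!i. i : I ==> m i : carrier M" "!!i. i : I ==> g (m i) = e i" by metis
 define \<sigma> where "\<sigma> z = (\<Oplus>\<^bsub>M\<^esub> i \<in> I. h i z \<odot>\<^bsub>M\<^esub> m i)" for z
 have \<sigma>a: "addhom N M \<sigma>" unfolding \<sigma>_def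
 proof (rule addhom_sum[OF MD(2)])
  fix i assume "i : I"
  then show "addhom N M (%z. h i z \<odot>\<^bsub>M\<^esub> m i)"
   using addhom_comp[OF dD(3) left_module_addhom(2)[OF M m(1)]] by blast
 qed
 have \<sigma>m: "\<sigma> : module_hom A N M"
 proof (rule module_homI[OF \<sigma>a])
  fix a z assume az: "a : carrier A" "z : carrier N"
  have "\<sigma> (a \<odot>\<^bsub>N\<^esub> z) = (\<Oplus>\<^bsub>M\<^esub> i \<in> I. a \<odot>\<^bsub>M\<^esub> (h i z \<odot>\<^bsub>M\<^esub> m i))"
   unfolding \<sigma>_def using az m dD MD by (intro M.finsum_cong') auto
  then show "\<sigma> (a \<odot>\<^bsub>N\<^esub> z) = a \<odot>\<^bsub>M\<^esub> \<sigma> z"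
   unfolding \<sigma>_def using addhom_finsum[OF MD(2) MD(2) left_module_addhom(1)[OF M az(1)],
     of "%i. h i z \<odot>\<^bsub>M\<^esub> m i" I] m dD MD az by auto
 qed
 have g\<sigma>: "g (\<sigma> z) = z" if z: "z : carrier N" for z
 proof -
  have "g (\<sigma> z) = (\<Oplus>\<^bsub>N\<^esub> i \<in> I. g (h i z \<odot>\<^bsub>M\<^esub> m i))"
   unfolding \<sigma>_def using m dD MD z by (intro addhom_finsum[OF MD(2) ND(2) ga]) auto
  also have "\<dots> = (\<Oplus>\<^bsub>N\<^esub> i \<in> I. h i z \<odot>\<^bsub>N\<^esub> e i)"
   using m dD ND z g by (intro N.finsum_cong') (auto simp: module_hom_def)
  finally show ?thesis using dD(6)[OF z] by simp
 qed
 have gf: "g (f x) = \<zero>\<^bsub>N\<^esub>" if "x : carrier L" for x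
 proof -
  have "f x : {x \<in> carrier M. g x = \<zero>\<^bsub>N\<^esub>}" using exD that by blast
  then show ?thesis by simp
 qed
 have ker: "y \<ominus>\<^bsub>M\<^esub> \<sigma> (g y) : f ` carrier L" if y: "y : carrier M" for y
 proof -
  have gy: "g y : carrier N" using ga y by (rule addhom_closed)
  then have "\<sigma> (g y) : carrier M" using \<sigma>a by (simp add: addhom_closed)
  then have "y \<ominus>\<^bsub>M\<^esub> \<sigma> (g y) : carrier M" "g (y \<ominus>\<^bsub>M\<^esub> \<sigma> (g y)) = \<zero>\<^bsub>N\<^esub>"
   using y gy g\<sigma>[OF gy] addhom_diff[OF MD(2) ND(2) ga] by (auto simp: a_minus_def N.r_neg)
  then show ?thesis using exD by blast
 qed
 define \<rho> where "\<rho> y = the_inv_into (carrier L) f (y \<ominus>\<^bsub>M\<^esub> \<sigma> (g y))" for y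
 have inj: "inj_on f (carrier L)" using exD by simp
 have \<rho>: "\<rho> y : carrier L" "f (\<rho> y) = y \<ominus>\<^bsub>M\<^esub> \<sigma> (g y)" if "y : carrier M" for y
  using ker[OF that] inj unfolding \<rho>_def by (auto simp: the_inv_into_f_f)
 have sg: "\<sigma> (g y) : carrier M" if "y : carrier M" for y
  using that \<sigma>a ga by (simp add: addhom_def)
 have \<rho>m: "\<rho> : module_hom A M L"
 proof (intro module_homI addhomI)
  fix y y' assume y: "y : carrier M" "y' : carrier M"
  have "f (\<rho> (y \<oplus>\<^bsub>M\<^esub> y')) = f (\<rho> y \<oplus>\<^bsub>L\<^esub> \<rho> y')"
   using y \<rho> sg addhom_add[OF fa] addhom_add[OF ga] addhom_add[OF \<sigma>a] addhom_closed[OF ga]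
   by (simp add: a_minus_def M.minus_add M.a_ac)
  then show "\<rho> (y \<oplus>\<^bsub>M\<^esub> y') = \<rho> y \<oplus>\<^bsub>L\<^esub> \<rho> y'"
   using inj_onD[OF inj] \<rho>(1) y abelian_monoid.a_closed[OF abelian_group.axioms(1)[OF LD(2)]] by simp
 next
  fix a y assume a: "a : carrier A" and y: "y : carrier M"
  have "f (\<rho> (a \<odot>\<^bsub>M\<^esub> y)) = (a \<odot>\<^bsub>M\<^esub> y) \<ominus>\<^bsub>M\<^esub> \<sigma> (g (a \<odot>\<^bsub>M\<^esub> y))"
   using \<rho> MD a y by simp
  also have "\<sigma> (g (a \<odot>\<^bsub>M\<^esub> y)) = a \<odot>\<^bsub>M\<^esub> \<sigma> (g y)"
   using g \<sigma>m a y by (auto simp: module_hom_def Pi_def)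
  also have "(a \<odot>\<^bsub>M\<^esub> y) \<ominus>\<^bsub>M\<^esub> (a \<odot>\<^bsub>M\<^esub> \<sigma> (g y)) = a \<odot>\<^bsub>M\<^esub> (y \<ominus>\<^bsub>M\<^esub> \<sigma> (g y))"
   using addhom_diff[OF MD(2) MD(2) left_module_addhom(1)[OF M a] y sg[OF y]] by simp
  also have "\<dots> = f (a \<odot>\<^bsub>L\<^esub> \<rho> y)" using f \<rho> a y by (auto simp: module_hom_def)
  finally show "\<rho> (a \<odot>\<^bsub>M\<^esub> y) = a \<odot>\<^bsub>L\<^esub> \<rho> y"
   using inj_onD[OF inj] \<rho>(1) MD(3) LD(3) a y by simp
 qed (rule \<rho>(1))
 have \<rho>f: "\<rho> (f x) = x" if x: "x : carrier L" for x
 proof -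
  have fx: "f x : carrier M" using fa x by (rule addhom_closed)
  have "f (\<rho> (f x)) = f x"
   using \<rho>(2)[OF fx] gf[OF x] addhom_zero[OF ND(2) MD(2) \<sigma>a] fx by (simp add: a_minus_def)
  then show ?thesis using inj_onD[OF inj] \<rho>(1)[OF fx] x by simp
 qed
 have "f (\<rho> y) \<oplus>\<^bsub>M\<^esub> \<sigma> (g y) = y" if "y : carrier M" for y
  using \<rho>[OF that] sg[OF that] that by (simp add: a_minus_def M.a_assoc M.l_neg)
 then have "split_pair L M N f g \<sigma> \<rho>"
  unfolding split_pair_def using fa ga \<sigma>a module_hom_addhom[OF \<rho>m] \<rho>f gf g\<sigma> by blast
 with \<sigma>m \<rho>m show thesis by (rule that)
qed

section \<open>Flatness of finitely generated projective modules\<close>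

context mtensor begin

text \<open>The i-th coordinate of x \<otimes> y is g_i(x) y. Expanding x in the dual basis and
  moving the scalars across the tensor sign recovers the element from its coordinates.\<close>

lemma tensor_coords:
 assumes d: "dual_basis (opp R) X I e g"
 obtains \<phi> where "!!i. i : I ==> addhom (tensor R X Y act) Y (\<phi> i)"
  "!!i x y. [|i : I; x : carrier X; y : carrier Y|] ==> \<phi> i (pt x y) = g i x \<odot>\<^bsub>Y\<^esub> y"
  "!!U. U : carrier (tensor R X Y act) ==>
   U = (\<Oplus>\<^bsub>tensor R X Y act\<^esub> i \<in> I. pt (e i) (\<phi> i U))"
proof -
 let ?T = "tensor R X Y act"
 note YD = left_moduleD[OF Y_mod] and XD = left_moduleD[OF X_mod, simplified]
  and dD = dual_basisD[OF d, simplified]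
 interpret T: abelian_group ?T by (rule tensor_abelian)
 have "\<exists>\<Phi>. addhom ?T Y \<Phi> \<and> (\<forall>x\<in>carrier X. \<forall>y\<in>carrier Y. \<Phi> (pt x y) = g i x \<odot>\<^bsub>Y\<^esub> y)" if i: "i : I" for i
 proof -
  have "balanced R X Y Y (%x y. g i x \<odot>\<^bsub>Y\<^esub> y)"
   using YD dD i addhom_add[OF dD(3)[OF i]] by (intro balancedI) simp_all
  then obtain \<Phi> where "addhom ?T Y \<Phi>"
   "!!x y. [|x : carrier X; y : carrier Y|] ==> \<Phi> (pt x y) = g i x \<odot>\<^bsub>Y\<^esub> y"
   by (rule tensor_lift[OF YD(2), where act = act]) blast
  then show ?thesis by blast
 qed
 then obtain \<phi> where \<phi>: "!!i. i : I ==> addhom ?T Y (\<phi> i)"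
  "!!i x y. [|i : I; x : carrier X; y : carrier Y|] ==> \<phi> i (pt x y) = g i x \<odot>\<^bsub>Y\<^esub> y"
  by metis
 have "U = (\<Oplus>\<^bsub>?T\<^esub> i \<in> I. pt (e i) (\<phi> i U))" if "U : carrier ?T" for U
 proof (rule tensor_hom_eqI[OF tensor_abelian addhom_id _ _ that])
  show "addhom ?T ?T (%U. \<Oplus>\<^bsub>?T\<^esub> i \<in> I. pt (e i) (\<phi> i U))"
   by (rule addhom_sum[OF tensor_abelian addhom_comp[OF \<phi>(1) pt_addhom_right]]) (use dD in auto)
  fix x y assume x: "x : carrier X" and y: "y : carrier Y"
  have c: "g i x \<odot>\<^bsub>X\<^esub> e i : carrier X" if "i : I" for i using that dD x X_smult by auto
  have "pt x y = pt (\<Oplus>\<^bsub>X\<^esub> i \<in> I. g i x \<odot>\<^bsub>X\<^esub> e i) y" using dD(6)[OF x] by simp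
  also have "\<dots> = (\<Oplus>\<^bsub>?T\<^esub> i \<in> I. pt (g i x \<odot>\<^bsub>X\<^esub> e i) y)"
   using c by (intro addhom_finsum[OF X_group tensor_abelian pt_addhom_left[OF y]]) auto
  also have "\<dots> = (\<Oplus>\<^bsub>?T\<^esub> i \<in> I. pt (e i) (\<phi> i (pt x y)))"
   using dD x y Y_smult by (intro T.finsum_cong') (auto simp: \<phi>(2) pt_smult)
  finally show "pt x y = (\<Oplus>\<^bsub>?T\<^esub> i \<in> I. pt (e i) (\<phi> i (pt x y)))" .
 qed
 with \<phi> show thesis by (rule that)
qed

end

text \<open>Tensoring with a finitely generated projective module is exact: in the coordinates given by a
  dual basis the tensor product is a natural direct summand of a power of the second factor.\<close>

lemma tensor_exact_right:
 assumes T1: "mtensor R X Y1" and T2: "mtensor R X Y2" and T3: "mtensor R X Y3"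
  and d: "dual_basis (opp R) X I e h"
  and f: "f : module_hom R Y1 Y2" and g: "g : module_hom R Y2 Y3" and ex: "exact_pair Y1 Y2 Y3 f g"
  and F: "addhom (tensor R X Y1 act1) (tensor R X Y2 act2) F"
   "!!x y. [|x : carrier X; y : carrier Y1|] ==> F (pure_tensor R X Y1 x y) = pure_tensor R X Y2 x (f y)"
  and G: "addhom (tensor R X Y2 act2) (tensor R X Y3 act3) G"
   "!!x y. [|x : carrier X; y : carrier Y2|] ==> G (pure_tensor R X Y2 x y) = pure_tensor R X Y3 x (g y)"
 shows "exact_pair (tensor R X Y1 act1) (tensor R X Y2 act2) (tensor R X Y3 act3) F G"
proof -
 interpret T1: mtensor R X Y1 by fact
 interpret T2: mtensor R X Y2 by fact
 interpret T3: mtensor R X Y3 by fact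
 let ?A = "tensor R X Y1 act1" and ?B = "tensor R X Y2 act2" and ?C = "tensor R X Y3 act3"
 note dD = dual_basisD[OF d, simplified] and exD = ex[unfolded exact_pair_def]
 have fa: "addhom Y1 Y2 f" and ga: "addhom Y2 Y3 g" using exD by simp_all
 have fs: "f (r \<odot>\<^bsub>Y1\<^esub> y) = r \<odot>\<^bsub>Y2\<^esub> f y" if "r : carrier R" "y : carrier Y1" for r y
  using f that by (auto simp: module_hom_def)
 have gs: "g (r \<odot>\<^bsub>Y2\<^esub> y) = r \<odot>\<^bsub>Y3\<^esub> g y" if "r : carrier R" "y : carrier Y2" for r y
  using g that by (auto simp: module_hom_def)
 interpret A: abelian_group ?A by (rule T1.tensor_abelian)
 interpret B: abelian_group ?B by (rule T2.tensor_abelian)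
 interpret C: abelian_group ?C by (rule T3.tensor_abelian)
 obtain \<phi>1 where 1: "!!i. i : I ==> addhom ?A Y1 (\<phi>1 i)"
  "!!i x y. [|i : I; x : carrier X; y : carrier Y1|] ==> \<phi>1 i (T1.pt x y) = h i x \<odot>\<^bsub>Y1\<^esub> y"
  "!!U. U : carrier ?A ==> U = (\<Oplus>\<^bsub>?A\<^esub> i \<in> I. T1.pt (e i) (\<phi>1 i U))"
  by (rule T1.tensor_coords[OF d, where act = act1]) blast
 obtain \<phi>2 where 2: "!!i. i : I ==> addhom ?B Y2 (\<phi>2 i)"
  "!!i x y. [|i : I; x : carrier X; y : carrier Y2|] ==> \<phi>2 i (T2.pt x y) = h i x \<odot>\<^bsub>Y2\<^esub> y"
  "!!U. U : carrier ?B ==> U = (\<Oplus>\<^bsub>?B\<^esub> i \<in> I. T2.pt (e i) (\<phi>2 i U))"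
  by (rule T2.tensor_coords[OF d, where act = act2]) blast
 obtain \<phi>3 where 3: "!!i. i : I ==> addhom ?C Y3 (\<phi>3 i)"
  "!!i x y. [|i : I; x : carrier X; y : carrier Y3|] ==> \<phi>3 i (T3.pt x y) = h i x \<odot>\<^bsub>Y3\<^esub> y"
  by (rule T3.tensor_coords[OF d, where act = act3]) blast
 \<comment> \<open>Coordinates are natural in the second factor because f is linear over R; the
   functionals of X are not touched.\<close>
 have nat1: "\<phi>2 i (F U) = f (\<phi>1 i U)" if i: "i : I" and U: "U : carrier ?A" for i U
  by (rule T1.tensor_hom_eqI[OF T2.Y_group addhom_comp[OF F(1) 2(1)[OF i]] addhom_comp[OF 1(1)[OF i] fa] _ U])
   (simp add: F(2) 1(2) 2(2) i fs dD addhom_closed[OF fa])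
 have nat2: "\<phi>3 i (G U) = g (\<phi>2 i U)" if i: "i : I" and U: "U : carrier ?B" for i U
  by (rule T2.tensor_hom_eqI[OF T3.Y_group addhom_comp[OF G(1) 3(1)[OF i]] addhom_comp[OF 2(1)[OF i] ga] _ U])
   (simp add: G(2) 2(2) 3(2) i gs dD addhom_closed[OF ga])
 \<comment> \<open>If F U vanishes then so do its coordinates, hence by injectivity of f those of U,
   and an element is determined by its coordinates.\<close>
 have Fz: "U = \<zero>\<^bsub>?A\<^esub>" if U: "U : carrier ?A" and z: "F U = \<zero>\<^bsub>?B\<^esub>" for U
 proof -
  have "\<phi>1 i U = \<zero>\<^bsub>Y1\<^esub>" if i: "i : I" for i
  proof -
   have "f (\<phi>1 i U) = f \<zero>\<^bsub>Y1\<^esub>"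
    using nat1[OF i U] z addhom_zero[OF T2.tensor_abelian T2.Y_group 2(1)[OF i]]
     addhom_zero[OF T1.Y_group T2.Y_group fa] by simp
   moreover have "\<phi>1 i U : carrier Y1" using 1(1)[OF i] U by (rule addhom_closed)
   moreover have "\<zero>\<^bsub>Y1\<^esub> : carrier Y1"
    using T1.Y_group by (simp add: abelian_group_def abelian_monoid.zero_closed)
   ultimately show ?thesis using exD by (auto dest: inj_onD)
  qed
  then have "(\<Oplus>\<^bsub>?A\<^esub> i \<in> I. T1.pt (e i) (\<phi>1 i U)) = (\<Oplus>\<^bsub>?A\<^esub> i \<in> I. \<zero>\<^bsub>?A\<^esub>)"
   using addhom_zero[OF T1.Y_group T1.tensor_abelian T1.pt_addhom_right] dD
   by (intro A.finsum_cong') auto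
  then show ?thesis using 1(3)[OF U] by simp
 qed
 have "inj_on F (carrier ?A)"
 proof (rule inj_onI)
  fix U V assume UV: "U : carrier ?A" "V : carrier ?A" "F U = F V"
  have "F (U \<ominus>\<^bsub>?A\<^esub> V) = F U \<ominus>\<^bsub>?B\<^esub> F V"
   by (rule addhom_diff[OF T1.tensor_abelian T2.tensor_abelian F(1) UV(1,2)])
  also have "\<dots> = \<zero>\<^bsub>?B\<^esub>"
   using UV addhom_closed[OF F(1)] by (simp add: a_minus_def B.r_neg)
  finally have "F (U \<ominus>\<^bsub>?A\<^esub> V) = \<zero>\<^bsub>?B\<^esub>" .
  then have "U \<ominus>\<^bsub>?A\<^esub> V = \<zero>\<^bsub>?A\<^esub>" using UV by (intro Fz) simp_all
  then show "U = V" using UV by simp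
 qed
 moreover have "F ` carrier ?A <= {U \<in> carrier ?B. G U = \<zero>\<^bsub>?C\<^esub>}"
 proof -
  have "G (F U) = \<zero>\<^bsub>?C\<^esub>" if U: "U : carrier ?A" for U
  proof (rule T1.tensor_hom_eqI[OF T3.tensor_abelian addhom_comp[OF F(1) G(1)] _ _ U])
   show "addhom ?A ?C (%U. \<zero>\<^bsub>?C\<^esub>)" by (rule addhomI) auto
   fix x y assume xy: "x : carrier X" "y : carrier Y1"
   then have "f y : carrier Y2" "g (f y) = \<zero>\<^bsub>Y3\<^esub>" using exD by (auto simp: addhom_def)
   then show "G (F (T1.pt x y)) = \<zero>\<^bsub>?C\<^esub>"
    using xy addhom_zero[OF T3.Y_group T3.tensor_abelian T3.pt_addhom_right] by (simp add: F(2) G(2))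
  qed
  then show ?thesis using addhom_closed[OF F(1)] by auto
 qed
 moreover have "U : F ` carrier ?A" if U: "U : carrier ?B" and z: "G U = \<zero>\<^bsub>?C\<^esub>" for U
 proof -
  have "\<exists>y\<in>carrier Y1. f y = \<phi>2 i U" if i: "i : I" for i
  proof -
   have "g (\<phi>2 i U) = \<zero>\<^bsub>Y3\<^esub>"
    using nat2[OF i U] z addhom_zero[OF T3.tensor_abelian T3.Y_group 3(1)[OF i]] by simp
   moreover have "\<phi>2 i U : carrier Y2" using 2(1)[OF i] U by (rule addhom_closed)
   ultimately have "\<phi>2 i U : f ` carrier Y1" using exD by blast
   then show ?thesis by auto
  qed
  then obtain y where y: "!!i. i : I ==> y i : carrier Y1" "!!i. i : I ==> f (y i) = \<phi>2 i U"
   by metis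
  \<comment> \<open>Exactness of the original sequence supplies a preimage of each coordinate
    separately; the element assembled from these preimages is sent by F to the expansion of
    U.\<close>
  let ?V = "\<Oplus>\<^bsub>?A\<^esub> i \<in> I. T1.pt (e i) (y i)"
  have V: "?V : carrier ?A" using y dD by (intro A.finsum_closed) auto
  have "F ?V = (\<Oplus>\<^bsub>?B\<^esub> i \<in> I. F (T1.pt (e i) (y i)))"
   using y dD by (intro addhom_finsum[OF T1.tensor_abelian T2.tensor_abelian F(1)]) auto
  also have "\<dots> = (\<Oplus>\<^bsub>?B\<^esub> i \<in> I. T2.pt (e i) (\<phi>2 i U))"
   using y dD addhom_closed[OF 2(1)] U by (intro B.finsum_cong') (auto simp: F(2))
  finally have "U = F ?V" using 2(3)[OF U] by simp
  then show ?thesis using V by (rule image_eqI)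
 qed
 moreover have "U : G ` carrier ?B" if "U : carrier ?C" for U
  using that
 proof (induction rule: T3.tensor_induct)
  case zero
  show ?case
   using addhom_zero[OF T2.tensor_abelian T3.tensor_abelian G(1), symmetric] B.zero_closed
   by (rule image_eqI)
 next
  case (diff U V)
  then obtain U' V' where "U' : carrier ?B" "V' : carrier ?B" "U = G U'" "V = G V'" by auto
  then have "U \<ominus>\<^bsub>?C\<^esub> V = G (U' \<ominus>\<^bsub>?B\<^esub> V')" "U' \<ominus>\<^bsub>?B\<^esub> V' : carrier ?B"
   using addhom_diff[OF T2.tensor_abelian T3.tensor_abelian G(1)] by simp_all
  then show ?case by (rule image_eqI)
 next
  case (pure x y)
  then have "y : g ` carrier Y2" using exD by simp
  then obtain y' where "y' : carrier Y2" "y = g y'" by auto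
  then have "T3.pt x y = G (T2.pt x y')" "T2.pt x y' : carrier ?B" using G(2) pure(1) by simp_all
  then show ?case by (rule image_eqI)
 qed
 ultimately show ?thesis unfolding exact_pair_def
  using F(1) G(1) addhom_closed[OF G(1)] by (intro conjI subset_antisym) auto
qed

section \<open>Dimensions\<close>

abbreviation "vdim \<equiv> vectorspace.dim"
abbreviation "vfin \<equiv> vectorspace.fin_dim"

text \<open>Subspaces in the form in which homogeneous parts present themselves;
  \<open>ksub_submodule\<close> identifies them with the submodules of the vector space.\<close>

definition ksub :: "('k, 'u) ring_scheme => ('k, 'v, 'w) module_scheme => 'v set => bool" where
 "ksub K V H \<longleftrightarrow> additive_subgroup H V \<and> (\<forall>c \<in> carrier K. \<forall>x \<in> H. c \<odot>\<^bsub>V\<^esub> x : H)"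

lemma vectorspace_left_module:
 "vectorspace K V \<longleftrightarrow> field K \<and> left_module K V"
proof
 assume "vectorspace K V"
 then interpret vectorspace K V .
 show "field K \<and> left_module K V"
  unfolding left_module_def
  by (auto simp: smult_l_distr smult_r_distr smult_assoc1 field.field_axioms R.ring_axioms M.abelian_group_axioms)
next
 assume A: "field K \<and> left_module K V"
 then interpret field K by simp
 note V = left_moduleD[OF conjunct2[OF A]]
 have "module K V" by (rule moduleI) (use V is_cring in auto)
 then show "vectorspace K V" by (simp add: vectorspace_def field_axioms)
qed

lemma ksub_submodule:
 assumes "vectorspace K V"
 shows "ksub K V H \<longleftrightarrow> LinearCombinations.submodule K H V"
proof -
 interpret vectorspace K V by fact
 have "additive_subgroup H V" if "LinearCombinations.submodule K H V"
 proof -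
  interpret H: LinearCombinations.submodule K H V by fact
  have "\<ominus>\<^bsub>V\<^esub> x : H" if "x : H" for x
  proof -
   have x: "x : carrier V" using H.subset that by auto
   have "(\<ominus>\<^bsub>K\<^esub> \<one>\<^bsub>K\<^esub>) \<odot>\<^bsub>V\<^esub> x : H" using H.smult_closed[OF _ that] R.a_inv_closed[OF R.one_closed] .
   moreover have "(\<ominus>\<^bsub>K\<^esub> \<one>\<^bsub>K\<^esub>) \<odot>\<^bsub>V\<^esub> x = \<ominus>\<^bsub>V\<^esub> x"
    using smult_l_minus[OF R.one_closed x] x by simp
   ultimately show ?thesis by simp
  qed
  then show ?thesis by (intro additive_subgroupI'[OF M.abelian_group_axioms] H.subset) auto
 qed
 then show ?thesis
  by (auto simp: ksub_def LinearCombinations.submodule_def module_axioms dest: additive_subgroupD)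
qed

lemma ksub_vs:
 assumes "vectorspace K V" "ksub K V H"
 shows "vectorspace K (V\<lparr>carrier := H\<rparr>)"
 using vectorspace.subspace_is_vs[OF assms(1)] assms by (simp add: subspace_def ksub_submodule)

text \<open>Spanning is phrased as: every subspace containing B is everything. In this form it is
  used by exhibiting a suitable subspace, with no linear combinations in sight.\<close>

lemma vfinE:
 assumes "vectorspace K V" "vfin K V"
 obtains B where "finite B" "B <= carrier V" "!!H. [|ksub K V H; B <= H|] ==> carrier V <= H"
proof -
 interpret vectorspace K V by fact
 obtain B where B: "finite B" "B <= carrier V" "gen_set B" using assms(2) by (auto simp: fin_dim_def)
 then show thesis
  using that[of B] span_is_subset by (metis ksub_submodule[OF assms(1)])
qed

lemma vfinI:
 assumes "vectorspace K V" "finite B" "B <= carrier V"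
  "!!H. [|ksub K V H; B <= H|] ==> carrier V <= H"
 shows "vfin K V"
proof -
 interpret vectorspace K V by fact
 have "ksub K V (span B)" "B <= span B"
  using span_is_submodule[OF assms(3)] in_own_span[OF assms(3)] by (auto simp: ksub_submodule[OF assms(1)])
 then have "carrier V <= span B" by (rule assms(4))
 then have "span B = carrier V" using span_is_subset2[OF assms(3)] by blast
 then show ?thesis using assms(2,3) by (auto simp: fin_dim_def)
qed

text \<open>Independent subsets of H stay independent in V and are bounded in size by the dimension
  of V, so a maximal one exists, and it spans H.\<close>

lemma ksub_vfin:
 assumes V: "vectorspace K V" and fd: "vfin K V" and H: "ksub K V H"
 shows "vfin K (V\<lparr>carrier := H\<rparr>)" "vdim K (V\<lparr>carrier := H\<rparr>) \<le> vdim K V"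
proof -
 interpret vectorspace K V by (rule V)
 have sm: "LinearCombinations.submodule K H V" using H V by (simp add: ksub_submodule)
 have HV: "H <= carrier V" using sm by (simp add: LinearCombinations.submodule_def)
 interpret W: vectorspace K "V\<lparr>carrier := H\<rparr>" by (rule ksub_vs[OF V H])
 have lin: "W.lin_dep S = lin_dep S" if "S <= H" for S
  by (rule span_li_not_depend(2)[OF that sm])
 have *: "finite S \<and> card S \<le> dim" if "S <= H \<and> W.lin_indpt S" for S
  using that lin[of S] HV li_le_dim[OF fd, of S] by auto
 have "{} <= H \<and> W.lin_indpt {}" using W.finite_lin_indpt2[of "{}"] by auto
 from maximal_exists[where P = "%S. S <= H \<and> W.lin_indpt S", OF * this]
 obtain S where S: "finite S" "maximal S (%S. S <= H \<and> W.lin_indpt S)" by blast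
 then have SH: "S <= H" "W.lin_indpt S" by (auto simp: maximal_def)
 have "W.gen_set S" by (rule W.max_li_is_gen) (use S in simp)
 then show "W.fin_dim" using S SH by (auto simp: W.fin_dim_def)
 have "W.dim \<le> card S" using W.gen_ge_dim[of S] S(1) SH \<open>W.gen_set S\<close> by simp
 then show "W.dim \<le> dim" using *[of S] SH by simp
qed

lemma linear_mapI:
 assumes "vectorspace K V" "vectorspace K W" "f : module_hom K V W"
 shows "linear_map K V W f"
 using assms by (simp add: linear_map_def mod_hom_def mod_hom_axioms_def vectorspace.axioms)

lemma vdim_bij:
 assumes "vectorspace K V" "vectorspace K W" "f : module_hom K V W" "vfin K V"
  "inj_on f (carrier V)" "f ` carrier V = carrier W"
 shows "vfin K W" "vdim K W = vdim K V"
proof -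
 interpret linear_map K V W f by (rule linear_mapI) fact+
 show "vfin K W" using surj_fin_dim assms by simp
 show "vdim K W = vdim K V" using dim_eq assms by simp
qed

lemma module_hom_inv:
 assumes V: "left_module K V" and f: "f : module_hom K V W"
  and inj: "inj_on f (carrier V)" and surj: "f ` carrier V = carrier W"
 shows "the_inv_into (carrier V) f : module_hom K W V"
proof (intro module_homI addhomI)
 note VD = left_moduleD[OF V]
 interpret V: abelian_group V by (rule VD(2))
 let ?g = "the_inv_into (carrier V) f"
 show g: "?g x : carrier V" if "x : carrier W" for x
  using that the_inv_into_into[OF inj, of x] surj by auto
 have fg: "f (?g x) = x" if "x : carrier W" for x
  using f_the_inv_into_f[OF inj, of x] that surj by auto
 fix x y assume xy: "x : carrier W" "y : carrier W"
 have "f (?g x \<oplus>\<^bsub>V\<^esub> ?g y) = x \<oplus>\<^bsub>W\<^esub> y"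
  using f g[OF xy(1)] g[OF xy(2)] fg xy by (auto simp: module_hom_def)
 then show "?g (x \<oplus>\<^bsub>W\<^esub> y) = ?g x \<oplus>\<^bsub>V\<^esub> ?g y"
  using the_inv_into_f_f[OF inj V.a_closed[OF g[OF xy(1)] g[OF xy(2)]]] by simp
next
 note VD = left_moduleD[OF V]
 let ?g = "the_inv_into (carrier V) f"
 fix r x assume rx: "r : carrier K" "x : carrier W"
 have g: "?g x : carrier V" using rx the_inv_into_into[OF inj, of x] surj by auto
 have fg: "f (?g x) = x" using f_the_inv_into_f[OF inj, of x] rx surj by auto
 have "f (r \<odot>\<^bsub>V\<^esub> ?g x) = r \<odot>\<^bsub>W\<^esub> x" using f g fg rx by (auto simp: module_hom_def)
 then show "?g (r \<odot>\<^bsub>W\<^esub> x) = r \<odot>\<^bsub>V\<^esub> ?g x"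
  using the_inv_into_f_f[OF inj VD(3)[OF rx(1) g]] by simp
qed

text \<open>Rank and nullity of g: the image is W, and the kernel is identified with U by the
  inverse of f.\<close>

lemma vdim_exact:
 assumes U: "vectorspace K U" and V: "vectorspace K V" and W: "vectorspace K W"
  and f: "f : module_hom K U V" and g: "g : module_hom K V W" and ex: "exact_pair U V W f g"
  and fd: "vfin K V"
 shows "vfin K U" "vfin K W" "vdim K V = vdim K U + vdim K W"
proof -
 interpret g: linear_map K V W g by (rule linear_mapI) fact+
 have e: "inj_on f (carrier U)" "f ` carrier U = {x \<in> carrier V. g x = \<zero>\<^bsub>W\<^esub>}" "g ` carrier V = carrier W"
  using ex by (simp_all add: exact_pair_def)
 show "vfin K W" using g.surj_fin_dim[OF fd e(3)] .
 let ?H = "{x \<in> carrier V. g x = \<zero>\<^bsub>W\<^esub>}"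
 let ?VH = "V\<lparr>carrier := ?H\<rparr>"
 have ker: "g.ker = ?H" by (simp add: g.ker_def)
 have im: "g.im = carrier W" using e(3) by (simp add: g.im_def)
 have sub: "ksub K V ?H" unfolding ksub_submodule[OF V] ker[symmetric] by (rule g.ker_is_submodule)
 note VH = ksub_vs[OF V sub]
 have "f : module_hom K U ?VH"
  using f e(2) by (auto simp: module_hom_def)
 note inv = module_hom_inv[OF _ this e(1)]
 let ?h = "the_inv_into (carrier U) f"
 have h: "?h : module_hom K ?VH U" using inv U e(2) by (simp add: vectorspace_left_module)
 have hi: "inj_on ?h (carrier ?VH)" "?h ` carrier ?VH = carrier U"
  using e(1) bij_betw_the_inv_into[of f "carrier U" ?H] e(2) by (auto simp: bij_betw_def)
 note * = vdim_bij[OF VH U h ksub_vfin(1)[OF V fd sub] hi]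
 show "vfin K U" by (rule *)
 have "vdim K V = vdim K (W\<lparr>carrier := g.im\<rparr>) + vdim K (V\<lparr>carrier := g.ker\<rparr>)"
  using g.rank_nullity[OF fd] by simp
 then show "vdim K V = vdim K U + vdim K W" using *(2) by (simp add: ker im)
qed

lemma vdim_zero_iff:
 assumes V: "vectorspace K V" and fd: "vfin K V"
 shows "vdim K V = 0 \<longleftrightarrow> carrier V = {\<zero>\<^bsub>V\<^esub>}"
proof -
 interpret vectorspace K V by (rule V)
 show ?thesis
 proof
  assume z: "dim = 0"
  obtain B where "finite B" "basis B" using finite_basis_exists[OF fd] by blast
  then have "B = {}" using dim_basis z by simp
  then show "carrier V = {\<zero>\<^bsub>V\<^esub>}" using \<open>basis B\<close> span_empty by (simp add: basis_def)
 next
  assume z: "carrier V = {\<zero>\<^bsub>V\<^esub>}"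
  then have "gen_set {\<zero>\<^bsub>V\<^esub>}" using span_is_subset2[of "{\<zero>\<^bsub>V\<^esub>}"] in_own_span[of "{\<zero>\<^bsub>V\<^esub>}"] by auto
  then show "dim = 0" by (rule dim0I)
 qed
qed

text \<open>A basis of the subspace is independent in V and already has as many elements as the
  dimension of V, so it spans V.\<close>

lemma ksub_dim_eq:
 assumes V: "vectorspace K V" and fd: "vfin K V" and H: "ksub K V H"
  and eq: "vdim K (V\<lparr>carrier := H\<rparr>) = vdim K V"
 shows "H = carrier V"
proof -
 interpret vectorspace K V by (rule V)
 have sm: "LinearCombinations.submodule K H V" using H V by (simp add: ksub_submodule)
 have HV: "H <= carrier V" using sm by (simp add: LinearCombinations.submodule_def)
 interpret W: vectorspace K "V\<lparr>carrier := H\<rparr>" by (rule ksub_vs[OF V H])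
 obtain B where B: "finite B" "W.basis B" using W.finite_basis_exists[OF ksub_vfin(1)[OF V fd H]] by blast
 have BH: "B <= H" "W.lin_indpt B" using B(2) by (auto simp: W.basis_def)
 have "lin_indpt B" using BH span_li_not_depend(2)[OF BH(1) sm] by simp
 moreover have "card B = dim" using W.dim_basis[OF B] eq by simp
 ultimately have "basis B" using B(1) BH HV fd by (intro dim_li_is_basis) auto
 then have "span B = carrier V" by (simp add: basis_def)
 then show ?thesis using span_is_subset[OF BH(1) sm] HV by blast
qed

text \<open>Rank and nullity leave a kernel of dimension zero. Intended for right multiplication by
  an element on a left ideal of the degree zero part of an algebra.\<close>

lemma vdim_surj_inj:
 assumes V: "vectorspace K V" and fd: "vfin K V" and f: "f : module_hom K V V"
  and surj: "f ` carrier V = carrier V" and x: "x : carrier V" "f x = \<zero>\<^bsub>V\<^esub>"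
 shows "x = \<zero>\<^bsub>V\<^esub>"
proof -
 interpret f: linear_map K V V f by (rule linear_mapI) fact+
 have im: "f.im = carrier V" using surj by (simp add: f.im_def)
 have sub: "ksub K V f.ker" unfolding ksub_submodule[OF V] by (rule f.ker_is_submodule)
 have "vdim K (V\<lparr>carrier := f.ker\<rparr>) = 0"
  using f.rank_nullity[OF fd] by (simp add: im)
 then have "f.ker = {\<zero>\<^bsub>V\<^esub>}"
  using vdim_zero_iff[OF ksub_vs[OF V sub] ksub_vfin(1)[OF V fd sub]] by simp
 then show ?thesis using x by (auto simp: f.ker_def)
qed

section \<open>Graded dimensions\<close>

definition gr_space :: "'k ring => ('k, 'm) gr_module => bool" where
 "gr_space K V \<longleftrightarrow> vectorspace K V \<and> graded_group V \<and>
   (\<forall>i. \<forall>c \<in> carrier K. \<forall>x \<in> gr V i. c \<odot>\<^bsub>V\<^esub> x : gr V i) \<and> vfin K V"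

lemma gr_space_ksub:
 assumes "gr_space K V"
 shows "ksub K V (gr V i)"
 using assms unfolding gr_space_def ksub_def graded_group_def by blast

text \<open>The members of a finite spanning set involve finitely many degrees, and the elements
  supported in these degrees form a subspace, which must be everything.\<close>

lemma gr_space_finite:
 assumes "gr_space K V"
 shows "finite {i. gr V i ~= {\<zero>\<^bsub>V\<^esub>}}"
proof -
 have V: "vectorspace K V" "vfin K V" and gg: "graded_group V"
  and sm: "!!i c x. [|c : carrier K; x : gr V i|] ==> c \<odot>\<^bsub>V\<^esub> x : gr V i"
  using assms by (auto simp: gr_space_def)
 interpret vectorspace K V by (rule V)
 interpret V: graded V by unfold_locales (rule gg)
 have L: "left_module K V" using V vectorspace_left_module by blast
 note LD = left_moduleD[OF L]
 obtain B where B: "finite B" "B <= carrier V" "!!H. [|ksub K V H; B <= H|] ==> carrier V <= H"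
  using vfinE[OF V] by blast
 define F where "F = (\<Union>b\<in>B. {i. hcomp V i b ~= \<zero>\<^bsub>V\<^esub>})"
 have F: "finite F" unfolding F_def using B V.hcomp_finite by auto
 let ?H = "{x \<in> carrier V. \<forall>i. i \<notin> F \<longrightarrow> hcomp V i x = \<zero>\<^bsub>V\<^esub>}"
 have hs: "hcomp V i (c \<odot>\<^bsub>V\<^esub> x) = c \<odot>\<^bsub>V\<^esub> hcomp V i x" if "c : carrier K" "x : carrier V" for i c x
 proof -
  have "(\<odot>\<^bsub>V\<^esub>) c ` gr V j <= gr V j" for j using sm[OF that(1)] by auto
  from graded_hom_hcomp[OF gg gg left_module_addhom(1)[OF L that(1)] this that(2), of i]
  show ?thesis by simp
 qed
 have "ksub K V ?H" unfolding ksub_def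
 proof (intro conjI ballI)
  show "additive_subgroup ?H V"
   by (rule additive_subgroupI'[OF V.ab])
    (auto simp: addhom_add[OF V.hcomp_addhom] addhom_zero[OF V.ab V.ab V.hcomp_addhom]
     addhom_minus[OF V.ab V.ab V.hcomp_addhom])
  fix c x assume "c : carrier K" "x : ?H"
  then show "c \<odot>\<^bsub>V\<^esub> x : ?H" using LD(3) left_module_zero(1)[OF L] by (auto simp: hs)
 qed
 moreover have "B <= ?H" using B(2) unfolding F_def by blast
 ultimately have H: "carrier V <= ?H" by (rule B(3))
 have "i : F" if "gr V i ~= {\<zero>\<^bsub>V\<^esub>}" for i
 proof (rule ccontr)
  assume i: "i \<notin> F"
  have "x = \<zero>\<^bsub>V\<^esub>" if x: "x : gr V i" for x
   using H i V.gr_closed(1)[OF x] V.hcomp_homog[OF x, of i] by auto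
  then show False using that V.gr_closed(2) by blast
 qed
 then show ?thesis using F finite_subset by (metis (mono_tags, lifting) mem_Collect_eq subsetI)
qed

text \<open>The finite support makes \<open>gdim\<close> a genuine finite sum; a degree left out of
  it has the zero space, hence dimension 0, so the formula holds in all degrees.\<close>

lemma gdim_lookup:
 assumes "gr_space K V"
 shows "Poly_Mapping.lookup (gdim K V) i = int (vdim K (V\<lparr>carrier := gr V i\<rparr>))"
proof -
 let ?d = "%j. int (vdim K (V\<lparr>carrier := gr V j\<rparr>))"
 have V: "vectorspace K V" "vfin K V" using assms by (auto simp: gr_space_def)
 have "Poly_Mapping.lookup (gdim K V) i = (\<Sum>j | gr V j ~= {\<zero>\<^bsub>V\<^esub>}. if j = i then ?d j else 0)"
  unfolding gdim_def by (simp add: lookup_sum lookup_single when_def)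
 also have "\<dots> = (if gr V i ~= {\<zero>\<^bsub>V\<^esub>} then ?d i else 0)"
  using gr_space_finite[OF assms] by (simp add: sum.delta')
 also have "\<dots> = ?d i"
  using vdim_zero_iff[OF ksub_vs[OF V(1) gr_space_ksub[OF assms]]
    ksub_vfin(1)[OF V gr_space_ksub[OF assms]], of i] by auto
 finally show ?thesis .
qed

lemma gdim_exact:
 assumes U: "gr_space K U" and V: "gr_space K V" and W: "gr_space K W"
  and f: "f : module_hom K U V" and g: "g : module_hom K V W" and ex: "exact_pair U V W f g"
  and fg: "!!i. f ` gr U i <= gr V i" and gg: "!!i. g ` gr V i <= gr W i"
 shows "gdim K V = gdim K U + gdim K W"
proof (rule poly_mapping_eqI)
 fix i
 have vs: "vectorspace K U" "vectorspace K V" "vectorspace K W" "vfin K V" and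
  gr: "graded_group U" "graded_group V" "graded_group W" using U V W by (auto simp: gr_space_def)
 interpret U: graded U by unfold_locales (rule gr)
 interpret V: graded V by unfold_locales (rule gr)
 interpret W: graded W by unfold_locales (rule gr)
 have e: "inj_on f (carrier U)" "f ` carrier U = {x \<in> carrier V. g x = \<zero>\<^bsub>W\<^esub>}" "g ` carrier V = carrier W"
  using ex by (simp_all add: exact_pair_def)
 note fa = module_hom_addhom[OF f] and ga = module_hom_addhom[OF g]
 let ?U = "U\<lparr>carrier := gr U i\<rparr>" and ?V = "V\<lparr>carrier := gr V i\<rparr>" and ?W = "W\<lparr>carrier := gr W i\<rparr>"
 have f': "f : module_hom K ?U ?V" using f fg[of i] U.gr_closed(1) by (auto simp: module_hom_def)
 have g': "g : module_hom K ?V ?W" using g gg[of i] V.gr_closed(1) by (auto simp: module_hom_def)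
 have "exact_pair ?U ?V ?W f g" unfolding exact_pair_def
 proof (intro conjI)
  show "inj_on f (carrier ?U)" using e(1) U.gr_closed(1) by (auto intro: inj_on_subset)
  show "f ` carrier ?U = {x \<in> carrier ?V. g x = \<zero>\<^bsub>?W\<^esub>}"
  proof (intro subset_antisym subsetI)
   fix y assume "y : f ` carrier ?U"
   then obtain x where x: "x : gr U i" "y = f x" by auto
   then have "f x : {x \<in> carrier V. g x = \<zero>\<^bsub>W\<^esub>}" using e(2) U.gr_closed(1) by blast
   then show "y : {x \<in> carrier ?V. g x = \<zero>\<^bsub>?W\<^esub>}" using x fg[of i] by auto
  next
   fix y assume "y : {x \<in> carrier ?V. g x = \<zero>\<^bsub>?W\<^esub>}"
   then have y: "y : gr V i" "g y = \<zero>\<^bsub>W\<^esub>" by auto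
   then have "y : f ` carrier U" using e(2) V.gr_closed(1) by auto
   then obtain x where x: "x : carrier U" "y = f x" by auto
   \<comment> \<open>The preimage found need not be homogeneous; its degree i component is one that
     is.\<close>
   have "f (hcomp U i x) = hcomp V i (f x)" by (rule graded_hom_hcomp[OF gr(1,2) fa fg x(1)])
   then have "y = f (hcomp U i x)" using x y V.hcomp_homog[OF y(1), of i] by simp
   then show "y : f ` carrier ?U" using U.hcomp_gr[OF x(1)] by auto
  qed
  show "g ` carrier ?V = carrier ?W"
  proof (intro subset_antisym subsetI)
   fix z assume "z : carrier ?W"
   then have z: "z : gr W i" by simp
   then have "z : g ` carrier V" using e(3) W.gr_closed(1) by auto
   then obtain y where y: "y : carrier V" "z = g y" by auto
   have "g (hcomp V i y) = hcomp W i (g y)" by (rule graded_hom_hcomp[OF gr(2,3) ga gg y(1)])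
   then have "z = g (hcomp V i y)" using y z W.hcomp_homog[OF z, of i] by simp
   then show "z : g ` carrier ?V" using V.hcomp_gr[OF y(1)] by auto
  qed (use gg in auto)
 qed (use module_hom_addhom[OF f'] module_hom_addhom[OF g'] in simp_all)
 from vdim_exact(3)[OF ksub_vs[OF vs(1) gr_space_ksub[OF U]] ksub_vs[OF vs(2) gr_space_ksub[OF V]]
   ksub_vs[OF vs(3) gr_space_ksub[OF W]] f' g' this ksub_vfin(1)[OF vs(2,4) gr_space_ksub[OF V]]]
 show "Poly_Mapping.lookup (gdim K V) i = Poly_Mapping.lookup (gdim K U + gdim K W) i"
  by (simp add: lookup_add gdim_lookup U V W)
qed

lemma gdim_iso:
 assumes V: "gr_space K V" and W: "gr_space K W"
  and f: "f : module_hom K V W" and bij: "bij_betw f (carrier V) (carrier W)"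
  and fg: "!!i. f ` gr V i <= gr W i"
 shows "gdim K V = gdim K W"
proof (rule poly_mapping_eqI)
 fix i
 have vs: "vectorspace K V" "vectorspace K W" "vfin K V" and
  gr: "graded_group V" "graded_group W" using V W by (auto simp: gr_space_def)
 interpret V: graded V by unfold_locales (rule gr)
 interpret W: graded W by unfold_locales (rule gr)
 let ?V = "V\<lparr>carrier := gr V i\<rparr>" and ?W = "W\<lparr>carrier := gr W i\<rparr>"
 have f': "f : module_hom K ?V ?W" using f fg[of i] V.gr_closed(1) by (auto simp: module_hom_def)
 have inj: "inj_on f (carrier ?V)" using bij V.gr_closed(1) by (auto simp: bij_betw_def intro: inj_on_subset)
 have surj: "f ` carrier ?V = carrier ?W"
 proof (intro subset_antisym subsetI)
  fix z assume "z : carrier ?W"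
  then have z: "z : gr W i" by simp
  then have "z : f ` carrier V" using bij W.gr_closed(1) by (auto simp: bij_betw_def)
  then obtain y where y: "y : carrier V" "z = f y" by auto
  have "f (hcomp V i y) = hcomp W i (f y)"
   by (rule graded_hom_hcomp[OF gr module_hom_addhom[OF f] fg y(1)])
  then have "z = f (hcomp V i y)" using y z W.hcomp_homog[OF z, of i] by simp
  then show "z : f ` carrier ?V" using V.hcomp_gr[OF y(1)] by auto
 qed (use fg in auto)
 from vdim_bij(2)[OF ksub_vs[OF vs(1) gr_space_ksub[OF V]] ksub_vs[OF vs(2) gr_space_ksub[OF W]] f'
   ksub_vfin(1)[OF vs(1,3) gr_space_ksub[OF V]] inj surj]
 show "Poly_Mapping.lookup (gdim K V) i = Poly_Mapping.lookup (gdim K W) i"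
  by (simp add: gdim_lookup V W)
qed

text \<open>The space is spanned by the e_i \<otimes> b with e_i from the dual basis and b from a
  spanning set of the second factor. V is Y regarded as a vector space over K.\<close>

lemma (in mtensor) tensor_vfin:
 assumes d: "dual_basis (opp R) X I e g"
  and T: "vectorspace K (tensor R X Y act)" and Y: "vectorspace K V" and fd: "vfin K V"
  and V: "carrier V = carrier Y" "add V = add Y" "\<zero>\<^bsub>V\<^esub> = \<zero>\<^bsub>Y\<^esub>"
  and act: "!!c x y. [|c : carrier K; x : carrier X; y : carrier Y|] ==>
   c \<odot>\<^bsub>tensor R X Y act\<^esub> pt x y = pt x (c \<odot>\<^bsub>V\<^esub> y)"
 shows "vfin K (tensor R X Y act)"
proof -
 let ?T = "tensor R X Y act"
 note dD = dual_basisD[OF d, simplified]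
 have LV: "left_module K V" using Y vectorspace_left_module by blast
 note VD = left_moduleD[OF LV]
 obtain B where B: "finite B" "B <= carrier V" "!!H. [|ksub K V H; B <= H|] ==> carrier V <= H"
  using vfinE[OF Y fd] by blast
 obtain \<phi> where \<phi>: "!!i. i : I ==> addhom ?T Y (\<phi> i)"
  "!!U. U : carrier ?T ==> U = (\<Oplus>\<^bsub>?T\<^esub> i \<in> I. pt (e i) (\<phi> i U))"
  by (rule tensor_coords[OF d, where act = act]) blast
 show ?thesis
 proof (rule vfinI[OF T])
  let ?B = "(%(i, b). pt (e i) b) ` (I \<times> B)"
  show "finite ?B" using B dD by auto
  show "?B <= carrier ?T" using B dD V by auto
  fix H assume H: "ksub K ?T H" "?B <= H"
  have Ha: "additive_subgroup H ?T" and Hs: "!!c x. [|c : carrier K; x : H|] ==> c \<odot>\<^bsub>?T\<^esub> x : H"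
   using H(1) by (auto simp: ksub_def)
  note Hc = additive_subgroupD[OF Ha]
  have eH: "pt (e i) y : H" if i: "i : I" and y: "y : carrier Y" for i y
  proof -
   let ?G = "{y \<in> carrier Y. pt (e i) y : H}"
   have ei: "e i : carrier X" using dD i by auto
   have pa: "addhom V ?T (pt (e i))" using pt_addhom_right[OF ei, of act] by (simp add: addhom_def V)
   interpret V: abelian_group V by (rule VD(2))
   have ei': "pt (e i) \<zero>\<^bsub>V\<^esub> = \<zero>\<^bsub>?T\<^esub>" "!!y. y : carrier V ==> pt (e i) (\<ominus>\<^bsub>V\<^esub> y) = \<ominus>\<^bsub>?T\<^esub> pt (e i) y"
    using addhom_zero[OF VD(2) tensor_abelian pa] addhom_minus[OF VD(2) tensor_abelian pa] by simp_all
   have "additive_subgroup ?G V"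
   proof (rule additive_subgroupI'[OF VD(2)])
    fix x y assume "x : ?G" "y : ?G"
    then show "x \<oplus>\<^bsub>V\<^esub> y : ?G"
     using addhom_add[OF pa, of x y] V.a_closed[of x y] by (simp add: V(1) Hc)
   next
    fix x assume "x : ?G"
    then show "\<ominus>\<^bsub>V\<^esub> x : ?G" using ei'(2)[of x] V.a_inv_closed[of x] by (simp add: V(1) Hc)
   next
    show "\<zero>\<^bsub>V\<^esub> : ?G" using ei'(1) V.zero_closed Hc(2) unfolding V(1) by simp
   qed (auto simp: V(1))
   then have "ksub K V ?G" unfolding ksub_def using VD(3) V Hs by (auto simp: act[OF _ ei, symmetric])
   moreover have "B <= ?G" using B H(2) i V by auto
   ultimately show ?thesis using B(3) y V by blast
  qed
  show "carrier ?T <= H"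
  proof
   fix U assume U: "U : carrier ?T"
   have "(\<Oplus>\<^bsub>?T\<^esub> i \<in> I. pt (e i) (\<phi> i U)) : H"
    by (rule additive_subgroup_finsum[OF tensor_abelian Ha]) (use eH addhom_closed[OF \<phi>(1)] U in blast)
   then show "U : H" using \<phi>(2)[OF U] by simp
  qed
 qed
qed

section \<open>Graded algebras and exterior tensor products\<close>

lemma restrict_scalars_sel [simp]:
 "carrier (restrict_scalars f M) = carrier M" "add (restrict_scalars f M) = add M"
 "\<zero>\<^bsub>restrict_scalars f M\<^esub> = \<zero>\<^bsub>M\<^esub>" "smult (restrict_scalars f M) = (%b x. f b \<odot>\<^bsub>M\<^esub> x)"
 "gr (restrict_scalars f M) = gr M"
 by (simp_all add: restrict_scalars_def)

lemma regular_sel [simp]: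
 "carrier (regular A) = carrier A" "add (regular A) = add A"
 "\<zero>\<^bsub>regular A\<^esub> = \<zero>\<^bsub>A\<^esub>" "smult (regular A) = monoid.mult A" "gr (regular A) = gr A"
 by (simp_all add: regular_def)

lemma opp_gr [simp]: "gr (opp A) = gr A" "smult (opp A) = smult A"
 by (simp_all add: opp_def)

lemma abelian_group_cong:
 assumes "carrier M = carrier N" "add M = add N" "\<zero>\<^bsub>M\<^esub> = \<zero>\<^bsub>N\<^esub>" "abelian_group M"
 shows "abelian_group N"
proof -
 interpret M: abelian_group M by fact
 note * = M.a_closed M.zero_closed M.a_assoc M.a_comm M.l_zero
 show ?thesis
 proof (rule abelian_groupI)
  fix x assume "x : carrier N"
  then show "\<exists>y\<in>carrier N. y \<oplus>\<^bsub>N\<^esub> x = \<zero>\<^bsub>N\<^esub>"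
   using M.l_neg[of x] M.a_inv_closed[of x] unfolding assms(1-3) by blast
 qed (use *[unfolded assms(1-3)] in simp_all)
qed

lemma additive_subgroup_cong:
 assumes "carrier M = carrier N" "add M = add N" "\<zero>\<^bsub>M\<^esub> = \<zero>\<^bsub>N\<^esub>"
 shows "additive_subgroup H M \<longleftrightarrow> additive_subgroup H N"
 using assms by (simp add: additive_subgroup_def subgroup_def m_inv_def)

lemma finsum_cong_struct:
 assumes "carrier M = carrier N" "add M = add N" "\<zero>\<^bsub>M\<^esub> = \<zero>\<^bsub>N\<^esub>"
 shows "finsum M f I = finsum N f I"
 using assms by (simp add: finsum_def finprod_def)

lemma graded_group_cong:
 assumes "carrier M = carrier N" "add M = add N" "\<zero>\<^bsub>M\<^esub> = \<zero>\<^bsub>N\<^esub>" "gr M = gr N"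
 shows "graded_group M \<longleftrightarrow> graded_group N"
proof -
 have "hdecomp M = hdecomp N"
  by (intro ext) (simp add: hdecomp_def assms finsum_cong_struct[OF assms(1-3)])
 then show ?thesis
  using abelian_group_cong[OF assms(1-3)] abelian_group_cong[OF assms(1-3)[symmetric]]
  by (auto simp: graded_group_def assms additive_subgroup_cong[OF assms(1-3)])
qed

lemma restrict_graded [simp]: "graded_group (restrict_scalars f M) \<longleftrightarrow> graded_group M"
 by (rule graded_group_cong) simp_all

lemma restrict_abelian [simp]: "abelian_group (restrict_scalars f M) \<longleftrightarrow> abelian_group M"
 using abelian_group_cong[of "restrict_scalars f M" M] abelian_group_cong[of M "restrict_scalars f M"]
 by auto

lemma left_module_restrict:
 assumes "ring B" "f : ring_hom B A" "left_module A M"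
 shows "left_module B (restrict_scalars f M)"
 unfolding left_module_def
 using assms(1) left_moduleD[OF assms(3)]
 by (simp add: ring_hom_closed[OF assms(2)] ring_hom_add[OF assms(2)] ring_hom_mult[OF assms(2)]
   ring_hom_one[OF assms(2)])

locale galgebra =
 fixes K :: "'k ring" and A :: "('k, 'a) gr_algebra"
 assumes ga: "graded_algebra K A"
begin

sublocale A: ring A using ga by (simp add: graded_algebra_def)
sublocale K: field K using ga by (simp add: graded_algebra_def)
sublocale KA: module K A using ga by (simp add: graded_algebra_def)

lemma gr_A: "graded_group A" using ga by (simp add: graded_algebra_def)

sublocale GA: graded A by unfold_locales (rule gr_A)

lemma ring_A: "ring A" ..
lemma field_K: "field K" ..

lemma A_gr_mult: "[|a : gr A i; b : gr A j|] ==> a \<otimes>\<^bsub>A\<^esub> b : gr A (i + j)"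
 using ga by (simp add: graded_algebra_def)

lemma A_gr_smult: "[|c : carrier K; a : gr A i|] ==> c \<odot>\<^bsub>A\<^esub> a : gr A i"
 using ga by (simp add: graded_algebra_def)

lemma smult_mult:
 assumes "c : carrier K" "a : carrier A" "b : carrier A"
 shows "(c \<odot>\<^bsub>A\<^esub> a) \<otimes>\<^bsub>A\<^esub> b = c \<odot>\<^bsub>A\<^esub> (a \<otimes>\<^bsub>A\<^esub> b)" "a \<otimes>\<^bsub>A\<^esub> (c \<odot>\<^bsub>A\<^esub> b) = c \<odot>\<^bsub>A\<^esub> (a \<otimes>\<^bsub>A\<^esub> b)"
 using ga assms unfolding graded_algebra_def by metis+

lemma K_left_module: "left_module K A"
 unfolding left_module_def
 by (auto simp: KA.smult_l_distr KA.smult_r_distr KA.smult_assoc1 K.ring_axioms GA.ab)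

lemma regular_left_module: "left_module A (regular A)"
 unfolding left_module_def
 using abelian_group_cong[of A "regular A"]
 by (auto simp: A.ring_axioms A.l_distr A.r_distr A.m_assoc GA.ab)

text \<open>Comparing degrees in x 1 = x shows that the degree zero component e of 1 is a right unit
  on homogeneous elements, hence on all, so that 1 = 1 e = e.\<close>

lemma one_gr: "\<one>\<^bsub>A\<^esub> : gr A 0"
proof -
 let ?e = "hcomp A 0 \<one>\<^bsub>A\<^esub>"
 have e: "?e : carrier A" by (rule GA.hcomp_closed) simp
 have l: "addhom A A (%b. x \<otimes>\<^bsub>A\<^esub> b)" "addhom A A (%b. b \<otimes>\<^bsub>A\<^esub> x)" if "x : carrier A" for x
  using that by (simp_all add: addhom_def A.l_distr A.r_distr)
 have "x \<otimes>\<^bsub>A\<^esub> ?e = x" if x: "x : gr A i" for x i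
 proof -
  have xc: "x : carrier A" using x by (rule GA.gr_closed)
  have "hcomp A i (x \<otimes>\<^bsub>A\<^esub> b) = x \<otimes>\<^bsub>A\<^esub> hcomp A 0 b" if "b : carrier A" for b
  proof (rule GA.addhom_eqI[OF GA.ab addhom_comp[OF l(1)[OF xc] GA.hcomp_addhom]
     addhom_comp[OF GA.hcomp_addhom l(1)[OF xc]] _ that])
   fix j b assume b: "b : gr A j"
   show "hcomp A i (x \<otimes>\<^bsub>A\<^esub> b) = x \<otimes>\<^bsub>A\<^esub> hcomp A 0 b"
    using GA.hcomp_homog[OF A_gr_mult[OF x b], of i] GA.hcomp_homog[OF b, of 0] xc by (auto split: if_splits)
  qed
  from this[of "\<one>\<^bsub>A\<^esub>"] show ?thesis using GA.hcomp_homog[OF x, of i] xc by simp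
 qed
 then have "\<one>\<^bsub>A\<^esub> \<otimes>\<^bsub>A\<^esub> ?e = \<one>\<^bsub>A\<^esub>"
  by (rule GA.addhom_eqI[OF GA.ab l(2)[OF e] addhom_id _ A.one_closed])
 then show ?thesis using GA.hcomp_gr[of "\<one>\<^bsub>A\<^esub>" 0] e by simp
qed

text \<open>The structure map from K to A. Its image is central (\<open>sc_mult\<close>) and sits in
  degree zero (\<open>sc_gr\<close>).\<close>

definition sc :: "'k => 'a" where "sc c = c \<odot>\<^bsub>A\<^esub> \<one>\<^bsub>A\<^esub>"

lemma sc_closed: "c : carrier K ==> sc c : carrier A"
 by (simp add: sc_def)

lemma sc_gr: "c : carrier K ==> sc c : gr A 0"
 unfolding sc_def by (rule A_gr_smult[OF _ one_gr])

lemma sc_mult: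
 assumes "c : carrier K" "a : carrier A"
 shows "sc c \<otimes>\<^bsub>A\<^esub> a = c \<odot>\<^bsub>A\<^esub> a" "a \<otimes>\<^bsub>A\<^esub> sc c = c \<odot>\<^bsub>A\<^esub> a"
 using assms by (simp_all add: sc_def smult_mult)

lemma sc_ring_hom: "sc : ring_hom K A"
proof (rule ring_hom_memI)
 fix c d assume "c : carrier K" "d : carrier K"
 then show "sc (c \<otimes>\<^bsub>K\<^esub> d) = sc c \<otimes>\<^bsub>A\<^esub> sc d" "sc (c \<oplus>\<^bsub>K\<^esub> d) = sc c \<oplus>\<^bsub>A\<^esub> sc d"
  by (simp_all add: sc_mult(1) sc_closed) (simp_all add: sc_def KA.smult_assoc1 KA.smult_l_distr)
qed (auto simp: sc_closed, simp add: sc_def)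

lemma kspace_sel [simp]:
 "carrier (kspace A M) = carrier M" "add (kspace A M) = add M"
 "\<zero>\<^bsub>kspace A M\<^esub> = \<zero>\<^bsub>M\<^esub>" "smult (kspace A M) = (%c x. sc c \<odot>\<^bsub>M\<^esub> x)" "gr (kspace A M) = gr M"
 by (simp_all add: kspace_def sc_def)

lemma kspace_left_module: "left_module A M ==> left_module K (kspace A M)"
 using left_module_restrict[OF K.ring_axioms sc_ring_hom, of M]
 by (simp add: kspace_def sc_def[abs_def])

lemma kspace_vs: "left_module A M ==> vectorspace K (kspace A M)"
 using kspace_left_module field_K by (simp add: vectorspace_left_module)

lemma kspace_graded: "graded_group M ==> graded_group (kspace A M)"
 by (simp add: kspace_def)

lemma kspace_gr_smult:
 "[|gr_left_module A M; c : carrier K; x : gr M i|] ==> sc c \<odot>\<^bsub>M\<^esub> x : gr M i"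
 using sc_gr[of c] unfolding gr_left_module_def by (metis add_0)

lemma fmod_gr_space: "fmod K A M \<longleftrightarrow> gr_left_module A M \<and> gr_space K (kspace A M)"
proof
 assume fm: "fmod K A M"
 then have M: "gr_left_module A M" by (simp add: fmod_def)
 then have "left_module A M" "graded_group M" by (simp_all add: gr_left_module_def)
 then show "gr_left_module A M \<and> gr_space K (kspace A M)"
  using M fm kspace_gr_smult[OF M] unfolding gr_space_def
  by (simp add: kspace_vs kspace_graded fmod_def)
qed (simp add: fmod_def gr_space_def)

lemma module_hom_kspace:
 assumes "f : module_hom A M N"
 shows "f : module_hom K (kspace A M) (kspace A N)"
 using assms sc_closed by (auto simp: module_hom_def)

end

lemma opp_left_module:
 assumes "left_module K M" "cring K"
 shows "left_module (opp K) M"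
proof -
 interpret cring K by fact
 note MD = left_moduleD[OF assms(1)]
 have "(b \<otimes>\<^bsub>K\<^esub> a) \<odot>\<^bsub>M\<^esub> x = a \<odot>\<^bsub>M\<^esub> (b \<odot>\<^bsub>M\<^esub> x)"
  if "a : carrier K" "b : carrier K" "x : carrier M" for a b x
  using MD(6)[OF that] m_comm[OF that(1,2)] by simp
 then show ?thesis unfolding left_module_def using MD ring_opp[OF MD(1)] by simp
qed

text \<open>Operations on tensor products are defined by \<open>frag_extend\<close> over chosen
  representatives, lifts are known by their values on pure tensors. The two are compared here: an
  additive map is computed term by term on any formal sum.\<close>

lemma lift_class:
 assumes "tensor_pair R X Y" "tensor_pair R' X' Y'"
  and keys: "!!x y. [|x : carrier X; y : carrier Y|]
   ==> keys (h (x, y)) <= carrier X' \<times> carrier Y'"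
  and \<Phi>: "addhom (tensor R X Y act) (tensor R' X' Y' act') \<Phi>"
   "!!x y. [|x : carrier X; y : carrier Y|]
    ==> \<Phi> (pure_tensor R X Y x y) = tensor_class R' X' Y' (h (x, y))"
  and u: "keys u <= carrier X \<times> carrier Y"
 shows "\<Phi> (tensor_class R X Y u) = tensor_class R' X' Y' (frag_extend h u)"
proof -
 interpret A: tensor_pair R X Y by fact
 interpret B: tensor_pair R' X' Y' by fact
 interpret T: abelian_group "tensor R' X' Y' act'" by (rule B.tensor_abelian)
 have ke: "keys (frag_extend h u) <= B.XY" if "keys u <= A.XY" for u
 proof
  fix z assume "z : keys (frag_extend h u)"
  with keys_frag_extend[of h u]
  have "z : (\<Union>w\<in>keys u. keys (h w))" by (rule subsetD)
  then obtain w where w: "w : keys u" "z : keys (h w)" by blast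
  obtain x y where xy: "w = (x, y)" by (cases w)
  with w(1) that have "x : carrier X" "y : carrier Y" by auto
  from subsetD[OF keys[OF this]] show "z : B.XY" using w(2) xy by simp
 qed
 show ?thesis
 proof (rule free_Abelian_group_hom_eqI[OF T.a_group, where S = A.XY
    and f = "%u. \<Phi> (A.cl u)" and g = "%u. B.cl (frag_extend h u)"])
  show "(%u. \<Phi> (A.cl u)) : hom (pairs_group X Y) (add_monoid (tensor R' X' Y' act'))"
  proof (rule homI)
   fix u v assume "u : carrier (pairs_group X Y)" "v : carrier (pairs_group X Y)"
   then have uv: "keys u <= A.XY" "keys v <= A.XY" by simp_all
   then show "\<Phi> (A.cl (u \<otimes>\<^bsub>pairs_group X Y\<^esub> v)) =
     \<Phi> (A.cl u) \<otimes>\<^bsub>add_monoid (tensor R' X' Y' act')\<^esub> \<Phi> (A.cl v)"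
    using addhom_add[OF \<Phi>(1) A.cl_carrier[OF uv(1)] A.cl_carrier[OF uv(2)]] by (simp add: A.cl_add)
  qed (use \<Phi>(1) A.cl_carrier in \<open>auto simp: addhom_def\<close>)
  show "(%u. B.cl (frag_extend h u)) : hom (pairs_group X Y) (add_monoid (tensor R' X' Y' act'))"
   using ke by (intro homI) (auto simp: B.cl_add frag_extend_add B.cl_carrier)
  fix s assume "s : A.XY"
  then show "\<Phi> (A.cl (frag_of s)) = B.cl (frag_extend h (frag_of s))"
   using \<Phi>(2) by (auto simp: pure_tensor_def)
 qed (use u in auto)
qed

section \<open>Tensor products of algebras\<close>

lemma alg_tensor_sel:
 "carrier (alg_tensor K A B) = carrier (tensor K A B (%c (a, b). frag_of (c \<odot>\<^bsub>A\<^esub> a, b)))"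
 "add (alg_tensor K A B) = add (tensor K A B (%c (a, b). frag_of (c \<odot>\<^bsub>A\<^esub> a, b)))"
 "\<zero>\<^bsub>alg_tensor K A B\<^esub> = \<zero>\<^bsub>tensor K A B (%c (a, b). frag_of (c \<odot>\<^bsub>A\<^esub> a, b))\<^esub>"
 "smult (alg_tensor K A B) = smult (tensor K A B (%c (a, b). frag_of (c \<odot>\<^bsub>A\<^esub> a, b)))"
 "gr (alg_tensor K A B) = gr (tensor K A B (%c (a, b). frag_of (c \<odot>\<^bsub>A\<^esub> a, b)))"
 "\<one>\<^bsub>alg_tensor K A B\<^esub> = pure_tensor K A B \<one>\<^bsub>A\<^esub> \<one>\<^bsub>B\<^esub>"
 by (simp_all add: alg_tensor_def)

text \<open>The ring axioms for the tensor product algebra enter as an assumption; for a tower they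
  are contained in its projectivity clause (\<open>TA_ring\<close>).\<close>

locale galgebra2 = A: galgebra K A + B: galgebra K B
 for K :: "'k ring" and A :: "('k, 'a) gr_algebra" and B :: "('k, 'b) gr_algebra" +
 assumes ring_AB: "ring (alg_tensor K A B)"
begin

abbreviation "AB \<equiv> alg_tensor K A B"
abbreviation "ta \<equiv> pure_tensor K A B"
abbreviation "TAB \<equiv> tensor K A B (%c (a, b). frag_of (c \<odot>\<^bsub>A\<^esub> a, b))"

text \<open>The base field sits in degree zero. The remaining degrees can be left empty, since
  \<open>gtensor\<close> asks for generation and not for subgroups.\<close>

definition kgr :: "int => 'k set" where "kgr i = (if i = 0 then carrier K else {})"

sublocale T: gtensor K A B kgr
proof (unfold_locales)
 show "left_module (opp K) A"
  by (rule opp_left_module[OF A.K_left_module A.K.is_cring])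
 show "left_module K B" by (rule B.K_left_module)
 show "graded_group A" by (rule A.gr_A)
 show "graded_group B" by (rule B.gr_A)
 show "!!H. [|additive_subgroup H K; !!i. kgr i <= H|] ==> carrier K <= H"
  using kgr_def by (metis (full_types))
 show "!!i. kgr i <= carrier K" by (simp add: kgr_def)
 show "!!i j r x. [|r : kgr i; x : gr A j|] ==> r \<odot>\<^bsub>A\<^esub> x : gr A (i + j)"
  using A.A_gr_smult by (auto simp: kgr_def split: if_splits)
 show "!!i j r x. [|r : kgr i; x : gr B j|] ==> r \<odot>\<^bsub>B\<^esub> x : gr B (i + j)"
  using B.A_gr_smult by (auto simp: kgr_def split: if_splits)
qed

lemma addhom_AB: "addhom AB H f \<longleftrightarrow> addhom TAB H f" "addhom H AB f' \<longleftrightarrow> addhom H TAB f'"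
 by (simp_all add: addhom_def alg_tensor_sel)

lemma ta_closed: "[|a : carrier A; b : carrier B|] ==> ta a b : carrier AB"
 by (simp add: alg_tensor_sel T.pt_carrier)

lemma AB_hom_eqI:
 assumes "abelian_group H" "addhom AB H f" "addhom AB H g"
  "!!a b. [|a : carrier A; b : carrier B|] ==> f (ta a b) = g (ta a b)" "S : carrier AB"
 shows "f S = g S"
proof (rule T.tensor_hom_eqI)
 show "abelian_group H" "addhom TAB H f" "addhom TAB H g" "S : carrier TAB"
  using assms by (simp_all add: addhom_AB alg_tensor_sel)
qed (rule assms(4))

lemma AB_gr_gen: "[|additive_subgroup H AB; !!i. gr AB i <= H|] ==> carrier AB <= H"
proof
 fix H S assume H: "additive_subgroup H AB" "!!i. gr AB i <= H" and S: "S : carrier AB"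
 interpret G: graded TAB by unfold_locales (rule T.tensor_graded)
 note HD = additive_subgroupD[OF H(1)]
 have "S : carrier TAB" using S by (simp add: alg_tensor_sel)
 then show "S : H"
 proof (induction rule: G.graded_induct)
  case (homog i x)
  then show ?case using H(2)[of i] by (auto simp: alg_tensor_sel)
 qed (use HD in \<open>auto simp: alg_tensor_sel\<close>)
qed

lemma AB_gr_carrier: "gr AB i <= carrier AB"
 using T.gr_closed(1) by (auto simp: alg_tensor_sel)

text \<open>The lift of (a, b), (x, y) \<mapsto> \<mu> a x \<otimes> \<nu> b y, additive in each of
  the two tensors. Its last two conclusions identify it with the two orders of nesting formal sums
  over representatives: the former occurs in the action on \<open>outer_tensor\<close>, the latter
  in the product of \<open>alg_tensor\<close>.\<close>

lemma quad_balanced: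
 assumes MN: "tensor_pair K X Y"
  and \<mu>: "!!a x. [|a : carrier A; x : carrier X|] ==> \<mu> a x : carrier X"
   "!!x. x : carrier X ==> addhom A X (%a. \<mu> a x)"
   "!!a. a : carrier A ==> addhom X X (\<mu> a)"
   "!!c a x. [|c : carrier K; a : carrier A; x : carrier X|] ==> \<mu> (c \<odot>\<^bsub>A\<^esub> a) x = c \<odot>\<^bsub>X\<^esub> \<mu> a x"
   "!!c a x. [|c : carrier K; a : carrier A; x : carrier X|] ==> \<mu> a (c \<odot>\<^bsub>X\<^esub> x) = c \<odot>\<^bsub>X\<^esub> \<mu> a x"
  and \<nu>: "!!a x. [|a : carrier B; x : carrier Y|] ==> \<nu> a x : carrier Y"
   "!!x. x : carrier Y ==> addhom B Y (%a. \<nu> a x)"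
   "!!a. a : carrier B ==> addhom Y Y (\<nu> a)"
   "!!c a x. [|c : carrier K; a : carrier B; x : carrier Y|] ==> \<nu> (c \<odot>\<^bsub>B\<^esub> a) x = c \<odot>\<^bsub>Y\<^esub> \<nu> a x"
   "!!c a x. [|c : carrier K; a : carrier B; x : carrier Y|] ==> \<nu> a (c \<odot>\<^bsub>Y\<^esub> x) = c \<odot>\<^bsub>Y\<^esub> \<nu> a x"
 obtains \<Theta> where
  "!!S U. [|S : carrier TAB; U : carrier (tensor K X Y act)|] ==> \<Theta> S U : carrier (tensor K X Y act)"
  "!!S. S : carrier TAB ==> addhom (tensor K X Y act) (tensor K X Y act) (\<Theta> S)"
  "!!U. U : carrier (tensor K X Y act) ==> addhom TAB (tensor K X Y act) (%S. \<Theta> S U)"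
  "!!a b x y. [|a : carrier A; b : carrier B; x : carrier X; y : carrier Y|] ==>
    \<Theta> (ta a b) (pure_tensor K X Y x y) = pure_tensor K X Y (\<mu> a x) (\<nu> b y)"
  "!!S U. [|S : carrier TAB; U : carrier (tensor K X Y act)|] ==> \<Theta> S U = tensor_class K X Y
   (frag_extend (%(x, y). frag_extend (%(a, b). frag_of (\<mu> a x, \<nu> b y)) (rep S)) (rep U))"
  "!!S U. [|S : carrier TAB; U : carrier (tensor K X Y act)|] ==> \<Theta> S U = tensor_class K X Y
   (frag_extend (%(a, b). frag_extend (%(x, y). frag_of (\<mu> a x, \<nu> b y)) (rep U)) (rep S))"
proof -
 interpret P: tensor_pair K X Y by fact
 let ?T = "tensor K X Y act"
 interpret T': abelian_group ?T by (rule P.tensor_abelian)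
 have muD: "\<mu> (a \<oplus>\<^bsub>A\<^esub> a') x = \<mu> a x \<oplus>\<^bsub>X\<^esub> \<mu> a' x"
  if "a : carrier A" "a' : carrier A" "x : carrier X" for a a' x
  using addhom_add[OF \<mu>(2)] that by blast
 have muD': "\<mu> a (x \<oplus>\<^bsub>X\<^esub> x') = \<mu> a x \<oplus>\<^bsub>X\<^esub> \<mu> a x'"
  if "a : carrier A" "x : carrier X" "x' : carrier X" for a x x'
  using addhom_add[OF \<mu>(3)] that by blast
 have nuD: "\<nu> (a \<oplus>\<^bsub>B\<^esub> a') x = \<nu> a x \<oplus>\<^bsub>Y\<^esub> \<nu> a' x"
  if "a : carrier B" "a' : carrier B" "x : carrier Y" for a a' x
  using addhom_add[OF \<nu>(2)] that by blast
 have nuD': "\<nu> a (x \<oplus>\<^bsub>Y\<^esub> x') = \<nu> a x \<oplus>\<^bsub>Y\<^esub> \<nu> a x'"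
  if "a : carrier B" "x : carrier Y" "x' : carrier Y" for a x x'
  using addhom_add[OF \<nu>(3)] that by blast
 \<comment> \<open>For fixed x and y the formula is lifted in the algebra variables; the resulting
   family is lifted once more, in x and y, below.\<close>
 have "\<exists>\<Phi>. addhom TAB ?T \<Phi> \<and> (\<forall>a\<in>carrier A. \<forall>b\<in>carrier B. \<Phi> (ta a b) = P.pt (\<mu> a x) (\<nu> b y))"
  if xy: "x : carrier X" "y : carrier Y" for x y
 proof -
  have "balanced K A B ?T (%a b. P.pt (\<mu> a x) (\<nu> b y))"
   using xy by (intro balancedI)
    (auto simp: muD nuD \<mu>(1,4) \<nu>(1,4) P.pt_add_left P.pt_add_right P.pt_smult)
  then obtain \<Phi> where "addhom TAB ?T \<Phi>"
   "!!a b. [|a : carrier A; b : carrier B|] ==> \<Phi> (ta a b) = P.pt (\<mu> a x) (\<nu> b y)"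
   by (rule T.tensor_lift[OF P.tensor_abelian, where act = "%c (a, b). frag_of (c \<odot>\<^bsub>A\<^esub> a, b)"]) blast
  then show ?thesis by blast
 qed
 then obtain \<Phi> where \<Phi>: "!!x y. [|x : carrier X; y : carrier Y|] ==> addhom TAB ?T (\<Phi> x y)"
  "!!a b x y. [|a : carrier A; b : carrier B; x : carrier X; y : carrier Y|]
   ==> \<Phi> x y (ta a b) = P.pt (\<mu> a x) (\<nu> b y)"
  by metis
 \<comment> \<open>Balancedness in x and y is needed for an arbitrary S, but each law is additive in
   S, so pure tensors suffice.\<close>
 have \<Phi>bal: "balanced K X Y ?T (%x y. \<Phi> x y S)" if S: "S : carrier TAB" for S
 proof (rule balancedI)
  fix x x' y assume xy: "x : carrier X" "x' : carrier X" "y : carrier Y"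
  have c: "x \<oplus>\<^bsub>X\<^esub> x' : carrier X"
   using xy P.X_group by (simp add: abelian_group_def abelian_monoid.a_closed)
  show "\<Phi> x y S : carrier ?T" using \<Phi>(1) xy S by (blast intro: addhom_closed)
  show "\<Phi> (x \<oplus>\<^bsub>X\<^esub> x') y S = \<Phi> x y S \<oplus>\<^bsub>?T\<^esub> \<Phi> x' y S"
  proof (rule T.tensor_hom_eqI[OF P.tensor_abelian \<Phi>(1)[OF c xy(3)] _ _ S])
   show "addhom TAB ?T (%S. \<Phi> x y S \<oplus>\<^bsub>?T\<^esub> \<Phi> x' y S)"
    using \<Phi>(1)[OF xy(1,3)] \<Phi>(1)[OF xy(2,3)] by (simp add: addhom_def T'.a_ac)
  qed (use xy c in \<open>simp add: \<Phi>(2) muD' P.pt_add_left \<mu>(1) \<nu>(1)\<close>)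
 next
  fix x y y' assume xy: "x : carrier X" "y : carrier Y" "y' : carrier Y"
  have c: "y \<oplus>\<^bsub>Y\<^esub> y' : carrier Y"
   using xy P.Y_group by (simp add: abelian_group_def abelian_monoid.a_closed)
  show "\<Phi> x (y \<oplus>\<^bsub>Y\<^esub> y') S = \<Phi> x y S \<oplus>\<^bsub>?T\<^esub> \<Phi> x y' S"
  proof (rule T.tensor_hom_eqI[OF P.tensor_abelian \<Phi>(1)[OF xy(1) c] _ _ S])
   show "addhom TAB ?T (%S. \<Phi> x y S \<oplus>\<^bsub>?T\<^esub> \<Phi> x y' S)"
    using \<Phi>(1)[OF xy(1,2)] \<Phi>(1)[OF xy(1,3)] by (simp add: addhom_def T'.a_ac)
  qed (use xy c in \<open>simp add: \<Phi>(2) nuD' P.pt_add_right \<mu>(1) \<nu>(1)\<close>)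
 next
  fix c x y assume xy: "c : carrier K" "x : carrier X" "y : carrier Y"
  note cx = P.X_smult[OF xy(1,2)] and cy = P.Y_smult[OF xy(1,3)]
  show "\<Phi> (c \<odot>\<^bsub>X\<^esub> x) y S = \<Phi> x (c \<odot>\<^bsub>Y\<^esub> y) S"
   by (rule T.tensor_hom_eqI[OF P.tensor_abelian \<Phi>(1)[OF cx xy(3)] \<Phi>(1)[OF xy(2) cy] _ S])
    (use xy cx cy in \<open>simp add: \<Phi>(2) P.pt_smult \<mu>(1,5) \<nu>(1,5)\<close>)
 qed
 have "\<exists>\<Psi>. addhom ?T ?T \<Psi> \<and> (\<forall>x\<in>carrier X. \<forall>y\<in>carrier Y. \<Psi> (P.pt x y) = \<Phi> x y S)"
  if S: "S : carrier TAB" for S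
 proof -
  from \<Phi>bal[OF S] obtain \<Psi> where "addhom ?T ?T \<Psi>"
   "!!x y. [|x : carrier X; y : carrier Y|] ==> \<Psi> (P.pt x y) = \<Phi> x y S"
   by (rule P.tensor_lift[OF P.tensor_abelian, where act = act]) blast
  then show ?thesis by blast
 qed
 then have "\<forall>S\<in>carrier TAB. \<exists>\<Psi>. addhom ?T ?T \<Psi> \<and>
   (\<forall>x\<in>carrier X. \<forall>y\<in>carrier Y. \<Psi> (P.pt x y) = \<Phi> x y S)" by blast
 from bchoice[OF this] obtain \<Theta> where \<Theta>: "!!S. S : carrier TAB ==> addhom ?T ?T (\<Theta> S)"
  "!!S x y. [|S : carrier TAB; x : carrier X; y : carrier Y|] ==> \<Theta> S (P.pt x y) = \<Phi> x y S"
  by blast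
 interpret TT: abelian_group TAB by (rule T.tensor_abelian)
 have \<Theta>left: "addhom TAB ?T (%S. \<Theta> S U)" if U: "U : carrier ?T" for U
 proof (rule addhomI)
  fix S S' assume S: "S : carrier TAB" "S' : carrier TAB"
  show "\<Theta> S U : carrier ?T" using \<Theta>(1)[OF S(1)] U by (rule addhom_closed)
  have c: "S \<oplus>\<^bsub>TAB\<^esub> S' : carrier TAB" using S by simp
  show "\<Theta> (S \<oplus>\<^bsub>TAB\<^esub> S') U = \<Theta> S U \<oplus>\<^bsub>?T\<^esub> \<Theta> S' U"
  proof (rule P.tensor_hom_eqI[OF P.tensor_abelian \<Theta>(1)[OF c] _ _ U])
   show "addhom ?T ?T (%U. \<Theta> S U \<oplus>\<^bsub>?T\<^esub> \<Theta> S' U)"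
    using \<Theta>(1)[OF S(1)] \<Theta>(1)[OF S(2)] by (simp add: addhom_def T'.a_ac)
   fix x y assume xy: "x : carrier X" "y : carrier Y"
   show "\<Theta> (S \<oplus>\<^bsub>TAB\<^esub> S') (P.pt x y) = \<Theta> S (P.pt x y) \<oplus>\<^bsub>?T\<^esub> \<Theta> S' (P.pt x y)"
    using addhom_add[OF \<Phi>(1)[OF xy] S] by (simp only: \<Theta>(2)[OF c xy] \<Theta>(2)[OF S(1) xy] \<Theta>(2)[OF S(2) xy])
  qed
 qed
 have pure: "\<Theta> (ta a b) (P.pt x y) = P.pt (\<mu> a x) (\<nu> b y)"
  if "a : carrier A" "b : carrier B" "x : carrier X" "y : carrier Y" for a b x y
  using that by (simp add: \<Theta>(2) \<Phi>(2) T.pt_carrier)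
 have kf: "keys (frag_of (\<mu> a x, \<nu> b y)) <= P.XY"
  if "a : carrier A" "b : carrier B" "x : carrier X" "y : carrier Y" for a b x y
  using that \<mu>(1) \<nu>(1) by (simp add: keys_frag_of)
 have ext_keys: "keys (frag_extend h u) <= P.XY"
  if "!!z. z : keys u ==> keys (h z) <= P.XY" for h and u :: "'z \<Rightarrow>\<^sub>0 int"
  using that by (intro subset_trans[OF keys_frag_extend]) blast
 show thesis
 proof (rule that[of \<Theta>])
  fix S U assume S: "S : carrier TAB" and U: "U : carrier ?T"
  note rS = T.rep_keys[OF S] T.cl_rep[OF S] and rU = P.rep_keys[OF U] P.cl_rep[OF U]
  show "\<Theta> S U : carrier ?T" using \<Theta>(1)[OF S] U by (rule addhom_closed)
  have 1: "\<Phi> x y S = P.cl (frag_extend (%(a, b). frag_of (\<mu> a x, \<nu> b y)) (rep S))"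
   if xy: "x : carrier X" "y : carrier Y" for x y
  proof -
   have "\<Phi> x y (T.cl (rep S)) = P.cl (frag_extend (%(a, b). frag_of (\<mu> a x, \<nu> b y)) (rep S))"
    by (rule lift_class[OF T.tensor_pair_axioms P.tensor_pair_axioms _ \<Phi>(1)[OF xy] _ rS(1)])
     (use kf xy in \<open>simp_all add: \<Phi>(2) pure_tensor_def[of K X Y]\<close>)
   then show ?thesis by (simp add: rS)
  qed
  have "\<Theta> S (P.cl (rep U)) = P.cl (frag_extend (%(x, y). frag_extend (%(a, b). frag_of (\<mu> a x, \<nu> b y)) (rep S)) (rep U))"
  proof (rule lift_class[OF P.tensor_pair_axioms P.tensor_pair_axioms _ \<Theta>(1)[OF S] _ rU(1)])
   fix x y assume xy: "x : carrier X" "y : carrier Y"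
   show "keys (case (x, y) of (x, y) => frag_extend (%(a, b). frag_of (\<mu> a x, \<nu> b y)) (rep S)) <= P.XY"
    unfolding prod.case by (rule ext_keys) (use \<mu>(1) \<nu>(1) xy rS(1) in \<open>auto simp: keys_frag_of\<close>)
  qed (simp add: \<Theta>(2) S 1)
  then show "\<Theta> S U = P.cl (frag_extend (%(x, y). frag_extend (%(a, b). frag_of (\<mu> a x, \<nu> b y)) (rep S)) (rep U))"
   by (simp add: rU)
  have 2: "\<Theta> (ta a b) U = P.cl (frag_extend (%(x, y). frag_of (\<mu> a x, \<nu> b y)) (rep U))"
   if ab: "a : carrier A" "b : carrier B" for a b
  proof -
   have "\<Theta> (ta a b) (P.cl (rep U)) = P.cl (frag_extend (%(x, y). frag_of (\<mu> a x, \<nu> b y)) (rep U))"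
    by (rule lift_class[OF P.tensor_pair_axioms P.tensor_pair_axioms _ \<Theta>(1) _ rU(1)])
     (use kf ab pure in \<open>auto simp: pure_tensor_def[of K X Y "\<mu> _ _"] T.pt_carrier\<close>)
   then show ?thesis by (simp add: rU)
  qed
  have "\<Theta> (T.cl (rep S)) U = P.cl (frag_extend (%(a, b). frag_extend (%(x, y). frag_of (\<mu> a x, \<nu> b y)) (rep U)) (rep S))"
  proof (rule lift_class[OF T.tensor_pair_axioms P.tensor_pair_axioms _ \<Theta>left[OF U] _ rS(1)])
   fix a b assume ab: "a : carrier A" "b : carrier B"
   show "keys (case (a, b) of (a, b) => frag_extend (%(x, y). frag_of (\<mu> a x, \<nu> b y)) (rep U)) <= P.XY"
    unfolding prod.case by (rule ext_keys) (use \<mu>(1) \<nu>(1) ab rU(1) in \<open>auto simp: keys_frag_of\<close>)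
  qed (simp add: 2)
  then show "\<Theta> S U = P.cl (frag_extend (%(a, b). frag_extend (%(x, y). frag_of (\<mu> a x, \<nu> b y)) (rep U)) (rep S))"
   by (simp add: rS)
 qed (use \<Theta>(1) \<Theta>left pure in auto)
qed

end

lemma gr_modD:
 assumes "gr_left_module A M"
 shows "left_module A M" "graded_group M"
  "!!i j a x. [|a : gr A i; x : gr M j|] ==> a \<odot>\<^bsub>M\<^esub> x : gr M (i + j)"
 using assms by (simp_all add: gr_left_module_def)

lemma gr_graded: "gr_left_module A M ==> graded M"
  by (simp add: gr_left_module_def graded_def)

lemma (in abelian_monoid) finsum_Times:
 assumes "finite I" "finite J" "!!i j. [|i : I; j : J|] ==> f i j : carrier G"
 shows "(\<Oplus>z\<in>I \<times> J. f (fst z) (snd z)) = (\<Oplus>i\<in>I. \<Oplus>j\<in>J. f i j)"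
 using assms(1,3)
proof (induction I rule: finite_induct)
 case (insert a I)
 have "(\<Oplus>z\<in>insert a I \<times> J. f (fst z) (snd z)) =
   (\<Oplus>z\<in>(Pair a ` J) \<union> (I \<times> J). f (fst z) (snd z))"
  by (intro finsum_cong') (use insert in auto)
 also have "\<dots> = (\<Oplus>z\<in>Pair a ` J. f (fst z) (snd z)) \<oplus> (\<Oplus>z\<in>I \<times> J. f (fst z) (snd z))"
  by (rule finsum_Un_disjoint) (use insert assms(2) in auto)
 also have "(\<Oplus>z\<in>Pair a ` J. f (fst z) (snd z)) = (\<Oplus>j\<in>J. f a j)"
  by (subst finsum_reindex) (use insert in \<open>auto simp: inj_on_def\<close>)
 also have "(\<Oplus>z\<in>I \<times> J. f (fst z) (snd z)) = (\<Oplus>i\<in>I. \<Oplus>j\<in>J. f i j)"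
  by (rule insert.IH) (use insert in auto)
 finally show ?case
  using insert by (subst finsum_insert) (auto intro!: finsum_closed)
qed simp

context galgebra2 begin

text \<open>The product is defined through representatives; by \<open>quad_balanced\<close> it is
  the biadditive map determined by its values on pure tensors.\<close>

lemma ta_mult:
 assumes "a : carrier A" "b : carrier B" "a' : carrier A" "b' : carrier B"
 shows "ta a b \<otimes>\<^bsub>AB\<^esub> ta a' b' = ta (a \<otimes>\<^bsub>A\<^esub> a') (b \<otimes>\<^bsub>B\<^esub> b')"
proof -
 have muA: "addhom A A (%a. a \<otimes>\<^bsub>A\<^esub> x)" "addhom A A ((\<otimes>\<^bsub>A\<^esub>) x)" if "x : carrier A" for x
  using that by (auto intro!: addhomI simp: A.A.l_distr A.A.r_distr)
 have muB: "addhom B B (%a. a \<otimes>\<^bsub>B\<^esub> x)" "addhom B B ((\<otimes>\<^bsub>B\<^esub>) x)" if "x : carrier B" for x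
  using that by (auto intro!: addhomI simp: B.A.l_distr B.A.r_distr)
 obtain \<Theta> where \<Theta>: "!!a b x y. [|a : carrier A; b : carrier B; x : carrier A; y : carrier B|] ==>
    \<Theta> (ta a b) (ta x y) = ta (a \<otimes>\<^bsub>A\<^esub> x) (b \<otimes>\<^bsub>B\<^esub> y)"
  "!!S U. [|S : carrier TAB; U : carrier TAB|] ==> \<Theta> S U = tensor_class K A B
   (frag_extend (%(a, b). frag_extend (%(x, y). frag_of (a \<otimes>\<^bsub>A\<^esub> x, b \<otimes>\<^bsub>B\<^esub> y)) (rep U)) (rep S))"
  by (rule quad_balanced[OF T.tensor_pair_axioms, where \<mu> = "monoid.mult A" and \<nu> = "monoid.mult B"
     and act = "%c (a, b). frag_of (c \<odot>\<^bsub>A\<^esub> a, b)"])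
   (use muA muB in \<open>simp_all add: A.smult_mult B.smult_mult\<close>)
 have "S \<otimes>\<^bsub>AB\<^esub> U = \<Theta> S U" if "S : carrier TAB" "U : carrier TAB" for S U
  using \<Theta>(2)[OF that] by (simp add: alg_tensor_def)
 then show ?thesis using assms by (simp add: T.pt_carrier \<Theta>(1))
qed

end

section \<open>Exterior tensor products of graded modules\<close>

locale outer = galgebra2 K A B
 for K :: "'k ring" and A :: "('k, 'a) gr_algebra" and B :: "('k, 'b) gr_algebra" +
 fixes M :: "('a, 'm) gr_module" and N :: "('b, 'n) gr_module"
 assumes M: "gr_left_module A M" and N: "gr_left_module B N"
begin

abbreviation "MN \<equiv> outer_tensor K A B M N"
abbreviation "po \<equiv> pure_tensor K (kspace A M) (kspace B N)"

lemmas MD = left_moduleD[OF gr_modD(1)[OF M]]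
lemmas ND = left_moduleD[OF gr_modD(1)[OF N]]

sublocale O: gtensor K "kspace A M" "kspace B N" kgr
proof (unfold_locales)
 have M': "left_module K (kspace A M)" and N': "left_module K (kspace B N)"
  using A.kspace_left_module B.kspace_left_module M N by (auto simp: gr_left_module_def)
 show "left_module (opp K) (kspace A M)"
  by (rule opp_left_module[OF M' A.K.is_cring])
 show "left_module K (kspace B N)" by (rule N')
 show "graded_group (kspace A M)" "graded_group (kspace B N)"
  using M N by (auto simp: gr_left_module_def intro: A.kspace_graded B.kspace_graded)
 show "!!i j r x. [|r : kgr i; x : gr (kspace A M) j|] ==> r \<odot>\<^bsub>kspace A M\<^esub> x : gr (kspace A M) (i + j)"
  using A.kspace_gr_smult[OF M] by (auto simp: kgr_def split: if_splits)
 show "!!i j r x. [|r : kgr i; x : gr (kspace B N) j|] ==> r \<odot>\<^bsub>kspace B N\<^esub> x : gr (kspace B N) (i + j)"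
  using B.kspace_gr_smult[OF N] by (auto simp: kgr_def split: if_splits)
qed (use T.rg_gen T.rg_carrier in auto)

lemma MN_abelian: "abelian_group MN"
 unfolding outer_tensor_def by (rule O.tensor_abelian)

lemma po_closed: "[|x : carrier M; y : carrier N|] ==> po x y : carrier MN"
 unfolding outer_tensor_def by (rule O.pt_carrier) simp_all

text \<open>The action is again given by nested formal sums. Identifying it with the lift of
  \<open>quad_balanced\<close> makes it additive in both arguments, after which every module law can
  be tested on pure tensors.\<close>

lemma MN_smult:
 shows "S : carrier AB ==> addhom MN MN (smult MN S)"
  and "U : carrier MN ==> addhom AB MN (%S. S \<odot>\<^bsub>MN\<^esub> U)"
  and "[|a : carrier A; b : carrier B; x : carrier M; y : carrier N|] ==>
   ta a b \<odot>\<^bsub>MN\<^esub> po x y = po (a \<odot>\<^bsub>M\<^esub> x) (b \<odot>\<^bsub>N\<^esub> y)"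
proof -
 interpret MN: abelian_group MN by (rule MN_abelian)
 have scM: "(c \<odot>\<^bsub>A\<^esub> a) \<odot>\<^bsub>M\<^esub> x = A.sc c \<odot>\<^bsub>M\<^esub> (a \<odot>\<^bsub>M\<^esub> x)" "a \<odot>\<^bsub>M\<^esub> (A.sc c \<odot>\<^bsub>M\<^esub> x) = A.sc c \<odot>\<^bsub>M\<^esub> (a \<odot>\<^bsub>M\<^esub> x)"
  if "c : carrier K" "a : carrier A" "x : carrier M" for c a x
  using that MD(6)[of a "A.sc c" x] MD(6)[of "A.sc c" a x] A.sc_closed by (simp_all add: A.sc_mult)
 have scN: "(c \<odot>\<^bsub>B\<^esub> a) \<odot>\<^bsub>N\<^esub> x = B.sc c \<odot>\<^bsub>N\<^esub> (a \<odot>\<^bsub>N\<^esub> x)" "a \<odot>\<^bsub>N\<^esub> (B.sc c \<odot>\<^bsub>N\<^esub> x) = B.sc c \<odot>\<^bsub>N\<^esub> (a \<odot>\<^bsub>N\<^esub> x)"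
  if "c : carrier K" "a : carrier B" "x : carrier N" for c a x
  using that ND(6)[of a "B.sc c" x] ND(6)[of "B.sc c" a x] B.sc_closed by (simp_all add: B.sc_mult)
 note am = left_module_addhom[OF gr_modD(1)[OF M]] and an = left_module_addhom[OF gr_modD(1)[OF N]]
 let ?act = "%T (x, y). frag_extend (%(a, b). frag_of (a \<odot>\<^bsub>M\<^esub> x, b \<odot>\<^bsub>N\<^esub> y)) (rep T)"
 obtain \<Theta> where
  1: "!!S. S : carrier TAB ==> addhom (tensor K (kspace A M) (kspace B N) ?act) (tensor K (kspace A M) (kspace B N) ?act) (\<Theta> S)"
  and 2: "!!U. U : carrier (tensor K (kspace A M) (kspace B N) ?act) ==> addhom TAB (tensor K (kspace A M) (kspace B N) ?act) (%S. \<Theta> S U)"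
  and 3: "!!a b x y. [|a : carrier A; b : carrier B; x : carrier (kspace A M); y : carrier (kspace B N)|] ==>
    \<Theta> (ta a b) (po x y) = po (a \<odot>\<^bsub>M\<^esub> x) (b \<odot>\<^bsub>N\<^esub> y)"
  and 4: "!!S U. [|S : carrier TAB; U : carrier (tensor K (kspace A M) (kspace B N) ?act)|] ==>
   \<Theta> S U = O.cl (frag_extend (%(x, y). frag_extend (%(a, b). frag_of (a \<odot>\<^bsub>M\<^esub> x, b \<odot>\<^bsub>N\<^esub> y)) (rep S)) (rep U))"
  by (rule quad_balanced[OF O.tensor_pair_axioms, where \<mu> = "smult M" and \<nu> = "smult N" and act = ?act],
    (use am an in \<open>simp_all add: scM scN MD ND addhom_def\<close>)[10], blast)
 have eq: "S \<odot>\<^bsub>MN\<^esub> U = \<Theta> S U" if "S : carrier TAB" "U : carrier MN" for S U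
  using 4[OF that[unfolded outer_tensor_def]] by (simp add: outer_tensor_def tensor_def Let_def)
 show "S : carrier AB ==> addhom MN MN (smult MN S)"
  using 1[of S, folded outer_tensor_def] eq[of S] by (simp add: addhom_def alg_tensor_sel)
 show "U : carrier MN ==> addhom AB MN (%S. S \<odot>\<^bsub>MN\<^esub> U)"
 proof -
  assume U: "U : carrier MN"
  interpret TT: abelian_group TAB by (rule T.tensor_abelian)
  show ?thesis
   using 2[folded outer_tensor_def, OF U] eq[OF _ U] by (simp add: addhom_def alg_tensor_sel)
 qed
 show "[|a : carrier A; b : carrier B; x : carrier M; y : carrier N|] ==>
   ta a b \<odot>\<^bsub>MN\<^esub> po x y = po (a \<odot>\<^bsub>M\<^esub> x) (b \<odot>\<^bsub>N\<^esub> y)"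
  by (simp add: eq T.pt_carrier po_closed 3)
qed

lemma MN_hom_eqI:
 assumes "abelian_group H" "addhom MN H f" "addhom MN H g"
  "!!x y. [|x : carrier M; y : carrier N|] ==> f (po x y) = g (po x y)" "U : carrier MN"
 shows "f U = g U"
 by (rule O.tensor_hom_eqI[OF assms(1) assms(2,3)[unfolded outer_tensor_def] _ assms(5)[unfolded outer_tensor_def]])
  (simp add: assms(4))

lemma MN_left_module: "left_module AB MN"
proof -
 interpret R: ring AB by (rule ring_AB)
 let ?act = "%T (x, y). frag_extend (%(a, b). frag_of (a \<odot>\<^bsub>M\<^esub> x, b \<odot>\<^bsub>N\<^esub> y)) (rep T)"
 have "left_module AB (tensor K (kspace A M) (kspace B N) ?act)"
 proof (rule O.tensor_left_module[OF ring_AB], unfold outer_tensor_def[symmetric])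
  fix S S' x y
  assume S: "S : carrier AB" "S' : carrier AB" and "x : carrier (kspace A M)" "y : carrier (kspace B N)"
  then have xy: "x : carrier M" "y : carrier N" by simp_all
  note p = po_closed[OF xy]
  show "(S \<oplus>\<^bsub>AB\<^esub> S') \<odot>\<^bsub>MN\<^esub> po x y = (S \<odot>\<^bsub>MN\<^esub> po x y) \<oplus>\<^bsub>MN\<^esub> (S' \<odot>\<^bsub>MN\<^esub> po x y)"
   using addhom_add[OF MN_smult(2)[OF p] S] .
  have l: "addhom AB AB (%S. S \<otimes>\<^bsub>AB\<^esub> S')" if "S' : carrier AB" for S'
   using that by (auto intro!: addhomI simp: R.l_distr)
  have r: "addhom AB AB ((\<otimes>\<^bsub>AB\<^esub>) S)" if "S : carrier AB" for S
   using that by (auto intro!: addhomI simp: R.r_distr)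
  show "(S \<otimes>\<^bsub>AB\<^esub> S') \<odot>\<^bsub>MN\<^esub> po x y = S \<odot>\<^bsub>MN\<^esub> (S' \<odot>\<^bsub>MN\<^esub> po x y)"
  proof (rule AB_hom_eqI[OF MN_abelian addhom_comp[OF l[OF S(2)] MN_smult(2)[OF p]]
     MN_smult(2)[OF addhom_closed[OF MN_smult(2)[OF p] S(2)]] _ S(1)])
   fix a b assume ab: "a : carrier A" "b : carrier B"
   note t = ta_closed[OF ab]
   show "(ta a b \<otimes>\<^bsub>AB\<^esub> S') \<odot>\<^bsub>MN\<^esub> po x y = ta a b \<odot>\<^bsub>MN\<^esub> (S' \<odot>\<^bsub>MN\<^esub> po x y)"
    by (rule AB_hom_eqI[OF MN_abelian addhom_comp[OF r[OF t] MN_smult(2)[OF p]]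
       addhom_comp[OF MN_smult(2)[OF p] MN_smult(1)[OF t]] _ S(2)])
     (use ab xy in \<open>simp add: ta_mult MN_smult(3) MD ND\<close>)
  qed
 next
  fix x y assume "x : carrier (kspace A M)" "y : carrier (kspace B N)"
  then show "\<one>\<^bsub>AB\<^esub> \<odot>\<^bsub>MN\<^esub> po x y = po x y"
   by (simp add: alg_tensor_sel MN_smult(3) MD ND)
 qed (rule MN_smult(1))
 then show ?thesis by (simp add: outer_tensor_def)
qed

lemma MN_gr_left_module: "gr_left_module AB MN"
proof -
 let ?act = "%T (x, y). frag_extend (%(a, b). frag_of (a \<odot>\<^bsub>M\<^esub> x, b \<odot>\<^bsub>N\<^esub> y)) (rep T)"
 have gg: "graded_group MN" unfolding outer_tensor_def by (rule O.tensor_graded)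
 have sub: "additive_subgroup (gr MN i) MN" for i using gg by (simp add: graded_group_def)
 interpret gM: graded M by (rule gr_graded[OF M])
 interpret gN: graded N by (rule gr_graded[OF N])
 have 1: "S \<odot>\<^bsub>MN\<^esub> po x y : gr MN (i + j)"
  if S: "S : gr AB i" and x: "x : gr M k" and y: "y : gr N l" and kl: "k + l = j" for S i j k l x y
 proof -
  have xy: "x : carrier M" "y : carrier N" using x y gM.gr_closed gN.gr_closed by auto
  have "(%S. S \<odot>\<^bsub>MN\<^esub> po x y) ` gr TAB i <= gr MN (i + j)"
  proof (rule T.gr_addhom_image[OF _ MN_abelian sub])
   show "addhom TAB MN (%S. S \<odot>\<^bsub>MN\<^esub> po x y)"
    using MN_smult(2)[OF po_closed[OF xy]] by (simp add: addhom_AB)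
   fix a b s t assume ab: "a : gr A s" "b : gr B t" "s + t = i"
   have "po (a \<odot>\<^bsub>M\<^esub> x) (b \<odot>\<^bsub>N\<^esub> y) : gr MN (i + j)" unfolding outer_tensor_def
    by (rule O.pt_gr[where j = "s + k" and k = "t + l"])
     (use ab kl x y gr_modD(3)[OF M] gr_modD(3)[OF N] in auto)
   then show "ta a b \<odot>\<^bsub>MN\<^esub> po x y : gr MN (i + j)"
    using MN_smult(3)[OF _ _ xy] A.GA.gr_closed(1)[OF ab(1)] B.GA.gr_closed(1)[OF ab(2)] by simp
  qed
  then show ?thesis using S by (auto simp: alg_tensor_sel)
 qed
 have "S \<odot>\<^bsub>MN\<^esub> U : gr MN (i + j)" if S: "S : gr AB i" and U: "U : gr MN j" for S U i j
 proof -
  have "smult MN S ` gr (tensor K (kspace A M) (kspace B N) ?act) j <= gr MN (i + j)"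
  proof (rule O.gr_addhom_image[OF _ MN_abelian sub])
   have "S : carrier AB" using S AB_gr_carrier by auto
   then show "addhom (tensor K (kspace A M) (kspace B N) ?act) MN (smult MN S)"
    using MN_smult(1) unfolding outer_tensor_def by blast
  qed (use 1[OF S] in simp)
  then show ?thesis using U unfolding outer_tensor_def by blast
 qed
 then show ?thesis unfolding gr_left_module_def using MN_left_module gg by blast
qed

text \<open>The functionals are the f_i \<otimes> f'_j, induced by functoriality over K. The
  expansion of x \<otimes> y is the product of the expansions of x and y, multiplied out by
  biadditivity.\<close>

lemma MN_dual_basis:
 assumes d: "dual_basis A M I e f" and d': "dual_basis B N J e' f'"
 obtains F where "dual_basis AB MN (I \<times> J) (%z. po (e (fst z)) (e' (snd z))) F"
proof -
 note dD = dual_basisD[OF d] and dD' = dual_basisD[OF d']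
 interpret MN: abelian_group MN by (rule MN_abelian)
 have fk: "f i : module_hom K (kspace A M) A" if "i : I" for i
  by (rule module_homI) (use dD that A.sc_closed in \<open>simp_all add: addhom_def A.sc_mult\<close>)
 have fk': "f' i : module_hom K (kspace B N) B" if "i : J" for i
  by (rule module_homI) (use dD' that B.sc_closed in \<open>simp_all add: addhom_def B.sc_mult\<close>)
 have "\<exists>F. addhom MN AB F \<and> (\<forall>x\<in>carrier M. \<forall>y\<in>carrier N. F (po x y) = ta (f i x) (f' j y))"
  if ij: "i : I" "j : J" for i j
 proof -
  obtain F where "addhom (tensor K (kspace A M) (kspace B N) (%T (x, y). frag_extend (%(a, b). frag_of (a \<odot>\<^bsub>M\<^esub> x, b \<odot>\<^bsub>N\<^esub> y)) (rep T))) TAB F"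
   "!!x y. [|x : carrier (kspace A M); y : carrier (kspace B N)|] ==> F (po x y) = ta (f i x) (f' j y)"
   by (rule tensor_map[OF O.mtensor_axioms T.mtensor_axioms fk[OF ij(1)] fk'[OF ij(2)]]) blast
  then show ?thesis unfolding outer_tensor_def[symmetric] addhom_AB(2)[symmetric] by auto
 qed
 then obtain F where F: "!!i j. [|i : I; j : J|] ==> addhom MN AB (F i j)"
  "!!i j x y. [|i : I; j : J; x : carrier M; y : carrier N|] ==> F i j (po x y) = ta (f i x) (f' j y)"
  by metis
 interpret R: ring AB by (rule ring_AB)
 have "dual_basis AB MN (I \<times> J) (%z. po (e (fst z)) (e' (snd z))) (%z. F (fst z) (snd z))"
  unfolding dual_basis_def
 proof (intro conjI ballI)
  show "finite (I \<times> J)" using dD(1) dD'(1) by simp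
  show "(%z. po (e (fst z)) (e' (snd z))) : I \<times> J \<rightarrow> carrier MN"
   using dD(2) dD'(2) po_closed by auto
  fix z assume "z : I \<times> J"
  then have ij: "fst z : I" "snd z : J" by auto
  show "addhom MN AB (F (fst z) (snd z))" by (rule F(1)[OF ij])
  fix S U assume S: "S : carrier AB" and U: "U : carrier MN"
  have r: "addhom AB AB ((\<otimes>\<^bsub>AB\<^esub>) S)" if "S : carrier AB" for S
   using that by (auto intro!: addhomI simp: R.r_distr)
  have l: "addhom AB AB (%S. S \<otimes>\<^bsub>AB\<^esub> S')" if "S' : carrier AB" for S'
   using that by (auto intro!: addhomI simp: R.l_distr)
  show "F (fst z) (snd z) (S \<odot>\<^bsub>MN\<^esub> U) = S \<otimes>\<^bsub>AB\<^esub> F (fst z) (snd z) U"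
  proof (rule MN_hom_eqI[OF R.abelian_group_axioms addhom_comp[OF MN_smult(1)[OF S] F(1)[OF ij]]
     addhom_comp[OF F(1)[OF ij] r[OF S]] _ U])
   fix x y assume xy: "x : carrier M" "y : carrier N"
   have t: "ta (f (fst z) x) (f' (snd z) y) : carrier AB"
    using xy dD(4)[OF ij(1)] dD'(4)[OF ij(2)] by (intro ta_closed) auto
   show "F (fst z) (snd z) (S \<odot>\<^bsub>MN\<^esub> po x y) = S \<otimes>\<^bsub>AB\<^esub> F (fst z) (snd z) (po x y)"
    unfolding F(2)[OF ij xy]
    by (rule AB_hom_eqI[OF R.abelian_group_axioms addhom_comp[OF MN_smult(2)[OF po_closed[OF xy]] F(1)[OF ij]]
       l[OF t] _ S])
     (use ij xy dD dD' MD ND in \<open>simp add: MN_smult(3) F(2) ta_mult\<close>)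
  qed
 next
  fix U assume U: "U : carrier MN"
  let ?rhs = "%U. \<Oplus>\<^bsub>MN\<^esub>z\<in>I \<times> J. F (fst z) (snd z) U \<odot>\<^bsub>MN\<^esub> po (e (fst z)) (e' (snd z))"
  show "U = ?rhs U"
  proof (rule MN_hom_eqI[OF MN_abelian addhom_id addhom_sum[OF MN_abelian] _ U])
   fix z assume "z : I \<times> J"
   then have ij: "fst z : I" "snd z : J" by auto
   show "addhom MN MN (%U. F (fst z) (snd z) U \<odot>\<^bsub>MN\<^esub> po (e (fst z)) (e' (snd z)))"
    by (rule addhom_comp[OF F(1)[OF ij] MN_smult(2)]) (use ij dD(2) dD'(2) po_closed in auto)
  next
   fix x y assume xy: "x : carrier M" "y : carrier N"
   have c: "f i x \<odot>\<^bsub>M\<^esub> e i : carrier M" if "i : I" for i using that dD MD xy by auto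
   have c': "f' i y \<odot>\<^bsub>N\<^esub> e' i : carrier N" if "i : J" for i using that dD' ND xy by auto
   have pl: "addhom M MN (%x. po x y)" if "y : carrier N" for y
    using O.pt_addhom_left[of y] that unfolding outer_tensor_def by (simp add: addhom_def)
   have pr: "addhom N MN (%y. po x y)" if "x : carrier M" for x
    using O.pt_addhom_right[of x] that unfolding outer_tensor_def by (simp add: addhom_def)
   have "?rhs (po x y) = (\<Oplus>\<^bsub>MN\<^esub>z\<in>I \<times> J. po (f (fst z) x \<odot>\<^bsub>M\<^esub> e (fst z)) (f' (snd z) y \<odot>\<^bsub>N\<^esub> e' (snd z)))"
    using xy dD dD' c c' po_closed by (intro MN.finsum_cong') (auto simp: F(2) MN_smult(3))
   also have "\<dots> = (\<Oplus>\<^bsub>MN\<^esub>i\<in>I. \<Oplus>\<^bsub>MN\<^esub>j\<in>J. po (f i x \<odot>\<^bsub>M\<^esub> e i) (f' j y \<odot>\<^bsub>N\<^esub> e' j))"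
    using c c' dD(1) dD'(1) po_closed by (intro MN.finsum_Times) auto
   also have "\<dots> = (\<Oplus>\<^bsub>MN\<^esub>i\<in>I. po (f i x \<odot>\<^bsub>M\<^esub> e i) y)"
   proof (rule MN.finsum_cong')
    fix i assume i: "i : I"
    have "po (f i x \<odot>\<^bsub>M\<^esub> e i) (\<Oplus>\<^bsub>N\<^esub>j\<in>J. f' j y \<odot>\<^bsub>N\<^esub> e' j) =
      (\<Oplus>\<^bsub>MN\<^esub>j\<in>J. po (f i x \<odot>\<^bsub>M\<^esub> e i) (f' j y \<odot>\<^bsub>N\<^esub> e' j))"
     by (rule addhom_finsum[OF ND(2) MN_abelian pr[OF c[OF i]]]) (use c' in auto)
    then show "(\<Oplus>\<^bsub>MN\<^esub>j\<in>J. po (f i x \<odot>\<^bsub>M\<^esub> e i) (f' j y \<odot>\<^bsub>N\<^esub> e' j)) = po (f i x \<odot>\<^bsub>M\<^esub> e i) y"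
     using dD'(6)[OF xy(2)] by simp
   qed (use c xy po_closed in auto)
   also have "\<dots> = po (\<Oplus>\<^bsub>M\<^esub>i\<in>I. f i x \<odot>\<^bsub>M\<^esub> e i) y"
    by (rule addhom_finsum[OF MD(2) MN_abelian pl[OF xy(2)], symmetric]) (use c in auto)
   finally show "po x y = ?rhs (po x y)" using dD(6)[OF xy(1)] by simp
  qed
 qed
 then show thesis by (rule that)
qed

end

section \<open>Induction and twisted tensor products\<close>

text \<open>Extension of scalars along h. \<open>CR\<close> is C as a right module over the tensor
  algebra, hence built from the opposite algebra, and C itself acts on \<open>Ind\<close> by
  multiplication from the left.\<close>

locale inducing = galgebra2 K A B + C: galgebra K C
 for K :: "'k ring" and A :: "('k, 'a) gr_algebra" and B :: "('k, 'b) gr_algebra"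
  and C :: "('k, 'c) gr_algebra" +
 fixes h :: "('a \<times> 'b \<Rightarrow>\<^sub>0 int) set => 'c" and M :: "(('a \<times> 'b \<Rightarrow>\<^sub>0 int) set, 'm) gr_module"
 assumes h: "h : ring_hom AB C" and h_gr: "!!i. h ` gr AB i <= gr C i"
  and M: "gr_left_module AB M"
begin

abbreviation "CR \<equiv> restrict_scalars h (regular (opp C))"
abbreviation "ind_act \<equiv> %a (x, y). frag_of (a \<otimes>\<^bsub>C\<^esub> x, y)"
abbreviation "Ind \<equiv> tensor AB CR M ind_act"
abbreviation "pind \<equiv> pure_tensor AB CR M"

lemmas MD = left_moduleD[OF gr_modD(1)[OF M]]

sublocale I: gtensor AB CR M "gr AB"
proof (unfold_locales)
 interpret R: ring AB by (rule ring_AB)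
 show "left_module (opp AB) CR"
  unfolding left_module_def
  by (simp add: ring_opp[OF ring_AB] C.GA.ab abelian_group_cong[of C "regular (opp C)"]
    ring_hom_closed[OF h] ring_hom_add[OF h] ring_hom_mult[OF h] ring_hom_one[OF h]
    C.A.l_distr C.A.r_distr C.A.m_assoc)
 show "left_module AB M" "graded_group M" by (rule gr_modD[OF M])+
 show "graded_group CR" using graded_group_cong[of C "regular (opp C)"] C.gr_A by simp
 show "!!i j r x. [|r : gr AB i; x : gr CR j|] ==> r \<odot>\<^bsub>CR\<^esub> x : gr CR (i + j)"
  using C.A_gr_mult h_gr by (simp add: image_subset_iff) (metis add.commute)
 show "!!i j r x. [|r : gr AB i; x : gr M j|] ==> r \<odot>\<^bsub>M\<^esub> x : gr M (i + j)"
  by (rule gr_modD(3)[OF M])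
qed (use AB_gr_gen AB_gr_carrier in auto)

lemma Ind_smult:
 assumes "a : carrier C"
 shows "addhom Ind Ind (smult Ind a)"
  "[|x : carrier C; y : carrier M|] ==> a \<odot>\<^bsub>Ind\<^esub> pind x y = pind (a \<otimes>\<^bsub>C\<^esub> x) y"
proof -
 have hom: "(\<otimes>\<^bsub>C\<^esub>) a : module_hom AB CR CR"
  by (rule module_homI, rule addhomI)
   (use assms in \<open>simp_all add: C.A.r_distr C.A.m_assoc ring_hom_closed[OF h]\<close>)
 show "addhom Ind Ind (smult Ind a)" by (rule I.smult_left(1)[OF _ hom]) simp
 show "[|x : carrier C; y : carrier M|] ==> a \<odot>\<^bsub>Ind\<^esub> pind x y = pind (a \<otimes>\<^bsub>C\<^esub> x) y"
  by (rule I.smult_left(2)[OF _ hom]) simp_all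
qed

lemma pind_closed: "[|x : carrier C; y : carrier M|] ==> pind x y : carrier Ind"
 by (rule I.pt_carrier) simp_all

lemma Ind_hom_eqI:
 assumes "abelian_group H" "addhom Ind H f" "addhom Ind H g"
  "!!x y. [|x : carrier C; y : carrier M|] ==> f (pind x y) = g (pind x y)" "U : carrier Ind"
 shows "f U = g U"
 by (rule I.tensor_hom_eqI[OF assms(1-3) _ assms(5)]) (simp add: assms(4))

lemma Ind_left_module: "left_module C Ind"
proof (rule I.tensor_left_module[OF C.ring_A Ind_smult(1)])
 fix a b x y
 assume ab: "a : carrier C" "b : carrier C" and "x : carrier CR" and y: "y : carrier M"
 then have x: "x : carrier C" by simp
 have "addhom C Ind (%x. pind x y)"
  using I.pt_addhom_left[OF y] by (simp add: addhom_def)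
 from addhom_add[OF this, of "a \<otimes>\<^bsub>C\<^esub> x" "b \<otimes>\<^bsub>C\<^esub> x"]
 show "(a \<oplus>\<^bsub>C\<^esub> b) \<odot>\<^bsub>Ind\<^esub> pind x y = (a \<odot>\<^bsub>Ind\<^esub> pind x y) \<oplus>\<^bsub>Ind\<^esub> (b \<odot>\<^bsub>Ind\<^esub> pind x y)"
  using ab x y by (simp add: Ind_smult C.A.l_distr)
 show "(a \<otimes>\<^bsub>C\<^esub> b) \<odot>\<^bsub>Ind\<^esub> pind x y = a \<odot>\<^bsub>Ind\<^esub> (b \<odot>\<^bsub>Ind\<^esub> pind x y)"
  using ab x y by (simp add: Ind_smult C.A.m_assoc)
qed (simp_all add: Ind_smult)

lemma Ind_gr_left_module: "gr_left_module C Ind"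
proof -
 have sub: "additive_subgroup (gr Ind i) Ind" for i by (rule I.gr_subgroup)
 have "a \<odot>\<^bsub>Ind\<^esub> U : gr Ind (i + j)" if a: "a : gr C i" and U: "U : gr Ind j" for a U i j
 proof -
  have ac: "a : carrier C" using a by (rule C.GA.gr_closed)
  interpret gM: graded M by (rule gr_graded[OF M])
  have "smult Ind a ` gr Ind j <= gr Ind (i + j)"
  proof (rule I.gr_addhom_image[OF Ind_smult(1)[OF ac] I.tensor_abelian sub])
   fix x y k l assume xy: "x : gr CR k" "y : gr M l" "k + l = j"
   then have c: "x : carrier C" "y : carrier M" using C.GA.gr_closed gM.gr_closed by auto
   have "a \<otimes>\<^bsub>C\<^esub> x : gr CR (i + k)" using C.A_gr_mult[OF a] xy by simp
   then show "a \<odot>\<^bsub>Ind\<^esub> pind x y : gr Ind (i + j)"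
    unfolding Ind_smult(2)[OF ac c] by (rule I.pt_gr) (use xy in auto)
  qed
  then show ?thesis using U by blast
 qed
 then show ?thesis unfolding gr_left_module_def using Ind_left_module I.tensor_graded by blast
qed

text \<open>The coordinate of x \<otimes> y at the basis element 1 \<otimes> e_i is x h(f_i y),
  which is balanced because f_i is linear and h multiplicative.\<close>

lemma Ind_dual_basis:
 assumes d: "dual_basis AB M I e f"
 obtains F where "dual_basis C Ind I (%i. pind \<one>\<^bsub>C\<^esub> (e i)) F"
proof -
 note dD = dual_basisD[OF d]
 interpret T: abelian_group Ind by (rule I.tensor_abelian)
 have cp: "x \<otimes>\<^bsub>C\<^esub> h (f i y) : carrier C" if "x : carrier C" "i : I" "y : carrier M" for x i y
  using that dD(4) ring_hom_closed[OF h] by simp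
 have "\<exists>F. addhom Ind C F \<and> (\<forall>x\<in>carrier C. \<forall>y\<in>carrier M. F (pind x y) = x \<otimes>\<^bsub>C\<^esub> h (f i y))"
  if i: "i : I" for i
 proof -
  have "balanced AB CR M C (%x y. x \<otimes>\<^bsub>C\<^esub> h (f i y))"
   by (rule balancedI) (use i cp dD MD addhom_add[OF dD(3)[OF i]] in
     \<open>simp_all add: C.A.l_distr C.A.r_distr C.A.m_assoc ring_hom_closed[OF h] ring_hom_add[OF h] ring_hom_mult[OF h]\<close>)
  then obtain F where "addhom Ind C F"
   "!!x y. [|x : carrier CR; y : carrier M|] ==> F (pind x y) = x \<otimes>\<^bsub>C\<^esub> h (f i y)"
   by (rule I.tensor_lift[OF C.GA.ab]) blast
  then show ?thesis by auto
 qed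
 then obtain F where F: "!!i. i : I ==> addhom Ind C (F i)"
  "!!i x y. [|i : I; x : carrier C; y : carrier M|] ==> F i (pind x y) = x \<otimes>\<^bsub>C\<^esub> h (f i y)"
  by metis
 have "dual_basis C Ind I (%i. pind \<one>\<^bsub>C\<^esub> (e i)) F"
  unfolding dual_basis_def
 proof (intro conjI ballI)
  show "finite I" by (rule dD)
  show "(%i. pind \<one>\<^bsub>C\<^esub> (e i)) : I \<rightarrow> carrier Ind" using dD(2) pind_closed by simp
  show "addhom Ind C (F i)" if "i : I" for i using F(1)[OF that] .
  fix i a U assume i: "i : I" and a: "a : carrier C" and U: "U : carrier Ind"
  have r: "addhom C C ((\<otimes>\<^bsub>C\<^esub>) a)" using a by (auto intro!: addhomI simp: C.A.r_distr)
  show "F i (a \<odot>\<^bsub>Ind\<^esub> U) = a \<otimes>\<^bsub>C\<^esub> F i U"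
   by (rule Ind_hom_eqI[OF C.GA.ab addhom_comp[OF Ind_smult(1)[OF a] F(1)[OF i]] addhom_comp[OF F(1)[OF i] r] _ U])
    (use i a dD(4) ring_hom_closed[OF h] in \<open>simp add: Ind_smult F(2) C.A.m_assoc\<close>)
 next
  fix U assume U: "U : carrier Ind"
  show "U = (\<Oplus>\<^bsub>Ind\<^esub>i\<in>I. F i U \<odot>\<^bsub>Ind\<^esub> pind \<one>\<^bsub>C\<^esub> (e i))"
  proof (rule Ind_hom_eqI[OF I.tensor_abelian addhom_id addhom_sum[OF I.tensor_abelian] _ U])
   fix i assume i: "i : I"
   show "addhom Ind Ind (%U. F i U \<odot>\<^bsub>Ind\<^esub> pind \<one>\<^bsub>C\<^esub> (e i))"
    by (rule addhom_comp[OF F(1)[OF i] left_module_addhom(2)[OF Ind_left_module]])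
     (use i dD(2) pind_closed in simp)
  next
   fix x y assume x: "x : carrier C" and y: "y : carrier M"
   have c: "f i y \<odot>\<^bsub>M\<^esub> e i : carrier M" if "i : I" for i using that dD MD y by auto
   have pr: "addhom M Ind (%y. pind x y)" using I.pt_addhom_right[of x] x by simp
   have sm: "pind (x \<otimes>\<^bsub>C\<^esub> h r) y = pind x (r \<odot>\<^bsub>M\<^esub> y)" if "r : carrier AB" "y : carrier M" for r y
    using I.pt_smult[OF that(1), of x y] x that(2) by simp
   have "(\<Oplus>\<^bsub>Ind\<^esub>i\<in>I. F i (pind x y) \<odot>\<^bsub>Ind\<^esub> pind \<one>\<^bsub>C\<^esub> (e i)) = (\<Oplus>\<^bsub>Ind\<^esub>i\<in>I. pind x (f i y \<odot>\<^bsub>M\<^esub> e i))"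
    using x y dD cp c pind_closed sm ring_hom_closed[OF h]
    by (intro T.finsum_cong') (auto simp: F(2) Ind_smult)
   also have "\<dots> = pind x (\<Oplus>\<^bsub>M\<^esub>i\<in>I. f i y \<odot>\<^bsub>M\<^esub> e i)"
    by (rule addhom_finsum[OF MD(2) I.tensor_abelian pr, symmetric]) (use c in auto)
   finally show "pind x y = (\<Oplus>\<^bsub>Ind\<^esub>i\<in>I. F i (pind x y) \<odot>\<^bsub>Ind\<^esub> pind \<one>\<^bsub>C\<^esub> (e i))"
    using dD(6)[OF y] by simp
  qed
 qed
 then show thesis by (rule that)
qed

end

section \<open>Twisting by the anti-automorphism\<close>

locale twisted = galgebra K A
 for K :: "'k ring" and A :: "('k, 'a) gr_algebra" +
 fixes \<psi> :: "'a => 'a"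
 assumes \<psi>_hom: "\<psi> : gr_alg_hom K A (opp A)" and \<psi>_bij: "bij_betw \<psi> (carrier A) (carrier A)"
begin

lemma \<psi>: "a : carrier A ==> \<psi> a : carrier A"
  "[|a : carrier A; b : carrier A|] ==> \<psi> (a \<oplus>\<^bsub>A\<^esub> b) = \<psi> a \<oplus>\<^bsub>A\<^esub> \<psi> b"
  "[|a : carrier A; b : carrier A|] ==> \<psi> (a \<otimes>\<^bsub>A\<^esub> b) = \<psi> b \<otimes>\<^bsub>A\<^esub> \<psi> a"
  "\<psi> \<one>\<^bsub>A\<^esub> = \<one>\<^bsub>A\<^esub>" "a : gr A i ==> \<psi> a : gr A i"
  "[|c : carrier K; a : carrier A|] ==> \<psi> (c \<odot>\<^bsub>A\<^esub> a) = c \<odot>\<^bsub>A\<^esub> \<psi> a"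
proof -
 have r: "\<psi> : ring_hom A (opp A)" and m: "\<psi> : module_hom K A (opp A)"
  and g: "!!i. \<psi> ` gr A i <= gr A i"
  using \<psi>_hom by (simp_all add: gr_alg_hom_def)
 show "a : carrier A ==> \<psi> a : carrier A"
  "[|a : carrier A; b : carrier A|] ==> \<psi> (a \<oplus>\<^bsub>A\<^esub> b) = \<psi> a \<oplus>\<^bsub>A\<^esub> \<psi> b"
  "[|a : carrier A; b : carrier A|] ==> \<psi> (a \<otimes>\<^bsub>A\<^esub> b) = \<psi> b \<otimes>\<^bsub>A\<^esub> \<psi> a" "\<psi> \<one>\<^bsub>A\<^esub> = \<one>\<^bsub>A\<^esub>"
  using ring_hom_closed[OF r] ring_hom_add[OF r] ring_hom_mult[OF r] ring_hom_one[OF r] by simp_all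
 show "a : gr A i ==> \<psi> a : gr A i" using g by blast
 show "[|c : carrier K; a : carrier A|] ==> \<psi> (c \<odot>\<^bsub>A\<^esub> a) = c \<odot>\<^bsub>A\<^esub> \<psi> a"
  using module_hom_smult[OF m] by simp
qed

lemma \<psi>_sc: "c : carrier K ==> \<psi> (sc c) = sc c"
 by (simp add: sc_def \<psi>)

abbreviation "tw \<equiv> restrict_scalars \<psi>"

lemma tw_module: "left_module A P ==> left_module (opp A) (tw P)"
proof -
 assume "left_module A P"
 note PD = left_moduleD[OF this]
 show ?thesis
  unfolding left_module_def[of "opp A"] by (simp add: PD \<psi> ring_opp[OF ring_A])
qed

lemma tw_module_hom: "f : module_hom A P Q ==> f : module_hom A (tw P) (tw Q)"
 using \<psi>(1) by (auto simp: module_hom_def)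

definition \<psi>i :: "'a => 'a" where "\<psi>i = the_inv_into (carrier A) \<psi>"

lemma \<psi>i:
 shows "a : carrier A ==> \<psi>i a : carrier A" "a : carrier A ==> \<psi> (\<psi>i a) = a"
  "a : carrier A ==> \<psi>i (\<psi> a) = a"
  "[|a : carrier A; b : carrier A|] ==> \<psi>i (a \<oplus>\<^bsub>A\<^esub> b) = \<psi>i a \<oplus>\<^bsub>A\<^esub> \<psi>i b"
  "[|a : carrier A; b : carrier A|] ==> \<psi>i (a \<otimes>\<^bsub>A\<^esub> b) = \<psi>i b \<otimes>\<^bsub>A\<^esub> \<psi>i a"
proof -
 have inj: "inj_on \<psi> (carrier A)" and im: "\<psi> ` carrier A = carrier A"
  using \<psi>_bij by (auto simp: bij_betw_def)
 show c: "\<psi>i a : carrier A" if "a : carrier A" for a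
  using the_inv_into_into[OF inj, of a] that im by (simp add: \<psi>i_def)
 show r: "\<psi> (\<psi>i a) = a" if "a : carrier A" for a
  using f_the_inv_into_f[OF inj, of a] that im by (simp add: \<psi>i_def)
 show l: "\<psi>i (\<psi> a) = a" if "a : carrier A" for a
  using the_inv_into_f_f[OF inj that] by (simp add: \<psi>i_def)
 show "\<psi>i (a \<oplus>\<^bsub>A\<^esub> b) = \<psi>i a \<oplus>\<^bsub>A\<^esub> \<psi>i b" if "a : carrier A" "b : carrier A" for a b
  using l[of "\<psi>i a \<oplus>\<^bsub>A\<^esub> \<psi>i b"] that by (simp add: c r \<psi>)
 show "\<psi>i (a \<otimes>\<^bsub>A\<^esub> b) = \<psi>i b \<otimes>\<^bsub>A\<^esub> \<psi>i a" if "a : carrier A" "b : carrier A" for a b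
  using l[of "\<psi>i b \<otimes>\<^bsub>A\<^esub> \<psi>i a"] that by (simp add: c r \<psi>)
qed

text \<open>Twisting changes P but not the algebra in which functionals take values, so these have
  to be composed with the inverse of \<psi>, which turns left multiplication into right
  multiplication.\<close>

lemma tw_dual_basis:
 assumes P: "left_module A P" and d: "dual_basis A P I e f"
 shows "dual_basis (opp A) (tw P) I e (%i x. \<psi>i (f i x))"
proof -
 note dD = dual_basisD[OF d] and PD = left_moduleD[OF P]
 interpret P: abelian_group P by (rule PD(2))
 show ?thesis unfolding dual_basis_def
 proof (intro conjI ballI)
  show "addhom (tw P) (opp A) (%x. \<psi>i (f i x))" if "i : I" for i
   using dD(3)[OF that] dD(4)[OF that] by (simp add: addhom_def \<psi>i)
  fix x assume "x : carrier (tw P)"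
  then have x: "x : carrier P" by simp
  have "(\<Oplus>\<^bsub>tw P\<^esub>i\<in>I. \<psi>i (f i x) \<odot>\<^bsub>tw P\<^esub> e i) = (\<Oplus>\<^bsub>P\<^esub>i\<in>I. \<psi>i (f i x) \<odot>\<^bsub>tw P\<^esub> e i)"
   by (rule finsum_cong_struct) simp_all
  also have "\<dots> = (\<Oplus>\<^bsub>P\<^esub>i\<in>I. f i x \<odot>\<^bsub>P\<^esub> e i)"
   using x dD PD by (intro P.finsum_cong') (auto simp: \<psi>i)
  finally show "x = (\<Oplus>\<^bsub>tw P\<^esub>i\<in>I. \<psi>i (f i x) \<odot>\<^bsub>tw P\<^esub> e i)" using dD(6)[OF x] by simp
 qed (use dD in \<open>auto simp: \<psi>i \<psi>\<close>)
qed

lemma tw_gtensor: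
 assumes P: "gr_left_module A P" and M: "gr_left_module A M"
 shows "gtensor A (tw P) M (gr A)"
proof (unfold_locales)
 show "left_module (opp A) (tw P)" by (rule tw_module[OF gr_modD(1)[OF P]])
 show "left_module A M" by (rule gr_modD(1)[OF M])
 show "graded_group (tw P)" using gr_modD(2)[OF P] by simp
 show "graded_group M" by (rule gr_modD(2)[OF M])
 fix H assume H: "additive_subgroup H A" "!!i. gr A i <= H"
 note HD = additive_subgroupD[OF H(1)]
 show "carrier A <= H"
 proof
  fix a assume "a : carrier A"
  then show "a : H"
  proof (induction rule: GA.graded_induct)
   case (homog i x)
   then show ?case using H(2) by blast
  qed (use HD in auto)
 qed
next
 show "!!i. gr A i <= carrier A" using GA.gr_closed(1) by blast
 show "!!i j r x. [|r : gr A i; x : gr (tw P) j|] ==> r \<odot>\<^bsub>tw P\<^esub> x : gr (tw P) (i + j)"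
  using gr_modD(3)[OF P] \<psi>(5) by simp
 show "!!i j r x. [|r : gr A i; x : gr M j|] ==> r \<odot>\<^bsub>M\<^esub> x : gr M (i + j)"
  by (rule gr_modD(3)[OF M])
qed

abbreviation "pair_act M \<equiv> (%c (x, y). frag_of (x, (c \<odot>\<^bsub>A\<^esub> \<one>\<^bsub>A\<^esub>) \<odot>\<^bsub>M\<^esub> y))"
abbreviation "PM P M \<equiv> tensor A (tw P) M (pair_act M)"
abbreviation "ppm P M \<equiv> pure_tensor A (tw P) M"

text \<open>Scalars from K are central in A, so acting by them on the second factor is linear over A
  and passes to the tensor product.\<close>

lemma PM_smult:
 assumes P: "gr_left_module A P" and M: "gr_left_module A M" and c: "c : carrier K"
 shows "addhom (PM P M) (PM P M) (smult (PM P M) c)"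
  "[|x : carrier P; y : carrier M|] ==> c \<odot>\<^bsub>PM P M\<^esub> ppm P M x y = ppm P M x (sc c \<odot>\<^bsub>M\<^esub> y)"
proof -
 interpret G: gtensor A "tw P" M "gr A" by (rule tw_gtensor[OF P M])
 note MD = left_moduleD[OF gr_modD(1)[OF M]]
 have hom: "(\<odot>\<^bsub>M\<^esub>) (sc c) : module_hom A M M"
 proof (rule module_homI)
  show "addhom M M ((\<odot>\<^bsub>M\<^esub>) (sc c))"
   by (rule left_module_addhom(1)[OF gr_modD(1)[OF M] sc_closed[OF c]])
  fix a y assume a: "a : carrier A" and y: "y : carrier M"
  have "sc c \<odot>\<^bsub>M\<^esub> (a \<odot>\<^bsub>M\<^esub> y) = (sc c \<otimes>\<^bsub>A\<^esub> a) \<odot>\<^bsub>M\<^esub> y" using MD(6)[OF sc_closed[OF c] a y] by simp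
  also have "\<dots> = (a \<otimes>\<^bsub>A\<^esub> sc c) \<odot>\<^bsub>M\<^esub> y" using sc_mult[OF c a] by simp
  also have "\<dots> = a \<odot>\<^bsub>M\<^esub> (sc c \<odot>\<^bsub>M\<^esub> y)" using MD(6)[OF a sc_closed[OF c] y] .
  finally show "sc c \<odot>\<^bsub>M\<^esub> (a \<odot>\<^bsub>M\<^esub> y) = a \<odot>\<^bsub>M\<^esub> (sc c \<odot>\<^bsub>M\<^esub> y)" .
 qed
 show "addhom (PM P M) (PM P M) (smult (PM P M) c)"
  by (rule G.smult_right(1)[OF _ hom]) (simp add: sc_def)
 show "[|x : carrier P; y : carrier M|] ==> c \<odot>\<^bsub>PM P M\<^esub> ppm P M x y = ppm P M x (sc c \<odot>\<^bsub>M\<^esub> y)"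
  by (rule G.smult_right(2)[OF _ hom]) (simp_all add: sc_def)
qed

lemma PM_left_module:
 assumes P: "gr_left_module A P" and M: "gr_left_module A M"
 shows "left_module K (PM P M)"
proof -
 interpret G: gtensor A "tw P" M "gr A" by (rule tw_gtensor[OF P M])
 note kM = left_moduleD[OF kspace_left_module[OF gr_modD(1)[OF M]], simplified]
 show ?thesis
 proof (rule G.tensor_left_module)
  fix a b x y
  assume ab: "a : carrier K" "b : carrier K" and "x : carrier (tw P)" and y: "y : carrier M"
  then have x: "x : carrier P" by simp
  have "addhom M (PM P M) (ppm P M x)" using G.pt_addhom_right[of x] x by simp
  from addhom_add[OF this, of "sc a \<odot>\<^bsub>M\<^esub> y" "sc b \<odot>\<^bsub>M\<^esub> y"]
  show "(a \<oplus>\<^bsub>K\<^esub> b) \<odot>\<^bsub>PM P M\<^esub> ppm P M x y = (a \<odot>\<^bsub>PM P M\<^esub> ppm P M x y) \<oplus>\<^bsub>PM P M\<^esub> (b \<odot>\<^bsub>PM P M\<^esub> ppm P M x y)"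
   using ab x y by (simp add: PM_smult[OF P M] kM)
  show "(a \<otimes>\<^bsub>K\<^esub> b) \<odot>\<^bsub>PM P M\<^esub> ppm P M x y = a \<odot>\<^bsub>PM P M\<^esub> (b \<odot>\<^bsub>PM P M\<^esub> ppm P M x y)"
   using ab x y by (simp add: PM_smult[OF P M] kM)
 qed (use kM PM_smult[OF P M] K.ring_axioms in simp_all)
qed

lemma PM_gr_space:
 assumes P: "gr_left_module A P" and M: "fmod K A M" and d: "dual_basis A P I e f"
 shows "gr_space K (PM P M)"
proof -
 have gM: "gr_left_module A M" and sM: "gr_space K (kspace A M)" using M by (auto simp: fmod_gr_space)
 interpret G: gtensor A "tw P" M "gr A" by (rule tw_gtensor[OF P gM])
 interpret gP: graded P by (rule gr_graded[OF P])
 interpret gM: graded M by (rule gr_graded[OF gM])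
 have vs: "vectorspace K (PM P M)" using PM_left_module[OF P gM] field_K by (simp add: vectorspace_left_module)
 have "c \<odot>\<^bsub>PM P M\<^esub> U : gr (PM P M) i" if c: "c : carrier K" and U: "U : gr (PM P M) i" for c U i
 proof -
  have "smult (PM P M) c ` gr (PM P M) i <= gr (PM P M) i"
  proof (rule G.gr_addhom_image[OF PM_smult(1)[OF P gM c] G.tensor_abelian G.gr_subgroup])
   fix x y j k assume xy: "x : gr (tw P) j" "y : gr M k" "j + k = i"
   then have "x : carrier P" "y : carrier M" using gP.gr_closed gM.gr_closed by auto
   then show "c \<odot>\<^bsub>PM P M\<^esub> ppm P M x y : gr (PM P M) i"
    using G.pt_gr[OF xy(1) kspace_gr_smult[OF gM c xy(2)] xy(3)]
    by (simp add: PM_smult(2)[OF P gM c])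
  qed
  then show ?thesis using U by blast
 qed
 moreover have "vfin K (PM P M)"
  by (rule G.tensor_vfin[OF tw_dual_basis[OF gr_modD(1)[OF P] d] vs, of "kspace A M"])
   (use sM PM_smult(2)[OF P gM] in \<open>auto simp: gr_space_def\<close>)
 ultimately show ?thesis unfolding gr_space_def using vs G.tensor_graded by blast
qed

end

section \<open>Nice towers\<close>

context twisted begin

lemma \<psi>i_one: "\<psi>i \<one>\<^bsub>A\<^esub> = \<one>\<^bsub>A\<^esub>"
 using \<psi>i(3)[of "\<one>\<^bsub>A\<^esub>"] \<psi>(4) by simp

text \<open>Since \<psi> commutes with taking components, the degree i component of the preimage of
  a is also sent to a, and \<psi> is injective.\<close>

lemma \<psi>i_gr:
 assumes "a : gr A i"
 shows "\<psi>i a : gr A i"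
proof -
 have a: "a : carrier A" using assms by (rule GA.gr_closed)
 have "\<psi> (hcomp A i (\<psi>i a)) = hcomp A i (\<psi> (\<psi>i a))"
  by (rule graded_hom_hcomp[OF gr_A gr_A]) (use \<psi> \<psi>i(1)[OF a] in \<open>auto intro: addhomI\<close>)
 also have "\<dots> = a" using GA.hcomp_homog[OF assms, of i] a by (simp add: \<psi>i)
 finally have "\<psi>i a = hcomp A i (\<psi>i a)"
  using \<psi>i(3)[of "hcomp A i (\<psi>i a)"] GA.hcomp_closed \<psi>i(1)[OF a] by simp
 then show ?thesis using GA.hcomp_gr[OF \<psi>i(1)[OF a], of i] by simp
qed

end

locale nice_tower_alg =
 fixes K :: "'k ring" and \<A> :: "('k, 'a) tower"
 assumes K_field: "field K" and nt: "nice_tower K \<A>"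
begin

abbreviation "Al \<equiv> alg \<A>"
abbreviation "TA n m \<equiv> tensor_alg K \<A> n m"
abbreviation "xm n m \<equiv> xprod K \<A> n m"
abbreviation "an \<equiv> anti \<A>"

lemma nice_Al: "nice K (Al n)" using nt by (simp add: nice_tower_def)

sublocale G: galgebra K "Al n" for n
 using nice_Al[of n] by unfold_locales (simp add: nice_def)

sublocale W: twisted K "Al n" "an n" for n
 by unfold_locales (use nt in \<open>simp_all add: nice_tower_def\<close>)

text \<open>A projective module is in particular a module, and \<open>left_module\<close> includes
  that its ring of scalars is a ring.\<close>

lemma TA_ring: "ring (TA n m)"
proof -
 have "projective (TA n m) (restrict_scalars (xmul \<A> n m) (regular (Al (n + m))))"
  using nt by (simp add: nice_tower_def)
 then show ?thesis by (auto simp: projective_def left_module_def)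
qed

sublocale T: galgebra2 K "Al n" "Al m" for n m
 by (intro galgebra2.intro galgebra2_axioms.intro G.galgebra_axioms TA_ring)

lemma xmul_alg_hom: "xmul \<A> n m : gr_alg_hom K (TA n m) (Al (n + m))"
 using nt by (simp add: nice_tower_def)

lemma xmul_ring_hom: "xmul \<A> n m : ring_hom (TA n m) (Al (n + m))"
 using xmul_alg_hom[of n m] by (simp add: gr_alg_hom_def)

lemma xmul_gr: "xmul \<A> n m ` gr (TA n m) i <= gr (Al (n + m)) i"
 using xmul_alg_hom[of n m] by (simp add: gr_alg_hom_def)

lemma xmul_addhom: "addhom (TA n m) (Al (n + m)) (xmul \<A> n m)"
 by (rule addhomI) (simp_all add: ring_hom_closed[OF xmul_ring_hom] ring_hom_add[OF xmul_ring_hom])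

lemma inducing: "gr_left_module (TA n m) M ==> inducing K (Al n) (Al m) (Al (n + m)) (xmul \<A> n m) M"
 by (intro inducing.intro inducing_axioms.intro T.galgebra2_axioms G.galgebra_axioms
   xmul_ring_hom xmul_gr)

lemma xm_closed: "[|a : carrier (Al n); b : carrier (Al m)|] ==> xm n m a b : carrier (Al (n + m))"
 unfolding xprod_def by (rule ring_hom_closed[OF xmul_ring_hom T.ta_closed])

lemma xm_mult:
 assumes "a : carrier (Al n)" "b : carrier (Al m)" "a' : carrier (Al n)" "b' : carrier (Al m)"
 shows "xm n m a b \<otimes>\<^bsub>Al (n + m)\<^esub> xm n m a' b' = xm n m (a \<otimes>\<^bsub>Al n\<^esub> a') (b \<otimes>\<^bsub>Al m\<^esub> b')"
 using ring_hom_mult[OF xmul_ring_hom T.ta_closed[OF assms(1,2)] T.ta_closed[OF assms(3,4)]]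
  T.ta_mult[OF assms] by (simp add: xprod_def)

lemma xm_one: "xm n m \<one>\<^bsub>Al n\<^esub> \<one>\<^bsub>Al m\<^esub> = \<one>\<^bsub>Al (n + m)\<^esub>"
 using ring_hom_one[OF xmul_ring_hom[of n m]] by (simp add: xprod_def alg_tensor_sel)

lemma xm_addhom:
 shows "a : carrier (Al n) ==> addhom (Al m) (Al (n + m)) (%b. xm n m a b)"
  and "b : carrier (Al m) ==> addhom (Al n) (Al (n + m)) (%a. xm n m a b)"
 unfolding xprod_def
 using addhom_comp[OF _ xmul_addhom, unfolded T.addhom_AB, OF T.T.pt_addhom_right]
  addhom_comp[OF _ xmul_addhom, unfolded T.addhom_AB, OF T.T.pt_addhom_left]
 by blast+

lemma xm_gr:
 assumes "a : gr (Al n) i" "b : gr (Al m) j"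
 shows "xm n m a b : gr (Al (n + m)) (i + j)"
proof -
 have "tpair K \<A> n m a b : gr (TA n m) (i + j)"
  unfolding alg_tensor_sel by (rule T.T.pt_gr[OF assms refl])
 then show ?thesis using xmul_gr[of n m "i + j"] by (auto simp: xprod_def)
qed

lemma an_xm:
 "[|a : carrier (Al n); b : carrier (Al m)|] ==> an (n + m) (xm n m a b) = xm n m (an n a) (an m b)"
 using nt by (simp add: nice_tower_def)

text \<open>The compatibility of the anti-automorphisms with the multiplication of the tower, passed
  on to their inverses: algebra elements taken off the twisted modules L and P act on N through the
  inverse of \<psi>.\<close>

lemma \<psi>i_xm:
 assumes "a : carrier (Al n)" "b : carrier (Al m)"
 shows "W.\<psi>i (n + m) (xm n m a b) = xm n m (W.\<psi>i n a) (W.\<psi>i m b)"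
proof -
 have "an (n + m) (xm n m (W.\<psi>i n a) (W.\<psi>i m b)) = xm n m a b"
  using assms by (simp add: an_xm W.\<psi>i)
 then show ?thesis
  using W.\<psi>i(3)[OF xm_closed[OF W.\<psi>i(1)[OF assms(1)] W.\<psi>i(1)[OF assms(2)]]] by simp
qed

text \<open>\<open>xmul\<close> is linear over K and preserves 1, and a scalar may be moved between
  the two factors of a tensor over K; so both inclusions send scalars to scalars.\<close>

lemma xm_sc:
 assumes "c : carrier K"
 shows "xm n m (G.sc n c) \<one>\<^bsub>Al m\<^esub> = G.sc (n + m) c" "xm n m \<one>\<^bsub>Al n\<^esub> (G.sc m c) = G.sc (n + m) c"
proof -
 have h: "xmul \<A> n m : module_hom K (TA n m) (Al (n + m))"
  using xmul_alg_hom[of n m] by (simp add: gr_alg_hom_def)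
 let ?act = "%c (a, b). frag_of (c \<odot>\<^bsub>Al n\<^esub> a, b)"
 have hom: "(\<odot>\<^bsub>Al n\<^esub>) c : module_hom K (Al n) (Al n)"
 proof (rule module_homI)
  show "addhom (Al n) (Al n) ((\<odot>\<^bsub>Al n\<^esub>) c)" by (rule left_module_addhom(1)[OF G.K_left_module assms])
  fix r x assume "r : carrier K" "x : carrier (Al n)"
  then show "c \<odot>\<^bsub>Al n\<^esub> (r \<odot>\<^bsub>Al n\<^esub> x) = r \<odot>\<^bsub>Al n\<^esub> (c \<odot>\<^bsub>Al n\<^esub> x)"
   using assms G.KA.smult_assoc1[of c r x n] G.KA.smult_assoc1[of r c x n] G.K.m_comm[of c r] by simp
 qed
 have "c \<odot>\<^bsub>TA n m\<^esub> tpair K \<A> n m \<one>\<^bsub>Al n\<^esub> \<one>\<^bsub>Al m\<^esub> = tpair K \<A> n m (c \<odot>\<^bsub>Al n\<^esub> \<one>\<^bsub>Al n\<^esub>) \<one>\<^bsub>Al m\<^esub>"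
  unfolding alg_tensor_sel by (rule T.T.smult_left(2)[OF _ hom]) auto
 then have 1: "xm n m (c \<odot>\<^bsub>Al n\<^esub> \<one>\<^bsub>Al n\<^esub>) \<one>\<^bsub>Al m\<^esub> = c \<odot>\<^bsub>Al (n + m)\<^esub> \<one>\<^bsub>Al (n + m)\<^esub>"
  using module_hom_smult[OF h assms, of "tpair K \<A> n m \<one>\<^bsub>Al n\<^esub> \<one>\<^bsub>Al m\<^esub>"] T.ta_closed[of "\<one>\<^bsub>Al n\<^esub>" n "\<one>\<^bsub>Al m\<^esub>" m]
   xm_one[of n m] by (simp add: xprod_def)
 then show "xm n m (G.sc n c) \<one>\<^bsub>Al m\<^esub> = G.sc (n + m) c" by (simp add: G.sc_def)
 have "tpair K \<A> n m (c \<odot>\<^bsub>Al n\<^esub> \<one>\<^bsub>Al n\<^esub>) \<one>\<^bsub>Al m\<^esub> = tpair K \<A> n m \<one>\<^bsub>Al n\<^esub> (c \<odot>\<^bsub>Al m\<^esub> \<one>\<^bsub>Al m\<^esub>)"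
  by (rule T.T.pt_smult) (use assms in simp_all)
 then show "xm n m \<one>\<^bsub>Al n\<^esub> (G.sc m c) = G.sc (n + m) c"
  using 1 by (simp add: xprod_def G.sc_def)
qed

lemma xmul_tpair [simp]: "xmul \<A> n m (tpair K \<A> n m a b) = xm n m a b"
 by (simp add: xprod_def)

lemma Res_sel [simp]:
 "carrier (Res \<A> n m N) = carrier N" "add (Res \<A> n m N) = add N" "\<zero>\<^bsub>Res \<A> n m N\<^esub> = \<zero>\<^bsub>N\<^esub>"
 "gr (Res \<A> n m N) = gr N" "smult (Res \<A> n m N) = (%t y. xmul \<A> n m t \<odot>\<^bsub>N\<^esub> y)"
 by (simp_all add: Res_def)

abbreviation "RY m p N \<equiv> restrict_scalars (%a. tpair K \<A> m p \<one>\<^bsub>Al m\<^esub> a) (Res \<A> m p N)"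

lemma RY_sel:
 "carrier (RY m p N) = carrier N" "add (RY m p N) = add N" "\<zero>\<^bsub>RY m p N\<^esub> = \<zero>\<^bsub>N\<^esub>"
 "gr (RY m p N) = gr N" "a \<odot>\<^bsub>RY m p N\<^esub> y = xm m p \<one>\<^bsub>Al m\<^esub> a \<odot>\<^bsub>N\<^esub> y"
 by simp_all

lemma RY_gr_left_module:
 assumes N: "gr_left_module (Al (m + p)) N"
 shows "gr_left_module (Al p) (RY m p N)"
proof -
 note ND = left_moduleD[OF gr_modD(1)[OF N]]
 have one: "\<one>\<^bsub>Al m\<^esub> : carrier (Al m)" by simp
 have "left_module (Al p) (RY m p N)"
  unfolding left_module_def
 proof (intro conjI ballI)
  show "abelian_group (RY m p N)" using ND(2) by (simp add: Res_def)
  fix a b x assume ab: "a : carrier (Al p)" "b : carrier (Al p)" and x: "x : carrier (RY m p N)"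
  show "(a \<oplus>\<^bsub>Al p\<^esub> b) \<odot>\<^bsub>RY m p N\<^esub> x = (a \<odot>\<^bsub>RY m p N\<^esub> x) \<oplus>\<^bsub>RY m p N\<^esub> (b \<odot>\<^bsub>RY m p N\<^esub> x)"
   using ab x by (simp add: RY_sel addhom_add[OF xm_addhom(1)] ND xm_closed)
  have "xm m p \<one>\<^bsub>Al m\<^esub> (a \<otimes>\<^bsub>Al p\<^esub> b) = xm m p \<one>\<^bsub>Al m\<^esub> a \<otimes>\<^bsub>Al (m + p)\<^esub> xm m p \<one>\<^bsub>Al m\<^esub> b"
   using xm_mult[OF one ab(1) one ab(2)] by simp
  then show "(a \<otimes>\<^bsub>Al p\<^esub> b) \<odot>\<^bsub>RY m p N\<^esub> x = a \<odot>\<^bsub>RY m p N\<^esub> (b \<odot>\<^bsub>RY m p N\<^esub> x)"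
   using ab x by (simp add: RY_sel ND xm_closed)
 qed (simp_all add: RY_sel ND xm_closed xm_one G.ring_A)
 moreover have "graded_group (RY m p N)" using gr_modD(2)[OF N] by (simp add: Res_def)
 moreover have "a \<odot>\<^bsub>RY m p N\<^esub> x : gr (RY m p N) (i + j)" if "a : gr (Al p) i" "x : gr (RY m p N) j" for a x i j
  using gr_modD(3)[OF N xm_gr[OF G.one_gr that(1)]] that(2) by (simp add: RY_sel)
 ultimately show ?thesis by (simp add: gr_left_module_def)
qed

text \<open>TR with n given as m + p. All constructions are carried out in this form, free of
  natural number subtraction.\<close>

abbreviation "TRm m p \<equiv> TR K \<A> p (m + p)"
abbreviation "ptr m p P N \<equiv> pure_tensor (Al p) (restrict_scalars (an p) P) (RY m p N)"

lemma TRm_def: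
 "TRm m p P N = tensor (Al p) (restrict_scalars (an p) P) (RY m p N)
   (%a (x, y). frag_of (x, xm m p a \<one>\<^bsub>Al p\<^esub> \<odot>\<^bsub>N\<^esub> y))"
 by (simp add: TR_def Let_def twist_def)

end

section \<open>The module TR\<close>

locale TR_ctxt = nice_tower_alg K \<A> for K :: "'k ring" and \<A> :: "('k, 'a) tower" +
 fixes m p :: nat and P :: "('a, 'p) gr_module" and N :: "('a, 'n) gr_module"
 assumes P: "gr_left_module (Al p) P" and N: "gr_left_module (Al (m + p)) N"
begin

abbreviation "TT \<equiv> TRm m p P N"
abbreviation "pt2 \<equiv> ptr m p P N"

lemmas ND = left_moduleD[OF gr_modD(1)[OF N]]
lemmas PD = left_moduleD[OF gr_modD(1)[OF P]]

sublocale R: gtensor "Al p" "restrict_scalars (an p) P" "RY m p N" "gr (Al p)"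
 by (rule W.tw_gtensor[OF P RY_gr_left_module[OF N]])

lemma TT_abelian: "abelian_group TT" unfolding TRm_def by (rule R.tensor_abelian)

lemma pt2_closed: "[|x : carrier P; y : carrier N|] ==> pt2 x y : carrier TT"
 unfolding TRm_def by (rule R.pt_carrier) (simp_all add: RY_sel)

lemma pt2_addhom:
 "x : carrier P ==> addhom N TT (%y. pt2 x y)" "y : carrier N ==> addhom P TT (%x. pt2 x y)"
 using R.pt_addhom_right[of x] R.pt_addhom_left[of y]
 unfolding TRm_def by (simp_all add: addhom_def RY_sel)

lemma TT_hom_eqI:
 assumes "abelian_group H" "addhom TT H f" "addhom TT H g"
  "!!x y. [|x : carrier P; y : carrier N|] ==> f (pt2 x y) = g (pt2 x y)" "U : carrier TT"
 shows "f U = g U"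
 by (rule R.tensor_hom_eqI[OF assms(1) assms(2,3)[unfolded TRm_def] _ assms(5)[unfolded TRm_def]])
  (simp add: assms(4) RY_sel)

lemma pt2_tw:
 assumes "r : carrier (Al p)" "x : carrier P" "y : carrier N"
 shows "pt2 (an p r \<odot>\<^bsub>P\<^esub> x) y = pt2 x (xm m p \<one>\<^bsub>Al m\<^esub> r \<odot>\<^bsub>N\<^esub> y)"
 using R.pt_smult[of r x y] assms by (simp add: RY_sel)

text \<open>The products of a \<otimes> 1 and 1 \<otimes> b in either order are a \<otimes> b. Hence
  the actions of A_m and A_p on N commute, which is what lets A_m act on the tensor product over
  A_p.\<close>

lemma xm_commute:
 assumes "a : carrier (Al m)" "b : carrier (Al p)" "y : carrier N"
 shows "xm m p a \<one>\<^bsub>Al p\<^esub> \<odot>\<^bsub>N\<^esub> (xm m p \<one>\<^bsub>Al m\<^esub> b \<odot>\<^bsub>N\<^esub> y) = xm m p a b \<odot>\<^bsub>N\<^esub> y"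
  "xm m p \<one>\<^bsub>Al m\<^esub> b \<odot>\<^bsub>N\<^esub> (xm m p a \<one>\<^bsub>Al p\<^esub> \<odot>\<^bsub>N\<^esub> y) = xm m p a b \<odot>\<^bsub>N\<^esub> y"
 using assms by (simp_all add: ND(6)[symmetric] xm_closed xm_mult)

lemma TT_smult:
 assumes "a : carrier (Al m)"
 shows "addhom TT TT (smult TT a)"
  "[|x : carrier P; y : carrier N|] ==> a \<odot>\<^bsub>TT\<^esub> pt2 x y = pt2 x (xm m p a \<one>\<^bsub>Al p\<^esub> \<odot>\<^bsub>N\<^esub> y)"
proof -
 have "(%y. xm m p a \<one>\<^bsub>Al p\<^esub> \<odot>\<^bsub>N\<^esub> y) : module_hom (Al p) (RY m p N) (RY m p N)"
  by (rule module_homI, rule addhomI) (use assms in \<open>simp_all add: RY_sel ND xm_closed xm_commute\<close>)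
 note * = R.smult_right[OF _ this]
 show "addhom TT TT (smult TT a)" unfolding TRm_def by (rule *(1)) simp
 show "[|x : carrier P; y : carrier N|] ==> a \<odot>\<^bsub>TT\<^esub> pt2 x y = pt2 x (xm m p a \<one>\<^bsub>Al p\<^esub> \<odot>\<^bsub>N\<^esub> y)"
  unfolding TRm_def by (rule *(2)) (simp_all add: RY_sel)
qed

lemma TT_left_module: "left_module (Al m) TT"
 unfolding TRm_def
proof (rule R.tensor_left_module, unfold TRm_def[symmetric])
 fix a b x y
 assume ab: "a : carrier (Al m)" "b : carrier (Al m)"
  and "x : carrier (restrict_scalars (an p) P)" "y : carrier (RY m p N)"
 then have x: "x : carrier P" and y: "y : carrier N" by (simp_all add: RY_sel)
 have one: "\<one>\<^bsub>Al p\<^esub> : carrier (Al p)" by simp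
 show "(a \<oplus>\<^bsub>Al m\<^esub> b) \<odot>\<^bsub>TT\<^esub> pt2 x y = (a \<odot>\<^bsub>TT\<^esub> pt2 x y) \<oplus>\<^bsub>TT\<^esub> (b \<odot>\<^bsub>TT\<^esub> pt2 x y)"
  using ab x y
  by (simp add: TT_smult addhom_add[OF xm_addhom(2)] ND xm_closed addhom_add[OF pt2_addhom(1)])
 have "xm m p (a \<otimes>\<^bsub>Al m\<^esub> b) \<one>\<^bsub>Al p\<^esub> = xm m p a \<one>\<^bsub>Al p\<^esub> \<otimes>\<^bsub>Al (m + p)\<^esub> xm m p b \<one>\<^bsub>Al p\<^esub>"
  using xm_mult[OF ab(1) one ab(2) one] by simp
 then show "(a \<otimes>\<^bsub>Al m\<^esub> b) \<odot>\<^bsub>TT\<^esub> pt2 x y = a \<odot>\<^bsub>TT\<^esub> (b \<odot>\<^bsub>TT\<^esub> pt2 x y)"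
  using ab x y by (simp add: TT_smult ND xm_closed)
next
 fix x y assume "x : carrier (restrict_scalars (an p) P)" "y : carrier (RY m p N)"
 then show "\<one>\<^bsub>Al m\<^esub> \<odot>\<^bsub>TT\<^esub> pt2 x y = pt2 x y" by (simp add: TT_smult RY_sel ND xm_one)
qed (use TT_smult(1) G.ring_A in auto)

lemma TT_gr_left_module: "gr_left_module (Al m) TT"
proof -
 have gg: "graded_group TT" unfolding TRm_def by (rule R.tensor_graded)
 have sub: "additive_subgroup (gr TT i) TT" for i using gg by (simp add: graded_group_def)
 interpret gP: graded P by (rule gr_graded[OF P])
 interpret gN: graded N by (rule gr_graded[OF N])
 let ?act = "%a (x, y). frag_of (x, xm m p a \<one>\<^bsub>Al p\<^esub> \<odot>\<^bsub>N\<^esub> y)"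
 let ?T = "tensor (Al p) (restrict_scalars (an p) P) (RY m p N) ?act"
 have "a \<odot>\<^bsub>TT\<^esub> U : gr TT (i + j)" if a: "a : gr (Al m) i" and U: "U : gr TT j" for a U i j
 proof -
  have ac: "a : carrier (Al m)" using a by (rule G.GA.gr_closed)
  have "smult TT a ` gr ?T j <= gr TT (i + j)"
  proof (rule R.gr_addhom_image[OF _ TT_abelian sub])
   show "addhom ?T TT (smult TT a)" using TT_smult(1)[OF ac] unfolding TRm_def .
   fix x y k l assume xy: "x : gr (restrict_scalars (an p) P) k" "y : gr (RY m p N) l" "k + l = j"
   have c: "x : carrier P" "y : carrier N" using xy gP.gr_closed gN.gr_closed by (auto simp: RY_sel)
   have "xm m p a \<one>\<^bsub>Al p\<^esub> \<odot>\<^bsub>N\<^esub> y : gr (RY m p N) (i + l)"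
    using gr_modD(3)[OF N xm_gr[OF a G.one_gr]] xy by (simp add: RY_sel)
   then show "a \<odot>\<^bsub>TT\<^esub> pt2 x y : gr TT (i + j)"
    unfolding TT_smult(2)[OF ac c] unfolding TRm_def
    by (rule R.pt_gr[OF xy(1)]) (use xy in simp)
  qed
  then show ?thesis using U unfolding TRm_def by blast
 qed
 then show ?thesis unfolding gr_left_module_def using TT_left_module gg by blast
qed

lemma TT_kspace_smult:
 assumes "c : carrier K" "x : carrier P" "y : carrier N"
 shows "G.sc m c \<odot>\<^bsub>TT\<^esub> pt2 x y = pt2 x (G.sc (m + p) c \<odot>\<^bsub>N\<^esub> y)"
 using assms by (simp add: TT_smult G.sc_closed xm_sc)

lemma TT_fmod:
 assumes d: "dual_basis (Al p) P I e f" and N': "fmod K (Al (m + p)) N"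
 shows "fmod K (Al m) TT"
proof -
 have sN: "gr_space K (kspace (Al (m + p)) N)" using N' by (simp add: G.fmod_gr_space)
 \<comment> \<open>The vector space underlying \<open>TT\<close> arises by restricting the action of
   A_m to K. \<open>?T\<close> presents the same group with the same K-action as a tensor product,
   so that \<open>tensor_vfin\<close> applies.\<close>
 let ?act = "%c (x, y). frag_of (x, xm m p (G.sc m c) \<one>\<^bsub>Al p\<^esub> \<odot>\<^bsub>N\<^esub> y)"
 have vs: "vectorspace K (kspace (Al m) TT)" by (rule G.kspace_vs[OF TT_left_module])
 let ?T = "tensor (Al p) (restrict_scalars (an p) P) (RY m p N) ?act"
 have eq: "carrier ?T = carrier TT" "add ?T = add TT" "\<zero>\<^bsub>?T\<^esub> = \<zero>\<^bsub>TT\<^esub>" "smult ?T = (%c. smult TT (G.sc m c))"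
  unfolding TRm_def by (simp_all add: R.tensor_sel) (simp add: tensor_def Let_def)
 have vsT: "vectorspace K ?T"
  using vs unfolding vectorspace_left_module left_module_def
  using abelian_group_cong[of "kspace (Al m) TT" ?T] by (simp add: eq)
 have "vfin K ?T"
  by (rule R.tensor_vfin[OF W.tw_dual_basis[OF gr_modD(1)[OF P] d] vsT, of "kspace (Al (m + p)) N"])
   (use sN in \<open>auto simp: gr_space_def RY_sel eq TT_kspace_smult\<close>)
 then obtain B where B: "finite B" "B <= carrier ?T" "!!H. [|ksub K ?T H; B <= H|] ==> carrier ?T <= H"
  using vfinE[OF vsT] by blast
 have "vfin K (kspace (Al m) TT)"
 proof (rule vfinI[OF vs B(1)])
  show "B <= carrier (kspace (Al m) TT)" using B(2) by (simp add: eq)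
  fix H assume H: "ksub K (kspace (Al m) TT) H" "B <= H"
  have "additive_subgroup H (kspace (Al m) TT) \<longleftrightarrow> additive_subgroup H ?T"
   by (rule additive_subgroup_cong) (simp_all add: eq)
  then have "ksub K ?T H" using H(1) by (simp add: ksub_def eq)
  then show "carrier (kspace (Al m) TT) <= H" using B(3)[OF _ H(2)] by (simp add: eq)
 qed
 then show ?thesis unfolding fmod_def using TT_gr_left_module by simp
qed

end

section \<open>Adjunction between induction and restriction\<close>

text \<open>With L over A_m, P over A_p and N over A_(m+p), \<open>lhs\<close> is the tensor product
  of the twisted induced module with N, and \<open>rhs\<close> that of the twisted L with TR_P(N).
  Triple tensors on the left carry an additional algebra element z from the induction.\<close>

locale adjunction = TR_ctxt K \<A> m p P N
 for K :: "'k ring" and \<A> :: "('k, 'a) tower" and m p :: nat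
  and P :: "('a, 'p) gr_module" and N :: "('a, 'n) gr_module" +
 fixes L :: "('a, 'l) gr_module"
 assumes L: "gr_left_module (Al m) L"
begin

sublocale O: outer K "Al m" "Al p" L P
 by (intro outer.intro outer_axioms.intro T.galgebra2_axioms L P)

sublocale D: inducing K "Al m" "Al p" "Al (m + p)" "xmul \<A> m p" O.MN
 by (rule inducing[OF O.MN_gr_left_module])

sublocale V: gtensor "Al (m + p)" "restrict_scalars (an (m + p)) D.Ind" N "gr (Al (m + p))"
 by (rule W.tw_gtensor[OF D.Ind_gr_left_module N])

sublocale Z: gtensor "Al m" "restrict_scalars (an m) L" TT "gr (Al m)"
 by (rule W.tw_gtensor[OF L TT_gr_left_module])

abbreviation "lhs \<equiv> W.PM (m + p) D.Ind N"
abbreviation "rhs \<equiv> W.PM m L TT"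
abbreviation "pl \<equiv> W.ppm (m + p) D.Ind N"
abbreviation "pr \<equiv> W.ppm m L TT"
abbreviation "\<psi>' \<equiv> W.\<psi>i"

lemmas LD = left_moduleD[OF gr_modD(1)[OF L]]
lemmas lhs_abelian = V.tensor_abelian[where act = "W.pair_act (m + p) N"]
lemmas rhs_abelian = Z.tensor_abelian[where act = "W.pair_act m TT"]

lemma pl_closed: "[|u : carrier D.Ind; y : carrier N|] ==> pl u y : carrier lhs"
 by (rule V.pt_carrier) simp_all

lemma pr_addhom:
 "x : carrier L ==> addhom TT rhs (%t. pr x t)" "t : carrier TT ==> addhom L rhs (%x. pr x t)"
 using Z.pt_addhom_right[of x "W.pair_act m TT"] Z.pt_addhom_left[of t "W.pair_act m TT"]
 by (simp_all add: addhom_def)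

lemma pl_addhom:
 "u : carrier D.Ind ==> addhom N lhs (%y. pl u y)" "y : carrier N ==> addhom D.Ind lhs (%u. pl u y)"
 using V.pt_addhom_right[of u "W.pair_act (m + p) N"] V.pt_addhom_left[of y "W.pair_act (m + p) N"]
 by (simp_all add: addhom_def)

lemma pr_tw:
 "[|r : carrier (Al m); x : carrier L; t : carrier TT|] ==> pr (an m r \<odot>\<^bsub>L\<^esub> x) t = pr x (r \<odot>\<^bsub>TT\<^esub> t)"
 using Z.pt_smult[of r x t] by simp

lemma pl_tw:
 "[|r : carrier (Al (m + p)); u : carrier D.Ind; y : carrier N|]
  ==> pl (an (m + p) r \<odot>\<^bsub>D.Ind\<^esub> u) y = pl u (r \<odot>\<^bsub>N\<^esub> y)"
 using V.pt_smult[of r u y] by simp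

lemma pt2_sc:
 "[|c : carrier K; x : carrier P; y : carrier N|]
  ==> pt2 (G.sc p c \<odot>\<^bsub>P\<^esub> x) y = pt2 x (G.sc (m + p) c \<odot>\<^bsub>N\<^esub> y)"
 using pt2_tw[of "G.sc p c" x y] by (simp add: G.sc_closed W.\<psi>_sc xm_sc)

lemma pr_sc:
 "[|c : carrier K; x : carrier L; t : carrier TT|] ==> pr (G.sc m c \<odot>\<^bsub>L\<^esub> x) t = pr x (G.sc m c \<odot>\<^bsub>TT\<^esub> t)"
 using pr_tw[of "G.sc m c" x t] by (simp add: G.sc_closed W.\<psi>_sc)

text \<open>The map x \<otimes> x' \<mapsto> x \<otimes> (x' \<otimes> w) for a fixed w in N. It is
  balanced over K because scalars can be carried from L through TR to P.\<close>

lemma outer_map: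
 obtains \<Lambda> where "!!w. w : carrier N ==> addhom O.MN rhs (\<Lambda> w)"
  "!!w x x'. [|w : carrier N; x : carrier L; x' : carrier P|] ==> \<Lambda> w (O.po x x') = pr x (pt2 x' w)"
proof -
 have "\<exists>\<Phi>. addhom O.MN rhs \<Phi> \<and> (\<forall>x\<in>carrier L. \<forall>x'\<in>carrier P. \<Phi> (O.po x x') = pr x (pt2 x' w))"
  if w: "w : carrier N" for w
 proof -
  have "balanced K (kspace (Al m) L) (kspace (Al p) P) rhs (%x x'. pr x (pt2 x' w))"
  proof (rule balancedI)
   fix x x' y assume A: "x : carrier (kspace (Al m) L)" "x' : carrier (kspace (Al m) L)" "y : carrier (kspace (Al p) P)"
   then show "pr (x \<oplus>\<^bsub>kspace (Al m) L\<^esub> x') (pt2 y w) = pr x (pt2 y w) \<oplus>\<^bsub>rhs\<^esub> pr x' (pt2 y w)"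
    using addhom_add[OF pr_addhom(2)[OF pt2_closed], of y w x x'] w by simp
  next
   fix x y y' assume A: "x : carrier (kspace (Al m) L)" "y : carrier (kspace (Al p) P)" "y' : carrier (kspace (Al p) P)"
   then show "pr x (pt2 (y \<oplus>\<^bsub>kspace (Al p) P\<^esub> y') w) = pr x (pt2 y w) \<oplus>\<^bsub>rhs\<^esub> pr x (pt2 y' w)"
    using addhom_add[OF addhom_comp[OF pt2_addhom(2) pr_addhom(1)], of w x y y'] w by simp
  qed (use w in \<open>simp_all add: pt2_closed pr_sc pt2_sc TT_kspace_smult\<close>)
  then obtain \<Phi> where "addhom O.MN rhs \<Phi>"
   "!!x x'. [|x : carrier (kspace (Al m) L); x' : carrier (kspace (Al p) P)|] ==> \<Phi> (O.po x x') = pr x (pt2 x' w)"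
   unfolding outer_tensor_def
   by (rule O.O.tensor_lift[OF rhs_abelian]) blast
  then show ?thesis by auto
 qed
 then have "\<forall>w\<in>carrier N. \<exists>\<Phi>. addhom O.MN rhs \<Phi> \<and>
   (\<forall>x\<in>carrier L. \<forall>x'\<in>carrier P. \<Phi> (O.po x x') = pr x (pt2 x' w))" by blast
 from bchoice[OF this] show thesis using that by blast
qed

text \<open>An element z of the big algebra in front of the twisted induced module crosses the
  tensor sign as its image under the inverse of \<psi> and acts on y; this dictates the formula. The
  map is lifted through three tensor products in turn: over K, over A_m \<otimes> A_p, and over
  A_(m+p).\<close>

lemma forward:
 obtains F where "addhom lhs rhs F"
  "!!z x x' y. [|z : carrier (Al (m + p)); x : carrier L; x' : carrier P; y : carrier N|] ==>
   F (pl (D.pind z (O.po x x')) y) = pr x (pt2 x' (\<psi>' (m + p) z \<odot>\<^bsub>N\<^esub> y))"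
  "!!i. F ` gr lhs i <= gr rhs i"
proof -
 interpret rhs: abelian_group rhs by (rule rhs_abelian)
 interpret gN: graded N by (rule gr_graded[OF N])
 interpret gP: graded P by (rule gr_graded[OF P])
 interpret gL: graded L by (rule gr_graded[OF L])
 interpret gI: graded D.Ind by (rule gr_graded[OF D.Ind_gr_left_module])
 interpret gO: graded O.MN by (rule gr_graded[OF O.MN_gr_left_module])
 interpret AB: ring "TA m p" by (rule TA_ring)
 obtain \<Lambda> where \<Lambda>: "!!w. w : carrier N ==> addhom O.MN rhs (\<Lambda> w)"
  "!!w x x'. [|w : carrier N; x : carrier L; x' : carrier P|] ==> \<Lambda> w (O.po x x') = pr x (pt2 x' w)"
  by (rule outer_map) blast
 let ?n = "m + p"
 note xc = ring_hom_closed[OF xmul_ring_hom[of m p]]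
 have \<Lambda>add: "addhom N rhs (%w. \<Lambda> w U)" if U: "U : carrier O.MN" for U
 proof (rule addhomI)
  fix w w' assume w: "w : carrier N" "w' : carrier N"
  then have c: "w \<oplus>\<^bsub>N\<^esub> w' : carrier N" by simp
  show "\<Lambda> w U : carrier rhs" by (rule addhom_closed[OF \<Lambda>(1)[OF w(1)] U])
  show "\<Lambda> (w \<oplus>\<^bsub>N\<^esub> w') U = \<Lambda> w U \<oplus>\<^bsub>rhs\<^esub> \<Lambda> w' U"
  proof (rule O.MN_hom_eqI[OF rhs_abelian \<Lambda>(1)[OF c] _ _ U])
   show "addhom O.MN rhs (%U. \<Lambda> w U \<oplus>\<^bsub>rhs\<^esub> \<Lambda> w' U)"
    using \<Lambda>(1)[OF w(1)] \<Lambda>(1)[OF w(2)] by (simp add: addhom_def rhs.a_ac)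
   fix x x' assume "x : carrier L" "x' : carrier P"
   then show "\<Lambda> (w \<oplus>\<^bsub>N\<^esub> w') (O.po x x') = \<Lambda> w (O.po x x') \<oplus>\<^bsub>rhs\<^esub> \<Lambda> w' (O.po x x')"
    using w c addhom_add[OF addhom_comp[OF pt2_addhom(1) pr_addhom(1)]] by (simp add: \<Lambda>(2))
  qed
 qed
 \<comment> \<open>Balancedness over A_m \<otimes> A_p, checked on a \<otimes> b: b crosses the
   inner tensor sign and a the outer one, each picking up the inverse of \<psi>; on N the two meet
   as the image of a \<otimes> b under the inverse of \<psi> for A_(m+p).\<close>
 have \<Lambda>sm: "\<Lambda> w (S \<odot>\<^bsub>O.MN\<^esub> U) = \<Lambda> (\<psi>' ?n (xmul \<A> m p S) \<odot>\<^bsub>N\<^esub> w) U"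
  if w: "w : carrier N" and S: "S : carrier (TA m p)" and U: "U : carrier O.MN" for w S U
 proof -
  have psi: "addhom (Al ?n) (Al ?n) (\<psi>' ?n)" by (rule addhomI) (simp_all add: W.\<psi>i)
  have right: "addhom (TA m p) rhs (%S. \<Lambda> (\<psi>' ?n (xmul \<A> m p S) \<odot>\<^bsub>N\<^esub> w) U)" if "U : carrier O.MN" for U
   using addhom_comp[OF addhom_comp[OF addhom_comp[OF xmul_addhom psi]
      left_module_addhom(2)[OF gr_modD(1)[OF N] w]] \<Lambda>add[OF that]] .
  have left: "addhom (TA m p) rhs (%S. \<Lambda> w (S \<odot>\<^bsub>O.MN\<^esub> U))" if "U : carrier O.MN" for U
   by (rule addhom_comp[OF O.MN_smult(2)[OF that] \<Lambda>(1)[OF w]])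
  have Sw: "\<psi>' ?n (xmul \<A> m p S) \<odot>\<^bsub>N\<^esub> w : carrier N" using w S by (simp add: W.\<psi>i ND xc)
  show ?thesis
  proof (rule O.MN_hom_eqI[OF rhs_abelian addhom_comp[OF O.MN_smult(1)[OF S] \<Lambda>(1)[OF w]] \<Lambda>(1)[OF Sw] _ U])
   fix x x' assume x: "x : carrier L" "x' : carrier P"
   show "\<Lambda> w (S \<odot>\<^bsub>O.MN\<^esub> O.po x x') = \<Lambda> (\<psi>' ?n (xmul \<A> m p S) \<odot>\<^bsub>N\<^esub> w) (O.po x x')"
   proof (rule T.AB_hom_eqI[OF rhs_abelian left[OF O.po_closed[OF x]] right[OF O.po_closed[OF x]] _ S])
    fix a b assume ab: "a : carrier (Al m)" "b : carrier (Al p)"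
    note pa = W.\<psi>i(1)[OF ab(1)] and pb = W.\<psi>i(1)[OF ab(2)]
    have c: "xm m p (\<psi>' m a) (\<psi>' p b) \<odot>\<^bsub>N\<^esub> w : carrier N" using pa pb w by (simp add: ND xm_closed)
    have "\<Lambda> w (tpair K \<A> m p a b \<odot>\<^bsub>O.MN\<^esub> O.po x x') = pr (a \<odot>\<^bsub>L\<^esub> x) (pt2 (b \<odot>\<^bsub>P\<^esub> x') w)"
     using ab x w by (simp add: O.MN_smult(3) \<Lambda>(2) LD PD)
    also have "pt2 (b \<odot>\<^bsub>P\<^esub> x') w = pt2 x' (xm m p \<one>\<^bsub>Al m\<^esub> (\<psi>' p b) \<odot>\<^bsub>N\<^esub> w)"
     using pt2_tw[OF pb x(2) w] ab by (simp add: W.\<psi>i)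
    also have "pr (a \<odot>\<^bsub>L\<^esub> x) (pt2 x' (xm m p \<one>\<^bsub>Al m\<^esub> (\<psi>' p b) \<odot>\<^bsub>N\<^esub> w)) =
      pr x (\<psi>' m a \<odot>\<^bsub>TT\<^esub> pt2 x' (xm m p \<one>\<^bsub>Al m\<^esub> (\<psi>' p b) \<odot>\<^bsub>N\<^esub> w))"
     using pr_tw[OF pa x(1), of "pt2 x' (xm m p \<one>\<^bsub>Al m\<^esub> (\<psi>' p b) \<odot>\<^bsub>N\<^esub> w)"] ab pb x w
     by (simp add: W.\<psi>i pt2_closed ND xm_closed)
    also have "\<dots> = pr x (pt2 x' (xm m p (\<psi>' m a) (\<psi>' p b) \<odot>\<^bsub>N\<^esub> w))"
     using pa pb x w by (simp add: TT_smult ND xm_closed xm_commute)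
    also have "\<dots> = \<Lambda> (\<psi>' ?n (xmul \<A> m p (tpair K \<A> m p a b)) \<odot>\<^bsub>N\<^esub> w) (O.po x x')"
     using ab x c by (simp add: \<psi>i_xm \<Lambda>(2))
    finally show "\<Lambda> w (tpair K \<A> m p a b \<odot>\<^bsub>O.MN\<^esub> O.po x x') =
      \<Lambda> (\<psi>' ?n (xmul \<A> m p (tpair K \<A> m p a b)) \<odot>\<^bsub>N\<^esub> w) (O.po x x')" .
   qed
  qed
 qed
 \<comment> \<open>The tensor over A_m \<otimes> A_p: for fixed y the parameter w of \<Lambda> is
   taken to be z, carried back by the inverse of \<psi>, applied to y.\<close>
 have "\<exists>\<Phi>. addhom D.Ind rhs \<Phi> \<and>
   (\<forall>z\<in>carrier (Al ?n). \<forall>U\<in>carrier O.MN. \<Phi> (D.pind z U) = \<Lambda> (\<psi>' ?n z \<odot>\<^bsub>N\<^esub> y) U)"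
  if y: "y : carrier N" for y
 proof -
  have "balanced (TA m p) D.CR O.MN rhs (%z U. \<Lambda> (\<psi>' ?n z \<odot>\<^bsub>N\<^esub> y) U)"
  proof (rule balancedI)
   fix z U assume "z : carrier D.CR" and U: "U : carrier O.MN"
   then have z: "z : carrier (Al ?n)" by simp
   have zy: "\<psi>' ?n z \<odot>\<^bsub>N\<^esub> y : carrier N" using z y by (simp add: ND W.\<psi>i)
   show "\<Lambda> (\<psi>' ?n z \<odot>\<^bsub>N\<^esub> y) U : carrier rhs" by (rule addhom_closed[OF \<Lambda>(1)[OF zy] U])
   fix U' assume U': "U' : carrier O.MN"
   show "\<Lambda> (\<psi>' ?n z \<odot>\<^bsub>N\<^esub> y) (U \<oplus>\<^bsub>O.MN\<^esub> U') = \<Lambda> (\<psi>' ?n z \<odot>\<^bsub>N\<^esub> y) U \<oplus>\<^bsub>rhs\<^esub> \<Lambda> (\<psi>' ?n z \<odot>\<^bsub>N\<^esub> y) U'"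
    by (rule addhom_add[OF \<Lambda>(1)[OF zy] U U'])
  next
   fix z z' U assume "z : carrier D.CR" "z' : carrier D.CR" and U: "U : carrier O.MN"
   then have z: "z : carrier (Al ?n)" "z' : carrier (Al ?n)" by simp_all
   show "\<Lambda> (\<psi>' ?n (z \<oplus>\<^bsub>D.CR\<^esub> z') \<odot>\<^bsub>N\<^esub> y) U = \<Lambda> (\<psi>' ?n z \<odot>\<^bsub>N\<^esub> y) U \<oplus>\<^bsub>rhs\<^esub> \<Lambda> (\<psi>' ?n z' \<odot>\<^bsub>N\<^esub> y) U"
    using z y addhom_add[OF \<Lambda>add[OF U]] by (simp add: W.\<psi>i ND)
  next
   fix S z U assume S: "S : carrier (TA m p)" and "z : carrier D.CR" and U: "U : carrier O.MN"
   then have z: "z : carrier (Al ?n)" by simp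
   show "\<Lambda> (\<psi>' ?n (S \<odot>\<^bsub>D.CR\<^esub> z) \<odot>\<^bsub>N\<^esub> y) U = \<Lambda> (\<psi>' ?n z \<odot>\<^bsub>N\<^esub> y) (S \<odot>\<^bsub>O.MN\<^esub> U)"
    using z y S U by (simp add: \<Lambda>sm W.\<psi>i ND xc)
  qed
  then obtain \<Phi> where "addhom D.Ind rhs \<Phi>"
   "!!z U. [|z : carrier D.CR; U : carrier O.MN|] ==> \<Phi> (D.pind z U) = \<Lambda> (\<psi>' ?n z \<odot>\<^bsub>N\<^esub> y) U"
   by (rule D.I.tensor_lift[OF rhs_abelian]) blast
  then show ?thesis by auto
 qed
 then have "\<forall>y\<in>carrier N. \<exists>\<Phi>. addhom D.Ind rhs \<Phi> \<and>
   (\<forall>z\<in>carrier (Al ?n). \<forall>U\<in>carrier O.MN. \<Phi> (D.pind z U) = \<Lambda> (\<psi>' ?n z \<odot>\<^bsub>N\<^esub> y) U)" by blast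
 from bchoice[OF this] obtain \<Phi> where \<Phi>: "!!y. y : carrier N ==> addhom D.Ind rhs (\<Phi> y)"
  "!!y z U. [|y : carrier N; z : carrier (Al ?n); U : carrier O.MN|] ==>
   \<Phi> y (D.pind z U) = \<Lambda> (\<psi>' ?n z \<odot>\<^bsub>N\<^esub> y) U" by blast
 \<comment> \<open>The tensor over A_(m+p): the inverse of \<psi> takes \<psi>(r) z to its value at
   z times r, so r ends up next to y, as balancedness demands.\<close>
 have "balanced (Al ?n) (restrict_scalars (an ?n) D.Ind) N rhs (%V y. \<Phi> y V)"
 proof (rule balancedI)
  fix V y assume V: "V : carrier (restrict_scalars (an ?n) D.Ind)" and y: "y : carrier N"
  then have V': "V : carrier D.Ind" by simp
  show "\<Phi> y V : carrier rhs" by (rule addhom_closed[OF \<Phi>(1)[OF y] V'])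
  fix y' assume y': "y' : carrier N"
  then have yy: "y \<oplus>\<^bsub>N\<^esub> y' : carrier N" using y by simp
  show "\<Phi> (y \<oplus>\<^bsub>N\<^esub> y') V = \<Phi> y V \<oplus>\<^bsub>rhs\<^esub> \<Phi> y' V"
  proof (rule D.Ind_hom_eqI[OF rhs_abelian \<Phi>(1)[OF yy] _ _ V'])
   show "addhom D.Ind rhs (%V. \<Phi> y V \<oplus>\<^bsub>rhs\<^esub> \<Phi> y' V)"
    using \<Phi>(1)[OF y] \<Phi>(1)[OF y'] by (simp add: addhom_def rhs.a_ac)
   fix z U assume z: "z : carrier (Al ?n)" and U: "U : carrier O.MN"
   show "\<Phi> (y \<oplus>\<^bsub>N\<^esub> y') (D.pind z U) = \<Phi> y (D.pind z U) \<oplus>\<^bsub>rhs\<^esub> \<Phi> y' (D.pind z U)"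
    using z U y y' yy addhom_add[OF \<Lambda>add[OF U]] by (simp add: \<Phi>(2) ND W.\<psi>i)
  qed
 next
  fix V V' y
  assume "V : carrier (restrict_scalars (an ?n) D.Ind)" "V' : carrier (restrict_scalars (an ?n) D.Ind)" and y: "y : carrier N"
  then show "\<Phi> y (V \<oplus>\<^bsub>restrict_scalars (an ?n) D.Ind\<^esub> V') = \<Phi> y V \<oplus>\<^bsub>rhs\<^esub> \<Phi> y V'"
   using addhom_add[OF \<Phi>(1)[OF y]] by simp
 next
  fix r V y
  assume r: "r : carrier (Al ?n)" and "V : carrier (restrict_scalars (an ?n) D.Ind)" and y: "y : carrier N"
  then have V: "V : carrier D.Ind" by simp
  have ry: "r \<odot>\<^bsub>N\<^esub> y : carrier N" and ar: "an ?n r : carrier (Al ?n)" using r y by (simp_all add: ND W.\<psi>)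
  have "\<Phi> y (an ?n r \<odot>\<^bsub>D.Ind\<^esub> V) = \<Phi> (r \<odot>\<^bsub>N\<^esub> y) V"
   by (rule D.Ind_hom_eqI[OF rhs_abelian addhom_comp[OF D.Ind_smult(1)[OF ar] \<Phi>(1)[OF y]] \<Phi>(1)[OF ry] _ V])
    (use r y ry ar in \<open>simp add: D.Ind_smult \<Phi>(2) W.\<psi>i ND\<close>)
  then show "\<Phi> y (r \<odot>\<^bsub>restrict_scalars (an ?n) D.Ind\<^esub> V) = \<Phi> (r \<odot>\<^bsub>N\<^esub> y) V" by simp
 qed
 then obtain F where F: "addhom lhs rhs F"
  "!!V y. [|V : carrier (restrict_scalars (an ?n) D.Ind); y : carrier N|] ==> F (pl V y) = \<Phi> y V"
  by (rule V.tensor_lift[OF rhs_abelian]) blast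
 show thesis
 proof (rule that[OF F(1)])
  fix z x x' y assume "z : carrier (Al ?n)" "x : carrier L" "x' : carrier P" "y : carrier N"
  then show "F (pl (D.pind z (O.po x x')) y) = pr x (pt2 x' (\<psi>' ?n z \<odot>\<^bsub>N\<^esub> y))"
   by (simp add: F(2) \<Phi>(2) \<Lambda>(2) O.po_closed D.pind_closed ND W.\<psi>i)
 next
  fix i
  show "F ` gr lhs i <= gr rhs i"
  proof (rule V.gr_addhom_image[OF F(1) rhs_abelian Z.gr_subgroup])
   fix V y j k assume "V : gr (restrict_scalars (an ?n) D.Ind) j" and y: "y : gr N k" and i: "j + k = i"
   then have V: "V : gr D.Ind j" by simp
   have yc: "y : carrier N" using y by (rule gN.gr_closed)
   \<comment> \<open>Degrees are traced through the nested tensor products one level at a time, over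
     Ind and over the exterior product; that the inverse of \<psi> preserves degrees keeps the total
     equal to i.\<close>
   have "\<Phi> y ` gr D.Ind j <= gr rhs i"
   proof (rule D.I.gr_addhom_image[OF \<Phi>(1)[OF yc] rhs_abelian Z.gr_subgroup])
    fix z U s t assume "z : gr D.CR s" and U: "U : gr O.MN t" and st: "s + t = j"
    then have z: "z : gr (Al ?n) s" by simp
    have zc: "z : carrier (Al ?n)" using z by (rule G.GA.gr_closed)
    have Uc: "U : carrier O.MN" using U by (rule gO.gr_closed)
    let ?w = "\<psi>' ?n z \<odot>\<^bsub>N\<^esub> y"
    have w: "?w : gr N (s + k)" by (rule gr_modD(3)[OF N W.\<psi>i_gr[OF z] y])
    have wc: "?w : carrier N" using w by (rule gN.gr_closed)
    let ?act = "%T (x, y). frag_extend (%(a, b). frag_of (a \<odot>\<^bsub>L\<^esub> x, b \<odot>\<^bsub>P\<^esub> y)) (rep T)"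
    have "\<Lambda> ?w ` gr (tensor K (kspace (Al m) L) (kspace (Al p) P) ?act) t <= gr rhs i"
    proof (rule O.O.gr_addhom_image[OF \<Lambda>(1)[OF wc, unfolded outer_tensor_def] rhs_abelian Z.gr_subgroup])
     fix x x' a b assume "x : gr (kspace (Al m) L) a" "x' : gr (kspace (Al p) P) b" and ab: "a + b = t"
     then have x: "x : gr L a" "x' : gr P b" by simp_all
     have xc: "x : carrier L" "x' : carrier P" using x gL.gr_closed gP.gr_closed by auto
     have "pt2 x' ?w : gr TT (b + (s + k))"
      unfolding TRm_def by (rule R.pt_gr) (use x w in auto)
     then show "\<Lambda> ?w (O.po x x') : gr rhs i"
      unfolding \<Lambda>(2)[OF wc xc]
      by (intro Z.pt_gr[where j = a and k = "b + (s + k)"]) (use x ab st i in auto)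
    qed
    from subsetD[OF this imageI[OF U[unfolded outer_tensor_def]]]
    show "\<Phi> y (D.pind z U) : gr rhs i" unfolding \<Phi>(2)[OF yc zc Uc] .
   qed
   from subsetD[OF this imageI[OF V]] show "F (pl V y) : gr rhs i"
    using F(2)[of V y] yc gI.gr_closed(1)[OF V] by simp
  qed
 qed
qed

text \<open>Every element of \<open>lhs\<close> is a sum of triples with z = 1, because z can be
  moved onto y; the inverse map therefore inserts 1.\<close>

lemma backward:
 obtains H where "addhom rhs lhs H"
  "!!x x' y. [|x : carrier L; x' : carrier P; y : carrier N|] ==>
   H (pr x (pt2 x' y)) = pl (D.pind \<one>\<^bsub>Al (m + p)\<^esub> (O.po x x')) y"
proof -
 interpret lhs: abelian_group lhs by (rule lhs_abelian)
 let ?n = "m + p" and ?u = "%x x'. D.pind \<one>\<^bsub>Al (m + p)\<^esub> (O.po x x')"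
 have one: "\<one>\<^bsub>Al ?n\<^esub> : carrier (Al ?n)" by simp
 have pia: "addhom O.MN D.Ind (%U. D.pind \<one>\<^bsub>Al ?n\<^esub> U)"
  using D.I.pt_addhom_right[of "\<one>\<^bsub>Al ?n\<^esub>" D.ind_act] by simp
 have poa: "addhom P O.MN (%x'. O.po x x')" if "x : carrier L" for x
  using O.O.pt_addhom_right[of x] that unfolding outer_tensor_def by (simp add: addhom_def)
 have pob: "addhom L O.MN (%x. O.po x x')" if "x' : carrier P" for x'
  using O.O.pt_addhom_left[of x'] that unfolding outer_tensor_def by (simp add: addhom_def)
 have uc: "?u x x' : carrier D.Ind" if "x : carrier L" "x' : carrier P" for x x'
  using that by (simp add: D.pind_closed O.po_closed)
 \<comment> \<open>Scalars on L and P, twisted by \<psi>, combine into one element of A_m \<otimes>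
   A_p, pass into the big algebra by balancedness of the induction, become \<psi> of a product by
   compatibility with the tower, and cross to N. Taking r = 1 or s = 1 gives the two balancing laws
   needed.\<close>
 have move: "pl (?u (an m r \<odot>\<^bsub>L\<^esub> x) (an p s \<odot>\<^bsub>P\<^esub> x')) y = pl (?u x x') (xm m p r s \<odot>\<^bsub>N\<^esub> y)"
  if r: "r : carrier (Al m)" "s : carrier (Al p)" and x: "x : carrier L" "x' : carrier P" and y: "y : carrier N" for r s x x' y
 proof -
  note a = W.\<psi>(1)[OF r(1)] W.\<psi>(1)[OF r(2)]
  have "D.pind (xmul \<A> m p (tpair K \<A> m p (an m r) (an p s)) ) (O.po x x') =
    D.pind \<one>\<^bsub>Al ?n\<^esub> (tpair K \<A> m p (an m r) (an p s) \<odot>\<^bsub>O.MN\<^esub> O.po x x')"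
   using D.I.pt_smult[OF T.ta_closed[OF a], of "\<one>\<^bsub>Al ?n\<^esub>" "O.po x x'"] O.po_closed[OF x] a
   by (simp add: xm_closed)
  then have "?u (an m r \<odot>\<^bsub>L\<^esub> x) (an p s \<odot>\<^bsub>P\<^esub> x') = D.pind (an ?n (xm m p r s)) (O.po x x')"
   using a x r by (simp add: O.MN_smult(3) an_xm)
  also have "\<dots> = an ?n (xm m p r s) \<odot>\<^bsub>D.Ind\<^esub> ?u x x'"
   using r x by (simp add: D.Ind_smult W.\<psi>(1) xm_closed O.po_closed)
  finally show ?thesis using pl_tw[OF xm_closed[OF r] uc[OF x] y] by simp
 qed
 have "\<exists>\<Phi>. addhom TT lhs \<Phi> \<and> (\<forall>x'\<in>carrier P. \<forall>y\<in>carrier N. \<Phi> (pt2 x' y) = pl (?u x x') y)"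
  if x: "x : carrier L" for x
 proof -
  have "balanced (Al p) (restrict_scalars (an p) P) (RY m p N) lhs (%x' y. pl (?u x x') y)"
  proof (rule balancedI)
   fix x' x'' y assume "x' : carrier (restrict_scalars (an p) P)" "x'' : carrier (restrict_scalars (an p) P)" "y : carrier (RY m p N)"
   then show "pl (?u x (x' \<oplus>\<^bsub>restrict_scalars (an p) P\<^esub> x'')) y = pl (?u x x') y \<oplus>\<^bsub>lhs\<^esub> pl (?u x x'') y"
    using addhom_add[OF addhom_comp[OF addhom_comp[OF poa[OF x] pia] pl_addhom(2)]] by simp
  next
   fix x' y y' assume "x' : carrier (restrict_scalars (an p) P)" "y : carrier (RY m p N)" "y' : carrier (RY m p N)"
   then show "pl (?u x x') (y \<oplus>\<^bsub>RY m p N\<^esub> y') = pl (?u x x') y \<oplus>\<^bsub>lhs\<^esub> pl (?u x x') y'"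
    using addhom_add[OF pl_addhom(1)[OF uc[OF x]]] by simp
  next
   fix r x' y assume "r : carrier (Al p)" "x' : carrier (restrict_scalars (an p) P)" "y : carrier (RY m p N)"
   then show "pl (?u x (r \<odot>\<^bsub>restrict_scalars (an p) P\<^esub> x')) y = pl (?u x x') (r \<odot>\<^bsub>RY m p N\<^esub> y)"
    using move[of "\<one>\<^bsub>Al m\<^esub>" r x x' y] x by (simp add: W.\<psi>(4) LD)
  qed (use x uc pl_closed in simp)
  then obtain \<Phi> where "addhom TT lhs \<Phi>"
   "!!x' y. [|x' : carrier (restrict_scalars (an p) P); y : carrier (RY m p N)|] ==> \<Phi> (pt2 x' y) = pl (?u x x') y"
   unfolding TRm_def by (rule R.tensor_lift[OF lhs_abelian]) blast
  then show ?thesis by auto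
 qed
 then have "\<forall>x\<in>carrier L. \<exists>\<Phi>. addhom TT lhs \<Phi> \<and>
   (\<forall>x'\<in>carrier P. \<forall>y\<in>carrier N. \<Phi> (pt2 x' y) = pl (?u x x') y)" by blast
 from bchoice[OF this] obtain \<Phi> where \<Phi>: "!!x. x : carrier L ==> addhom TT lhs (\<Phi> x)"
  "!!x x' y. [|x : carrier L; x' : carrier P; y : carrier N|] ==> \<Phi> x (pt2 x' y) = pl (?u x x') y" by blast
 have "balanced (Al m) (restrict_scalars (an m) L) TT lhs \<Phi>"
 proof (rule balancedI)
  fix x x1 t assume "x : carrier (restrict_scalars (an m) L)" "x1 : carrier (restrict_scalars (an m) L)" and t: "t : carrier TT"
  then have x: "x : carrier L" "x1 : carrier L" by simp_all
  have xx: "x \<oplus>\<^bsub>L\<^esub> x1 : carrier L"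
   using x abelian_monoid.a_closed[OF abelian_group.axioms(1)[OF LD(2)]] by simp
  have "\<Phi> (x \<oplus>\<^bsub>L\<^esub> x1) t = \<Phi> x t \<oplus>\<^bsub>lhs\<^esub> \<Phi> x1 t"
  proof (rule TT_hom_eqI[OF lhs_abelian \<Phi>(1)[OF xx] _ _ t])
   show "addhom TT lhs (%t. \<Phi> x t \<oplus>\<^bsub>lhs\<^esub> \<Phi> x1 t)"
    using \<Phi>(1)[OF x(1)] \<Phi>(1)[OF x(2)] by (simp add: addhom_def lhs.a_ac)
   fix x' y assume "x' : carrier P" "y : carrier N"
   then show "\<Phi> (x \<oplus>\<^bsub>L\<^esub> x1) (pt2 x' y) = \<Phi> x (pt2 x' y) \<oplus>\<^bsub>lhs\<^esub> \<Phi> x1 (pt2 x' y)"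
    using x xx addhom_add[OF addhom_comp[OF addhom_comp[OF pob pia] pl_addhom(2)]] by (simp add: \<Phi>(2))
  qed
  then show "\<Phi> (x \<oplus>\<^bsub>restrict_scalars (an m) L\<^esub> x1) t = \<Phi> x t \<oplus>\<^bsub>lhs\<^esub> \<Phi> x1 t" by simp
 next
  fix r x t assume r: "r : carrier (Al m)" and "x : carrier (restrict_scalars (an m) L)" and t: "t : carrier TT"
  then have x: "x : carrier L" by simp
  have rx: "an m r \<odot>\<^bsub>L\<^esub> x : carrier L" using r x by (simp add: LD W.\<psi>)
  have "\<Phi> (an m r \<odot>\<^bsub>L\<^esub> x) t = \<Phi> x (r \<odot>\<^bsub>TT\<^esub> t)"
  proof (rule TT_hom_eqI[OF lhs_abelian \<Phi>(1)[OF rx] addhom_comp[OF TT_smult(1)[OF r] \<Phi>(1)[OF x]] _ t])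
   fix x' y assume "x' : carrier P" "y : carrier N"
   then show "\<Phi> (an m r \<odot>\<^bsub>L\<^esub> x) (pt2 x' y) = \<Phi> x (r \<odot>\<^bsub>TT\<^esub> pt2 x' y)"
    using r x rx move[of r "\<one>\<^bsub>Al p\<^esub>" x x' y] by (simp add: \<Phi>(2) TT_smult W.\<psi>(4) PD ND xm_closed)
  qed
  then show "\<Phi> (r \<odot>\<^bsub>restrict_scalars (an m) L\<^esub> x) t = \<Phi> x (r \<odot>\<^bsub>TT\<^esub> t)" by simp
 qed (use \<Phi>(1) in \<open>simp_all add: addhom_def\<close>)
 then obtain H where "addhom rhs lhs H"
  "!!x t. [|x : carrier (restrict_scalars (an m) L); t : carrier TT|] ==> H (pr x t) = \<Phi> x t"
  by (rule Z.tensor_lift[OF lhs_abelian]) blast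
 then show thesis using that[of H] by (simp add: \<Phi>(2) pt2_closed)
qed

lemma lhs_hom_eqI:
 assumes "abelian_group H" "addhom lhs H f" "addhom lhs H g"
  "!!z x x' y. [|z : carrier (Al (m + p)); x : carrier L; x' : carrier P; y : carrier N|] ==>
   f (pl (D.pind z (O.po x x')) y) = g (pl (D.pind z (O.po x x')) y)" "U : carrier lhs"
 shows "f U = g U"
proof (rule V.tensor_hom_eqI[OF assms(1-3) _ assms(5)])
 fix u y assume "u : carrier (restrict_scalars (an (m + p)) D.Ind)" and y: "y : carrier N"
 then have u: "u : carrier D.Ind" by simp
 show "f (pl u y) = g (pl u y)"
 proof (rule D.Ind_hom_eqI[OF assms(1) addhom_comp[OF pl_addhom(2)[OF y] assms(2)]
    addhom_comp[OF pl_addhom(2)[OF y] assms(3)] _ u])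
  fix z v assume z: "z : carrier (Al (m + p))" and v: "v : carrier O.MN"
  have pia: "addhom O.MN D.Ind (%U. D.pind z U)"
   using D.I.pt_addhom_right[of z D.ind_act] z by simp
  show "f (pl (D.pind z v) y) = g (pl (D.pind z v) y)"
   by (rule O.MN_hom_eqI[OF assms(1) addhom_comp[OF addhom_comp[OF pia pl_addhom(2)[OF y]] assms(2)]
      addhom_comp[OF addhom_comp[OF pia pl_addhom(2)[OF y]] assms(3)] _ v])
    (use assms(4) z y in simp)
 qed
qed

lemma rhs_hom_eqI:
 assumes "abelian_group H" "addhom rhs H f" "addhom rhs H g"
  "!!x x' y. [|x : carrier L; x' : carrier P; y : carrier N|] ==>
   f (pr x (pt2 x' y)) = g (pr x (pt2 x' y))" "U : carrier rhs"
 shows "f U = g U"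
proof (rule Z.tensor_hom_eqI[OF assms(1-3) _ assms(5)])
 fix x t assume "x : carrier (restrict_scalars (an m) L)" and t: "t : carrier TT"
 then have x: "x : carrier L" by simp
 show "f (pr x t) = g (pr x t)"
  by (rule TT_hom_eqI[OF assms(1) addhom_comp[OF pr_addhom(1)[OF x] assms(2)]
     addhom_comp[OF pr_addhom(1)[OF x] assms(3)] _ t]) (use assms(4) x in simp)
qed

text \<open>The two maps are inverse to each other, and one of them is linear over K and homogeneous
  of degree 0. The dual bases ensure that both sides are finite-dimensional graded spaces, so that
  graded dimensions are read degree by degree.\<close>

theorem adjunction_gdim:
 assumes dP: "dual_basis (Al p) P I e f" and dL: "dual_basis (Al m) L J e' f'"
  and N': "fmod K (Al (m + p)) N"
 shows "gdim K lhs = gdim K rhs"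
proof -
 obtain F where F: "addhom lhs rhs F"
  "!!z x x' y. [|z : carrier (Al (m + p)); x : carrier L; x' : carrier P; y : carrier N|] ==>
   F (pl (D.pind z (O.po x x')) y) = pr x (pt2 x' (\<psi>' (m + p) z \<odot>\<^bsub>N\<^esub> y))"
  "!!i. F ` gr lhs i <= gr rhs i"
  by (rule forward) blast
 obtain H where H: "addhom rhs lhs H"
  "!!x x' y. [|x : carrier L; x' : carrier P; y : carrier N|] ==>
   H (pr x (pt2 x' y)) = pl (D.pind \<one>\<^bsub>Al (m + p)\<^esub> (O.po x x')) y"
  by (rule backward) blast
 have HF: "H (F U) = U" if U: "U : carrier lhs" for U
 proof (rule lhs_hom_eqI[OF lhs_abelian addhom_comp[OF F(1) H(1)] addhom_id _ U])
  fix z x x' y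
  assume A: "z : carrier (Al (m + p))" "x : carrier L" "x' : carrier P" "y : carrier N"
  have u: "D.pind \<one>\<^bsub>Al (m + p)\<^esub> (O.po x x') : carrier D.Ind" using A by (simp add: D.pind_closed O.po_closed)
  \<comment> \<open>Here z \<otimes> v = z (1 \<otimes> v), and z is \<psi> of its preimage, which
    can be moved across the tensor sign to y.\<close>
  have "pl (D.pind \<one>\<^bsub>Al (m + p)\<^esub> (O.po x x')) (\<psi>' (m + p) z \<odot>\<^bsub>N\<^esub> y) =
    pl (an (m + p) (\<psi>' (m + p) z) \<odot>\<^bsub>D.Ind\<^esub> D.pind \<one>\<^bsub>Al (m + p)\<^esub> (O.po x x')) y"
   using pl_tw[OF W.\<psi>i(1)[OF A(1)] u A(4)] by simp
  then show "H (F (pl (D.pind z (O.po x x')) y)) = pl (D.pind z (O.po x x')) y"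
   using A by (simp add: F(2) H(2) ND W.\<psi>i D.Ind_smult O.po_closed)
 qed
 have FH: "F (H U) = U" if U: "U : carrier rhs" for U
  by (rule rhs_hom_eqI[OF rhs_abelian addhom_comp[OF H(1) F(1)] addhom_id _ U])
   (simp add: F(2) H(2) W.\<psi>i_one ND)
 have bij: "bij_betw F (carrier lhs) (carrier rhs)"
  by (rule bij_betw_byWitness[where f' = H])
   (use HF FH addhom_closed[OF F(1)] addhom_closed[OF H(1)] in auto)
 have "F : module_hom K lhs rhs"
 proof (rule module_homI[OF F(1)])
  fix c U assume c: "c : carrier K" and U: "U : carrier lhs"
  note l = W.PM_smult[OF D.Ind_gr_left_module N c] and r = W.PM_smult[OF L TT_gr_left_module c]
  show "F (c \<odot>\<^bsub>lhs\<^esub> U) = c \<odot>\<^bsub>rhs\<^esub> F U"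
  proof (rule lhs_hom_eqI[OF rhs_abelian addhom_comp[OF l(1) F(1)] addhom_comp[OF F(1) r(1)] _ U])
   fix z x x' y
   assume A: "z : carrier (Al (m + p))" "x : carrier L" "x' : carrier P" "y : carrier N"
   let ?s = "G.sc (m + p) c" and ?z = "\<psi>' (m + p) z"
   have s: "?s : carrier (Al (m + p))" and z: "?z : carrier (Al (m + p))"
    using c A by (simp_all add: G.sc_closed W.\<psi>i)
   \<comment> \<open>Scalars act on y behind the factor that F puts in front of it; being central
     they can be moved past this factor.\<close>
   have "?z \<odot>\<^bsub>N\<^esub> (?s \<odot>\<^bsub>N\<^esub> y) = (?z \<otimes>\<^bsub>Al (m + p)\<^esub> ?s) \<odot>\<^bsub>N\<^esub> y" using ND(6)[OF z s A(4)] by simp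
   also have "\<dots> = (?s \<otimes>\<^bsub>Al (m + p)\<^esub> ?z) \<odot>\<^bsub>N\<^esub> y" using G.sc_mult[OF c z] by simp
   also have "\<dots> = ?s \<odot>\<^bsub>N\<^esub> (?z \<odot>\<^bsub>N\<^esub> y)" using ND(6)[OF s z A(4)] .
   finally have comm: "?z \<odot>\<^bsub>N\<^esub> (?s \<odot>\<^bsub>N\<^esub> y) = ?s \<odot>\<^bsub>N\<^esub> (?z \<odot>\<^bsub>N\<^esub> y)" .
   show "F (c \<odot>\<^bsub>lhs\<^esub> pl (D.pind z (O.po x x')) y) = c \<odot>\<^bsub>rhs\<^esub> F (pl (D.pind z (O.po x x')) y)"
    using A c s z comm
    by (simp add: l r F(2) D.pind_closed O.po_closed ND pt2_closed TT_kspace_smult)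
  qed
 qed
 moreover obtain F1 where "dual_basis (TA m p) O.MN (J \<times> I) (%z. O.po (e' (fst z)) (e (snd z))) F1"
  by (rule O.MN_dual_basis[OF dL dP]) blast
 then obtain F2 where d: "dual_basis (Al (m + p)) D.Ind (J \<times> I)
   (%i. D.pind \<one>\<^bsub>Al (m + p)\<^esub> (O.po (e' (fst i)) (e (snd i)))) F2"
  by (rule D.Ind_dual_basis) blast
 have "gr_space K lhs" by (rule W.PM_gr_space[OF D.Ind_gr_left_module N' d])
 moreover have "gr_space K rhs" by (rule W.PM_gr_space[OF L TT_fmod[OF dP N'] dL])
 ultimately show ?thesis using bij F(3) by (intro gdim_iso[of K lhs rhs F]) auto
qed

end

section \<open>Copies and quotients of graded modules\<close>

text \<open>Transport of structure along \<phi> by means of a section. If the fibres of \<phi> are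
  the cosets of a graded submodule this is the quotient module; if \<phi> is injective it is a copy
  of M on another type. Both uses occur.\<close>

definition img_mod :: "('m => 'n) => ('a, 'm) gr_module => ('a, 'n) gr_module" where
 "img_mod \<phi> M = (let s = inv_into (carrier M) \<phi> in
   \<lparr>carrier = \<phi> ` carrier M, monoid.mult = (%u v. undefined), monoid.one = undefined, ring.zero = \<phi> \<zero>\<^bsub>M\<^esub>,
   ring.add = (%u v. \<phi> (s u \<oplus>\<^bsub>M\<^esub> s v)), smult = (%a u. \<phi> (a \<odot>\<^bsub>M\<^esub> s u)), gr = (%i. \<phi> ` gr M i)\<rparr>)"

lemma gr_hom_iff:
 "f : gr_hom A M N \<longleftrightarrow> f : module_hom A M N \<and> (\<forall>i. f ` gr M i <= gr N i)"
 by (simp add: gr_hom_def)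

lemma gr_submodule_zero:
 assumes "gr_left_module A M"
 shows "gr_submodule A M {\<zero>\<^bsub>M\<^esub>}"
proof -
 interpret M: graded M by (rule gr_graded[OF assms])
 have "additive_subgroup {\<zero>\<^bsub>M\<^esub>} M" by (rule additive_subgroupI'[OF M.ab]) auto
 then show ?thesis
  using left_module_zero(1)[OF gr_modD(1)[OF assms]] addhom_zero[OF M.ab M.ab M.hcomp_addhom]
  by (simp add: gr_submodule_def)
qed

locale quotient_map =
 fixes A :: "('k, 'a) gr_algebra" and M :: "('a, 'm) gr_module" and H :: "'m set" and \<phi> :: "'m => 'n"
 assumes M: "gr_left_module A M" and H: "gr_submodule A M H"
  and \<phi>: "!!x y. [|x : carrier M; y : carrier M|] ==> \<phi> x = \<phi> y \<longleftrightarrow> x \<ominus>\<^bsub>M\<^esub> y : H"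
begin

abbreviation "Q \<equiv> img_mod \<phi> M"

interpretation M: graded M by (rule gr_graded[OF M])

lemmas MD = left_moduleD[OF gr_modD(1)[OF M]]

lemma H_sub: "additive_subgroup H M" using H by (simp add: gr_submodule_def)
lemmas HD = additive_subgroupD[OF H_sub]

lemma H_smult: "[|a : carrier A; x : H|] ==> a \<odot>\<^bsub>M\<^esub> x : H" and H_hcomp: "x : H ==> hcomp M i x : H"
 using H by (simp_all add: gr_submodule_def)

abbreviation "s \<equiv> inv_into (carrier M) \<phi>"

lemma Q_sel:
 "carrier Q = \<phi> ` carrier M" "\<zero>\<^bsub>Q\<^esub> = \<phi> \<zero>\<^bsub>M\<^esub>" "gr Q i = \<phi> ` gr M i"
 by (simp_all add: img_mod_def Let_def)

lemma s: "x : carrier M ==> s (\<phi> x) : carrier M" "x : carrier M ==> s (\<phi> x) \<ominus>\<^bsub>M\<^esub> x : H"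
proof -
 assume x: "x : carrier M"
 show "s (\<phi> x) : carrier M" using x by (intro inv_into_into) auto
 moreover have "\<phi> (s (\<phi> x)) = \<phi> x" using x by (intro f_inv_into_f) auto
 ultimately show "s (\<phi> x) \<ominus>\<^bsub>M\<^esub> x : H" using \<phi> x by blast
qed

lemma Q_add:
 assumes "x : carrier M" "y : carrier M"
 shows "\<phi> x \<oplus>\<^bsub>Q\<^esub> \<phi> y = \<phi> (x \<oplus>\<^bsub>M\<^esub> y)"
proof -
 note sx = s[OF assms(1)] and sy = s[OF assms(2)]
 have "(s (\<phi> x) \<oplus>\<^bsub>M\<^esub> s (\<phi> y)) \<ominus>\<^bsub>M\<^esub> (x \<oplus>\<^bsub>M\<^esub> y) = (s (\<phi> x) \<ominus>\<^bsub>M\<^esub> x) \<oplus>\<^bsub>M\<^esub> (s (\<phi> y) \<ominus>\<^bsub>M\<^esub> y)"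
  using assms sx(1) sy(1) by (simp add: a_minus_def M.minus_add M.a_ac)
 then have "(s (\<phi> x) \<oplus>\<^bsub>M\<^esub> s (\<phi> y)) \<ominus>\<^bsub>M\<^esub> (x \<oplus>\<^bsub>M\<^esub> y) : H" using HD(3)[OF sx(2) sy(2)] by simp
 then have "\<phi> (s (\<phi> x) \<oplus>\<^bsub>M\<^esub> s (\<phi> y)) = \<phi> (x \<oplus>\<^bsub>M\<^esub> y)" using assms sx(1) sy(1) \<phi> by simp
 then show ?thesis by (simp add: img_mod_def Let_def)
qed

lemma Q_smult:
 assumes "a : carrier A" "x : carrier M"
 shows "a \<odot>\<^bsub>Q\<^esub> \<phi> x = \<phi> (a \<odot>\<^bsub>M\<^esub> x)"
proof -
 note sx = s[OF assms(2)]
 have "(a \<odot>\<^bsub>M\<^esub> s (\<phi> x)) \<ominus>\<^bsub>M\<^esub> (a \<odot>\<^bsub>M\<^esub> x) = a \<odot>\<^bsub>M\<^esub> (s (\<phi> x) \<ominus>\<^bsub>M\<^esub> x)"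
  using addhom_diff[OF MD(2) MD(2) left_module_addhom(1)[OF gr_modD(1)[OF M] assms(1)] sx(1) assms(2)] by simp
 then have "\<phi> (a \<odot>\<^bsub>M\<^esub> s (\<phi> x)) = \<phi> (a \<odot>\<^bsub>M\<^esub> x)"
  using assms sx(1) \<phi> MD(3) H_smult[OF assms(1) sx(2)] by simp
 then show ?thesis by (simp add: img_mod_def Let_def)
qed

lemma Q_abelian: "abelian_group Q"
proof (rule abelian_groupI)
 fix u assume "u : carrier Q"
 then obtain x where x: "x : carrier M" "u = \<phi> x" by (auto simp: Q_sel)
 then show "\<exists>v\<in>carrier Q. v \<oplus>\<^bsub>Q\<^esub> u = \<zero>\<^bsub>Q\<^esub>"
  by (intro bexI[of _ "\<phi> (\<ominus>\<^bsub>M\<^esub> x)"]) (auto simp: Q_sel Q_add M.l_neg)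
qed (auto simp: Q_sel Q_add M.a_ac)

lemma \<phi>_hom: "addhom M Q \<phi>"
 by (rule addhomI) (auto simp: Q_sel Q_add)

lemma Q_left_module: "left_module A Q"
 unfolding left_module_def
proof (intro conjI ballI)
 show "ring A" by (rule MD)
 fix a b u assume a: "a : carrier A" and b: "b : carrier A" and "u : carrier Q"
 then obtain x where x: "x : carrier M" "u = \<phi> x" by (auto simp: Q_sel)
 interpret A: ring A by (rule MD)
 show "(a \<oplus>\<^bsub>A\<^esub> b) \<odot>\<^bsub>Q\<^esub> u = (a \<odot>\<^bsub>Q\<^esub> u) \<oplus>\<^bsub>Q\<^esub> (b \<odot>\<^bsub>Q\<^esub> u)" "(a \<otimes>\<^bsub>A\<^esub> b) \<odot>\<^bsub>Q\<^esub> u = a \<odot>\<^bsub>Q\<^esub> (b \<odot>\<^bsub>Q\<^esub> u)"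
  using a b x by (simp_all add: Q_smult Q_add MD)
next
 interpret A: ring A by (rule MD)
 show "!!x. x : carrier Q ==> \<one>\<^bsub>A\<^esub> \<odot>\<^bsub>Q\<^esub> x = x" by (auto simp: Q_sel Q_smult MD)
qed (auto simp: Q_abelian Q_sel Q_smult Q_add MD)

lemma \<phi>_module_hom: "\<phi> : module_hom A M Q"
 by (rule module_homI[OF \<phi>_hom]) (simp add: Q_smult)

lemma Q_graded: "graded_group Q"
proof (rule graded_groupI[OF Q_abelian])
 \<comment> \<open>Components are taken on a representative; they do not depend on it because H
   contains the components of its elements.\<close>
 let ?\<pi> = "%i u. \<phi> (hcomp M i (s u))"
 have p: "?\<pi> i (\<phi> x) = \<phi> (hcomp M i x)" if x: "x : carrier M" for i x
 proof -
  note sx = s[OF x]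
  have "hcomp M i (s (\<phi> x)) \<ominus>\<^bsub>M\<^esub> hcomp M i x = hcomp M i (s (\<phi> x) \<ominus>\<^bsub>M\<^esub> x)"
   using addhom_diff[OF M.ab M.ab M.hcomp_addhom sx(1) x] by simp
  then show ?thesis using \<phi> M.hcomp_closed sx x H_hcomp by simp
 qed
 show "additive_subgroup (gr Q i) Q" for i
 proof (rule additive_subgroupI'[OF Q_abelian])
  show "gr Q i <= carrier Q" using M.gr_closed(1) by (auto simp: Q_sel)
  show "\<zero>\<^bsub>Q\<^esub> : gr Q i" using M.gr_closed(2) by (auto simp: Q_sel)
  fix u v assume "u : gr Q i" "v : gr Q i"
  then show "u \<oplus>\<^bsub>Q\<^esub> v : gr Q i" using M.gr_closed(1,3) by (auto simp: Q_sel Q_add)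
 next
  fix u assume "u : gr Q i"
  then obtain x where x: "x : gr M i" "u = \<phi> x" by (auto simp: Q_sel)
  then have "\<ominus>\<^bsub>Q\<^esub> u = \<phi> (\<ominus>\<^bsub>M\<^esub> x)"
   using addhom_minus[OF M.ab Q_abelian \<phi>_hom M.gr_closed(1)[OF x(1)]] by simp
  then show "\<ominus>\<^bsub>Q\<^esub> u : gr Q i" using M.gr_closed(4)[OF x(1)] by (simp add: Q_sel)
 qed
 show "addhom Q Q (?\<pi> i)" for i
 proof (rule addhomI)
  fix u v assume "u : carrier Q" "v : carrier Q"
  then obtain x y where x: "x : carrier M" "u = \<phi> x" and y: "y : carrier M" "v = \<phi> y" by (auto simp: Q_sel)
  show "?\<pi> i u : carrier Q" unfolding x(2) p[OF x(1)] using M.hcomp_closed x by (simp add: Q_sel)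
  show "?\<pi> i (u \<oplus>\<^bsub>Q\<^esub> v) = ?\<pi> i u \<oplus>\<^bsub>Q\<^esub> ?\<pi> i v"
   using x y M.hcomp_closed addhom_add[OF M.hcomp_addhom, of x y] by (simp add: p Q_add)
 qed
 show "?\<pi> i u = u" if u: "u : gr Q i" for i u
 proof -
  obtain x where x: "x : gr M i" "u = \<phi> x" using u by (auto simp: Q_sel)
  show ?thesis unfolding x(2) p[OF M.gr_closed(1)[OF x(1)]] using M.hcomp_homog[OF x(1), of i] by simp
 qed
 show "?\<pi> i u = \<zero>\<^bsub>Q\<^esub>" if u: "u : gr Q j" and ji: "j ~= i" for i j u
 proof -
  obtain x where x: "x : gr M j" "u = \<phi> x" using u by (auto simp: Q_sel)
  show ?thesis unfolding x(2) p[OF M.gr_closed(1)[OF x(1)]]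
   using M.hcomp_homog[OF x(1), of i] ji by (simp add: Q_sel)
 qed
 fix J assume J: "additive_subgroup J Q" "!!i. gr Q i <= J"
 note JD = additive_subgroupD[OF J(1)]
 show "carrier Q <= J"
 proof
  fix u assume "u : carrier Q"
  then obtain x where x: "x : carrier M" "u = \<phi> x" by (auto simp: Q_sel)
  from x(1) have "\<phi> x : J"
  proof (induction rule: M.graded_induct)
   case zero
   then show ?case using JD(2) by (simp add: Q_sel)
  next
   case (add x y)
   then show ?case using JD(3) by (simp add: Q_add[symmetric])
  next
   case (homog i x)
   then show ?case using J(2)[of i] by (auto simp: Q_sel)
  qed
  then show "u : J" using x by simp
 qed
qed

lemma Q_gr_left_module:
 assumes "!!i. gr A i <= carrier A"
 shows "gr_left_module A Q"
proof -
 have "a \<odot>\<^bsub>Q\<^esub> u : gr Q (i + j)" if a: "a : gr A i" and u: "u : gr Q j" for a u i j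
 proof -
  obtain x where x: "x : gr M j" "u = \<phi> x" using u by (auto simp: Q_sel)
  have "a : carrier A" using assms a by blast
  then show ?thesis
   using x gr_modD(3)[OF M a x(1)] M.gr_closed(1)[OF x(1)] by (simp add: Q_sel Q_smult)
 qed
 then show ?thesis using Q_left_module Q_graded unfolding gr_left_module_def by blast
qed

lemma \<phi>_gr_hom: "\<phi> : gr_hom A M Q"
 by (simp add: gr_hom_iff \<phi>_module_hom Q_sel)

lemma \<phi>_zero_iff: "x : carrier M ==> \<phi> x = \<zero>\<^bsub>Q\<^esub> \<longleftrightarrow> x : H"
 using \<phi>[of x "\<zero>\<^bsub>M\<^esub>"] M.add.inv_one by (simp add: Q_sel a_minus_def a_inv_def)

end

section \<open>Graded isomorphisms and transport of exact sequences\<close>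

lemma gr_hom_comp: "[|f : gr_hom A L M; g : gr_hom A M N|] ==> (%x. g (f x)) : gr_hom A L N"
proof -
 assume f: "f : gr_hom A L M" and g: "g : gr_hom A M N"
 then have fm: "f : module_hom A L M" and gm: "g : module_hom A M N"
  and fi: "!!i. f ` gr L i <= gr M i" and gi: "!!i. g ` gr M i <= gr N i" by (simp_all add: gr_hom_iff)
 have "(%x. g (f x)) : module_hom A L N"
  by (rule module_homI[OF addhom_comp[OF module_hom_addhom[OF fm] module_hom_addhom[OF gm]]])
   (simp add: module_hom_smult[OF fm] module_hom_smult[OF gm] addhom_closed[OF module_hom_addhom[OF fm]])
 moreover have "(%x. g (f x)) ` gr L i <= gr N i" for i using fi[of i] gi[of i] by blast
 ultimately show ?thesis by (simp add: gr_hom_iff)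
qed

lemma gr_hom_inv:
 assumes M: "gr_left_module A M" and N: "gr_left_module A N"
  and f: "f : gr_hom A M N" and bij: "bij_betw f (carrier M) (carrier N)"
 shows "the_inv_into (carrier M) f : gr_hom A N M"
proof -
 interpret M: graded M by (rule gr_graded[OF M])
 interpret N: graded N by (rule gr_graded[OF N])
 let ?g = "the_inv_into (carrier M) f"
 have inj: "inj_on f (carrier M)" and surj: "f ` carrier M = carrier N" using bij by (auto simp: bij_betw_def)
 have fm: "f : module_hom A M N" and fg: "!!i. f ` gr M i <= gr N i" using f by (auto simp: gr_hom_iff)
 have "?g z : gr M i" if z: "z : gr N i" for z i
 proof -
  have zc: "z : carrier N" using z by (rule N.gr_closed)
  then have "z : f ` carrier M" using surj by simp
  then obtain y where y: "y : carrier M" "z = f y" by auto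
  have "f (hcomp M i y) = hcomp N i (f y)"
   by (rule graded_hom_hcomp[OF gr_modD(2)[OF M] gr_modD(2)[OF N] module_hom_addhom[OF fm] fg y(1)])
  then have "f (hcomp M i y) = f y" using y z N.hcomp_homog[OF z, of i] by simp
  then have "hcomp M i y = y" using inj y M.hcomp_closed[OF y(1)] by (auto dest: inj_onD)
  then show ?thesis using M.hcomp_gr[OF y(1), of i] y the_inv_into_f_f[OF inj y(1)] by simp
 qed
 then show ?thesis
  using module_hom_inv[OF gr_modD(1)[OF M] fm inj surj] by (auto simp: gr_hom_iff)
qed

lemma gr_iso_sym:
 assumes "gr_left_module A M" "gr_left_module A N" "gr_iso A M N"
 shows "gr_iso A N M"
proof -
 obtain f where f: "f : gr_hom A M N" "bij_betw f (carrier M) (carrier N)"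
  using assms(3) by (auto simp: gr_iso_def)
 from gr_hom_inv[OF assms(1,2) f] bij_betw_the_inv_into[OF f(2)] show ?thesis
  by (auto simp: gr_iso_def)
qed

lemma gr_iso_trans: "[|gr_iso A L M; gr_iso A M N|] ==> gr_iso A L N"
proof -
 assume "gr_iso A L M" "gr_iso A M N"
 then obtain f g where f: "f : gr_hom A L M" "bij_betw f (carrier L) (carrier M)"
  and g: "g : gr_hom A M N" "bij_betw g (carrier M) (carrier N)" by (auto simp: gr_iso_def)
 from gr_hom_comp[OF f(1) g(1)] bij_betw_trans[OF f(2) g(2)] show ?thesis
  by (auto simp: gr_iso_def o_def)
qed

lemma short_exact_exact_pair:
 "short_exact A L M N \<longleftrightarrow> (\<exists>f \<in> gr_hom A L M. \<exists>g \<in> gr_hom A M N. exact_pair L M N f g)"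
proof -
 have "exact_pair L M N f g \<longleftrightarrow> inj_on f (carrier L) \<and>
   f ` carrier L = {x \<in> carrier M. g x = \<zero>\<^bsub>N\<^esub>} \<and> g ` carrier M = carrier N"
  if "f : gr_hom A L M" "g : gr_hom A M N" for f g
  using that module_hom_addhom[of f A L M] module_hom_addhom[of g A M N]
  by (simp add: exact_pair_def gr_hom_iff)
 then show ?thesis unfolding short_exact_def by (intro bex_cong refl) simp
qed

lemma short_exact_iso:
 assumes L: "gr_left_module A L" "gr_left_module A L'" "gr_iso A L' L"
  and M: "gr_left_module A M" "gr_left_module A M'" "gr_iso A M' M"
  and N: "gr_left_module A N" "gr_left_module A N'" "gr_iso A N' N"
  and ex: "short_exact A L M N"
 shows "short_exact A L' M' N'"
proof -
 obtain f g where f: "f : gr_hom A L M" and g: "g : gr_hom A M N" and inj: "inj_on f (carrier L)"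
  and im: "f ` carrier L = {x \<in> carrier M. g x = \<zero>\<^bsub>N\<^esub>}" and surj: "g ` carrier M = carrier N"
  using ex by (auto simp: short_exact_def)
 obtain l where l: "l : gr_hom A L' L" "bij_betw l (carrier L') (carrier L)" using L(3) by (auto simp: gr_iso_def)
 obtain m where m: "m : gr_hom A M M'" "bij_betw m (carrier M) (carrier M')"
  using gr_iso_sym[OF M(2,1,3)] by (auto simp: gr_iso_def)
 let ?m = "the_inv_into (carrier M) m"
 have mi: "?m : gr_hom A M' M" by (rule gr_hom_inv[OF M(1,2) m])
 obtain n where n: "n : gr_hom A N N'" "bij_betw n (carrier N) (carrier N')"
  using gr_iso_sym[OF N(2,1,3)] by (auto simp: gr_iso_def)
 have minj: "inj_on m (carrier M)" and msurj: "m ` carrier M = carrier M'" using m by (auto simp: bij_betw_def)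
 have mm: "?m (m x) = x" if "x : carrier M" for x by (rule the_inv_into_f_f[OF minj that])
 have lsurj: "l ` carrier L' = carrier L" and linj: "inj_on l (carrier L')" using l by (auto simp: bij_betw_def)
 have ninj: "inj_on n (carrier N)" and nsurj: "n ` carrier N = carrier N'" using n by (auto simp: bij_betw_def)
 have nz: "n \<zero>\<^bsub>N\<^esub> = \<zero>\<^bsub>N'\<^esub>"
  by (rule addhom_zero[OF left_moduleD(2)[OF gr_modD(1)[OF N(1)]] left_moduleD(2)[OF gr_modD(1)[OF N(2)]]])
   (use n(1) module_hom_addhom[of n A N N'] in \<open>simp add: gr_hom_iff\<close>)
 have zN: "\<zero>\<^bsub>N\<^esub> : carrier N"
  using left_moduleD(2)[OF gr_modD(1)[OF N(1)]] by (simp add: abelian_group_def abelian_monoid.zero_closed)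
 let ?F = "%x. m (f (l x))" and ?G = "%y. n (g (?m y))"
 have fc: "f x : carrier M" if "x : carrier L" for x using f that by (auto simp: gr_hom_iff module_hom_def)
 have gc: "g x : carrier N" if "x : carrier M" for x using g that by (auto simp: gr_hom_iff module_hom_def)
 have F: "?F : gr_hom A L' M'" by (rule gr_hom_comp[OF gr_hom_comp[OF l(1) f] m(1)])
 have G: "?G : gr_hom A M' N'" by (rule gr_hom_comp[OF gr_hom_comp[OF mi g] n(1)])
 have "?F ` carrier L' = m ` f ` carrier L" by (simp add: lsurj[symmetric] image_image)
 also have "\<dots> = {y \<in> carrier M'. ?G y = \<zero>\<^bsub>N'\<^esub>}"
 proof (intro subset_antisym subsetI)
  fix y assume "y : m ` f ` carrier L"
  then obtain x where "x : carrier M" "g x = \<zero>\<^bsub>N\<^esub>" "y = m x" unfolding im by auto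
  then show "y : {y \<in> carrier M'. ?G y = \<zero>\<^bsub>N'\<^esub>}" using mm nz msurj by auto
 next
  fix y assume y: "y : {y \<in> carrier M'. ?G y = \<zero>\<^bsub>N'\<^esub>}"
  then obtain x where x: "x : carrier M" "y = m x" using msurj by blast
  then have "n (g x) = n \<zero>\<^bsub>N\<^esub>" using y mm nz by simp
  then have "g x = \<zero>\<^bsub>N\<^esub>" using ninj gc[OF x(1)] zN by (auto dest: inj_onD)
  then show "y : m ` f ` carrier L" unfolding im using x by auto
 qed
 finally have im': "?F ` carrier L' = {y \<in> carrier M'. ?G y = \<zero>\<^bsub>N'\<^esub>}" .
 have "inj_on ?F (carrier L')"
 proof (rule inj_onI)
  fix x y assume xy: "x : carrier L'" "y : carrier L'" "?F x = ?F y"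
  then have "l x : carrier L" "l y : carrier L" using lsurj by auto
  then have "l x = l y" using xy(3) inj_onD[OF minj] inj_onD[OF inj] fc by blast
  then show "x = y" using linj xy by (auto dest: inj_onD)
 qed
 moreover have "?G ` carrier M' = carrier N'"
 proof -
  have "?m ` carrier M' = carrier M"
   using bij_betw_the_inv_into[OF m(2)] by (simp add: bij_betw_def)
  then have "n ` g ` ?m ` carrier M' = carrier N'" by (simp add: surj nsurj)
  then show ?thesis by (simp add: image_image)
 qed
 ultimately show ?thesis unfolding short_exact_def by (intro bexI[OF _ F] bexI[OF _ G] conjI im')
qed

section \<open>Representatives carried by lists\<close>

context galgebra begin

text \<open>Along a fixed enumeration of the generators, each element is determined by a list of
  chosen coefficients. This injection of M into the lists over A transports the module
  structure.\<close>

lemma copy_exists: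
 assumes M: "gr_left_module A M" and fg: "fin_gen A M"
 shows "\<exists>M' :: ('a, 'a list) gr_module. gr_left_module A M' \<and> gr_iso A M' M"
proof -
 interpret M: graded M by (rule gr_graded[OF M])
 obtain S where S: "finite S" "S <= carrier M"
  and gen: "!!x. x : carrier M ==> \<exists>c \<in> S \<rightarrow> carrier A. x = (\<Oplus>\<^bsub>M\<^esub> s \<in> S. c s \<odot>\<^bsub>M\<^esub> s)"
  using fg unfolding fin_gen_def by blast
 obtain xs where xs: "set xs = S" using finite_list[OF S(1)] by blast
 from gen have "\<forall>x\<in>carrier M. \<exists>c. c : S \<rightarrow> carrier A \<and> x = (\<Oplus>\<^bsub>M\<^esub> s \<in> S. c s \<odot>\<^bsub>M\<^esub> s)" by blast
 from bchoice[OF this] obtain c where c: "!!x. x : carrier M ==> c x : S \<rightarrow> carrier A"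
  "!!x. x : carrier M ==> x = (\<Oplus>\<^bsub>M\<^esub> s \<in> S. c x s \<odot>\<^bsub>M\<^esub> s)" by blast
 define \<phi> where "\<phi> x = map (c x) xs" for x
 have inj: "x = y" if "x : carrier M" "y : carrier M" "\<phi> x = \<phi> y" for x y
 proof -
  have "c x s = c y s" if "s : S" for s
   using \<open>\<phi> x = \<phi> y\<close> that xs by (auto simp: \<phi>_def)
  moreover have "c y s \<odot>\<^bsub>M\<^esub> s : carrier M" if "s : S" for s
   using left_moduleD(3)[OF gr_modD(1)[OF M] Pi_mem[OF c(1)[OF \<open>y : carrier M\<close>] that]] that S(2) by blast
  ultimately have "(\<Oplus>\<^bsub>M\<^esub> s \<in> S. c x s \<odot>\<^bsub>M\<^esub> s) = (\<Oplus>\<^bsub>M\<^esub> s \<in> S. c y s \<odot>\<^bsub>M\<^esub> s)"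
   by (intro M.finsum_cong') auto
  then show ?thesis using c(2)[OF that(1)] c(2)[OF that(2)] by simp
 qed
 have "quotient_map A M {\<zero>\<^bsub>M\<^esub>} \<phi>"
 proof
  fix x y assume xy: "x : carrier M" "y : carrier M"
  then show "\<phi> x = \<phi> y \<longleftrightarrow> x \<ominus>\<^bsub>M\<^esub> y : {\<zero>\<^bsub>M\<^esub>}"
   using inj[OF xy] by auto
 qed (use M gr_submodule_zero in auto)
 then interpret q: quotient_map A M "{\<zero>\<^bsub>M\<^esub>}" \<phi> .
 have Q: "gr_left_module A (img_mod \<phi> M)" by (rule q.Q_gr_left_module) (use GA.gr_closed in auto)
 have "bij_betw \<phi> (carrier M) (carrier (img_mod \<phi> M))"
  using inj by (auto simp: bij_betw_def q.Q_sel intro: inj_onI)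
 then have "gr_iso A M (img_mod \<phi> M)" using q.\<phi>_gr_hom by (auto simp: gr_iso_def)
 from gr_iso_sym[OF M Q this] Q show ?thesis by blast
qed

lemma copy:
 assumes "gr_left_module A M" "fin_gen A M"
 shows "gr_left_module A (copy A M)" "gr_iso A (copy A M) M"
 using someI_ex[OF copy_exists[OF assms]] by (simp_all add: copy_def)

text \<open>A spanning set over K generates over A, the scalars being viewed in A through
  \<open>sc\<close>.\<close>

lemma fmod_fin_gen:
 assumes "fmod K A M"
 shows "fin_gen A M"
proof -
 have M: "gr_left_module A M" and fd: "vfin K (kspace A M)" using assms by (auto simp: fmod_def)
 note MD = left_moduleD[OF gr_modD(1)[OF M]]
 interpret M: abelian_group M by (rule MD(2))
 interpret V: vectorspace K "kspace A M" by (rule kspace_vs[OF gr_modD(1)[OF M]])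
 obtain B where B: "finite B" "B <= carrier M" "V.gen_set B" using fd by (auto simp: V.fin_dim_def)
 show ?thesis unfolding fin_gen_def
 proof (intro exI[of _ B] conjI ballI)
  fix x assume "x : carrier M"
  then have "x : V.span B" using B(3) by simp
  then obtain a where a: "a : B \<rightarrow> carrier K" "V.lincomb a B = x"
   using V.finite_in_span[OF B(1), of x] B(2) by auto
  have "x = (\<Oplus>\<^bsub>M\<^esub> s \<in> B. sc (a s) \<odot>\<^bsub>M\<^esub> s)"
   using a(2)[unfolded V.lincomb_def, symmetric]
    finsum_cong_struct[of "kspace A M" M "%s. sc (a s) \<odot>\<^bsub>M\<^esub> s" B] by simp
  moreover have "(%s. sc (a s)) : B \<rightarrow> carrier A" using a(1) sc_closed by auto
  ultimately show "\<exists>c\<in>B \<rightarrow> carrier A. x = (\<Oplus>\<^bsub>M\<^esub> s \<in> B. c s \<odot>\<^bsub>M\<^esub> s)"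
   by (rule bexI[of _ "%s. sc (a s)"])
 qed (use B in auto)
qed

lemma dual_basis_iso:
 assumes M: "gr_left_module A M" and N: "gr_left_module A N" and iso: "gr_iso A N M"
  and d: "dual_basis A M I e f"
 obtains e' f' where "dual_basis A N I e' f'"
proof -
 note dD = dual_basisD[OF d]
 note ND = left_moduleD[OF gr_modD(1)[OF N]] and MD = left_moduleD[OF gr_modD(1)[OF M]]
 interpret N: abelian_group N by (rule ND(2))
 obtain g where g: "g : gr_hom A N M" "bij_betw g (carrier N) (carrier M)" using iso by (auto simp: gr_iso_def)
 let ?h = "the_inv_into (carrier N) g"
 have h: "?h : gr_hom A M N" by (rule gr_hom_inv[OF N M g])
 have gm: "g : module_hom A N M" and hm: "?h : module_hom A M N" using g h by (auto simp: gr_hom_iff)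
 have hg: "?h (g x) = x" if "x : carrier N" for x using g(2) that by (simp add: bij_betw_def the_inv_into_f_f)
 have gc: "g x : carrier M" if "x : carrier N" for x using addhom_closed[OF module_hom_addhom[OF gm] that] .
 have "dual_basis A N I (%i. ?h (e i)) (%i x. f i (g x))"
  unfolding dual_basis_def
 proof (intro conjI ballI)
  show "(%i. ?h (e i)) : I \<rightarrow> carrier N" using dD(2) addhom_closed[OF module_hom_addhom[OF hm]] by auto
  show "addhom N A (%x. f i (g x))" if "i : I" for i
   by (rule addhom_comp[OF module_hom_addhom[OF gm] dD(3)[OF that]])
  fix x assume x: "x : carrier N"
  have "x = ?h (\<Oplus>\<^bsub>M\<^esub>i\<in>I. f i (g x) \<odot>\<^bsub>M\<^esub> e i)" using dD(6)[OF gc[OF x]] hg[OF x] by simp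
  also have "\<dots> = (\<Oplus>\<^bsub>N\<^esub>i\<in>I. ?h (f i (g x) \<odot>\<^bsub>M\<^esub> e i))"
   using dD gc[OF x] MD by (intro addhom_finsum[OF MD(2) ND(2) module_hom_addhom[OF hm]]) auto
  also have "\<dots> = (\<Oplus>\<^bsub>N\<^esub>i\<in>I. f i (g x) \<odot>\<^bsub>N\<^esub> ?h (e i))"
   using dD gc[OF x] ND module_hom_smult[OF hm] addhom_closed[OF module_hom_addhom[OF hm]]
   by (intro N.finsum_cong') auto
  finally show "x = (\<Oplus>\<^bsub>N\<^esub>i\<in>I. f i (g x) \<odot>\<^bsub>N\<^esub> ?h (e i))" .
 qed (use dD gc module_hom_smult[OF gm] in auto)
 then show thesis by (rule that)
qed

lemma pmod_dual_basis:
 assumes "pmod A M"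
 obtains I :: "'m set" and e f where "dual_basis A (M :: ('a, 'm) gr_module) I e f"
 using assms projective_dual_basis[of A M] by (auto simp: pmod_def)

lemma dual_basis_pmod:
 assumes "gr_left_module A M" "dual_basis A M I e f"
 shows "pmod A M"
 using assms dual_basis_fin_gen[OF gr_modD(1)] dual_basis_projective[OF gr_modD(1)]
 by (auto simp: pmod_def)

lemma copy_pmod:
 assumes "pmod A M"
 shows "pmod A (copy A M)" "gr_iso A (copy A M) M"
proof -
 have M: "gr_left_module A M" "fin_gen A M" using assms by (auto simp: pmod_def)
 obtain I :: "'b set" and e f where d: "dual_basis A M I e f" using pmod_dual_basis[OF assms] by blast
 obtain e' f' where "dual_basis A (copy A M) I e' f'"
  by (rule dual_basis_iso[OF M(1) copy[OF M] d])
 then show "pmod A (copy A M)" by (rule dual_basis_pmod[OF copy(1)[OF M]])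
 show "gr_iso A (copy A M) M" by (rule copy(2)[OF M])
qed

lemma fmod_iso:
 assumes M: "fmod K A M" and N: "gr_left_module A N" and iso: "gr_iso A M N"
 shows "fmod K A N"
proof -
 have gM: "gr_left_module A M" and fd: "vfin K (kspace A M)" using M by (auto simp: fmod_def)
 obtain f where f: "f : gr_hom A M N" "bij_betw f (carrier M) (carrier N)" using iso by (auto simp: gr_iso_def)
 have fk: "f : module_hom K (kspace A M) (kspace A N)"
  by (rule module_hom_kspace) (use f in \<open>simp add: gr_hom_iff\<close>)
 have "vfin K (kspace A N)"
  by (rule vdim_bij(1)[OF kspace_vs kspace_vs fk fd])
   (use gM N f(2) in \<open>auto simp: gr_left_module_def bij_betw_def\<close>)
 then show ?thesis using N by (simp add: fmod_def)
qed

lemma copy_fmod: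
 assumes "fmod K A M"
 shows "fmod K A (copy A M)" "gr_iso A (copy A M) M"
proof -
 have M: "gr_left_module A M" "fin_gen A M" using assms fmod_fin_gen by (auto simp: fmod_def)
 show "gr_iso A (copy A M) M" by (rule copy(2)[OF M])
 show "fmod K A (copy A M)" by (rule fmod_iso[OF assms copy(1)[OF M] gr_iso_sym[OF copy(1)[OF M] M(1) copy(2)[OF M]]])
qed

end

section \<open>Functoriality of the pairing, of induction and of TR\<close>

lemma module_hom_id: "(%x. x) : module_hom A M M"
 by (simp add: module_hom_def)

lemma id_image_subset: "(%x. x) ` X <= X" by simp

lemma gr_iso_refl: "gr_iso A M M"
 using module_hom_id[of A M] by (auto simp: gr_iso_def gr_hom_iff bij_betw_def intro!: bexI[of _ "%x. x"])

lemma split_pairI: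
 assumes "abelian_group L" "abelian_group M" "abelian_group N"
  and "addhom L M f" "addhom M N g" "addhom N M \<sigma>" "addhom M L \<rho>"
  and "!!x. x : carrier L ==> \<rho> (f x) = x" "!!x. x : carrier L ==> g (f x) = \<zero>\<^bsub>N\<^esub>"
  "!!z. z : carrier N ==> g (\<sigma> z) = z" "!!y. y : carrier M ==> f (\<rho> y) \<oplus>\<^bsub>M\<^esub> \<sigma> (g y) = y"
 shows "split_pair L M N f g \<sigma> \<rho>"
 using assms by (simp add: split_pair_def)

lemma split_pairD:
 assumes "split_pair L M N f g \<sigma> \<rho>"
 shows "!!x. x : carrier L ==> \<rho> (f x) = x" "!!x. x : carrier L ==> g (f x) = \<zero>\<^bsub>N\<^esub>"
  "!!z. z : carrier N ==> g (\<sigma> z) = z" "!!y. y : carrier M ==> f (\<rho> y) \<oplus>\<^bsub>M\<^esub> \<sigma> (g y) = y"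
 using assms by (simp_all add: split_pair_def)

lemma addhom_const_zero: "abelian_group N ==> addhom M N (%x. \<zero>\<^bsub>N\<^esub>)"
proof -
 assume "abelian_group N"
 then interpret N: abelian_group N .
 show ?thesis by (rule addhomI) auto
qed

lemma addhom_plus:
 assumes "abelian_group N" "addhom M N f" "addhom M N g"
 shows "addhom M N (%x. f x \<oplus>\<^bsub>N\<^esub> g x)"
proof -
 interpret N: abelian_group N by fact
 show ?thesis using assms(2,3) by (simp add: addhom_def N.a_ac)
qed

lemma short_exact_iff: "short_exact A L M N \<longleftrightarrow>
  (\<exists>F G. F : module_hom A L M \<and> G : module_hom A M N \<and>
  (\<forall>i. F ` gr L i <= gr M i) \<and> (\<forall>i. G ` gr M i <= gr N i) \<and> exact_pair L M N F G)"
 unfolding short_exact_exact_pair Bex_def gr_hom_iff by blast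

lemma short_exactE:
 assumes "short_exact A L M N"
 obtains f g where "f : module_hom A L M" "g : module_hom A M N" "!!i. f ` gr L i <= gr M i"
  "!!i. g ` gr M i <= gr N i" "exact_pair L M N f g"
 using assms by (auto simp: short_exact_exact_pair gr_hom_iff)

lemma gr_isoE:
 assumes "gr_left_module A M" "gr_left_module A N" "gr_iso A M N"
 obtains f g where "f : module_hom A M N" "g : module_hom A N M"
  "!!i. f ` gr M i <= gr N i" "!!i. g ` gr N i <= gr M i"
  "!!x. x : carrier M ==> g (f x) = x" "!!y. y : carrier N ==> f (g y) = y"
proof -
 obtain f where f: "f : gr_hom A M N" "bij_betw f (carrier M) (carrier N)"
  using assms(3) by (auto simp: gr_iso_def)
 have inj: "inj_on f (carrier M)" and surj: "f ` carrier M = carrier N" using f(2) by (auto simp: bij_betw_def)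
 show thesis
  by (rule that[of f "the_inv_into (carrier M) f"])
   (use f(1) gr_hom_inv[OF assms(1,2) f] the_inv_into_f_f[OF inj] f_the_inv_into_f[OF inj] surj
    in \<open>simp_all add: gr_hom_iff\<close>)
qed

text \<open>An additive functor preserves split exact sequences. It is described by maps \<open>t L j\<close> from \<open>L\<close> to
  \<open>T L\<close> whose images generate.\<close>

lemma (in galgebra) split_functor_exact:
 fixes T :: "('a, 'm) gr_module => ('b, 'n) gr_module"
 assumes C: "!!L. L : C ==> gr_left_module A L \<and> abelian_group (T L)"
  and add: "!!L j. [|L : C; j : J|] ==> addhom L (T L) (t L j)"
  and eqI: "!!L L' h k U. [|L : C; L' : C; addhom (T L) (T L') h; addhom (T L) (T L') k;
   !!j x. [|j : J; x : carrier L|] ==> h (t L j x) = k (t L j x); U : carrier (T L)|] ==> h U = k U"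
  and map: "!!L L' f. [|L : C; L' : C; f : module_hom A L L'|] ==> \<exists>F \<in> module_hom B (T L) (T L').
   (\<forall>j \<in> J. \<forall>x \<in> carrier L. F (t L j x) = t L' j (f x)) \<and>
   ((\<forall>i. f ` gr L i <= gr L' i) \<longrightarrow> (\<forall>i. F ` gr (T L) i <= gr (T L') i))"
  and L: "L1 : C" "L2 : C" "L3 : C" "pmod A L3" and ex: "short_exact A L1 L2 L3"
 shows "\<exists>F G. F : module_hom B (T L1) (T L2) \<and> G : module_hom B (T L2) (T L3) \<and>
  (\<forall>i. F ` gr (T L1) i <= gr (T L2) i) \<and> (\<forall>i. G ` gr (T L2) i <= gr (T L3) i) \<and> exact_pair (T L1) (T L2) (T L3) F G"
proof -
 have l: "left_module A L1" "left_module A L2" "left_module A L3" using C L by (auto simp: gr_left_module_def)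
 note ab = C[OF L(1), THEN conjunct2] C[OF L(2), THEN conjunct2] C[OF L(3), THEN conjunct2]
 obtain I :: "'m set" and e h where d: "dual_basis A L3 I e h" using pmod_dual_basis[OF L(4)] by blast
 obtain f g where fg: "f : module_hom A L1 L2" "g : module_hom A L2 L3" "!!i. f ` gr L1 i <= gr L2 i"
  "!!i. g ` gr L2 i <= gr L3 i" "exact_pair L1 L2 L3 f g" by (rule short_exactE[OF ex]) blast
 obtain \<sigma> \<rho> where sr: "\<sigma> : module_hom A L3 L2" "\<rho> : module_hom A L2 L1" "split_pair L1 L2 L3 f g \<sigma> \<rho>"
  by (rule exact_pair_split[OF l(3,2,1) fg(1,2,5) d])
 note sp = split_pairD[OF sr(3)]
 from map[OF L(1,2) fg(1)] obtain F where F: "F : module_hom B (T L1) (T L2)"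
  "\<forall>j \<in> J. \<forall>x \<in> carrier L1. F (t L1 j x) = t L2 j (f x)"
  "(\<forall>i. f ` gr L1 i <= gr L2 i) \<longrightarrow> (\<forall>i. F ` gr (T L1) i <= gr (T L2) i)" by (elim bexE conjE)
 from map[OF L(2,3) fg(2)] obtain G where G: "G : module_hom B (T L2) (T L3)"
  "\<forall>j \<in> J. \<forall>x \<in> carrier L2. G (t L2 j x) = t L3 j (g x)"
  "(\<forall>i. g ` gr L2 i <= gr L3 i) \<longrightarrow> (\<forall>i. G ` gr (T L2) i <= gr (T L3) i)" by (elim bexE conjE)
 from map[OF L(3,2) sr(1)] obtain S where S: "S : module_hom B (T L3) (T L2)"
  "\<forall>j \<in> J. \<forall>x \<in> carrier L3. S (t L3 j x) = t L2 j (\<sigma> x)" by (elim bexE conjE)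
 from map[OF L(2,1) sr(2)] obtain R where R: "R : module_hom B (T L2) (T L1)"
  "\<forall>j \<in> J. \<forall>x \<in> carrier L2. R (t L2 j x) = t L1 j (\<rho> x)" by (elim bexE conjE)
 note ah = module_hom_addhom[OF F(1)] module_hom_addhom[OF G(1)] module_hom_addhom[OF S(1)] module_hom_addhom[OF R(1)]
 note c = addhom_closed[OF module_hom_addhom[OF fg(1)]] addhom_closed[OF module_hom_addhom[OF fg(2)]]
  addhom_closed[OF module_hom_addhom[OF sr(1)]] addhom_closed[OF module_hom_addhom[OF sr(2)]]
 have z: "t L3 j \<zero>\<^bsub>L3\<^esub> = \<zero>\<^bsub>T L3\<^esub>" if "j : J" for j
  by (rule addhom_zero[OF left_moduleD(2)[OF l(3)] ab(3) add[OF L(3) that]])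
 \<comment> \<open>All four splitting equations are equalities of additive maps and are checked on
   the generating elements \<open>t L j x\<close>, where they reduce to the equations for f, g,
   \<sigma> and \<rho>.\<close>
 have "split_pair (T L1) (T L2) (T L3) F G S R"
 proof (rule split_pairI[OF ab ah])
  show "R (F U) = U" if "U : carrier (T L1)" for U
   by (rule eqI[OF L(1,1) addhom_comp[OF ah(1,4)] addhom_id _ that]) (simp add: F(2) R(2) c sp)
  show "G (F U) = \<zero>\<^bsub>T L3\<^esub>" if "U : carrier (T L1)" for U
   by (rule eqI[OF L(1,3) addhom_comp[OF ah(1,2)] addhom_const_zero[OF ab(3)] _ that]) (simp add: F(2) G(2) c sp z)
  show "G (S U) = U" if "U : carrier (T L3)" for U
   by (rule eqI[OF L(3,3) addhom_comp[OF ah(3,2)] addhom_id _ that]) (simp add: S(2) G(2) c sp)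
  show "F (R U) \<oplus>\<^bsub>T L2\<^esub> S (G U) = U" if "U : carrier (T L2)" for U
   by (rule eqI[OF L(2,2) addhom_plus[OF ab(2) addhom_comp[OF ah(4,1)] addhom_comp[OF ah(2,3)]] addhom_id _ that])
    (simp add: F(2) R(2) S(2) G(2) c sp addhom_add[OF add[OF L(2)], symmetric])
 qed
 then have "exact_pair (T L1) (T L2) (T L3) F G" by (rule split_pair_exact[OF _ ab(2,3)])
 then show ?thesis
  using F(1) G(1) F(3)[rule_format, OF fg(3)] G(3)[rule_format, OF fg(4)]
  by (intro exI[of _ F] exI[of _ G] conjI allI) auto
qed

section \<open>Functoriality and exactness of the pairing of modules\<close>

context twisted begin

lemma PM_map:
 assumes P: "gr_left_module A P" and P': "gr_left_module A P'" and M: "gr_left_module A M"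
  and M': "gr_left_module A M'" and f: "f : module_hom A P P'" and g: "g : module_hom A M M'"
 obtains F where "F : module_hom K (PM P M) (PM P' M')"
  "!!x y. [|x : carrier P; y : carrier M|] ==> F (ppm P M x y) = ppm P' M' (f x) (g y)"
  "[|!!i. f ` gr P i <= gr P' i; !!i. g ` gr M i <= gr M' i|]
   ==> (!!i. F ` gr (PM P M) i <= gr (PM P' M') i)"
proof -
 interpret G: gtensor A "tw P" M "gr A" by (rule tw_gtensor[OF P M])
 interpret G': gtensor A "tw P'" M' "gr A" by (rule tw_gtensor[OF P' M'])
 note fa = module_hom_addhom[OF f] and ga = module_hom_addhom[OF g]
 obtain F where F: "addhom (PM P M) (PM P' M') F"
  "!!x y. [|x : carrier (tw P); y : carrier M|] ==> F (ppm P M x y) = ppm P' M' (f x) (g y)"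
  by (rule tensor_map[OF G.mtensor_axioms G'.mtensor_axioms tw_module_hom[OF f] g]) blast
 show thesis
 proof (rule that)
  show "F : module_hom K (PM P M) (PM P' M')"
  proof (rule module_homI[OF F(1)])
   fix c U assume c: "c : carrier K" and U: "U : carrier (PM P M)"
   note l = PM_smult[OF P M c] and r = PM_smult[OF P' M' c]
   note MD = left_moduleD[OF gr_modD(1)[OF M]]
   show "F (c \<odot>\<^bsub>PM P M\<^esub> U) = c \<odot>\<^bsub>PM P' M'\<^esub> F U"
    by (rule G.tensor_hom_eqI[OF G'.tensor_abelian addhom_comp[OF l(1) F(1)] addhom_comp[OF F(1) r(1)] _ U])
     (use sc_closed[OF c] in \<open>simp add: l r F(2) MD addhom_closed[OF fa] addhom_closed[OF ga] module_hom_smult[OF g]\<close>)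
  qed
  show "!!x y. [|x : carrier P; y : carrier M|] ==> F (ppm P M x y) = ppm P' M' (f x) (g y)"
   using F(2) by simp
  fix i assume fg: "!!i. f ` gr P i <= gr P' i" and gg: "!!i. g ` gr M i <= gr M' i"
  interpret gP: graded P by (rule gr_graded[OF P])
  interpret gM: graded M by (rule gr_graded[OF M])
  show "F ` gr (PM P M) i <= gr (PM P' M') i"
  proof (rule G.gr_addhom_image[OF F(1) G'.tensor_abelian G'.gr_subgroup])
   fix x y j k assume xy: "x : gr (tw P) j" "y : gr M k" "j + k = i"
   then have "f x : gr (tw P') j" "g y : gr M' k" using fg[of j] gg[of k] by auto
   from G'.pt_gr[OF this xy(3)] show "F (ppm P M x y) : gr (PM P' M') i"
    using xy gP.gr_closed(1) gM.gr_closed(1) by (simp add: F(2))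
  qed
 qed
qed

lemma PM_hom_eqI:
 assumes P: "gr_left_module A P" and M: "gr_left_module A M" and "abelian_group H"
  "addhom (PM P M) H f" "addhom (PM P M) H g"
  "!!x y. [|x : carrier P; y : carrier M|] ==> f (ppm P M x y) = g (ppm P M x y)" "U : carrier (PM P M)"
 shows "f U = g U"
proof -
 interpret G: gtensor A "tw P" M "gr A" by (rule tw_gtensor[OF P M])
 show ?thesis by (rule G.tensor_hom_eqI[OF assms(3-5) _ assms(7)]) (simp add: assms(6))
qed

lemma PM_abelian: "[|gr_left_module A P; gr_left_module A M|] ==> abelian_group (PM P M)"
 using left_moduleD(2)[OF PM_left_module] .

lemma PM_addhom:
 assumes P: "gr_left_module A P" and M: "gr_left_module A M"
 shows "x : carrier P ==> addhom M (PM P M) (ppm P M x)"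
  "y : carrier M ==> addhom P (PM P M) (%x. ppm P M x y)"
proof -
 interpret G: gtensor A "tw P" M "gr A" by (rule tw_gtensor[OF P M])
 show "x : carrier P ==> addhom M (PM P M) (ppm P M x)"
  "y : carrier M ==> addhom P (PM P M) (%x. ppm P M x y)"
  using G.pt_addhom_right[of x] G.pt_addhom_left[of y] by (simp_all add: addhom_def)
qed

lemma PM_iso:
 assumes P: "pmod A P" "pmod A P'" "gr_iso A P P'" and M: "fmod K A M" "fmod K A M'" "gr_iso A M M'"
 shows "gdim K (PM P M) = gdim K (PM P' M')"
proof -
 have g: "gr_left_module A P" "gr_left_module A P'" "gr_left_module A M" "gr_left_module A M'"
  using P M by (auto simp: pmod_def fmod_def)
 obtain I :: "'b set" and e h where d: "dual_basis A P I e h" using pmod_dual_basis[OF P(1)] by blast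
 obtain I' :: "'c set" and e' h' where d': "dual_basis A P' I' e' h'" using pmod_dual_basis[OF P(2)] by blast
 obtain f f' where f: "f : module_hom A P P'" "f' : module_hom A P' P" "!!i. f ` gr P i <= gr P' i"
  "!!x. x : carrier P ==> f' (f x) = x" "!!y. y : carrier P' ==> f (f' y) = y"
  using gr_isoE[OF g(1,2) P(3)] by metis
 obtain u u' where u: "u : module_hom A M M'" "u' : module_hom A M' M" "!!i. u ` gr M i <= gr M' i"
  "!!x. x : carrier M ==> u' (u x) = x" "!!y. y : carrier M' ==> u (u' y) = y"
  using gr_isoE[OF g(3,4) M(3)] by metis
 obtain F where F: "F : module_hom K (PM P M) (PM P' M')"
  "!!x y. [|x : carrier P; y : carrier M|] ==> F (ppm P M x y) = ppm P' M' (f x) (u y)"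
  "!!i. [|!!i. f ` gr P i <= gr P' i; !!i. u ` gr M i <= gr M' i|] ==> F ` gr (PM P M) i <= gr (PM P' M') i"
  by (rule PM_map[OF g f(1) u(1)]) blast
 obtain G where G: "G : module_hom K (PM P' M') (PM P M)"
  "!!x y. [|x : carrier P'; y : carrier M'|] ==> G (ppm P' M' x y) = ppm P M (f' x) (u' y)"
  by (rule PM_map[OF g(2,1,4,3) f(2) u(2)]) blast
 note Fa = module_hom_addhom[OF F(1)] and Ga = module_hom_addhom[OF G(1)]
 note c = addhom_closed[OF module_hom_addhom[OF f(1)]] addhom_closed[OF module_hom_addhom[OF f(2)]]
  addhom_closed[OF module_hom_addhom[OF u(1)]] addhom_closed[OF module_hom_addhom[OF u(2)]]
 have GF: "G (F U) = U" if "U : carrier (PM P M)" for U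
  by (rule PM_hom_eqI[OF g(1,3) PM_abelian[OF g(1,3)] addhom_comp[OF Fa Ga] addhom_id _ that])
   (simp add: F(2) G(2) c f u)
 have FG: "F (G U) = U" if "U : carrier (PM P' M')" for U
  by (rule PM_hom_eqI[OF g(2,4) PM_abelian[OF g(2,4)] addhom_comp[OF Ga Fa] addhom_id _ that])
   (simp add: F(2) G(2) c f u)
 have "bij_betw F (carrier (PM P M)) (carrier (PM P' M'))"
  by (rule bij_betw_byWitness[where f' = G])
   (use GF FG addhom_closed[OF Fa] addhom_closed[OF Ga] in auto)
 then show ?thesis
  by (rule gdim_iso[OF PM_gr_space[OF g(1) M(1) d] PM_gr_space[OF g(2) M(2) d'] F(1)])
   (rule F(3)[OF f(3) u(3)])
qed

text \<open>The twisted P keeps a dual basis, so tensoring with it is exact; graded dimension is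
  additive on the resulting sequence.\<close>

lemma PM_exact_right:
 assumes P: "pmod A P" and M: "fmod K A M1" "fmod K A M2" "fmod K A M3"
  and ex: "short_exact A M1 M2 M3"
 shows "gdim K (PM P M2) = gdim K (PM P M1) + gdim K (PM P M3)"
proof -
 have gP: "gr_left_module A P" using P by (simp add: pmod_def)
 have gM: "gr_left_module A M1" "gr_left_module A M2" "gr_left_module A M3" using M by (auto simp: fmod_def)
 obtain I :: "'b set" and e h where d: "dual_basis A P I e h" using pmod_dual_basis[OF P] by blast
 obtain f g where fg: "f : module_hom A M1 M2" "g : module_hom A M2 M3" "!!i. f ` gr M1 i <= gr M2 i"
  "!!i. g ` gr M2 i <= gr M3 i" "exact_pair M1 M2 M3 f g" by (rule short_exactE[OF ex]) blast
 obtain F where F: "F : module_hom K (PM P M1) (PM P M2)"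
  "!!x y. [|x : carrier P; y : carrier M1|] ==> F (ppm P M1 x y) = ppm P M2 x (f y)"
  "!!i. [|!!i. (%x. x) ` gr P i <= gr P i; !!i. f ` gr M1 i <= gr M2 i|] ==> F ` gr (PM P M1) i <= gr (PM P M2) i"
  by (rule PM_map[OF gP gP gM(1,2) module_hom_id fg(1)]) blast
 obtain G where G: "G : module_hom K (PM P M2) (PM P M3)"
  "!!x y. [|x : carrier P; y : carrier M2|] ==> G (ppm P M2 x y) = ppm P M3 x (g y)"
  "!!i. [|!!i. (%x. x) ` gr P i <= gr P i; !!i. g ` gr M2 i <= gr M3 i|] ==> G ` gr (PM P M2) i <= gr (PM P M3) i"
  by (rule PM_map[OF gP gP gM(2,3) module_hom_id fg(2)]) blast
 have "exact_pair (PM P M1) (PM P M2) (PM P M3) F G"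
 proof (rule tensor_exact_right[OF _ _ _ tw_dual_basis[OF gr_modD(1)[OF gP] d] fg(1,2,5)
    module_hom_addhom[OF F(1)] _ module_hom_addhom[OF G(1)]])
  show "mtensor A (tw P) M1" "mtensor A (tw P) M2" "mtensor A (tw P) M3"
   using tw_gtensor[OF gP gM(1)] tw_gtensor[OF gP gM(2)] tw_gtensor[OF gP gM(3)] by (auto simp: gtensor_def)
 qed (simp_all add: F(2) G(2))
 then show ?thesis
  by (rule gdim_exact[OF PM_gr_space[OF gP M(1) d] PM_gr_space[OF gP M(2) d] PM_gr_space[OF gP M(3) d] F(1) G(1)])
   (use F(3)[OF id_image_subset fg(3)] G(3)[OF id_image_subset fg(4)] in auto)
qed

text \<open>With M fixed, the functor in P is generated by the maps x \<mapsto> x \<otimes> y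
  indexed by y in M, which is the shape \<open>split_functor_exact\<close> requires.\<close>

lemma PM_exact_left:
 fixes P1 P2 P3 :: "('a, 'b) gr_module"
 assumes P: "pmod A P1" "pmod A P2" "pmod A P3" and M: "fmod K A M"
  and ex: "short_exact A P1 P2 P3"
 shows "gdim K (PM P2 M) = gdim K (PM P1 M) + gdim K (PM P3 M)"
proof -
 have gP: "gr_left_module A P1" "gr_left_module A P2" "gr_left_module A P3" using P by (auto simp: pmod_def)
 have gM: "gr_left_module A M" using M by (simp add: fmod_def)
 obtain I1 :: "'b set" and e1 h1 where d1: "dual_basis A P1 I1 e1 h1" using pmod_dual_basis[OF P(1)] by blast
 obtain I2 :: "'b set" and e2 h2 where d2: "dual_basis A P2 I2 e2 h2" using pmod_dual_basis[OF P(2)] by blast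
 obtain I3 :: "'b set" and e3 h3 where d3: "dual_basis A P3 I3 e3 h3" using pmod_dual_basis[OF P(3)] by blast
 have "\<exists>F G. F : module_hom K (PM P1 M) (PM P2 M) \<and> G : module_hom K (PM P2 M) (PM P3 M) \<and>
  (\<forall>i. F ` gr (PM P1 M) i <= gr (PM P2 M) i) \<and> (\<forall>i. G ` gr (PM P2 M) i <= gr (PM P3 M) i) \<and> exact_pair (PM P1 M) (PM P2 M) (PM P3 M) F G"
 proof (rule split_functor_exact[where T = "%L. PM L M" and C = "{L. gr_left_module A L}"
    and J = "carrier M" and t = "%L y x. ppm L M x y", OF _ _ _ _ _ _ _ P(3) ex], goal_cases)
  case (4 L L' f)
  then have g: "gr_left_module A L" "gr_left_module A L'" and f: "f : module_hom A L L'" by simp_all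
  obtain F where F: "F : module_hom K (PM L M) (PM L' M)"
   "!!x y. [|x : carrier L; y : carrier M|] ==> F (ppm L M x y) = ppm L' M (f x) y"
   "!!i. [|!!i. f ` gr L i <= gr L' i; !!i. (%x. x) ` gr M i <= gr M i|] ==> F ` gr (PM L M) i <= gr (PM L' M) i"
   by (rule PM_map[OF g gM gM f module_hom_id]) blast
  show ?case
   using F by (intro bexI[of _ F]) auto
 next
  case (3 L L' h k U)
  show ?case by (rule PM_hom_eqI[OF _ gM PM_abelian[OF _ gM] 3(3,4) _ 3(6)]) (use 3(1,2,5) in simp_all)
 next
  case (2 L j)
  then show ?case using PM_addhom(2)[OF _ gM] by simp
 qed (use gP gM PM_abelian in simp_all)
 then obtain F G where FG: "F : module_hom K (PM P1 M) (PM P2 M)" "G : module_hom K (PM P2 M) (PM P3 M)"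
  and gr: "\<forall>i. F ` gr (PM P1 M) i <= gr (PM P2 M) i" "\<forall>i. G ` gr (PM P2 M) i <= gr (PM P3 M) i"
  and ex': "exact_pair (PM P1 M) (PM P2 M) (PM P3 M) F G" by (elim exE conjE)
 show ?thesis
  by (rule gdim_exact[OF PM_gr_space[OF gP(1) M d1] PM_gr_space[OF gP(2) M d2] PM_gr_space[OF gP(3) M d3] FG ex' gr[rule_format]])
qed

end

section \<open>The induction functor\<close>

context nice_tower_alg begin

abbreviation "IndT m p L P \<equiv> induce K \<A> m p (outer_tensor K (Al m) (Al p) L P)"
abbreviation "pT m p L P z x y \<equiv> pure_tensor (TA m p) (restrict_scalars (xmul \<A> m p) (regular (opp (Al (m + p)))))
  (outer_tensor K (Al m) (Al p) L P) z (pure_tensor K (kspace (Al m) L) (kspace (Al p) P) x y)"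

context
 fixes m p :: nat and L :: "('a, 'l) gr_module" and P :: "('a, 'p) gr_module"
 assumes L: "gr_left_module (Al m) L" and P: "gr_left_module (Al p) P"
begin

interpretation O: outer K "Al m" "Al p" L P
 by (intro outer.intro outer_axioms.intro T.galgebra2_axioms L P)

interpretation D: inducing K "Al m" "Al p" "Al (m + p)" "xmul \<A> m p" "outer_tensor K (Al m) (Al p) L P"
 by (rule inducing[OF O.MN_gr_left_module])

lemma IndT_gr_left_module: "gr_left_module (Al (m + p)) (IndT m p L P)"
 unfolding induce_def by (rule D.Ind_gr_left_module)

lemma IndT_pure:
 assumes "z : carrier (Al (m + p))" "x : carrier L" "y : carrier P"
 shows "pT m p L P z x y : carrier (IndT m p L P)"
  "a : carrier (Al (m + p)) ==>
   a \<odot>\<^bsub>IndT m p L P\<^esub> pT m p L P z x y = pT m p L P (a \<otimes>\<^bsub>Al (m + p)\<^esub> z) x y"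
 unfolding induce_def using assms by (simp_all add: D.pind_closed D.Ind_smult O.po_closed)

lemma pT_addhom:
 assumes "z : carrier (Al (m + p))"
 shows "x : carrier L ==> addhom P (IndT m p L P) (%y. pT m p L P z x y)"
  "y : carrier P ==> addhom L (IndT m p L P) (%x. pT m p L P z x y)"
proof -
 have pia: "addhom (outer_tensor K (Al m) (Al p) L P) D.Ind (D.pind z)"
  using D.I.pt_addhom_right[of z D.ind_act] assms by simp
 have poa: "addhom P (outer_tensor K (Al m) (Al p) L P) (%y. O.po x y)" if "x : carrier L" for x
  using O.O.pt_addhom_right[of x] that unfolding outer_tensor_def by (simp add: addhom_def)
 have pob: "addhom L (outer_tensor K (Al m) (Al p) L P) (%x. O.po x y)" if "y : carrier P" for y
  using O.O.pt_addhom_left[of y] that unfolding outer_tensor_def by (simp add: addhom_def)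
 show "x : carrier L ==> addhom P (IndT m p L P) (%y. pT m p L P z x y)"
  "y : carrier P ==> addhom L (IndT m p L P) (%x. pT m p L P z x y)"
  unfolding induce_def using addhom_comp[OF poa pia] addhom_comp[OF pob pia] by blast+
qed

lemma IndT_hom_eqI:
 assumes "abelian_group H" "addhom (IndT m p L P) H f" "addhom (IndT m p L P) H g"
  "!!z x y. [|z : carrier (Al (m + p)); x : carrier L; y : carrier P|] ==>
   f (pT m p L P z x y) = g (pT m p L P z x y)" "U : carrier (IndT m p L P)"
 shows "f U = g U"
proof (rule D.Ind_hom_eqI[OF assms(1) assms(2,3)[unfolded induce_def] _ assms(5)[unfolded induce_def]])
 fix z v assume z: "z : carrier (Al (m + p))" and v: "v : carrier (outer_tensor K (Al m) (Al p) L P)"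
 have pia: "addhom (outer_tensor K (Al m) (Al p) L P) D.Ind (D.pind z)"
  using D.I.pt_addhom_right[of z D.ind_act] z by simp
 show "f (D.pind z v) = g (D.pind z v)"
  by (rule O.MN_hom_eqI[OF assms(1) addhom_comp[OF pia assms(2)[unfolded induce_def]]
     addhom_comp[OF pia assms(3)[unfolded induce_def]] _ v]) (use assms(4) z in simp)
qed

lemma IndT_dual_basis:
 assumes dL: "dual_basis (Al m) L I e f" and dP: "dual_basis (Al p) P J e' f'"
 obtains F E where "dual_basis (Al (m + p)) (IndT m p L P) (I \<times> J) E F"
proof -
 obtain F1 where "dual_basis (TA m p) O.MN (I \<times> J) (%z. O.po (e (fst z)) (e' (snd z))) F1"
  by (rule O.MN_dual_basis[OF dL dP])
 then obtain F2 where "dual_basis (Al (m + p)) D.Ind (I \<times> J)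
   (%i. D.pind \<one>\<^bsub>Al (m + p)\<^esub> (O.po (e (fst i)) (e' (snd i)))) F2"
  by (rule D.Ind_dual_basis)
 then show thesis using that unfolding induce_def by blast
qed

end

lemma IndT_abelian:
 "[|gr_left_module (Al m) L; gr_left_module (Al p) P|] ==> abelian_group (IndT m p L P)"
 using left_moduleD(2)[OF gr_modD(1)[OF IndT_gr_left_module]] .

text \<open>Two applications of \<open>tensor_map\<close>: over K for the exterior product, whose
  map is linear over the tensor algebra, and over the tensor algebra for the induction.\<close>

lemma IndT_map:
 fixes L :: "('a, 'l) gr_module" and L' :: "('a, 'l2) gr_module"
  and P :: "('a, 'p) gr_module" and P' :: "('a, 'p2) gr_module"
 assumes L: "gr_left_module (Al m) L" and L': "gr_left_module (Al m) L'"
  and P: "gr_left_module (Al p) P" and P': "gr_left_module (Al p) P'"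
  and f: "f : module_hom (Al m) L L'" and g: "g : module_hom (Al p) P P'"
 obtains F where "F : module_hom (Al (m + p)) (IndT m p L P) (IndT m p L' P')"
  "!!z x y. [|z : carrier (Al (m + p)); x : carrier L; y : carrier P|] ==>
   F (pT m p L P z x y) = pT m p L' P' z (f x) (g y)"
  "[|!!i. f ` gr L i <= gr L' i; !!i. g ` gr P i <= gr P' i|]
   ==> (!!i. F ` gr (IndT m p L P) i <= gr (IndT m p L' P') i)"
proof -
 interpret O: outer K "Al m" "Al p" L P
  by (intro outer.intro outer_axioms.intro T.galgebra2_axioms L P)
 interpret O': outer K "Al m" "Al p" L' P'
  by (intro outer.intro outer_axioms.intro T.galgebra2_axioms L' P')
 interpret D: inducing K "Al m" "Al p" "Al (m + p)" "xmul \<A> m p" "outer_tensor K (Al m) (Al p) L P"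
  by (rule inducing[OF O.MN_gr_left_module])
 interpret D': inducing K "Al m" "Al p" "Al (m + p)" "xmul \<A> m p" "outer_tensor K (Al m) (Al p) L' P'"
  by (rule inducing[OF O'.MN_gr_left_module])
 let ?O = "outer_tensor K (Al m) (Al p) L P" and ?P = "outer_tensor K (Al m) (Al p) L' P'"
 note fa = module_hom_addhom[OF f] and gaa = module_hom_addhom[OF g]
 obtain E where E: "addhom ?O ?P E"
  "!!x y. [|x : carrier (kspace (Al m) L); y : carrier (kspace (Al p) P)|] ==> E (O.po x y) = O'.po (f x) (g y)"
  unfolding outer_tensor_def
  by (rule tensor_map[OF O.O.mtensor_axioms O'.O.mtensor_axioms G.module_hom_kspace[OF f] G.module_hom_kspace[OF g]]) blast
 have Em: "E : module_hom (TA m p) ?O ?P"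
 proof (rule module_homI[OF E(1)])
  fix S U assume S: "S : carrier (TA m p)" and U: "U : carrier ?O"
  show "E (S \<odot>\<^bsub>?O\<^esub> U) = S \<odot>\<^bsub>?P\<^esub> E U"
  proof (rule O.MN_hom_eqI[OF O'.MN_abelian addhom_comp[OF O.MN_smult(1)[OF S] E(1)] addhom_comp[OF E(1) O'.MN_smult(1)[OF S]] _ U])
   fix x y assume xy: "x : carrier L" "y : carrier P"
   have o: "O'.po (f x) (g y) : carrier ?P" using xy addhom_closed[OF fa] addhom_closed[OF gaa] by (intro O'.po_closed) auto
   have e: "E (O.po x y) = O'.po (f x) (g y)" using E(2)[of x y] xy by simp
   show "E (S \<odot>\<^bsub>?O\<^esub> O.po x y) = S \<odot>\<^bsub>?P\<^esub> E (O.po x y)" unfolding e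
    by (rule T.AB_hom_eqI[OF O'.MN_abelian addhom_comp[OF O.MN_smult(2)[OF O.po_closed[OF xy]] E(1)] O'.MN_smult(2)[OF o] _ S])
     (use xy in \<open>simp add: O.MN_smult(3) O'.MN_smult(3) E(2) O.MD O.ND module_hom_smult[OF f] module_hom_smult[OF g]
      addhom_closed[OF fa] addhom_closed[OF gaa]\<close>)
  qed
 qed
 obtain F where F: "addhom (IndT m p L P) (IndT m p L' P') F"
  "!!z U. [|z : carrier D.CR; U : carrier ?O|] ==> F (D.pind z U) = D'.pind z (E U)"
  unfolding induce_def
  by (rule tensor_map[OF D.I.mtensor_axioms D'.I.mtensor_axioms module_hom_id Em]) blast
 have Fp: "F (pT m p L P z x y) = pT m p L' P' z (f x) (g y)"
  if "z : carrier (Al (m + p))" "x : carrier L" "y : carrier P" for z x y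
  using that E(2)[of x y] by (simp add: F(2) O.po_closed)
 show thesis
 proof (rule that[OF _ Fp])
  show "F : module_hom (Al (m + p)) (IndT m p L P) (IndT m p L' P')"
  proof (rule module_homI[OF F(1)])
   fix a U assume a: "a : carrier (Al (m + p))" and U: "U : carrier (IndT m p L P)"
   note sm = left_module_addhom(1)[OF gr_modD(1)[OF IndT_gr_left_module[OF L P]] a]
    and sm' = left_module_addhom(1)[OF gr_modD(1)[OF IndT_gr_left_module[OF L' P']] a]
   show "F (a \<odot>\<^bsub>IndT m p L P\<^esub> U) = a \<odot>\<^bsub>IndT m p L' P'\<^esub> F U"
    by (rule IndT_hom_eqI[OF L P IndT_abelian[OF L' P'] addhom_comp[OF sm F(1)] addhom_comp[OF F(1) sm'] _ U])
     (use a in \<open>simp add: IndT_pure[OF L P] IndT_pure[OF L' P'] Fp addhom_closed[OF fa] addhom_closed[OF gaa]\<close>)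
  qed
  fix i assume fg: "!!i. f ` gr L i <= gr L' i" and gg: "!!i. g ` gr P i <= gr P' i"
  interpret gL: graded L by (rule gr_graded[OF L])
  interpret gP: graded P by (rule gr_graded[OF P])
  interpret gO: graded ?O by (rule gr_graded[OF O.MN_gr_left_module])
  let ?act = "%T (x, y). frag_extend (%(a, b). frag_of (a \<odot>\<^bsub>L\<^esub> x, b \<odot>\<^bsub>P\<^esub> y)) (rep T)"
  let ?act' = "%T (x, y). frag_extend (%(a, b). frag_of (a \<odot>\<^bsub>L'\<^esub> x, b \<odot>\<^bsub>P'\<^esub> y)) (rep T)"
  have Egr: "E ` gr ?O j <= gr ?P j" for j
  proof -
   have "E ` gr (tensor K (kspace (Al m) L) (kspace (Al p) P) ?act) j <=
     gr (tensor K (kspace (Al m) L') (kspace (Al p) P') ?act') j"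
   proof (rule O.O.gr_addhom_image[OF E(1)[unfolded outer_tensor_def] O'.O.tensor_abelian O'.O.gr_subgroup])
    fix x y s t assume xy: "x : gr (kspace (Al m) L) s" "y : gr (kspace (Al p) P) t" "s + t = j"
    then have "f x : gr (kspace (Al m) L') s" "g y : gr (kspace (Al p) P') t" using fg[of s] gg[of t] by auto
    from O'.O.pt_gr[OF this xy(3)]
    show "E (O.po x y) : gr (tensor K (kspace (Al m) L') (kspace (Al p) P') ?act') j"
     using xy gL.gr_closed(1) gP.gr_closed(1) by (simp add: E(2))
   qed
   then show ?thesis by (simp add: outer_tensor_def)
  qed
  have "F ` gr D.Ind i <= gr D'.Ind i"
  proof (rule D.I.gr_addhom_image[OF F(1)[unfolded induce_def] D'.I.tensor_abelian D'.I.gr_subgroup])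
   fix z U s t assume zU: "z : gr D.CR s" "U : gr ?O t" "s + t = i"
   then have "z : gr D'.CR s" "E U : gr ?P t" using Egr[of t] by auto
   from D'.I.pt_gr[OF this zU(3)] show "F (D.pind z U) : gr D'.Ind i"
    using zU(1,2) G.GA.gr_closed(1) gO.gr_closed(1) by (simp add: F(2))
  qed
  then show "F ` gr (IndT m p L P) i <= gr (IndT m p L' P') i" by (simp add: induce_def)
 qed
qed

text \<open>The functor L \<mapsto> Ind (L \<otimes> P) is generated by the maps x \<mapsto> z
  \<otimes> (x \<otimes> y), indexed by the pairs (z, y); the sequence splits because L3 is
  projective.\<close>

lemma IndT_exact_left:
 fixes L1 L2 L3 :: "('a, 'b) gr_module"
 assumes L: "pmod (Al m) L1" "pmod (Al m) L2" "pmod (Al m) L3" and P: "gr_left_module (Al p) P"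
  and ex: "short_exact (Al m) L1 L2 L3"
 shows "short_exact (Al (m + p)) (IndT m p L1 P) (IndT m p L2 P) (IndT m p L3 P)"
unfolding short_exact_iff
proof (rule G.split_functor_exact[where T = "%L. IndT m p L P" and C = "{L. gr_left_module (Al m) L}"
   and J = "carrier (Al (m + p)) \<times> carrier P" and t = "%L (z, y) x. pT m p L P z x y", OF _ _ _ _ _ _ _ L(3) ex], goal_cases)
 case (4 L L' f)
 then have g: "gr_left_module (Al m) L" "gr_left_module (Al m) L'" and f: "f : module_hom (Al m) L L'" by simp_all
 obtain F where F: "F : module_hom (Al (m + p)) (IndT m p L P) (IndT m p L' P)"
  "!!z x y. [|z : carrier (Al (m + p)); x : carrier L; y : carrier P|] ==> F (pT m p L P z x y) = pT m p L' P z (f x) y"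
  "!!i. [|!!i. f ` gr L i <= gr L' i; !!i. (%x. x) ` gr P i <= gr P i|] ==> F ` gr (IndT m p L P) i <= gr (IndT m p L' P) i"
  by (rule IndT_map[OF g P P f module_hom_id]) blast
 show ?case
  using F by (intro bexI[of _ F]) auto
next
 case (3 L L' h k U)
 note eq = 3(5)[of "(z, y)" x for z y x, simplified]
 show ?case
  by (rule IndT_hom_eqI[OF _ P IndT_abelian[OF _ P] 3(3,4) _ 3(6)]) (use 3(1,2) eq in \<open>simp_all\<close>)
next
 case (2 L j)
 then show ?case by (cases j) (auto intro: pT_addhom(2)[OF _ P])
qed (use L P IndT_abelian in \<open>simp_all add: pmod_def\<close>)

lemma IndT_exact_right:
 fixes L1 L2 L3 :: "('a, 'b) gr_module"
 assumes L: "pmod (Al p) L1" "pmod (Al p) L2" "pmod (Al p) L3" and P: "gr_left_module (Al m) P"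
  and ex: "short_exact (Al p) L1 L2 L3"
 shows "short_exact (Al (m + p)) (IndT m p P L1) (IndT m p P L2) (IndT m p P L3)"
unfolding short_exact_iff
proof (rule G.split_functor_exact[where T = "%L. IndT m p P L" and C = "{L. gr_left_module (Al p) L}"
   and J = "carrier (Al (m + p)) \<times> carrier P" and t = "%L (z, y) x. pT m p P L z y x", OF _ _ _ _ _ _ _ L(3) ex], goal_cases)
 case (4 L L' f)
 then have g: "gr_left_module (Al p) L" "gr_left_module (Al p) L'" and f: "f : module_hom (Al p) L L'" by simp_all
 obtain F where F: "F : module_hom (Al (m + p)) (IndT m p P L) (IndT m p P L')"
  "!!z y x. [|z : carrier (Al (m + p)); y : carrier P; x : carrier L|] ==> F (pT m p P L z y x) = pT m p P L' z y (f x)"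
  "!!i. [|!!i. (%x. x) ` gr P i <= gr P i; !!i. f ` gr L i <= gr L' i|] ==> F ` gr (IndT m p P L) i <= gr (IndT m p P L') i"
  by (rule IndT_map[OF P P g module_hom_id f]) blast
 show ?case
  using F by (intro bexI[of _ F]) auto
next
 case (3 L L' h k U)
 note eq = 3(5)[of "(z, y)" x for z y x, simplified]
 show ?case
  by (rule IndT_hom_eqI[OF P _ IndT_abelian[OF P] 3(3,4) _ 3(6)]) (use 3(1,2) eq in \<open>simp_all\<close>)
next
 case (2 L j)
 then show ?case by (cases j) (auto intro: pT_addhom(1)[OF P])
qed (use L P IndT_abelian in \<open>simp_all add: pmod_def\<close>)

lemma IndT_pmod:
 assumes "pmod (Al m) L" "pmod (Al p) P"
 shows "pmod (Al (m + p)) (IndT m p L P)"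
proof -
 have g: "gr_left_module (Al m) L" "gr_left_module (Al p) P" using assms by (auto simp: pmod_def)
 obtain I :: "'b set" and e f where d: "dual_basis (Al m) L I e f" using G.pmod_dual_basis[OF assms(1)] by blast
 obtain J :: "'c set" and e' f' where d': "dual_basis (Al p) P J e' f'" using G.pmod_dual_basis[OF assms(2)] by blast
 obtain F E where "dual_basis (Al (m + p)) (IndT m p L P) (I \<times> J) E F"
  by (rule IndT_dual_basis[OF g d d'])
 then show ?thesis by (rule G.dual_basis_pmod[OF IndT_gr_left_module[OF g]])
qed

lemma TR_fmod:
 assumes "pmod (Al p) P" "fmod K (Al (m + p)) N"
 shows "fmod K (Al m) (TRm m p P N)"
proof -
 interpret TR_ctxt K \<A> m p P N by unfold_locales (use assms in \<open>auto simp: pmod_def fmod_def\<close>)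
 obtain I :: "'b set" and e f where d: "dual_basis (Al p) P I e f" using G.pmod_dual_basis[OF assms(1)] by blast
 show ?thesis by (rule TT_fmod[OF d assms(2)])
qed

text \<open>TR is functorial in both arguments, and inverse pairs of isomorphisms induce inverse
  maps. Used to replace P and N by their copies on lists.\<close>

lemma TR_iso:
 assumes P: "pmod (Al p) P" "pmod (Al p) P'" "gr_iso (Al p) P P'"
  and N: "fmod K (Al (m + p)) N" "fmod K (Al (m + p)) N'" "gr_iso (Al (m + p)) N N'"
 shows "gr_iso (Al m) (TRm m p P N) (TRm m p P' N')"
proof -
 have gP: "gr_left_module (Al p) P" "gr_left_module (Al p) P'" using P by (auto simp: pmod_def)
 have gN: "gr_left_module (Al (m + p)) N" "gr_left_module (Al (m + p)) N'" using N by (auto simp: fmod_def)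
 interpret A: TR_ctxt K \<A> m p P N by unfold_locales (use gP gN in auto)
 interpret B: TR_ctxt K \<A> m p P' N' by unfold_locales (use gP gN in auto)
 obtain f f' where f: "f : module_hom (Al p) P P'" "f' : module_hom (Al p) P' P" "!!i. f ` gr P i <= gr P' i"
  "!!x. x : carrier P ==> f' (f x) = x" "!!y. y : carrier P' ==> f (f' y) = y"
  using gr_isoE[OF gP P(3)] by metis
 obtain u u' where u: "u : module_hom (Al (m + p)) N N'" "u' : module_hom (Al (m + p)) N' N" "!!i. u ` gr N i <= gr N' i"
  "!!x. x : carrier N ==> u' (u x) = x" "!!y. y : carrier N' ==> u (u' y) = y"
  using gr_isoE[OF gN N(3)] by metis
 have ru: "u : module_hom (Al p) (RY m p N) (RY m p N')" "u' : module_hom (Al p) (RY m p N') (RY m p N)"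
  using u(1,2) by (auto simp: module_hom_def RY_sel xm_closed)
 obtain F where F: "addhom A.TT B.TT F"
  "!!x y. [|x : carrier (restrict_scalars (an p) P); y : carrier (RY m p N)|] ==> F (A.pt2 x y) = B.pt2 (f x) (u y)"
  unfolding TRm_def by (rule tensor_map[OF A.R.mtensor_axioms B.R.mtensor_axioms W.tw_module_hom[OF f(1)] ru(1)]) blast
 obtain G where G: "addhom B.TT A.TT G"
  "!!x y. [|x : carrier (restrict_scalars (an p) P'); y : carrier (RY m p N')|] ==> G (B.pt2 x y) = A.pt2 (f' x) (u' y)"
  unfolding TRm_def by (rule tensor_map[OF B.R.mtensor_axioms A.R.mtensor_axioms W.tw_module_hom[OF f(2)] ru(2)]) blast
 note F2 = F(2)[simplified] and G2 = G(2)[simplified]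
 note c = addhom_closed[OF module_hom_addhom[OF f(1)]] addhom_closed[OF module_hom_addhom[OF f(2)]]
  addhom_closed[OF module_hom_addhom[OF u(1)]] addhom_closed[OF module_hom_addhom[OF u(2)]]
 have GF: "G (F U) = U" if "U : carrier A.TT" for U
  by (rule A.TT_hom_eqI[OF A.TT_abelian addhom_comp[OF F(1) G(1)] addhom_id _ that]) (simp add: F2 G2 c f u)
 have FG: "F (G U) = U" if "U : carrier B.TT" for U
  by (rule B.TT_hom_eqI[OF B.TT_abelian addhom_comp[OF G(1) F(1)] addhom_id _ that]) (simp add: F2 G2 c f u)
 have bij: "bij_betw F (carrier A.TT) (carrier B.TT)"
  by (rule bij_betw_byWitness[where f' = G])
   (use GF FG addhom_closed[OF F(1)] addhom_closed[OF G(1)] in auto)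
 have "F : module_hom (Al m) A.TT B.TT"
 proof (rule module_homI[OF F(1)])
  fix a U assume a: "a : carrier (Al m)" and U: "U : carrier A.TT"
  show "F (a \<odot>\<^bsub>A.TT\<^esub> U) = a \<odot>\<^bsub>B.TT\<^esub> F U"
   by (rule A.TT_hom_eqI[OF B.TT_abelian addhom_comp[OF A.TT_smult(1)[OF a] F(1)] addhom_comp[OF F(1) B.TT_smult(1)[OF a]] _ U])
    (use a in \<open>simp add: A.TT_smult B.TT_smult F2 c A.ND xm_closed module_hom_smult[OF u(1)]\<close>)
 qed
 moreover have "F ` gr A.TT i <= gr B.TT i" for i
 proof -
  interpret gP: graded P by (rule gr_graded[OF gP(1)])
  interpret gN: graded N by (rule gr_graded[OF gN(1)])
  show ?thesis unfolding TRm_def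
  proof (rule A.R.gr_addhom_image[OF F(1)[unfolded TRm_def] B.R.tensor_abelian B.R.gr_subgroup])
   fix x y j k assume xy: "x : gr (restrict_scalars (an p) P) j" "y : gr (RY m p N) k" "j + k = i"
   then have "f x : gr (restrict_scalars (an p) P') j" "u y : gr (RY m p N') k" using f(3)[of j] u(3)[of k] by auto
   from B.R.pt_gr[OF this xy(3)]
   show "F (A.pt2 x y) : gr (tensor (Al p) (restrict_scalars (an p) P') (RY m p N') (%a (x, y). frag_of (x, xm m p a \<one>\<^bsub>Al p\<^esub> \<odot>\<^bsub>N'\<^esub> y))) i"
    using xy gP.gr_closed(1) gN.gr_closed(1) by (simp add: F2)
  qed
 qed
 ultimately show ?thesis using bij by (auto simp: gr_iso_def gr_hom_iff)
qed

abbreviation "mp \<equiv> module_pairing K \<A>"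

lemma mp_def: "mp n P M = gdim K (W.PM n P M)"
 by (simp add: module_pairing_def twist_def)

text \<open>The adjunction for the modules that represent classes: induction and TR leave the type
  of lists, and replacing their values by copies does not change the pairing.\<close>

lemma mp_adjunction:
 assumes pL: "pmod (Al m) L" and pP: "pmod (Al p) P" and fN: "fmod K (Al (m + p)) N"
 shows "mp (m + p) (copy (Al (m + p)) (IndT m p L P)) N = mp m L (copy (Al m) (TRm m p P N))"
proof -
 have g: "gr_left_module (Al m) L" "gr_left_module (Al p) P" "gr_left_module (Al (m + p)) N"
  using pL pP fN by (auto simp: pmod_def fmod_def)
 interpret adjunction K \<A> m p P N L by unfold_locales (use g in auto)
 obtain I :: "'b set" and e f where d: "dual_basis (Al m) L I e f" using G.pmod_dual_basis[OF pL] by blast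
 obtain J :: "'c set" and e' f' where d': "dual_basis (Al p) P J e' f'" using G.pmod_dual_basis[OF pP] by blast
 note I = IndT_pmod[OF pL pP] and T = TR_fmod[OF pP fN]
 have "mp (m + p) (copy (Al (m + p)) (IndT m p L P)) N = mp (m + p) (IndT m p L P) N"
  unfolding mp_def by (rule W.PM_iso[OF G.copy_pmod(1)[OF I] I G.copy_pmod(2)[OF I] fN fN gr_iso_refl])
 also have "\<dots> = gdim K rhs" unfolding mp_def using adjunction_gdim[OF d' d fN] by (simp add: induce_def)
 also have "\<dots> = mp m L (copy (Al m) (TRm m p P N))"
  unfolding mp_def
  by (rule W.PM_iso[OF pL pL gr_iso_refl T G.copy_fmod(1)[OF T] gr_iso_sym[OF _ _ G.copy_fmod(2)[OF T]]])
   (use T G.copy_fmod(1)[OF T] in \<open>auto simp: fmod_def\<close>)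
 finally show ?thesis .
qed

end

section \<open>Submodules and Grothendieck groups\<close>

definition sub_mod :: "('a, 'm) gr_module => 'm set => ('a, 'm) gr_module" where
 "sub_mod M H = M\<lparr>carrier := H, gr := %i. gr M i \<inter> H\<rparr>"

lemma sub_mod_sel [simp]:
 "carrier (sub_mod M H) = H" "\<zero>\<^bsub>sub_mod M H\<^esub> = \<zero>\<^bsub>M\<^esub>" "add (sub_mod M H) = add M"
 "smult (sub_mod M H) = smult M" "gr (sub_mod M H) i = gr M i \<inter> H"
 by (simp_all add: sub_mod_def)

lemma abelian_group_sub:
 assumes "abelian_group M" "additive_subgroup H M"
  and N: "carrier N = H" "add N = add M" "\<zero>\<^bsub>N\<^esub> = \<zero>\<^bsub>M\<^esub>"
 shows "abelian_group N" "!!x. x : H ==> \<ominus>\<^bsub>N\<^esub> x = \<ominus>\<^bsub>M\<^esub> x"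
proof -
 interpret M: abelian_group M by fact
 note HD = additive_subgroupD[OF assms(2)]
 show ab: "abelian_group N"
 proof (rule abelian_groupI)
  show "\<exists>y\<in>carrier N. y \<oplus>\<^bsub>N\<^esub> x = \<zero>\<^bsub>N\<^esub>" if "x : carrier N" for x
   using that HD by (intro bexI[of _ "\<ominus>\<^bsub>M\<^esub> x"]) (auto simp: N M.l_neg)
 qed (use HD in \<open>auto simp: N M.a_ac\<close>)
 interpret N: abelian_group N by (rule ab)
 show "\<ominus>\<^bsub>N\<^esub> x = \<ominus>\<^bsub>M\<^esub> x" if x: "x : H" for x
  using x HD(1,4) N.add.inv_equality[of "\<ominus>\<^bsub>M\<^esub> x" x] M.l_neg[of x] by (simp add: N a_inv_def)
qed

lemma additive_subgroup_sub:
 assumes "abelian_group M" "additive_subgroup H M"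
  and N: "carrier N = H" "add N = add M" "\<zero>\<^bsub>N\<^esub> = \<zero>\<^bsub>M\<^esub>" and J: "additive_subgroup J N"
 shows "additive_subgroup J M"
proof (rule additive_subgroupI'[OF assms(1)])
 note HD = additive_subgroupD[OF assms(2)] and JD = additive_subgroupD[OF J]
 show "J <= carrier M" using JD(1) HD(1) N(1) by auto
 fix x assume "x : J"
 then show "\<ominus>\<^bsub>M\<^esub> x : J" using JD(1,4) abelian_group_sub(2)[OF assms(1-5)] N(1) by fastforce
qed (use additive_subgroupD[OF J] N in auto)

lemma submodule_gr_left_module:
 assumes M: "gr_left_module A M" and H: "gr_submodule A M H" and grA: "!!i. gr A i <= carrier A"
 shows "gr_left_module A (sub_mod M H)" "(%x. x) : gr_hom A (sub_mod M H) M"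
  "!!x i. x : H ==> hcomp (sub_mod M H) i x = hcomp M i x"
proof -
 interpret M: graded M by (rule gr_graded[OF M])
 let ?N = "sub_mod M H"
 note MD = left_moduleD[OF gr_modD(1)[OF M]]
 have sub: "additive_subgroup H M" using H by (simp add: gr_submodule_def)
 note HD = additive_subgroupD[OF sub]
 have sm: "!!a x. [|a : carrier A; x : H|] ==> a \<odot>\<^bsub>M\<^esub> x : H"
  and hc: "!!x i. x : H ==> hcomp M i x : H" using H by (auto simp: gr_submodule_def)
 note ab = abelian_group_sub[OF M.ab sub, of ?N, simplified]
 have lm: "left_module A ?N"
  unfolding left_module_def using ab(1) MD HD(1) sm by auto
 have "graded_group ?N"
 proof (rule graded_groupI[OF ab(1), where \<pi> = "hcomp M"])
  show "additive_subgroup (gr ?N i) ?N" for i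
   by (rule additive_subgroupI'[OF ab(1)]) (use M.gr_closed HD ab(2) in auto)
  show "addhom ?N ?N (hcomp M i)" for i
   by (rule addhomI) (use hc HD(1) addhom_add[OF M.hcomp_addhom] in auto)
  fix J assume J: "additive_subgroup J ?N" "!!i. gr ?N i <= J"
  have J': "additive_subgroup J M" by (rule additive_subgroup_sub[OF M.ab sub _ _ _ J(1)]) auto
  show "carrier ?N <= J"
  proof
   fix x assume "x : carrier ?N"
   then have x: "x : H" by simp
   have "(\<Oplus>\<^bsub>M\<^esub> i\<in>{i. hcomp M i x ~= \<zero>\<^bsub>M\<^esub>}. hcomp M i x) : J"
    by (rule additive_subgroup_finsum[OF M.ab J']) (use J(2) hc[OF x] M.hcomp_gr[OF HD(1)[OF x]] in auto)
   then show "x : J" using M.hcomp_sum[OF HD(1)[OF x] M.hcomp_finite[OF HD(1)[OF x]]] by simp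
  qed
 qed (auto simp: M.hcomp_homog)
 then show g: "gr_left_module A ?N"
  using lm gr_modD(3)[OF M] sm grA unfolding gr_left_module_def by fastforce
 show i: "(%x. x) : gr_hom A ?N M" using HD(1) by (auto simp: gr_hom_iff module_hom_def)
 interpret N: graded ?N by (rule gr_graded[OF g])
 show "hcomp ?N i x = hcomp M i x" if "x : H" for x i
  using graded_hom_hcomp[OF N.gg M.gg module_hom_addhom, of "%x. x" A x i] i that by (simp add: gr_hom_iff)
qed

text \<open>The condition under \<open>SOME\<close> depends only on the coset of x, so it selects
  one representative per coset. The quotient thus lives on the type of M, and \<open>fmods\<close>
  is closed under it.\<close>

definition quot_mod :: "('a, 'm) gr_module => 'm set => ('a, 'm) gr_module" where
 "quot_mod M H = img_mod (%x. SOME y. y : carrier M \<and> x \<ominus>\<^bsub>M\<^esub> y : H) M"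

context galgebra begin

text \<open>Prepared for the induction on dimension that produces simple constituents: the dimension
  formula gives the descent, and the last clause shows that the quotient by a proper submodule is
  nonzero.\<close>

lemma submodule_exact:
 assumes M: "fmod K A M" and H: "gr_submodule A M H"
 shows "fmod K A (sub_mod M H)" "fmod K A (quot_mod M H)" "short_exact A (sub_mod M H) M (quot_mod M H)"
  "vdim K (kspace A M) = vdim K (kspace A (sub_mod M H)) + vdim K (kspace A (quot_mod M H))"
  "carrier (quot_mod M H) = {\<zero>\<^bsub>quot_mod M H\<^esub>} ==> H = carrier M"
proof -
 have g: "gr_left_module A M" and fd: "vfin K (kspace A M)" using M by (auto simp: fmod_def)
 interpret M: graded M by (rule gr_graded[OF g])
 let ?\<phi> = "%x. SOME y. y : carrier M \<and> x \<ominus>\<^bsub>M\<^esub> y : H"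
 have sub: "additive_subgroup H M" using H by (simp add: gr_submodule_def)
 note HD = additive_subgroupD[OF sub]
 have ref: "x \<ominus>\<^bsub>M\<^esub> x : H" if "x : carrier M" for x using that HD(2) M.r_neg by (simp add: a_minus_def)
 have sy: "y \<ominus>\<^bsub>M\<^esub> x : H" if "x : carrier M" "y : carrier M" "x \<ominus>\<^bsub>M\<^esub> y : H" for x y
  using HD(4)[OF that(3)] that by (simp add: a_minus_def M.minus_add M.a_comm)
 have tr: "x \<ominus>\<^bsub>M\<^esub> z : H" if "x : carrier M" "y : carrier M" "z : carrier M" "x \<ominus>\<^bsub>M\<^esub> y : H" "y \<ominus>\<^bsub>M\<^esub> z : H" for x y z
 proof -
  have "(x \<ominus>\<^bsub>M\<^esub> y) \<oplus>\<^bsub>M\<^esub> (y \<ominus>\<^bsub>M\<^esub> z) = x \<ominus>\<^bsub>M\<^esub> z"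
   using that by (simp add: a_minus_def M.a_assoc M.r_neg1)
  then show ?thesis using HD(3)[OF that(4,5)] by simp
 qed
 have \<phi>1: "?\<phi> x : carrier M \<and> x \<ominus>\<^bsub>M\<^esub> ?\<phi> x : H" if "x : carrier M" for x
  by (rule someI[of "%y. y : carrier M \<and> x \<ominus>\<^bsub>M\<^esub> y : H" x]) (use that ref in simp)
 have \<phi>: "?\<phi> x = ?\<phi> y \<longleftrightarrow> x \<ominus>\<^bsub>M\<^esub> y : H" if x: "x : carrier M" and y: "y : carrier M" for x y
 proof
  assume "?\<phi> x = ?\<phi> y"
  then show "x \<ominus>\<^bsub>M\<^esub> y : H" using \<phi>1[OF x] \<phi>1[OF y] tr[of x "?\<phi> x" y] sy[of y "?\<phi> y"] x y by simp
 next
  assume xy: "x \<ominus>\<^bsub>M\<^esub> y : H"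
  have "z : carrier M \<and> x \<ominus>\<^bsub>M\<^esub> z : H \<longleftrightarrow> z : carrier M \<and> y \<ominus>\<^bsub>M\<^esub> z : H" for z
   using xy x y tr[of x y z] tr[of y x z] sy[of x y] by blast
  then show "?\<phi> x = ?\<phi> y" by simp
 qed
 interpret Q: quotient_map A M H ?\<phi>
  by unfold_locales (use g H \<phi> in auto)
 have grA: "!!i. gr A i <= carrier A" using GA.gr_closed(1) by blast
 have gQ: "gr_left_module A (quot_mod M H)" unfolding quot_mod_def by (rule Q.Q_gr_left_module[OF grA])
 note gS = submodule_gr_left_module[OF g H grA]
 have ex: "exact_pair (sub_mod M H) M (quot_mod M H) (%x. x) ?\<phi>"
  unfolding exact_pair_def quot_mod_def
  using Q.\<phi>_hom Q.\<phi>_zero_iff HD(1) gS(2) module_hom_addhom[of "%x. x" A "sub_mod M H" M]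
  by (auto simp: Q.Q_sel gr_hom_iff)
 have h: "?\<phi> : gr_hom A M (quot_mod M H)" unfolding quot_mod_def by (rule Q.\<phi>_gr_hom)
 show "short_exact A (sub_mod M H) M (quot_mod M H)"
  unfolding short_exact_exact_pair by (intro bexI[OF _ gS(2)] bexI[OF _ h] ex)
 have mh: "(%x. x) : module_hom A (sub_mod M H) M" "?\<phi> : module_hom A M (quot_mod M H)"
  using gS(2) h by (auto simp: gr_hom_iff)
 show "H = carrier M" if z: "carrier (quot_mod M H) = {\<zero>\<^bsub>quot_mod M H\<^esub>}"
 proof -
  have "H = {x \<in> carrier M. ?\<phi> x = \<zero>\<^bsub>quot_mod M H\<^esub>}" using ex by (simp add: exact_pair_def)
  moreover have "?\<phi> x = \<zero>\<^bsub>quot_mod M H\<^esub>" if x: "x : carrier M" for x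
  proof -
   have "addhom M (quot_mod M H) ?\<phi>" using ex by (simp only: exact_pair_def simp_thms)
   from addhom_closed[OF this x] show ?thesis by (simp only: z singleton_iff)
  qed
  ultimately show ?thesis by blast
 qed
 have ex': "exact_pair (kspace A (sub_mod M H)) (kspace A M) (kspace A (quot_mod M H)) (%x. x) ?\<phi>"
  using ex by (simp add: exact_pair_def addhom_def)
 note v = vdim_exact[OF kspace_vs[OF gr_modD(1)[OF gS(1)]] kspace_vs[OF gr_modD(1)[OF g]]
   kspace_vs[OF gr_modD(1)[OF gQ]] module_hom_kspace[OF mh(1)] module_hom_kspace[OF mh(2)] ex' fd]
 show "fmod K A (sub_mod M H)" "fmod K A (quot_mod M H)" using v gS(1) gQ by (auto simp: fmod_def)
 show "vdim K (kspace A M) = vdim K (kspace A (sub_mod M H)) + vdim K (kspace A (quot_mod M H))" by (rule v(3))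
qed

end

section \<open>Linear extension of functions to formal sums\<close>

definition frag_sum :: "('b => 'c::comm_ring_1) => ('b \<Rightarrow>\<^sub>0 int) => 'c" where
 "frag_sum \<phi> u = (\<Sum>x \<in> keys u. of_int (Poly_Mapping.lookup u x) * \<phi> x)"

lemma frag_sum_superset:
 assumes "finite S" "keys u <= S"
 shows "frag_sum \<phi> u = (\<Sum>x\<in>S. of_int (Poly_Mapping.lookup u x) * \<phi> x)"
 unfolding frag_sum_def using assms by (intro sum.mono_neutral_left) (auto simp: in_keys_iff)

lemma frag_sum_0 [simp]: "frag_sum \<phi> 0 = 0"
 by (simp add: frag_sum_def)

lemma frag_sum_of [simp]: "frag_sum \<phi> (frag_of x) = \<phi> x"
 by (simp add: frag_sum_def)

lemma frag_sum_add: "frag_sum \<phi> (u + v) = frag_sum \<phi> u + frag_sum \<phi> v"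
proof -
 let ?S = "keys u \<union> keys v"
 have "keys (u + v) <= ?S" by (rule Poly_Mapping.keys_add)
 then show ?thesis
  by (simp add: frag_sum_superset[of ?S] lookup_add distrib_right sum.distrib)
qed

lemma frag_sum_minus: "frag_sum \<phi> (- u) = - frag_sum \<phi> u"
 by (simp add: frag_sum_def sum_negf)

lemma frag_sum_diff: "frag_sum \<phi> (u - v) = frag_sum \<phi> u - frag_sum \<phi> v"
 using frag_sum_add[of \<phi> u "- v"] by (simp add: frag_sum_minus)

lemma frag_sum_cong:
 "(!!x. x : keys u ==> \<phi> x = \<phi>' x) ==> frag_sum \<phi> u = frag_sum \<phi>' u"
 by (simp add: frag_sum_def)

lemma frag_sum_extend: "frag_sum \<phi> (frag_extend f u) = frag_sum (%x. frag_sum \<phi> (f x)) u"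
 by (rule frag_induct[of u UNIV]) (simp_all add: frag_extend_diff frag_sum_diff)

lemma frag_sum_swap: "frag_sum (%x. frag_sum (\<phi> x) v) u = frag_sum (%y. frag_sum (%x. \<phi> x y) u) v"
 by (simp add: frag_sum_def sum_distrib_left mult.left_commute sum.swap[of _ "keys v"])

lemma frag_sum_fun_add: "frag_sum (%x. \<phi> x + \<phi>' x) u = frag_sum \<phi> u + frag_sum \<phi>' u"
 by (simp add: frag_sum_def distrib_left sum.distrib)

section \<open>Relations of Grothendieck groups\<close>

lemma K0_relators: "{frag_of M - frag_of M' - frag_of M'' | M M' M''.
  M : C \<and> M' : C \<and> M'' : C \<and> short_exact A M' M M''} <= carrier (free_Abelian_group C)"
proof -
 have "keys (frag_of M - frag_of M' - frag_of M'') <= C" if "M : C" "M' : C" "M'' : C" for M M' M''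
  using keys_diff[of "frag_of M - frag_of M'" "frag_of M''"] keys_diff[of "frag_of M" "frag_of M'"] that by auto
 then show ?thesis by auto
qed

lemmas K0_rels = free_generate[OF K0_relators, folded K0_rels_def]

lemma K0_rels_exact:
 assumes "M : C" "M' : C" "M'' : C" "short_exact A M' M M''"
 shows "frag_of M - frag_of M' - frag_of M'' : K0_rels A C"
 unfolding K0_rels_def using assms by (intro generate.incl) blast

lemma K0_rels_induct [consumes 1, case_names zero add minus exact]:
 assumes "u : K0_rels A C" "P 0" "!!a b. [|P a; P b|] ==> P (a + b)" "!!a. P a ==> P (- a)"
  and ex: "!!M M' M''. [|M : C; M' : C; M'' : C; short_exact A M' M M''|]
   ==> P (frag_of M - frag_of M' - frag_of M'')"
 shows "P u"
 using assms(1) unfolding K0_rels_def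
proof (induction rule: generate.induct)
 case (inv h)
 then obtain M M' M'' where h: "h = frag_of M - frag_of M' - frag_of M''" "M : C" "M' : C" "M'' : C" "short_exact A M' M M''"
  by blast
 have "h : carrier (free_Abelian_group C)" using inv K0_relators[of C A] by (rule subsetD[rotated])
 then have "keys h <= C" by simp
 then show ?case using assms(4)[OF ex[OF h(2-5)]] h(1) by simp
qed (use assms in auto)

lemma K0_class_coset: "K0_class A C u = {v. v - u : K0_rels A C}"
 using free_generate_coset[OF K0_relators] by (simp add: K0_class_def K0_rels_def)

lemma K0_class_eq_iff: "K0_class A C u = K0_class A C v \<longleftrightarrow> u - v : K0_rels A C"
 using free_generate_coset_eq[OF K0_relators] by (simp add: K0_class_def K0_rels_def)

lemma K0_rep: "rep (K0_class A C u) - u : K0_rels A C"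
proof -
 have "u : K0_class A C u" using K0_rels(1) by (simp add: K0_class_coset)
 then have "rep (K0_class A C u) : K0_class A C u" unfolding rep_def by (rule someI)
 then show ?thesis by (simp add: K0_class_coset)
qed

lemma K0_rep_keys:
 assumes "keys u <= C"
 shows "keys (rep (K0_class A C u)) <= C"
proof -
 have "keys (rep (K0_class A C u) - u) <= C" by (rule K0_rels(5)[OF K0_rep])
 then have "keys ((rep (K0_class A C u) - u) + u) <= C"
  using assms keys_add[of "rep (K0_class A C u) - u" u] by blast
 then show ?thesis by simp
qed

lemma K0_normal: "subgroup (K0_rels A C) (free_Abelian_group C)" "K0_rels A C \<lhd> free_Abelian_group C"
proof -
 show s: "subgroup (K0_rels A C) (free_Abelian_group C)"
  unfolding K0_rels_def by (intro group.generate_is_subgroup K0_relators) simp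
 show "K0_rels A C \<lhd> free_Abelian_group C"
  using abelian_free_Abelian_group comm_group.normal_iff_subgroup s by blast
qed

lemma K0_comm_group: "comm_group (K0 A C)"
 unfolding K0_def using comm_group.abelian_FactGroup[OF abelian_free_Abelian_group K0_normal(1)] .

lemma K0_carrier: "U : carrier (K0 A C) \<longleftrightarrow> (\<exists>u. keys u <= C \<and> U = K0_class A C u)"
 by (simp add: K0_def carrier_FactGroup K0_class_def image_iff Bex_def)

lemma K0_one: "\<one>\<^bsub>K0 A C\<^esub> = K0_class A C 0"
proof -
 have "\<one>\<^bsub>K0 A C\<^esub> = K0_rels A C" by (simp add: K0_def FactGroup_def)
 also have "\<dots> = K0_class A C 0" by (simp add: K0_class_coset)
 finally show ?thesis .
qed

lemma K0_mult:
 assumes "keys u <= C" "keys v <= C"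
 shows "K0_class A C u \<otimes>\<^bsub>K0 A C\<^esub> K0_class A C v = K0_class A C (u + v)"
 using normal.rcos_sum[OF K0_normal(2), of u C v A] assms by (simp add: K0_def FactGroup_def K0_class_def)

lemma K0_finprod:
 assumes "finite I" "!!i. i : I ==> keys (u i) <= C"
 shows "finprod (K0 A C) (%i. K0_class A C (u i)) I = K0_class A C (sum u I)"
 using assms
proof (induction I rule: finite_induct)
 case empty
 then show ?case by (simp add: comm_monoid.finprod_empty[OF comm_group.axioms(1)[OF K0_comm_group]] K0_one)
next
 case (insert i I)
 have "keys (sum u I) <= C" using keys_sum[of u I] insert by blast
 moreover have "K0_class A C (u j) : carrier (K0 A C)" if "j : insert i I" for j
  using insert.prems[OF that] unfolding K0_carrier by blast
 ultimately show ?case using insert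
  by (subst comm_monoid.finprod_insert[OF comm_group.axioms(1)[OF K0_comm_group]]) (simp_all add: K0_mult Pi_def)
qed

text \<open>A function that is additive on short exact sequences induces a function on the
  Grothendieck group.\<close>

lemma frag_sum_K0_rels:
 assumes "!!M M' M''. [|M : C; M' : C; M'' : C; short_exact A M' M M''|] ==> \<phi> M = \<phi> M' + \<phi> M''"
  and "u : K0_rels A C"
 shows "frag_sum \<phi> u = 0"
 using assms(2)
 by (induction rule: K0_rels_induct) (simp_all add: frag_sum_add frag_sum_minus frag_sum_diff assms(1))

lemma frag_extend_K0_rels:
 assumes "!!M M' M''. [|M : C; M' : C; M'' : C; short_exact A M' M M''|] ==> F M - F M' - F M'' : K0_rels B D"
  and "u : K0_rels A C"
 shows "frag_extend F u : K0_rels B D"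
 using assms(2)
 by (induction rule: K0_rels_induct)
  (simp_all add: frag_extend_add frag_extend_minus frag_extend_diff assms(1) K0_rels(1-3))

lemma frag_cmul_diff: "frag_cmul c (a - b) = frag_cmul c a - frag_cmul c b"
 by (rule poly_mapping_eqI) (simp add: lookup_minus right_diff_distrib)

lemma frag_extend_fun_diff:
 "frag_extend (%x. f x - g x) u = frag_extend f u - frag_extend g u"
 by (simp add: frag_extend_def frag_cmul_diff sum_subtractf)

lemma K0_rels_cmul: "v : K0_rels A C ==> frag_cmul c v : K0_rels A C"
 by (rule frag_closure_minus_cmul) (use K0_rels(1,4) in auto)

lemma frag_extend_mem_rels:
 assumes "!!x. x : keys u ==> f x : K0_rels A C"
 shows "frag_extend f (u :: 'b \<Rightarrow>\<^sub>0 int) : K0_rels A C"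
proof -
 have "sum g I : K0_rels A C" if "!!i. i : I ==> g i : K0_rels A C" for g and I :: "'b set"
  using that by (induction I rule: infinite_finite_induct) (simp_all add: K0_rels(1,2))
 then show ?thesis using assms by (simp add: frag_extend_def K0_rels_cmul)
qed

context galgebra begin

lemma copy_exact:
 assumes "pmod A L" "pmod A M" "pmod A N" "short_exact A L M N"
 shows "short_exact A (copy A L) (copy A M) (copy A N)"
 by (rule short_exact_iso[OF _ _ copy_pmod(2)[OF assms(1)] _ _ copy_pmod(2)[OF assms(2)] _ _ copy_pmod(2)[OF assms(3)] assms(4)])
  (use assms copy_pmod(1)[OF assms(1)] copy_pmod(1)[OF assms(2)] copy_pmod(1)[OF assms(3)] in \<open>auto simp: pmod_def\<close>)

text \<open>Isomorphic modules are identified by the exact sequences alone: with Z the zero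
  submodule, Z \<rightarrow> M \<rightarrow> M' gives [M] = [Z] + [M'], while Z \<rightarrow> Z
  \<rightarrow> Z gives [Z] = 0.\<close>

lemma iso_fmods_rels:
 assumes M: "M : fmods K A" "M' : fmods K A" "gr_iso A M M'"
 shows "frag_of M - frag_of M' : K0_rels A (fmods K A)"
proof -
 have f: "fmod K A M" "fmod K A M'" using M by (simp_all add: fmods_def)
 then have g: "gr_left_module A M" "gr_left_module A M'" by (simp_all add: fmod_def)
 interpret M: graded M by (rule gr_graded[OF g(1)])
 interpret M': graded M' by (rule gr_graded[OF g(2)])
 let ?Z = "sub_mod M {\<zero>\<^bsub>M\<^esub>}"
 note H = gr_submodule_zero[OF g(1)]
 have Z: "?Z : fmods K A" using submodule_exact(1)[OF f(1) H] by (simp add: fmods_def)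
 have grA: "!!i. gr A i <= carrier A" using GA.gr_closed(1) by blast
 note Zi = submodule_gr_left_module[OF g(1) H grA]
 obtain h where h: "h : gr_hom A M M'" "bij_betw h (carrier M) (carrier M')" using M(3) by (auto simp: gr_iso_def)
 have inj: "inj_on h (carrier M)" and surj: "h ` carrier M = carrier M'" using h(2) by (auto simp: bij_betw_def)
 have h0: "h \<zero>\<^bsub>M\<^esub> = \<zero>\<^bsub>M'\<^esub>"
  by (rule addhom_zero[OF M.ab M'.ab module_hom_addhom[of h A]]) (use h(1) in \<open>simp add: gr_hom_iff\<close>)
 have ker: "{x \<in> carrier M. h x = \<zero>\<^bsub>M'\<^esub>} = {\<zero>\<^bsub>M\<^esub>}"
 proof -
  have "x = \<zero>\<^bsub>M\<^esub>" if "x : carrier M" "h x = \<zero>\<^bsub>M'\<^esub>" for x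
   by (rule inj_onD[OF inj]) (use that h0 in simp_all)
  then show ?thesis using h0 by auto
 qed
 have "short_exact A ?Z M M'" unfolding short_exact_def
  by (intro bexI[OF _ Zi(2)] bexI[OF _ h(1)] conjI) (simp_all add: ker surj)
 from K0_rels_exact[OF M(1) Z M(2) this]
 have 1: "frag_of M - frag_of ?Z - frag_of M' : K0_rels A (fmods K A)" .
 have "(%x. x) : gr_hom A ?Z ?Z" by (simp add: gr_hom_iff module_hom_id)
 then have "short_exact A ?Z ?Z ?Z" unfolding short_exact_def
  by (intro bexI[of _ "%x. x"] conjI) auto
 from K0_rels_exact[OF Z Z Z this] have "- frag_of ?Z : K0_rels A (fmods K A)" by simp
 from K0_rels(4)[OF 1 this] show ?thesis by simp
qed

end

section \<open>Pairing and product on Grothendieck groups\<close>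

context nice_tower_alg begin

abbreviation "pm n \<equiv> pmods (Al n)"
abbreviation "fm n \<equiv> fmods K (Al n)"

lemma mp_exact:
 assumes "P : pm n" "L : fm n" "M : fm n" "N : fm n" "short_exact (Al n) L M N"
 shows "mp n P M = mp n P L + mp n P N"
 using W.PM_exact_right[of n P L M N] assms unfolding mp_def by (simp add: pmods_def fmods_def)

lemma mp_exact':
 assumes "L : pm n" "M : pm n" "N : pm n" "short_exact (Al n) L M N" "F : fm n"
 shows "mp n M F = mp n L F + mp n N F"
 using W.PM_exact_left[of n L M N F] assms unfolding mp_def by (simp add: pmods_def fmods_def)

text \<open>The pairing of formal sums, before passing to classes.\<close>

definition mpf :: "nat => (('a, 'a list) gr_module \<Rightarrow>\<^sub>0 int) => (('a, 'a list) gr_module \<Rightarrow>\<^sub>0 int) => laurent" where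
 "mpf n u v = frag_sum (%P. frag_sum (mp n P) v) u"

lemma mpf_zero [simp]: "mpf n 0 v = 0" "mpf n u 0 = 0"
 by (simp_all add: mpf_def) (simp add: frag_sum_def)

lemma mpf_diff: "mpf n (u - u') v = mpf n u v - mpf n u' v" "mpf n u (v - v') = mpf n u v - mpf n u v'"
proof -
 show "mpf n (u - u') v = mpf n u v - mpf n u' v" by (simp add: mpf_def frag_sum_diff)
 show "mpf n u (v - v') = mpf n u v - mpf n u v'"
  unfolding mpf_def frag_sum_swap[of "mp n"] by (simp add: frag_sum_diff)
qed

lemma mpf_rels:
 assumes "u : K0_rels (Al n) (pm n)" "keys v <= fm n"
 shows "mpf n u v = 0"
 unfolding mpf_def
proof (rule frag_sum_K0_rels[OF _ assms(1)])
 fix M M' M'' assume "M : pm n" "M' : pm n" "M'' : pm n" "short_exact (Al n) M' M M''"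
 then show "frag_sum (mp n M) v = frag_sum (mp n M') v + frag_sum (mp n M'') v"
  using assms(2) mp_exact'[of M' n M M''] unfolding frag_sum_fun_add[symmetric] by (intro frag_sum_cong) auto
qed

lemma mpf_rels':
 assumes "keys u <= pm n" "v : K0_rels (Al n) (fm n)"
 shows "mpf n u v = 0"
proof -
 have "frag_sum (mp n P) v = 0" if "P : keys u" for P
 proof (rule frag_sum_K0_rels[OF _ assms(2)])
  fix M M' M'' assume "M : fm n" "M' : fm n" "M'' : fm n" "short_exact (Al n) M' M M''"
  then show "mp n P M = mp n P M' + mp n P M''" using mp_exact[of P n M' M M''] that assms(1) by blast
 qed
 then have "mpf n u v = frag_sum (%P. 0) u" unfolding mpf_def by (rule frag_sum_cong)
 then show ?thesis by (simp add: frag_sum_def)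
qed

text \<open>\<open>K0_pairing\<close> evaluates at chosen representatives. These differ from u and v
  by relations, on which \<open>mpf\<close> vanishes in either argument by exactness.\<close>

lemma K0_pairing_class:
 assumes u: "keys u <= pm n" and v: "keys v <= fm n"
 shows "K0_pairing K \<A> n (K0_class (Al n) (pm n) u) (K0_class (Al n) (fm n) v) = mpf n u v"
proof -
 let ?u = "rep (K0_class (Al n) (pm n) u)" and ?v = "rep (K0_class (Al n) (fm n) v)"
 have "K0_pairing K \<A> n (K0_class (Al n) (pm n) u) (K0_class (Al n) (fm n) v) = mpf n ?u ?v"
  unfolding K0_pairing_def mpf_def frag_sum_def by (simp add: sum_distrib_left mult.assoc)
 also have "mpf n ?u ?v = mpf n u ?v"
  using mpf_rels[OF K0_rep K0_rep_keys[OF v, of "Al n"]] mpf_diff(1)[of n ?u u ?v] by simp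
 also have "\<dots> = mpf n u v"
  using mpf_rels'[OF u K0_rep] mpf_diff(2)[of n u ?v v] by simp
 finally show ?thesis .
qed

definition prodf :: "nat => nat => (('a, 'a list) gr_module \<Rightarrow>\<^sub>0 int) => (('a, 'a list) gr_module \<Rightarrow>\<^sub>0 int)
  => (('a, 'a list) gr_module \<Rightarrow>\<^sub>0 int)" where
 "prodf n m u v = frag_extend (%P. frag_extend (%P'. frag_of (copy (Al (n + m)) (IndT n m P P'))) v) u"

lemma prodf_zero [simp]: "prodf n m 0 v = 0" "prodf n m u 0 = 0"
 by (simp_all add: prodf_def frag_extend_eq_0)

lemma prodf_diff: "prodf n m (u - u') v = prodf n m u v - prodf n m u' v" "prodf n m u (v - v') = prodf n m u v - prodf n m u v'"
 by (simp_all add: prodf_def frag_extend_diff frag_extend_fun_diff)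

lemma prodf_keys:
 assumes "keys u <= pm n" "keys v <= pm m"
 shows "keys (prodf n m u v) <= pm (n + m)"
proof -
 have "copy (Al (n + m)) (IndT n m P P') : pm (n + m)" if "P : pm n" "P' : pm m" for P P'
  using G.copy_pmod(1)[OF IndT_pmod, of n P m P'] that by (simp add: pmods_def)
 then have "keys (frag_extend (%P'. frag_of (copy (Al (n + m)) (IndT n m P P'))) v) <= pm (n + m)"
  if "P : pm n" for P
  using keys_frag_extend[of "%P'. frag_of (copy (Al (n + m)) (IndT n m P P'))" v] assms(2) that by fastforce
 then show ?thesis
  using keys_frag_extend[of "%P. frag_extend (%P'. frag_of (copy (Al (n + m)) (IndT n m P P'))) v" u] assms(1)
  unfolding prodf_def by blast
qed

text \<open>For each P' occurring in v, an exact sequence in the left factor remains exact after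
  induction and after passing to copies, and so yields a relation; relations are closed under
  integer combinations over v.\<close>

lemma prodf_rels:
 assumes "u : K0_rels (Al n) (pm n)" "keys v <= pm m"
 shows "prodf n m u v : K0_rels (Al (n + m)) (pm (n + m))"
 unfolding prodf_def
proof (rule frag_extend_K0_rels[OF _ assms(1)])
 fix M M' M'' assume M: "M : pm n" "M' : pm n" "M'' : pm n" "short_exact (Al n) M' M M''"
 let ?c = "%M P'. copy (Al (n + m)) (IndT n m M P')"
 have "frag_of (?c M P') - frag_of (?c M' P') - frag_of (?c M'' P') : K0_rels (Al (n + m)) (pm (n + m))"
  if "P' : keys v" for P'
 proof -
  have P: "pmod (Al m) P'" and pM: "pmod (Al n) M" "pmod (Al n) M'" "pmod (Al n) M''"
   using that assms(2) M by (auto simp: pmods_def)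
  note i = IndT_pmod[OF pM(1) P] IndT_pmod[OF pM(2) P] IndT_pmod[OF pM(3) P]
  show ?thesis
   by (rule K0_rels_exact)
    (use G.copy_pmod(1) i G.copy_exact[OF i(2,1,3) IndT_exact_left[OF pM(2,1,3) _ M(4)]] P in
     \<open>auto simp: pmods_def pmod_def\<close>)
 qed
 then show "frag_extend (%P'. frag_of (?c M P')) v - frag_extend (%P'. frag_of (?c M' P')) v -
   frag_extend (%P'. frag_of (?c M'' P')) v : K0_rels (Al (n + m)) (pm (n + m))"
  unfolding frag_extend_fun_diff[symmetric] by (rule frag_extend_mem_rels)
qed

lemma prodf_rels':
 assumes "keys u <= pm n" "v : K0_rels (Al m) (pm m)"
 shows "prodf n m u v : K0_rels (Al (n + m)) (pm (n + m))"
 unfolding prodf_def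
proof (rule frag_extend_mem_rels, rule frag_extend_K0_rels[OF _ assms(2)])
 fix P M M' M'' assume P': "P : keys u"
  and M: "M : pm m" "M' : pm m" "M'' : pm m" "short_exact (Al m) M' M M''"
 let ?c = "%M. copy (Al (n + m)) (IndT n m P M)"
 have P: "pmod (Al n) P" and pM: "pmod (Al m) M" "pmod (Al m) M'" "pmod (Al m) M''"
  using P' assms(1) M by (auto simp: pmods_def)
 note i = IndT_pmod[OF P pM(1)] IndT_pmod[OF P pM(2)] IndT_pmod[OF P pM(3)]
 show "frag_of (?c M) - frag_of (?c M') - frag_of (?c M'') : K0_rels (Al (n + m)) (pm (n + m))"
  by (rule K0_rels_exact)
   (use G.copy_pmod(1) i G.copy_exact[OF i(2,1,3) IndT_exact_right[OF pM(2,1,3) _ M(4)]] P in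
    \<open>auto simp: pmods_def pmod_def\<close>)
qed

lemma K0_prod_class:
 assumes u: "keys u <= pm n" and v: "keys v <= pm m"
 shows "K0_prod K \<A> n m (K0_class (Al n) (pm n) u) (K0_class (Al m) (pm m) v) =
  K0_class (Al (n + m)) (pm (n + m)) (prodf n m u v)"
proof -
 let ?u = "rep (K0_class (Al n) (pm n) u)" and ?v = "rep (K0_class (Al m) (pm m) v)"
 have "K0_prod K \<A> n m (K0_class (Al n) (pm n) u) (K0_class (Al m) (pm m) v) =
   K0_class (Al (n + m)) (pm (n + m)) (prodf n m ?u ?v)"
  by (simp add: K0_prod_def prodf_def)
 also have "\<dots> = K0_class (Al (n + m)) (pm (n + m)) (prodf n m u ?v)"
  unfolding K0_class_eq_iff prodf_diff[symmetric] by (rule prodf_rels[OF K0_rep K0_rep_keys[OF v]])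
 also have "\<dots> = K0_class (Al (n + m)) (pm (n + m)) (prodf n m u v)"
  unfolding K0_class_eq_iff prodf_diff[symmetric] by (rule prodf_rels'[OF u K0_rep])
 finally show ?thesis .
qed

section \<open>Direct sums over the tower\<close>

type_synonym 'b frag_family = "nat => (('b, 'b list) gr_module \<Rightarrow>\<^sub>0 int)"

definition pcl :: "'a frag_family => 'a k_elem" where
 "pcl u = (%n. K0_class (Al n) (pm n) (u n))"

definition fcl :: "'a frag_family => 'a k_elem" where
 "fcl v = (%n. K0_class (Al n) (fm n) (v n))"

text \<open>Finitely supported families of formal sums; by \<open>sum_group_K0\<close> they
  represent all elements of the direct sums of Grothendieck groups.\<close>

definition fam :: "(nat => ('a, 'a list) gr_module set) => 'a frag_family set" where
 "fam C = {u. (\<forall>n. keys (u n) <= C n) \<and> finite {n. u n ~= 0}}"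

lemma sum_group_K0:
 fixes C :: "nat => ('a, 'a list) gr_module set"
 shows "carrier (sum_group UNIV (%n. K0 (Al n) (C n))) = (%u n. K0_class (Al n) (C n) (u n)) ` fam C"
  (is "?L = ?f ` _")
proof -
 have g: "!!n. group (K0 (Al n) (C n))" by (rule comm_group.axioms(2)[OF K0_comm_group])
 have L: "?L = {x. (\<forall>n. x n : carrier (K0 (Al n) (C n))) \<and> finite {n. x n ~= \<one>\<^bsub>K0 (Al n) (C n)\<^esub>}}"
  using g by (subst carrier_sum_group) (auto simp: PiE_def Pi_def)
 show ?thesis
 proof (intro subset_antisym subsetI)
  fix x assume "x : ?L"
  then have x: "!!n. x n : carrier (K0 (Al n) (C n))" and fin: "finite {n. x n ~= \<one>\<^bsub>K0 (Al n) (C n)\<^esub>}"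
   by (auto simp: L)
  have "\<forall>n. \<exists>u. keys u <= C n \<and> x n = K0_class (Al n) (C n) u"
   using x K0_carrier by blast
  from choice[OF this] obtain u where u: "!!n. keys (u n) <= C n" "!!n. x n = K0_class (Al n) (C n) (u n)"
   by blast
  \<comment> \<open>A trivial class may have been given a nonzero formal sum. Resetting it to 0
    makes the family of formal sums finitely supported, like the family of classes.\<close>
  let ?u = "%n. if x n = \<one>\<^bsub>K0 (Al n) (C n)\<^esub> then 0 else u n"
  have "finite {n. ?u n ~= 0}" by (rule finite_subset[OF _ fin]) auto
  then have uf: "?u : fam C" using u(1) by (simp add: fam_def)
  have xf: "x = ?f ?u"
  proof
   fix n show "x n = ?f ?u n" using u(2)[of n] by (simp add: K0_one)
  qed
  show "x : ?f ` fam C" by (rule image_eqI[of x ?f, OF xf uf])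
 next
  fix x assume "x : ?f ` fam C"
  then obtain u where u: "u : fam C" "x = ?f u" by blast
  have "finite {n. x n ~= \<one>\<^bsub>K0 (Al n) (C n)\<^esub>}"
   by (rule finite_subset[of _ "{n. u n ~= 0}"]) (use u in \<open>auto simp: K0_one fam_def\<close>)
  moreover have "x n : carrier (K0 (Al n) (C n))" for n
   unfolding K0_carrier using u by (auto simp: fam_def)
  ultimately show "x : ?L" by (simp add: L)
 qed
qed

lemma KP_carrier: "carrier (KP \<A>) = pcl ` fam pm"
 unfolding KP_def sum_group_K0 by (simp add: pcl_def[abs_def])

lemma GF_carrier: "carrier (GF K \<A>) = fcl ` fam fm"
 unfolding GF_def sum_group_K0 by (simp add: fcl_def[abs_def])

lemma KP_one: "\<one>\<^bsub>KP \<A>\<^esub> = pcl (%_. 0)" and GF_one: "\<one>\<^bsub>GF K \<A>\<^esub> = fcl (%_. 0)"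
 by (simp_all add: KP_def GF_def pcl_def fcl_def K0_one restrict_def)

lemma pclass_pcl: "pclass \<A> p P = pcl ((%_. 0)(p := frag_of (copy (Al p) P)))"
 and fclass_fcl: "fclass K \<A> n N = fcl ((%_. 0)(n := frag_of (copy (Al n) N)))"
 by (simp_all add: pclass_def fclass_def KP_one GF_one pcl_def fcl_def fun_eq_iff)

lemma fam_single: "M : C n ==> (%_. 0)(n := frag_of M) : fam C"
 by (simp add: fam_def)

text \<open>A degree in which the class of u is trivial may still carry a nonzero formal sum, but
  this consists of relations and pairs to 0. Hence the sum may run over any finite set containing
  the support of u.\<close>

lemma pairing_classes:
 assumes u: "u : fam pm" and v: "v : fam fm" and S: "finite S" "{n. u n ~= 0} <= S"
 shows "pairing K \<A> (pcl u) (fcl v) = (\<Sum>n\<in>S. mpf n (u n) (v n))"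
proof -
 have k: "K0_pairing K \<A> n (pcl u n) (fcl v n) = mpf n (u n) (v n)" for n
  unfolding pcl_def fcl_def by (rule K0_pairing_class) (use u v in \<open>auto simp: fam_def\<close>)
 have z: "mpf n (u n) (v n) = 0" if "pcl u n = \<one>\<^bsub>KP \<A>\<^esub> n" for n
 proof -
  have "u n - 0 : K0_rels (Al n) (pm n)"
   using that unfolding KP_one pcl_def K0_class_eq_iff .
  then show ?thesis using mpf_rels[of "u n" n "v n"] v by (simp add: fam_def)
 qed
 have "pairing K \<A> (pcl u) (fcl v) = (\<Sum>n | pcl u n ~= \<one>\<^bsub>KP \<A>\<^esub> n. mpf n (u n) (v n))"
  by (simp add: pairing_def k)
 also have "\<dots> = (\<Sum>n\<in>S. mpf n (u n) (v n))"
 proof (rule sum.mono_neutral_left[OF S(1)])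
  show "{n. pcl u n ~= \<one>\<^bsub>KP \<A>\<^esub> n} <= S"
  proof
   fix n assume "n : {n. pcl u n ~= \<one>\<^bsub>KP \<A>\<^esub> n}"
   then have "u n ~= 0" by (auto simp: KP_one pcl_def)
   then show "n : S" using S(2) by blast
  qed
 qed (use z in auto)
 finally show ?thesis .
qed

text \<open>The right factor lives in degree p alone, so the component of the product in degree k
  has the single term coming from k - p, and none if k < p.\<close>

lemma KP_mult_pcl:
 assumes u: "u : fam pm" and P: "P : pm p"
 defines "w \<equiv> %k. if p \<le> k then prodf (k - p) p (u (k - p)) (frag_of P) else 0"
 shows "KP_mult K \<A> (pcl u) (pcl ((%_. 0)(p := frag_of P))) = pcl w" "w : fam pm"
proof -
 let ?a = "(%_. 0)(p := frag_of P)"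
 have uk: "keys (u n) <= pm n" for n using u by (simp add: fam_def)
 have ak: "keys (?a n) <= pm n" for n using P by simp
 show "KP_mult K \<A> (pcl u) (pcl ?a) = pcl w"
 proof
  fix k
  have kk: "keys (prodf n (k - n) (u n) (?a (k - n))) <= pm k" if "n \<le> k" for n
   using prodf_keys[OF uk ak, of n "k - n"] that by simp
  have kc: "K0_class (Al k) (pm k) (prodf n (k - n) (u n) (?a (k - n))) : carrier (K0 (Al k) (pm k))" if "n \<le> k" for n
   unfolding K0_carrier using kk[OF that] by blast
  have "K0_prod K \<A> n (k - n) (pcl u n) (pcl ?a (k - n)) = K0_class (Al k) (pm k) (prodf n (k - n) (u n) (?a (k - n)))"
   if "n \<le> k" for n
   using K0_prod_class[OF uk ak, of n "k - n"] that by (simp add: pcl_def)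
  then have "KP_mult K \<A> (pcl u) (pcl ?a) k =
    finprod (K0 (Al k) (pm k)) (%n. K0_class (Al k) (pm k) (prodf n (k - n) (u n) (?a (k - n)))) {..k}"
   unfolding KP_mult_def
   by (intro comm_monoid.finprod_cong'[OF comm_group.axioms(1)[OF K0_comm_group]])
    (use kc in \<open>simp_all del: fun_upd_apply\<close>)
  also have "\<dots> = K0_class (Al k) (pm k) (\<Sum>n\<le>k. prodf n (k - n) (u n) (?a (k - n)))"
   by (rule K0_finprod) (use kk in auto)
  also have "(\<Sum>n\<le>k. prodf n (k - n) (u n) (?a (k - n))) = w k"
  proof (cases "p \<le> k")
   case True
   have "(\<Sum>n\<le>k. prodf n (k - n) (u n) (?a (k - n))) = (\<Sum>n\<in>{k - p}. prodf n (k - n) (u n) (?a (k - n)))"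
    by (rule sum.mono_neutral_right) (use True in auto)
   then show ?thesis using True by (simp add: w_def)
  next
   case False
   then have "prodf n (k - n) (u n) (?a (k - n)) = 0" if "n \<le> k" for n using that by (cases "k - n = p") auto
   then show ?thesis using False by (simp add: w_def)
  qed
  finally show "KP_mult K \<A> (pcl u) (pcl ?a) k = pcl w k" by (simp add: pcl_def)
 qed
 have "{k. w k ~= 0} <= (%m. m + p) ` {m. u m ~= 0}"
 proof
  fix k assume "k : {k. w k ~= 0}"
  then have "p \<le> k" "u (k - p) ~= 0" by (auto simp: w_def split: if_splits)
  then show "k : (%m. m + p) ` {m. u m ~= 0}" by (intro image_eqI[of _ _ "k - p"]) auto
 qed
 moreover have "finite {m. u m ~= 0}" using u by (simp add: fam_def)
 ultimately have "finite {k. w k ~= 0}" by (meson finite_imageI finite_subset)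
 moreover have "keys (w k) <= pm k" for k
  using prodf_keys[OF uk, of "frag_of P" p "k - p"] P by (cases "p \<le> k") (simp_all add: w_def)
 ultimately show "w : fam pm" by (simp add: fam_def)
qed

text \<open>The prospective adjoint on representatives: TR_P applied termwise. It lowers degrees by
  p, so the components of v in degrees below p are discarded.\<close>

definition adj :: "nat => ('a, 'a list) gr_module => 'a frag_family => 'a frag_family" where
 "adj p P v = (%m. frag_extend (%M. frag_of (copy (Al m) (TRm m p P M))) (v (m + p)))"

lemma adj_fam:
 assumes v: "v : fam fm" and P: "P : pm p"
 shows "adj p P v : fam fm"
proof -
 have "finite ((%m. m + p) -` {n. v n ~= 0})"
  by (rule finite_vimageI) (use v in \<open>auto simp: fam_def\<close>)
 moreover have "{m. adj p P v m ~= 0} <= (%m. m + p) -` {n. v n ~= 0}"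
  by (auto simp: adj_def)
 ultimately have "finite {m. adj p P v m ~= 0}" by (rule rev_finite_subset)
 moreover have "keys (adj p P v m) <= fm m" for m
 proof -
  have "copy (Al m) (TRm m p P M) : fm m" if "M : keys (v (m + p))" for M
  proof -
   have "fmod K (Al (m + p)) M" using that v by (auto simp: fam_def fmods_def)
   then show ?thesis using G.copy_fmod(1)[OF TR_fmod[of p P m M]] P by (simp add: fmods_def pmods_def)
  qed
  then show ?thesis unfolding adj_def
   using keys_frag_extend[of "%M. frag_of (copy (Al m) (TRm m p P M))" "v (m + p)"] by fastforce
 qed
 ultimately show ?thesis by (simp add: fam_def)
qed

text \<open>\<open>mp_adjunction\<close> for each pair of terms, extended bilinearly. The degrees on
  the two sides are matched by m \<mapsto> m + p.\<close>

theorem pairing_adj: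
 assumes u: "u : fam pm" and v: "v : fam fm" and P: "P : pm p"
 shows "pairing K \<A> (pcl u) (fcl (adj p P v)) =
  pairing K \<A> (KP_mult K \<A> (pcl u) (pcl ((%_. 0)(p := frag_of P)))) (fcl v)"
proof -
 let ?w = "%k. if p \<le> k then prodf (k - p) p (u (k - p)) (frag_of P) else 0"
 let ?S = "{m. u m ~= 0}"
 have S: "finite ?S" using u by (simp add: fam_def)
 note w = KP_mult_pcl[OF u P]
 have S': "{k. ?w k ~= 0} <= (%m. m + p) ` ?S"
 proof
  fix k assume "k : {k. ?w k ~= 0}"
  then have "p \<le> k" "u (k - p) ~= 0" by (auto split: if_splits)
  then show "k : (%m. m + p) ` ?S" by (intro image_eqI[of _ _ "k - p"]) auto
 qed
 have "mpf m (u m) (adj p P v m) = mpf (m + p) (?w (m + p)) (v (m + p))" for m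
 proof -
  have L: "pmod (Al m) L" if "L : keys (u m)" for L using that u by (auto simp: fam_def pmods_def)
  have N: "fmod K (Al (m + p)) N" if "N : keys (v (m + p))" for N using that v by (auto simp: fam_def fmods_def)
  have "mpf m (u m) (adj p P v m) =
    frag_sum (%L. frag_sum (%N. mp m L (copy (Al m) (TRm m p P N))) (v (m + p))) (u m)"
   by (simp add: mpf_def adj_def frag_sum_extend)
  also have "\<dots> = frag_sum (%L. frag_sum (mp (m + p) (copy (Al (m + p)) (IndT m p L P))) (v (m + p))) (u m)"
   by (intro frag_sum_cong) (use mp_adjunction[OF L _ N, symmetric] P in \<open>simp add: pmods_def\<close>)
  also have "\<dots> = mpf (m + p) (?w (m + p)) (v (m + p))"
   by (simp add: mpf_def prodf_def frag_sum_extend)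
  finally show ?thesis .
 qed
 then have "pairing K \<A> (pcl u) (fcl (adj p P v)) = (\<Sum>m\<in>?S. mpf (m + p) (?w (m + p)) (v (m + p)))"
  by (simp add: pairing_classes[OF u adj_fam[OF v P] S subset_refl])
 also have "\<dots> = (\<Sum>k\<in>(%m. m + p) ` ?S. mpf k (?w k) (v k))"
  by (subst sum.reindex) (simp_all add: inj_on_def)
 also have "\<dots> = pairing K \<A> (KP_mult K \<A> (pcl u) (pcl ((%_. 0)(p := frag_of P)))) (fcl v)"
  unfolding w(1) by (rule pairing_classes[OF w(2) v finite_imageI[OF S] S', symmetric])
 finally show ?thesis .
qed

end

section \<open>Graded simple modules\<close>

lemma additive_subgroup_restrict:
 assumes "abelian_group M" "additive_subgroup H M" "additive_subgroup J M" "J <= H"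
  and N: "carrier N = H" "add N = add M" "\<zero>\<^bsub>N\<^esub> = \<zero>\<^bsub>M\<^esub>"
 shows "additive_subgroup J N"
 by (rule additive_subgroupI'[OF abelian_group_sub(1)[OF assms(1,2) N]])
  (use additive_subgroupD[OF assms(3)] assms(4) N abelian_group_sub(2)[OF assms(1,2) N] in auto)

lemma additive_subgroup_image:
 assumes "abelian_group M" "abelian_group N" "addhom M N f" "additive_subgroup H M"
 shows "additive_subgroup (f ` H) N"
proof (rule additive_subgroupI'[OF assms(2)])
 note HD = additive_subgroupD[OF assms(4)]
 show "f ` H <= carrier N" using HD(1) addhom_closed[OF assms(3)] by blast
 show "\<zero>\<^bsub>N\<^esub> : f ` H" using HD(2) addhom_zero[OF assms(1-3)] by (metis imageI)
 fix u assume "u : f ` H"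
 then obtain x where x: "x : H" "u = f x" by blast
 show "\<ominus>\<^bsub>N\<^esub> u : f ` H" unfolding x(2)
  using addhom_minus[OF assms(1-3) HD(1)[OF x(1)]] HD(4)[OF x(1)] by (metis imageI)
 fix v assume "v : f ` H"
 then obtain y where y: "y : H" "v = f y" by blast
 show "u \<oplus>\<^bsub>N\<^esub> v : f ` H" unfolding x(2) y(2)
  using addhom_add[OF assms(3) HD(1)[OF x(1)] HD(1)[OF y(1)]] HD(3)[OF x(1) y(1)] by (metis imageI)
qed

section \<open>The degree zero part of a nice algebra\<close>

context galgebra begin

lemma A_vs: "vectorspace K A"
 using K_left_module field_K by (simp add: vectorspace_left_module)

text \<open>The action of K on A/I is defined through a chosen element of the coset. It does not
  depend on the choice, since c acts as the algebra element \<open>sc c\<close> and I is an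
  ideal.\<close>

lemma quot_space:
 assumes I: "ideal I A"
 shows "left_module K (quot_space A I)" "(%x. I +>\<^bsub>A\<^esub> x) : module_hom K A (quot_space A I)"
  "!!x y. [|x : carrier A; y : carrier A; I +>\<^bsub>A\<^esub> x = I +>\<^bsub>A\<^esub> y|] ==> x \<ominus>\<^bsub>A\<^esub> y : I"
proof -
 interpret I: ideal I A by (rule I)
 let ?W = "quot_space A I" and ?\<phi> = "%x. I +>\<^bsub>A\<^esub> x"
 have sel: "carrier ?W = carrier (A Quot I)" "add ?W = add (A Quot I)" "\<zero>\<^bsub>?W\<^esub> = \<zero>\<^bsub>A Quot I\<^esub>"
  by (simp_all add: quot_space_def)
 have ab: "abelian_group ?W"
  by (rule abelian_group_cong[OF sel[symmetric]]) (rule ring.is_abelian_group[OF I.quotient_is_ring])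
 have car: "carrier ?W = ?\<phi> ` carrier A" by (auto simp: sel FactRing_def A_RCOSETS_def')
 have add: "?\<phi> (x \<oplus>\<^bsub>A\<^esub> y) = ?\<phi> x \<oplus>\<^bsub>?W\<^esub> ?\<phi> y" if "x : carrier A" "y : carrier A" for x y
  using I.a_rcos_sum[OF that] by (simp add: sel FactRing_def)
 have sm: "c \<odot>\<^bsub>?W\<^esub> ?\<phi> x = ?\<phi> (c \<odot>\<^bsub>A\<^esub> x)" if c: "c : carrier K" and x: "x : carrier A" for c x
 proof -
  define y where "y = (SOME z. z : ?\<phi> x)"
  have "y : ?\<phi> x" unfolding y_def by (rule someI[of "%z. z : ?\<phi> x" x]) (rule I.a_rcos_self[OF x])
  then obtain h where h: "h : I" "y = h \<oplus>\<^bsub>A\<^esub> x" by (auto simp: a_r_coset_def')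
  have hc: "h : carrier A" using h(1) I.a_subset by blast
  have "c \<odot>\<^bsub>A\<^esub> h : I" using I.I_l_closed[OF h(1) sc_closed[OF c]] sc_mult(1)[OF c hc] by simp
  moreover have "c \<odot>\<^bsub>A\<^esub> y = c \<odot>\<^bsub>A\<^esub> h \<oplus>\<^bsub>A\<^esub> c \<odot>\<^bsub>A\<^esub> x" using h(2) hc c x by (simp add: KA.smult_r_distr)
  ultimately have "c \<odot>\<^bsub>A\<^esub> y : ?\<phi> (c \<odot>\<^bsub>A\<^esub> x)" by (auto simp: a_r_coset_def')
  from A.a_repr_independence[OF this _ I.a_subgroup] show ?thesis using c x by (simp add: quot_space_def y_def)
 qed
 show "(%x. I +>\<^bsub>A\<^esub> x) : module_hom K A ?W"
  by (rule module_homI, rule addhomI) (auto simp: car add sm)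
 show "left_module K ?W"
  unfolding left_module_def
 proof (intro conjI ballI)
  fix c d X assume cd: "c : carrier K" "d : carrier K" and "X : carrier ?W"
  then obtain x where x: "x : carrier A" "X = ?\<phi> x" by (auto simp: car)
  show "(c \<oplus>\<^bsub>K\<^esub> d) \<odot>\<^bsub>?W\<^esub> X = (c \<odot>\<^bsub>?W\<^esub> X) \<oplus>\<^bsub>?W\<^esub> (d \<odot>\<^bsub>?W\<^esub> X)"
   "(c \<otimes>\<^bsub>K\<^esub> d) \<odot>\<^bsub>?W\<^esub> X = c \<odot>\<^bsub>?W\<^esub> (d \<odot>\<^bsub>?W\<^esub> X)"
   using cd x by (simp_all add: sm add[symmetric] KA.smult_l_distr KA.smult_assoc1)
 next
  fix c X Y assume c: "c : carrier K" and "X : carrier ?W" "Y : carrier ?W"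
  then obtain x y where x: "x : carrier A" "X = ?\<phi> x" "y : carrier A" "Y = ?\<phi> y" by (auto simp: car)
  show "c \<odot>\<^bsub>?W\<^esub> (X \<oplus>\<^bsub>?W\<^esub> Y) = (c \<odot>\<^bsub>?W\<^esub> X) \<oplus>\<^bsub>?W\<^esub> (c \<odot>\<^bsub>?W\<^esub> Y)"
   using c x by (simp add: sm add[symmetric] KA.smult_r_distr)
 next
  fix X assume "X : carrier ?W"
  then obtain x where x: "x : carrier A" "X = ?\<phi> x" by (auto simp: car)
  show "\<one>\<^bsub>K\<^esub> \<odot>\<^bsub>?W\<^esub> X = X" using x by (simp add: sm)
 next
  fix c X assume "c : carrier K" "X : carrier ?W"
  then show "c \<odot>\<^bsub>?W\<^esub> X : carrier ?W" by (auto simp: car sm)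
 qed (use ab K.ring_axioms in simp_all)
 show "x \<ominus>\<^bsub>A\<^esub> y : I" if xy: "x : carrier A" "y : carrier A" and eq: "?\<phi> x = ?\<phi> y" for x y
 proof -
  have "x : ?\<phi> y" using I.a_rcos_self[OF xy(1)] eq by simp
  then obtain h where h: "h : I" "x = h \<oplus>\<^bsub>A\<^esub> y" by (auto simp: a_r_coset_def')
  have "x \<ominus>\<^bsub>A\<^esub> y = h"
   using h xy(2) I.a_subset by (auto simp: a_minus_def A.a_assoc A.r_neg)
  then show ?thesis using h(1) by simp
 qed
qed

lemma A0_ksub: "ksub K A (gr A 0)"
 using GA.gr_sub A_gr_smult by (simp add: ksub_def)

text \<open>The quotient map embeds the degree zero part of A into A/I; the inverse of the embedding
  carries finite dimension back from its image.\<close>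

lemma nice_degree_zero:
 assumes "nice K A"
 shows "vfin K (A\<lparr>carrier := gr A 0\<rparr>)"
proof -
 obtain I where I: "ideal I A" and z: "!!x. x : I ==> hcomp A 0 x = \<zero>\<^bsub>A\<^esub>" and fd: "vfin K (quot_space A I)"
  using assms unfolding nice_def gr_ideal_def by (metis order_refl)
 note q = quot_space[OF I]
 let ?W = "quot_space A I" and ?\<phi> = "%x. I +>\<^bsub>A\<^esub> x" and ?A0 = "A\<lparr>carrier := gr A 0\<rparr>"
 have vW: "vectorspace K ?W" using q(1) field_K by (simp add: vectorspace_left_module)
 have v0: "vectorspace K ?A0" by (rule ksub_vs[OF A_vs A0_ksub])
 let ?H = "?\<phi> ` gr A 0" and ?W' = "?W\<lparr>carrier := ?\<phi> ` gr A 0\<rparr>"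
 have "additive_subgroup ?H ?W"
  by (rule additive_subgroup_image[OF GA.ab left_moduleD(2)[OF q(1)] module_hom_addhom[OF q(2)] GA.gr_sub])
 moreover have "c \<odot>\<^bsub>?W\<^esub> X : ?H" if c: "c : carrier K" and X: "X : ?H" for c X
 proof -
  obtain x where x: "x : gr A 0" "X = ?\<phi> x" using X by blast
  show ?thesis unfolding x(2)
   using module_hom_smult[OF q(2) c GA.gr_closed(1)[OF x(1)]] A_gr_smult[OF c x(1)] by (metis imageI)
 qed
 ultimately have kH: "ksub K ?W ?H" by (simp add: ksub_def)
 have f: "?\<phi> : module_hom K ?A0 ?W'"
  using q(2) GA.gr_closed(1) by (auto simp: module_hom_def)
 have inj: "inj_on ?\<phi> (carrier ?A0)"
 proof (rule inj_onI)
  fix x y assume xy: "x : carrier ?A0" "y : carrier ?A0" "?\<phi> x = ?\<phi> y"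
  then have g: "x : gr A 0" "y : gr A 0" and c: "x : carrier A" "y : carrier A" using GA.gr_closed(1) by auto
  \<comment> \<open>The difference is homogeneous of degree zero, hence equal to its own degree zero
    component, which vanishes because it lies in I.\<close>
  have "x \<ominus>\<^bsub>A\<^esub> y = hcomp A 0 (x \<ominus>\<^bsub>A\<^esub> y)"
   using GA.hcomp_homog[OF additive_subgroup_diff[OF GA.gr_sub g], of 0] by simp
  also have "\<dots> = \<zero>\<^bsub>A\<^esub>" by (rule z[OF q(3)[OF c xy(3)]])
  finally show "x = y" using c by simp
 qed
 have surj: "?\<phi> ` carrier ?A0 = carrier ?W'" by simp
 have l0: "left_module K ?A0" using v0 by (simp add: vectorspace_left_module)
 note g = module_hom_inv[OF l0 f inj surj]
 have bij: "bij_betw (the_inv_into (carrier ?A0) ?\<phi>) (carrier ?W') (carrier ?A0)"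
  by (rule bij_betw_the_inv_into) (simp only: bij_betw_def inj surj simp_thms)
 show ?thesis
  by (rule vdim_bij(1)[OF ksub_vs[OF vW kH] v0 g ksub_vfin(1)[OF vW fd kH]])
   (use bij in \<open>simp_all add: bij_betw_def\<close>)
qed

lemma hcomp_smult:
 assumes M: "gr_left_module A M" and y: "y : gr M i" and a: "a : carrier A"
 shows "hcomp M k (a \<odot>\<^bsub>M\<^esub> y) = hcomp A (k - i) a \<odot>\<^bsub>M\<^esub> y"
proof -
 interpret M: graded M by (rule gr_graded[OF M])
 have yc: "y : carrier M" by (rule M.gr_closed(1)[OF y])
 note sm = left_module_addhom(2)[OF gr_modD(1)[OF M] yc]
 show ?thesis
 proof (rule GA.addhom_eqI[OF M.ab addhom_comp[OF sm M.hcomp_addhom] addhom_comp[OF GA.hcomp_addhom sm] _ a])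
  fix j a assume aj: "a : gr A j"
  show "hcomp M k (a \<odot>\<^bsub>M\<^esub> y) = hcomp A (k - i) a \<odot>\<^bsub>M\<^esub> y"
   using M.hcomp_homog[OF gr_modD(3)[OF M aj y], of k] GA.hcomp_homog[OF aj, of "k - i"]
    left_module_zero(2)[OF gr_modD(1)[OF M] yc] by (auto split: if_splits)
 qed
qed

text \<open>A y is closed under components because y is homogeneous, so it is a nonzero graded
  submodule and must be all of S.\<close>

lemma simple_cyclic:
 assumes S: "gr_simple A S" and y: "y : gr S i" "y ~= \<zero>\<^bsub>S\<^esub>" and s: "s : carrier S"
 shows "\<exists>a \<in> carrier A. s = a \<odot>\<^bsub>S\<^esub> y"
proof -
 have M: "gr_left_module A S" using S by (simp add: gr_simple_def)
 interpret S: graded S by (rule gr_graded[OF M])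
 note SD = left_moduleD[OF gr_modD(1)[OF M]]
 have yc: "y : carrier S" by (rule S.gr_closed(1)[OF y(1)])
 let ?N = "(%a. a \<odot>\<^bsub>S\<^esub> y) ` carrier A"
 have "additive_subgroup (carrier A) A" by (rule additive_subgroupI'[OF GA.ab]) auto
 then have "additive_subgroup ?N S"
  by (rule additive_subgroup_image[OF GA.ab S.ab left_module_addhom(2)[OF gr_modD(1)[OF M] yc]])
 moreover have "b \<odot>\<^bsub>S\<^esub> x : ?N" if bx: "b : carrier A" "x : ?N" for b x
 proof -
  obtain a where a: "a : carrier A" "x = a \<odot>\<^bsub>S\<^esub> y" by (rule imageE[OF bx(2)])
  show ?thesis unfolding a(2) by (rule image_eqI[of _ _ "b \<otimes>\<^bsub>A\<^esub> a"]) (use bx(1) a(1) SD(6)[OF bx(1) a(1) yc] in simp_all)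
 qed
 moreover have "hcomp S k x : ?N" if "x : ?N" for x k
  using that hcomp_smult[OF M y(1)] GA.hcomp_closed by auto
 ultimately have "gr_submodule A S ?N" by (simp add: gr_submodule_def)
 moreover have "y : ?N" by (rule image_eqI[of _ _ "\<one>\<^bsub>A\<^esub>"]) (use SD(7)[OF yc] in simp_all)
 ultimately have "?N = carrier S" using S y(2) unfolding gr_simple_def by blast
 then show ?thesis using s by auto
qed

text \<open>Some a sends z to y, and its component of degree i - k does so too. This lets
  computations leave degree i and come back to it.\<close>

lemma simple_return:
 assumes S: "gr_simple A S" and z: "z : gr S k" "z ~= \<zero>\<^bsub>S\<^esub>" and y: "y : gr S i"
 obtains b where "b : gr A (i - k)" "y = b \<odot>\<^bsub>S\<^esub> z"
proof -
 have M: "gr_left_module A S" using S by (simp add: gr_simple_def)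
 interpret S: graded S by (rule gr_graded[OF M])
 obtain a where a: "a : carrier A" "y = a \<odot>\<^bsub>S\<^esub> z"
  using simple_cyclic[OF S z S.gr_closed(1)[OF y]] by blast
 have "y = hcomp S i y" using S.hcomp_homog[OF y, of i] by simp
 also have "\<dots> = hcomp A (i - k) a \<odot>\<^bsub>S\<^esub> z" unfolding a(2) by (rule hcomp_smult[OF M z(1) a(1)])
 finally show thesis using that GA.hcomp_gr[OF a(1)] by blast
qed

text \<open>S and T are both generated by one element of degree i with the same annihilator, so a y
  \<mapsto> a z is an isomorphism; the common degree of y and z makes it homogeneous of degree
  0.\<close>

lemma simple_iso:
 assumes S: "gr_simple A S" and T: "gr_simple A T" and y: "y : gr S i" "y ~= \<zero>\<^bsub>S\<^esub>"
  and z: "z : gr T i" "z ~= \<zero>\<^bsub>T\<^esub>"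
  and ann: "!!a. a : carrier A ==> a \<odot>\<^bsub>S\<^esub> y = \<zero>\<^bsub>S\<^esub> \<longleftrightarrow> a \<odot>\<^bsub>T\<^esub> z = \<zero>\<^bsub>T\<^esub>"
 shows "gr_iso A S T"
proof -
 have M: "gr_left_module A S" "gr_left_module A T" using S T by (simp_all add: gr_simple_def)
 interpret S: graded S by (rule gr_graded[OF M(1)])
 interpret T: graded T by (rule gr_graded[OF M(2)])
 note SD = left_moduleD[OF gr_modD(1)[OF M(1)]] and TD = left_moduleD[OF gr_modD(1)[OF M(2)]]
 have yc: "y : carrier S" and zc: "z : carrier T" using S.gr_closed(1)[OF y(1)] T.gr_closed(1)[OF z(1)] by auto
 note yh = left_module_addhom(2)[OF gr_modD(1)[OF M(1)] yc]
  and zh = left_module_addhom(2)[OF gr_modD(1)[OF M(2)] zc]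
 have eq: "a \<odot>\<^bsub>S\<^esub> y = b \<odot>\<^bsub>S\<^esub> y \<longleftrightarrow> a \<odot>\<^bsub>T\<^esub> z = b \<odot>\<^bsub>T\<^esub> z" if ab: "a : carrier A" "b : carrier A" for a b
  using ann[of "a \<ominus>\<^bsub>A\<^esub> b"] ab addhom_diff[OF GA.ab S.ab yh ab] addhom_diff[OF GA.ab T.ab zh ab] SD(3) TD(3) yc zc
  by simp
 \<comment> \<open>Different choices of a with s = a y give the same a z, because y and z have equal
   annihilators.\<close>
 define \<phi> where "\<phi> s = (SOME a. a : carrier A \<and> s = a \<odot>\<^bsub>S\<^esub> y) \<odot>\<^bsub>T\<^esub> z" for s
 have \<phi>: "\<phi> (a \<odot>\<^bsub>S\<^esub> y) = a \<odot>\<^bsub>T\<^esub> z" if a: "a : carrier A" for a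
 proof -
  let ?b = "SOME b. b : carrier A \<and> a \<odot>\<^bsub>S\<^esub> y = b \<odot>\<^bsub>S\<^esub> y"
  have "?b : carrier A \<and> a \<odot>\<^bsub>S\<^esub> y = ?b \<odot>\<^bsub>S\<^esub> y" by (rule someI[of _ a]) (use a in simp)
  then show ?thesis using eq[OF a, of ?b] by (simp add: \<phi>_def)
 qed
 have h: "\<phi> : module_hom A S T"
 proof (rule module_homI, rule addhomI)
  fix s assume "s : carrier S"
  then obtain a where a: "a : carrier A" "s = a \<odot>\<^bsub>S\<^esub> y" using simple_cyclic[OF S y] by blast
  show "\<phi> s : carrier T" using a TD(3) zc by (simp add: \<phi>)
  show "\<phi> (c \<odot>\<^bsub>S\<^esub> s) = c \<odot>\<^bsub>T\<^esub> \<phi> s" if "c : carrier A" for c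
   using a that SD(6)[OF that a(1) yc, symmetric] TD(6)[OF that a(1) zc] by (simp add: \<phi>)
  fix t assume "t : carrier S"
  then obtain b where b: "b : carrier A" "t = b \<odot>\<^bsub>S\<^esub> y" using simple_cyclic[OF S y] by blast
  show "\<phi> (s \<oplus>\<^bsub>S\<^esub> t) = \<phi> s \<oplus>\<^bsub>T\<^esub> \<phi> t"
   using a b SD(4)[OF a(1) b(1) yc, symmetric] TD(4)[OF a(1) b(1) zc] by (simp add: \<phi>)
 qed
 have g: "\<phi> ` gr S k <= gr T k" for k
 proof
  fix t assume "t : \<phi> ` gr S k"
  then obtain s where s: "s : gr S k" "t = \<phi> s" by blast
  obtain b where b: "b : gr A (k - i)" "s = b \<odot>\<^bsub>S\<^esub> y" by (rule simple_return[OF S y s(1)])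
  show "t : gr T k" using gr_modD(3)[OF M(2) b(1) z(1)] s(2) b \<phi>[OF GA.gr_closed(1)[OF b(1)]] by simp
 qed
 have "inj_on \<phi> (carrier S)"
 proof (rule inj_onI)
  fix s t assume st: "s : carrier S" "t : carrier S" "\<phi> s = \<phi> t"
  obtain a where a: "a : carrier A" "s = a \<odot>\<^bsub>S\<^esub> y" using simple_cyclic[OF S y st(1)] by blast
  obtain b where b: "b : carrier A" "t = b \<odot>\<^bsub>S\<^esub> y" using simple_cyclic[OF S y st(2)] by blast
  show "s = t" using st(3) eq[OF a(1) b(1)] a b by (simp add: \<phi>)
 qed
 moreover have "\<phi> ` carrier S = carrier T"
 proof (intro subset_antisym subsetI)
  show "t : carrier T" if "t : \<phi> ` carrier S" for t
   using that addhom_closed[OF module_hom_addhom[OF h]] by blast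
  fix t assume "t : carrier T"
  then obtain a where a: "a : carrier A" "t = a \<odot>\<^bsub>T\<^esub> z" using simple_cyclic[OF T z] by blast
  then show "t : \<phi> ` carrier S" using SD(3)[OF a(1) yc] by (intro image_eqI[of _ _ "a \<odot>\<^bsub>S\<^esub> y"]) (simp_all add: \<phi>)
 qed
 ultimately show ?thesis using h g by (auto simp: gr_iso_def gr_hom_iff bij_betw_def)
qed

end

section \<open>Minimal left ideals and idempotents\<close>

context galgebra begin

definition left_ideal0 :: "'a set => bool" where
 "left_ideal0 J \<longleftrightarrow> additive_subgroup J A \<and> J <= gr A 0 \<and> (\<forall>d \<in> gr A 0. \<forall>x \<in> J. d \<otimes>\<^bsub>A\<^esub> x : J)"

lemma A0_mult: "[|a : gr A 0; b : gr A 0|] ==> a \<otimes>\<^bsub>A\<^esub> b : gr A 0"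
 using A_gr_mult[of a 0 b 0] by simp

text \<open>Scalars lie in degree zero (\<open>sc_gr\<close>), so left ideals of the degree zero
  part are subspaces and have a dimension.\<close>

lemma left_ideal0_ksub:
 assumes J: "left_ideal0 J" "left_ideal0 J'" "J' <= J"
 shows "ksub K (A\<lparr>carrier := J\<rparr>) J'"
proof -
 have "c \<odot>\<^bsub>A\<^esub> x : J'" if c: "c : carrier K" and x: "x : J'" for c x
  using J(2) sc_gr[OF c] sc_mult(1)[OF c, of x] x GA.gr_closed(1) unfolding left_ideal0_def by (metis subsetD)
 moreover have "additive_subgroup J' (A\<lparr>carrier := J\<rparr>)"
  by (rule additive_subgroup_restrict[OF GA.ab, of J]) (use J in \<open>simp_all add: left_ideal0_def\<close>)
 ultimately show ?thesis by (simp add: ksub_def)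
qed

lemma left_ideal0_A0: "left_ideal0 (gr A 0)"
 using GA.gr_sub A0_mult by (simp add: left_ideal0_def)

lemma left_ideal0_mult:
 assumes J: "left_ideal0 J" and c: "c : J"
 shows "left_ideal0 ((%x. x \<otimes>\<^bsub>A\<^esub> c) ` J)" "(%x. x \<otimes>\<^bsub>A\<^esub> c) ` J <= J"
proof -
 have JD: "additive_subgroup J A" "J <= gr A 0" "!!d x. [|d : gr A 0; x : J|] ==> d \<otimes>\<^bsub>A\<^esub> x : J"
  using J by (auto simp: left_ideal0_def)
 have cl: "x : carrier A" if "x : J" for x using that JD(2) GA.gr_closed(1) by blast
 show sub: "(%x. x \<otimes>\<^bsub>A\<^esub> c) ` J <= J" using JD(2,3) c by blast
 have "addhom A A (%x. x \<otimes>\<^bsub>A\<^esub> c)" using cl[OF c] by (auto intro!: addhomI simp: A.l_distr)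
 from additive_subgroup_image[OF GA.ab GA.ab this JD(1)]
 have 1: "additive_subgroup ((%x. x \<otimes>\<^bsub>A\<^esub> c) ` J) A" .
 have "d \<otimes>\<^bsub>A\<^esub> u : (%x. x \<otimes>\<^bsub>A\<^esub> c) ` J" if d: "d : gr A 0" and u: "u : (%x. x \<otimes>\<^bsub>A\<^esub> c) ` J" for d u
 proof -
  obtain x where x: "x : J" "u = x \<otimes>\<^bsub>A\<^esub> c" using u by blast
  have "d \<otimes>\<^bsub>A\<^esub> u = (d \<otimes>\<^bsub>A\<^esub> x) \<otimes>\<^bsub>A\<^esub> c"
   using x(2) A.m_assoc[OF GA.gr_closed(1)[OF d] cl[OF x(1)] cl[OF c]] by simp
  then show ?thesis using JD(3)[OF d x(1)] by (rule image_eqI)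
 qed
 then show "left_ideal0 ((%x. x \<otimes>\<^bsub>A\<^esub> c) ` J)" using 1 sub JD(2) by (auto simp: left_ideal0_def)
qed

text \<open>The idempotent is found in a left ideal \<open>J\<close> of the degree zero part that is of minimal
  dimension among those acting nontrivially on the given homogeneous component: for
  every \<open>c \<in> J\<close> fixing a nonzero vector \<open>y\<close> minimality gives \<open>J c = J\<close>.\<close>

lemma isolating_idempotent:
 fixes S :: "('a, 'm) gr_module"
 assumes fd: "vfin K (A\<lparr>carrier := gr A 0\<rparr>)" and S: "gr_simple A S" and y0: "y0 : gr S i" "y0 ~= \<zero>\<^bsub>S\<^esub>"
 obtains e y where "e : gr A 0" "e \<otimes>\<^bsub>A\<^esub> e = e" "y : gr S i" "y ~= \<zero>\<^bsub>S\<^esub>" "e \<odot>\<^bsub>S\<^esub> y = y"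
  "!!T :: ('a, 'm) gr_module. !!x. [|gr_simple A T; x : gr T i; e \<odot>\<^bsub>T\<^esub> x ~= \<zero>\<^bsub>T\<^esub>|] ==> gr_iso A S T"
proof -
 have M: "gr_left_module A S" using S by (simp add: gr_simple_def)
 interpret S: graded S by (rule gr_graded[OF M])
 note SD = left_moduleD[OF gr_modD(1)[OF M]]
 define acts where "acts J \<longleftrightarrow> (\<exists>x \<in> J. \<exists>y \<in> gr S i. x \<odot>\<^bsub>S\<^esub> y ~= \<zero>\<^bsub>S\<^esub>)" for J
 have "left_ideal0 (gr A 0) \<and> acts (gr A 0)"
  using left_ideal0_A0 one_gr y0 SD(7)[OF S.gr_closed(1)[OF y0(1)]] unfolding acts_def by metis
 from ex_has_least_nat[of "%J. left_ideal0 J \<and> acts J", OF this, of "%J. vdim K (A\<lparr>carrier := J\<rparr>)"]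
 obtain J where J: "left_ideal0 J" "acts J"
  and min: "!!J'. [|left_ideal0 J'; acts J'|] ==> vdim K (A\<lparr>carrier := J\<rparr>) \<le> vdim K (A\<lparr>carrier := J'\<rparr>)" by blast
 let ?V = "A\<lparr>carrier := J\<rparr>"
 have JD: "additive_subgroup J A" "J <= gr A 0" "!!d x. [|d : gr A 0; x : J|] ==> d \<otimes>\<^bsub>A\<^esub> x : J"
  using J(1) by (auto simp: left_ideal0_def)
 have g0: "x : gr A 0" if "x : J" for x using that JD(2) by blast
 have cl: "x : carrier A" if "x : J" for x using g0[OF that] GA.gr_closed(1) by blast
 have v0: "vectorspace K (A\<lparr>carrier := gr A 0\<rparr>)" by (rule ksub_vs[OF A_vs A0_ksub])
 have vV: "vectorspace K ?V"
  using ksub_vs[OF v0 left_ideal0_ksub[OF left_ideal0_A0 J(1) JD(2)]] by simp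
 have fV: "vfin K ?V"
  using ksub_vfin(1)[OF v0 fd left_ideal0_ksub[OF left_ideal0_A0 J(1) JD(2)]] by simp
 \<comment> \<open>J c is a left ideal inside J that still acts nontrivially, so its dimension is
   not smaller than that of J, and the two coincide.\<close>
 have all: "(%x. x \<otimes>\<^bsub>A\<^esub> c) ` J = J" if c: "c : J" and x: "x : J" "x \<otimes>\<^bsub>A\<^esub> c \<odot>\<^bsub>S\<^esub> y ~= \<zero>\<^bsub>S\<^esub>" and y: "y : gr S i" for c x y
 proof -
  let ?J' = "(%x. x \<otimes>\<^bsub>A\<^esub> c) ` J"
  note J' = left_ideal0_mult[OF J(1) c]
  have "acts ?J'" unfolding acts_def using x y by blast
  from min[OF J'(1) this] have "vdim K ?V \<le> vdim K (?V\<lparr>carrier := ?J'\<rparr>)" by simp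
  moreover note k = left_ideal0_ksub[OF J(1) J'(1,2)]
  ultimately have "vdim K (?V\<lparr>carrier := ?J'\<rparr>) = vdim K ?V" using ksub_vfin(2)[OF vV fV k] by simp
  from ksub_dim_eq[OF vV fV k this] show ?thesis by simp
 qed
 obtain j0 y where j0: "j0 : J" and y: "y : gr S i" and j0y: "j0 \<odot>\<^bsub>S\<^esub> y ~= \<zero>\<^bsub>S\<^esub>" using J(2) by (auto simp: acts_def)
 have yc: "y : carrier S" by (rule S.gr_closed(1)[OF y])
 have yn: "y ~= \<zero>\<^bsub>S\<^esub>" using j0y left_module_zero(1)[OF gr_modD(1)[OF M] cl[OF j0]] by auto
 have j0g: "j0 \<odot>\<^bsub>S\<^esub> y : gr S i" using gr_modD(3)[OF M g0[OF j0] y] by simp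
 \<comment> \<open>By simplicity an element of degree zero leads from j0 y back to y; multiplying j0
   by it gives an element of J that fixes y.\<close>
 obtain d where d: "d : gr A (i - i)" "y = d \<odot>\<^bsub>S\<^esub> (j0 \<odot>\<^bsub>S\<^esub> y)" by (rule simple_return[OF S j0g j0y y])
 define j where "j = d \<otimes>\<^bsub>A\<^esub> j0"
 have j: "j : J" unfolding j_def using JD(3) d(1) j0 by simp
 have jy: "j \<odot>\<^bsub>S\<^esub> y = y" unfolding j_def using SD(6)[OF GA.gr_closed(1)[OF d(1)] cl[OF j0] yc] d(2) by simp
 have Rj: "(%x. x \<otimes>\<^bsub>A\<^esub> j) ` J = J"
  by (rule all[OF j j _ y]) (simp add: SD(6)[OF cl[OF j] cl[OF j] yc] jy yn)
 have "j : (%x. x \<otimes>\<^bsub>A\<^esub> j) ` J" using j by (simp only: Rj)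
 \<comment> \<open>J j = J contains j, which gives e j = j. Consequently e also fixes y = j
   y.\<close>
 then obtain e where e: "e : J" "e \<otimes>\<^bsub>A\<^esub> j = j" by auto
 note ec = cl[OF e(1)] and jc = cl[OF j]
 \<comment> \<open>Right multiplication by j maps J onto itself, so by finite dimension it is
   injective on J, and it kills e e - e.\<close>
 have ee: "e \<otimes>\<^bsub>A\<^esub> e = e"
 proof -
  have hom: "(%x. x \<otimes>\<^bsub>A\<^esub> j) : module_hom K ?V ?V"
   using left_ideal0_mult(2)[OF J(1) j] cl jc
   by (intro module_homI addhomI) (auto simp: A.l_distr smult_mult)
  have m: "e \<otimes>\<^bsub>A\<^esub> e \<ominus>\<^bsub>A\<^esub> e : J" by (rule additive_subgroup_diff[OF JD(1) JD(3)[OF g0[OF e(1)] e(1)] e(1)])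
  have "(e \<otimes>\<^bsub>A\<^esub> e \<ominus>\<^bsub>A\<^esub> e) \<otimes>\<^bsub>A\<^esub> j = (e \<otimes>\<^bsub>A\<^esub> e) \<otimes>\<^bsub>A\<^esub> j \<ominus>\<^bsub>A\<^esub> e \<otimes>\<^bsub>A\<^esub> j"
   using ec jc by (simp add: a_minus_def A.l_distr A.l_minus)
  also have "\<dots> = \<zero>\<^bsub>A\<^esub>" using ec jc e(2) A.m_assoc[OF ec ec jc] A.r_neg[OF jc] by (simp add: a_minus_def)
  finally have z: "(e \<otimes>\<^bsub>A\<^esub> e \<ominus>\<^bsub>A\<^esub> e) \<otimes>\<^bsub>A\<^esub> j = \<zero>\<^bsub>A\<^esub>" .
  have "e \<otimes>\<^bsub>A\<^esub> e \<ominus>\<^bsub>A\<^esub> e = \<zero>\<^bsub>A\<^esub>"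
   using vdim_surj_inj[OF vV fV hom, of "e \<otimes>\<^bsub>A\<^esub> e \<ominus>\<^bsub>A\<^esub> e"] m z Rj by simp
  then show ?thesis using ec by simp
 qed
 have ey: "e \<odot>\<^bsub>S\<^esub> y = y" using SD(6)[OF ec jc yc] e(2) jy by simp
 \<comment> \<open>Every element of J that fixes y has e as a left multiple. The contradictions
   below come from finding such an element that kills z.\<close>
 have key: "\<exists>x \<in> J. x \<otimes>\<^bsub>A\<^esub> c = e" if c: "c : J" and cy: "c \<odot>\<^bsub>S\<^esub> y = y" for c
 proof -
  have "(%x. x \<otimes>\<^bsub>A\<^esub> c) ` J = J"
   by (rule all[OF c e(1) _ y]) (simp add: SD(6)[OF ec cl[OF c] yc] cy ey yn)
  then have "e : (%x. x \<otimes>\<^bsub>A\<^esub> c) ` J" using e(1) by (simp only:)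
  then show ?thesis by auto
 qed
 have iso: "gr_iso A S T" if T: "gr_simple A T" and x: "x : gr T i" and ex: "e \<odot>\<^bsub>T\<^esub> x ~= \<zero>\<^bsub>T\<^esub>"
  for T :: "('a, 'm) gr_module" and x
 proof -
  have N: "gr_left_module A T" using T by (simp add: gr_simple_def)
  interpret T: graded T by (rule gr_graded[OF N])
  note TD = left_moduleD[OF gr_modD(1)[OF N]]
  define z where "z = e \<odot>\<^bsub>T\<^esub> x"
  have z: "z : gr T i" unfolding z_def using gr_modD(3)[OF N g0[OF e(1)] x] by simp
  have zn: "z ~= \<zero>\<^bsub>T\<^esub>" using ex by (simp add: z_def)
  have zc: "z : carrier T" by (rule T.gr_closed(1)[OF z])
  have ez: "e \<odot>\<^bsub>T\<^esub> z = z" unfolding z_def using TD(6)[OF ec ec T.gr_closed(1)[OF x]] ee by simp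
  \<comment> \<open>If a kills w' but not w, then some homogeneous component t of a does the same,
    and simplicity supplies b leading from t w back to w. The product b t has degree zero, fixes w
    and kills w'.\<close>
  have red: "\<exists>k t b. t : gr A (k - i) \<and> b : gr A (i - k) \<and> w = b \<odot>\<^bsub>U\<^esub> (t \<odot>\<^bsub>U\<^esub> w) \<and> t \<odot>\<^bsub>U'\<^esub> w' = \<zero>\<^bsub>U'\<^esub>"
   if U: "gr_simple A U" "gr_simple A U'" "w : gr U i" "w' : gr U' i"
    and a: "a : carrier A" "a \<odot>\<^bsub>U\<^esub> w ~= \<zero>\<^bsub>U\<^esub>" "a \<odot>\<^bsub>U'\<^esub> w' = \<zero>\<^bsub>U'\<^esub>"
   for U U' :: "('a, 'm) gr_module" and w w' a
  proof -
   have Mu: "gr_left_module A U" "gr_left_module A U'" using U by (simp_all add: gr_simple_def)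
   interpret U: graded U by (rule gr_graded[OF Mu(1)])
   interpret U': graded U' by (rule gr_graded[OF Mu(2)])
   have "a \<odot>\<^bsub>U\<^esub> w : carrier U"
    by (rule left_moduleD(3)[OF gr_modD(1)[OF Mu(1)] a(1) U.gr_closed(1)[OF U(3)]])
   then obtain k where k: "hcomp U k (a \<odot>\<^bsub>U\<^esub> w) ~= \<zero>\<^bsub>U\<^esub>" using U.hcomp_eq_zeroD a(2) by blast
   let ?t = "hcomp A (k - i) a"
   have t: "?t : gr A (k - i)" by (rule GA.hcomp_gr[OF a(1)])
   have tw: "?t \<odot>\<^bsub>U\<^esub> w ~= \<zero>\<^bsub>U\<^esub>" using k hcomp_smult[OF Mu(1) U(3) a(1), of k] by simp
   have tg: "?t \<odot>\<^bsub>U\<^esub> w : gr U k" using gr_modD(3)[OF Mu(1) t U(3)] by simp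
   obtain b where b: "b : gr A (i - k)" "w = b \<odot>\<^bsub>U\<^esub> (?t \<odot>\<^bsub>U\<^esub> w)" by (rule simple_return[OF U(1) tg tw U(3)])
   have "?t \<odot>\<^bsub>U'\<^esub> w' = hcomp U' k (a \<odot>\<^bsub>U'\<^esub> w')" using hcomp_smult[OF Mu(2) U(4) a(1), of k] by simp
   also have "\<dots> = \<zero>\<^bsub>U'\<^esub>" unfolding a(3) by (rule addhom_zero[OF U'.ab U'.ab U'.hcomp_addhom])
   finally show ?thesis using t b by blast
  qed
  have dJ: "(b \<otimes>\<^bsub>A\<^esub> t) \<otimes>\<^bsub>A\<^esub> e : J" "b \<otimes>\<^bsub>A\<^esub> t : carrier A" "b : carrier A" "t : carrier A"
   if "t : gr A (k - i)" "b : gr A (i - k)" for b t k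
   using JD(3)[of "b \<otimes>\<^bsub>A\<^esub> t" e] A_gr_mult[OF that(2,1)] e(1) GA.gr_closed(1) that by auto
  have dS: "((b \<otimes>\<^bsub>A\<^esub> t) \<otimes>\<^bsub>A\<^esub> e) \<odot>\<^bsub>S\<^esub> y = b \<odot>\<^bsub>S\<^esub> (t \<odot>\<^bsub>S\<^esub> y)" if "b : carrier A" "t : carrier A" for b t
   using that ec yc ey by (simp add: SD)
  have dT: "((b \<otimes>\<^bsub>A\<^esub> t) \<otimes>\<^bsub>A\<^esub> e) \<odot>\<^bsub>T\<^esub> z = b \<odot>\<^bsub>T\<^esub> (t \<odot>\<^bsub>T\<^esub> z)" if "b : carrier A" "t : carrier A" for b t
   using that ec zc ez by (simp add: TD)
  show ?thesis
  proof (rule simple_iso[OF S T y yn z zn], rule iffI)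
   fix a assume a: "a : carrier A" and ay: "a \<odot>\<^bsub>S\<^esub> y = \<zero>\<^bsub>S\<^esub>"
   show "a \<odot>\<^bsub>T\<^esub> z = \<zero>\<^bsub>T\<^esub>"
   proof (rule ccontr)
    assume "a \<odot>\<^bsub>T\<^esub> z ~= \<zero>\<^bsub>T\<^esub>"
    from red[OF T S z y a this ay] obtain k t b where t: "t : gr A (k - i)" and b: "b : gr A (i - k)"
     and bt: "z = b \<odot>\<^bsub>T\<^esub> (t \<odot>\<^bsub>T\<^esub> z)" "t \<odot>\<^bsub>S\<^esub> y = \<zero>\<^bsub>S\<^esub>" by blast
    define d where "d = (b \<otimes>\<^bsub>A\<^esub> t) \<otimes>\<^bsub>A\<^esub> e"
    note dj = dJ[OF t b]
    have d: "d : J" "d \<odot>\<^bsub>S\<^esub> y = \<zero>\<^bsub>S\<^esub>" "d \<odot>\<^bsub>T\<^esub> z = z"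
     unfolding d_def using dj(1) dS[OF dj(3,4)] dT[OF dj(3,4)] bt
      left_module_zero(1)[OF gr_modD(1)[OF M] dj(3)] by simp_all
    note dc = cl[OF d(1)]
    \<comment> \<open>Here d kills y and fixes z, so e - d fixes y and kills z. As a left multiple
      of e - d the idempotent e kills z too, contrary to e z = z.\<close>
    have "(e \<ominus>\<^bsub>A\<^esub> d) \<odot>\<^bsub>S\<^esub> y = e \<odot>\<^bsub>S\<^esub> y \<ominus>\<^bsub>S\<^esub> d \<odot>\<^bsub>S\<^esub> y"
     by (rule addhom_diff[OF GA.ab S.ab left_module_addhom(2)[OF gr_modD(1)[OF M] yc] ec dc])
    also have "\<dots> = y" using yc by (simp add: d(2) ey S.minus_eq)
    finally have "(e \<ominus>\<^bsub>A\<^esub> d) \<odot>\<^bsub>S\<^esub> y = y" .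
    from key[OF additive_subgroup_diff[OF JD(1) e(1) d(1)] this]
    obtain u where u: "u : J" "u \<otimes>\<^bsub>A\<^esub> (e \<ominus>\<^bsub>A\<^esub> d) = e" by blast
    have "(e \<ominus>\<^bsub>A\<^esub> d) \<odot>\<^bsub>T\<^esub> z = e \<odot>\<^bsub>T\<^esub> z \<ominus>\<^bsub>T\<^esub> d \<odot>\<^bsub>T\<^esub> z"
     by (rule addhom_diff[OF GA.ab T.ab left_module_addhom(2)[OF gr_modD(1)[OF N] zc] ec dc])
    also have "\<dots> = \<zero>\<^bsub>T\<^esub>" using zc T.r_neg by (simp add: d(3) ez T.minus_eq)
    finally have "u \<odot>\<^bsub>T\<^esub> ((e \<ominus>\<^bsub>A\<^esub> d) \<odot>\<^bsub>T\<^esub> z) = \<zero>\<^bsub>T\<^esub>"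
     using left_module_zero(1)[OF gr_modD(1)[OF N] cl[OF u(1)]] by simp
    moreover have "u \<odot>\<^bsub>T\<^esub> ((e \<ominus>\<^bsub>A\<^esub> d) \<odot>\<^bsub>T\<^esub> z) = z"
     using TD(6)[OF cl[OF u(1)] A.minus_closed[OF ec dc] zc] u(2) ez by simp
    ultimately show False using zn by simp
   qed
  next
   fix a assume a: "a : carrier A" and az: "a \<odot>\<^bsub>T\<^esub> z = \<zero>\<^bsub>T\<^esub>"
   show "a \<odot>\<^bsub>S\<^esub> y = \<zero>\<^bsub>S\<^esub>"
   proof (rule ccontr)
    assume "a \<odot>\<^bsub>S\<^esub> y ~= \<zero>\<^bsub>S\<^esub>"
    from red[OF S T y z a this az] obtain k t b where t: "t : gr A (k - i)" and b: "b : gr A (i - k)"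
     and bt: "y = b \<odot>\<^bsub>S\<^esub> (t \<odot>\<^bsub>S\<^esub> y)" "t \<odot>\<^bsub>T\<^esub> z = \<zero>\<^bsub>T\<^esub>" by blast
    define d where "d = (b \<otimes>\<^bsub>A\<^esub> t) \<otimes>\<^bsub>A\<^esub> e"
    note dj = dJ[OF t b]
    have d: "d : J" "d \<odot>\<^bsub>S\<^esub> y = y" "d \<odot>\<^bsub>T\<^esub> z = \<zero>\<^bsub>T\<^esub>"
     unfolding d_def using dj(1) dS[OF dj(3,4)] dT[OF dj(3,4)] bt
      left_module_zero(1)[OF gr_modD(1)[OF N] dj(3)] by simp_all
    \<comment> \<open>Now d itself fixes y and kills z, and so takes the place that e - d had in the
      other case.\<close>
    from key[OF d(1,2)] obtain u where u: "u : J" "u \<otimes>\<^bsub>A\<^esub> d = e" by blast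
    have "z = u \<odot>\<^bsub>T\<^esub> (d \<odot>\<^bsub>T\<^esub> z)" using TD(6)[OF cl[OF u(1)] cl[OF d(1)] zc] u(2) ez by simp
    also have "\<dots> = \<zero>\<^bsub>T\<^esub>" unfolding d(3) by (rule left_module_zero(1)[OF gr_modD(1)[OF N] cl[OF u(1)]])
    finally show False using zn by simp
   qed
  qed
 qed
 show thesis by (rule that[OF g0[OF e(1)] ee y yn ey iso])
qed

end

section \<open>The projective module of an idempotent\<close>

context twisted begin

text \<open>For f = \<psi> e and P = A f, the tensor product of the twisted P with M is a copy of e
  M: each x \<otimes> y can be rewritten with first factor f, and f absorbs e. As f has degree zero,
  degrees correspond; what is recorded is in which degrees the space vanishes.\<close>

lemma projective_of_idempotent:
 assumes e: "e : gr A 0" "e \<otimes>\<^bsub>A\<^esub> e = e"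
 obtains P :: "('a, 'a) gr_module" where "pmod A P"
  "!!(M :: ('a, 'm) gr_module) i. [|fmod K A M; !!x. x : gr M i ==> e \<odot>\<^bsub>M\<^esub> x = \<zero>\<^bsub>M\<^esub>|] ==> Poly_Mapping.lookup (gdim K (PM P M)) i = 0"
  "!!(M :: ('a, 'm) gr_module) i x. [|fmod K A M; x : gr M i; e \<odot>\<^bsub>M\<^esub> x ~= \<zero>\<^bsub>M\<^esub>|] ==> Poly_Mapping.lookup (gdim K (PM P M)) i ~= 0"
proof -
 have ec: "e : carrier A" by (rule GA.gr_closed(1)[OF e(1)])
 define f where "f = \<psi> e"
 have f0: "f : gr A 0" unfolding f_def using \<psi>(5) e(1) by blast
 have fc: "f : carrier A" by (rule GA.gr_closed(1)[OF f0])
 have ff: "f \<otimes>\<^bsub>A\<^esub> f = f" unfolding f_def using \<psi> ec e(2) by metis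
 have \<psi>f: "\<psi>i f = e" unfolding f_def by (rule \<psi>i(3)[OF ec])
 \<comment> \<open>The left ideal A f, described by the equation x f = x, which is readily checked
   on sums and on components.\<close>
 let ?H = "{x \<in> carrier A. x \<otimes>\<^bsub>A\<^esub> f = x}"
 have gR: "gr_left_module A (regular A)"
  using regular_left_module gr_A A_gr_mult graded_group_cong[of "regular A" A] by (simp add: gr_left_module_def)
 have HA: "x : carrier A" "x \<otimes>\<^bsub>A\<^esub> f = x" if "x : ?H" for x using that by auto
 have "additive_subgroup ?H A"
  by (rule additive_subgroupI'[OF GA.ab]) (use fc in \<open>auto simp: A.l_distr A.l_minus\<close>)
 then have Hs: "additive_subgroup ?H (regular A)" using additive_subgroup_cong[of "regular A" A] by simp
 have "hcomp (regular A) k x : ?H" if x: "x : ?H" for x k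
 proof -
  have "hcomp (regular A) k (x \<odot>\<^bsub>regular A\<^esub> f) = hcomp A (k - 0) x \<odot>\<^bsub>regular A\<^esub> f"
   by (rule hcomp_smult[OF gR _ HA(1)[OF x]]) (use f0 in simp)
  then have "hcomp (regular A) k x = hcomp A k x \<otimes>\<^bsub>A\<^esub> f" using HA(2)[OF x] by simp
  then show ?thesis using GA.hcomp_closed[OF HA(1)[OF x], of k] fc ff by (simp add: A.m_assoc)
 qed
 then have sub: "gr_submodule A (regular A) ?H"
  unfolding gr_submodule_def using Hs fc by (auto simp: A.m_assoc)
 define P where "P = sub_mod (regular A) ?H"
 have Psel: "carrier P = ?H" "smult P = (\<otimes>\<^bsub>A\<^esub>)" "add P = add A" "\<zero>\<^bsub>P\<^esub> = \<zero>\<^bsub>A\<^esub>" "gr P i = gr A i \<inter> ?H" for i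
  by (simp_all add: P_def)
 have grA: "!!i. gr A i <= carrier A" using GA.gr_closed(1) by blast
 have gP: "gr_left_module A P" unfolding P_def by (rule submodule_gr_left_module(1)[OF gR sub grA])
 interpret gP: graded P by (rule gr_graded[OF gP])
 have fP: "f : ?H" using fc ff by simp
 \<comment> \<open>One element is enough: x = x f on P, so the functional belonging to f is the
   inclusion of P in A.\<close>
 have d: "dual_basis A P {()} (%_. f) (%_ x. x)"
  unfolding dual_basis_def
  by (intro conjI) (use fP fc in \<open>auto simp: Psel addhom_def gP.finsum_insert\<close>)
 have pP: "pmod A P" by (rule dual_basis_pmod[OF gP d])
 have dim: "Poly_Mapping.lookup (gdim K (PM P M)) i = 0 \<longleftrightarrow> gr (PM P M) i = {\<zero>\<^bsub>PM P M\<^esub>}" if M: "fmod K A M"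
  for M :: "('a, 'm) gr_module" and i
 proof -
  note gs = PM_gr_space[OF gP M d]
  have v: "vectorspace K (PM P M)" "vfin K (PM P M)" using gs by (simp_all add: gr_space_def)
  note k = gr_space_ksub[OF gs, of i]
  show ?thesis
   using gdim_lookup[OF gs, of i] vdim_zero_iff[OF ksub_vs[OF v(1) k] ksub_vfin(1)[OF v k]] by simp
 qed
 show thesis
 proof (rule that[OF pP])
  fix M :: "('a, 'm) gr_module" and i
  assume M: "fmod K A M"
  then have gM: "gr_left_module A M" by (simp add: fmod_def)
  interpret M: graded M by (rule gr_graded[OF gM])
  note MD = left_moduleD[OF gr_modD(1)[OF gM]]
  interpret G: gtensor A "tw P" M "gr A" by (rule tw_gtensor[OF gP gM])
  have fpt: "addhom M (PM P M) (ppm P M f)" by (rule PM_addhom(1)[OF gP gM]) (use fP in \<open>simp add: Psel\<close>)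
  {
   assume ez: "!!x. x : gr M i ==> e \<odot>\<^bsub>M\<^esub> x = \<zero>\<^bsub>M\<^esub>"
   have "U = \<zero>\<^bsub>PM P M\<^esub>" if "U : gr (PM P M) i" for U
    using that
   proof (induction rule: G.gr_induct)
    case (pure x y j k)
    have x: "x : gr A j" "x : ?H" using pure(1) by (simp_all add: Psel)
    have y: "y : carrier M" by (rule M.gr_closed(1)[OF pure(2)])
    note xa = \<psi>i(1)[OF HA(1)[OF x(2)]]
    have xy: "\<psi>i x \<odot>\<^bsub>M\<^esub> y : gr M i" using gr_modD(3)[OF gM \<psi>i_gr[OF x(1)] pure(2)] pure(3) by simp
    \<comment> \<open>In the twisted module x = x f is f acted upon by the preimage of x under
      \<psi>, which can be moved to y; writing f as f f inserts e in the same way.\<close>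
    have "ppm P M x y = ppm P M (\<psi>i x \<odot>\<^bsub>tw P\<^esub> f) y"
     using \<psi>i(2)[OF HA(1)[OF x(2)]] HA(2)[OF x(2)] by (simp add: Psel)
    also have "\<dots> = ppm P M f (\<psi>i x \<odot>\<^bsub>M\<^esub> y)" by (rule G.pt_smult) (use xa fP y in \<open>simp_all add: Psel\<close>)
    also have "\<dots> = ppm P M (e \<odot>\<^bsub>tw P\<^esub> f) (\<psi>i x \<odot>\<^bsub>M\<^esub> y)" using ff by (simp add: Psel f_def)
    also have "\<dots> = ppm P M f (e \<odot>\<^bsub>M\<^esub> (\<psi>i x \<odot>\<^bsub>M\<^esub> y))"
     by (rule G.pt_smult) (use ec fP xa y MD(3) in \<open>simp_all add: Psel\<close>)
    also have "\<dots> = \<zero>\<^bsub>PM P M\<^esub>" unfolding ez[OF xy] by (rule addhom_zero[OF M.ab G.tensor_abelian fpt])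
    finally show ?case .
   next
    case (neg U)
    interpret T: abelian_group "PM P M" by (rule G.tensor_abelian)
    show ?case using neg(2) T.add.inv_one by (simp add: a_inv_def)
   next
    case (add U V)
    interpret T: abelian_group "PM P M" by (rule G.tensor_abelian)
    show ?case using add by simp
   qed simp
   then have "gr (PM P M) i = {\<zero>\<^bsub>PM P M\<^esub>}" using additive_subgroupD(2)[OF G.gr_subgroup] by blast
   then show "Poly_Mapping.lookup (gdim K (PM P M)) i = 0" using dim[OF M] by blast
  }
  fix x assume x: "x : gr M i" "e \<odot>\<^bsub>M\<^esub> x ~= \<zero>\<^bsub>M\<^esub>"
  \<comment> \<open>This map sends f \<otimes> x to e x and thereby detects that f \<otimes> x is
    nonzero.\<close>
  have "balanced A (tw P) M M (%x y. \<psi>i x \<odot>\<^bsub>M\<^esub> y)"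
   by (rule balancedI) (simp_all add: Psel \<psi>i \<psi>(1) MD)
  then obtain \<Phi> where \<Phi>: "addhom (PM P M) M \<Phi>"
   "!!x y. [|x : carrier (tw P); y : carrier M|] ==> \<Phi> (ppm P M x y) = \<psi>i x \<odot>\<^bsub>M\<^esub> y"
   by (rule G.tensor_lift[OF M.ab, where act = "pair_act M"]) blast
  have "\<Phi> (ppm P M f x) = e \<odot>\<^bsub>M\<^esub> x"
   using \<Phi>(2)[of f x] fP M.gr_closed(1)[OF x(1)] \<psi>f by (simp add: Psel)
  then have "ppm P M f x ~= \<zero>\<^bsub>PM P M\<^esub>"
   using x(2) addhom_zero[OF G.tensor_abelian M.ab \<Phi>(1)] by metis
  moreover have "ppm P M f x : gr (PM P M) i"
   by (rule G.pt_gr[of f 0 x i]) (use f0 fP x(1) in \<open>simp_all add: Psel\<close>)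
  ultimately show "Poly_Mapping.lookup (gdim K (PM P M)) i ~= 0" using dim[OF M] by blast
 qed
qed

end

section \<open>Nondegeneracy of the pairing\<close>

context galgebra begin

text \<open>Induction on dimension: a module that is neither zero nor simple has a proper nonzero
  graded submodule, and both it and the quotient are of smaller dimension.\<close>

lemma simple_decomposition:
 assumes "M : fmods K A"
 shows "\<exists>v. keys v <= {S \<in> fmods K A. gr_simple A S} \<and> frag_of M - v : K0_rels A (fmods K A)"
 using assms
proof (induction "vdim K (kspace A M)" arbitrary: M rule: less_induct)
 case less
 have M: "fmod K A M" using less.prems by (simp add: fmods_def)
 then have g: "gr_left_module A M" and fd: "vfin K (kspace A M)" by (simp_all add: fmod_def)
 consider "carrier M = {\<zero>\<^bsub>M\<^esub>}" | "gr_simple A M"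
  | H where "carrier M ~= {\<zero>\<^bsub>M\<^esub>}" "gr_submodule A M H" "H ~= {\<zero>\<^bsub>M\<^esub>}" "H ~= carrier M"
  using g by (auto simp: gr_simple_def)
 then show ?case
 proof cases
  case 1
  \<comment> \<open>For the zero module this sequence gives [M] = [M] + [M], so the empty formal sum
    represents its class.\<close>
  have "short_exact A M M M" unfolding short_exact_def
   by (intro bexI[of _ "%x. x"] conjI) (auto simp: 1 gr_hom_iff module_hom_id)
  from K0_rels_exact[OF less.prems less.prems less.prems this]
  have "- frag_of M : K0_rels A (fmods K A)" by simp
  from K0_rels(3)[OF this] show ?thesis by (intro exI[of _ 0]) simp
 next
  case 2
  then show ?thesis using less.prems K0_rels(1) by (intro exI[of _ "frag_of M"]) simp
 next
  case 3
  note s = submodule_exact[OF M 3(2)]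
  let ?N = "sub_mod M H" and ?Q = "quot_mod M H"
  have gN: "left_module A ?N" "left_module A ?Q" and fN: "vfin K (kspace A ?N)" "vfin K (kspace A ?Q)"
   using s(1,2) by (auto simp: fmod_def gr_left_module_def)
  have "vdim K (kspace A ?N) ~= 0" using vdim_zero_iff[OF kspace_vs[OF gN(1)] fN(1)] 3(3) by simp
  moreover have "vdim K (kspace A ?Q) ~= 0" using vdim_zero_iff[OF kspace_vs[OF gN(2)] fN(2)] s(5) 3(4) by auto
  ultimately have lt: "vdim K (kspace A ?N) < vdim K (kspace A M)" "vdim K (kspace A ?Q) < vdim K (kspace A M)"
   using s(4) by simp_all
  have mem: "?N : fmods K A" "?Q : fmods K A" using s(1,2) by (simp_all add: fmods_def)
  obtain v where v: "keys v <= {S \<in> fmods K A. gr_simple A S}" "frag_of ?N - v : K0_rels A (fmods K A)"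
   using less.hyps[OF lt(1) mem(1)] by blast
  obtain w where w: "keys w <= {S \<in> fmods K A. gr_simple A S}" "frag_of ?Q - w : K0_rels A (fmods K A)"
   using less.hyps[OF lt(2) mem(2)] by blast
  have "frag_of M - (v + w) = (frag_of M - frag_of ?N - frag_of ?Q) + (frag_of ?N - v) + (frag_of ?Q - w)"
   by (simp add: algebra_simps)
  moreover have "\<dots> : K0_rels A (fmods K A)"
   by (intro K0_rels(2) v(2) w(2) K0_rels_exact[OF less.prems mem s(3)])
  ultimately have "frag_of M - (v + w) : K0_rels A (fmods K A)" by (simp only:)
  moreover have "keys (v + w) <= {S \<in> fmods K A. gr_simple A S}"
   using v(1) w(1) keys_add[of v w] by blast
  ultimately show ?thesis by blast
 qed
qed

lemma simple_representative:
 assumes "keys u <= fmods K A"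
 shows "\<exists>v. keys v <= {S \<in> fmods K A. gr_simple A S} \<and> u - v : K0_rels A (fmods K A)"
proof -
 have "\<forall>M \<in> fmods K A. \<exists>v. keys v <= {S \<in> fmods K A. gr_simple A S} \<and> frag_of M - v : K0_rels A (fmods K A)"
  using simple_decomposition by blast
 from bchoice[OF this] obtain F where F: "!!M. M : fmods K A ==> keys (F M) <= {S \<in> fmods K A. gr_simple A S}"
  "!!M. M : fmods K A ==> frag_of M - F M : K0_rels A (fmods K A)" by blast
 have "u - frag_extend F u = frag_extend (%M. frag_of M - F M) u"
  unfolding frag_extend_fun_diff using frag_expansion[of u] by simp
 moreover have "\<dots> : K0_rels A (fmods K A)"
  by (rule frag_extend_mem_rels) (use F(2) assms in blast)
 moreover have "keys (frag_extend F u) <= {S \<in> fmods K A. gr_simple A S}"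
  using keys_frag_extend[of F u] F(1) assms by blast
 ultimately show ?thesis by (intro exI[of _ "frag_extend F u"]) simp
qed

end

lemma lookup_of_int_mult: "Poly_Mapping.lookup (of_int c * f) i = c * Poly_Mapping.lookup f i"
 for f :: laurent
 by (induction c rule: int_induct[of _ 0]) (simp_all add: distrib_right left_diff_distrib lookup_add lookup_minus)

lemma lookup_frag_sum: "Poly_Mapping.lookup (frag_sum \<phi> u) i = frag_sum (%x. Poly_Mapping.lookup (\<phi> x) i) u"
 for \<phi> :: "'b => laurent"
 by (simp add: frag_sum_def lookup_sum lookup_of_int_mult)

section \<open>Separation of classes and uniqueness of adjoints\<close>

context nice_tower_alg begin

lemma frag_sum_mp_rels:
 assumes "P : pm n" "u : K0_rels (Al n) (fm n)"
 shows "frag_sum (mp n P) u = 0"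
 by (rule frag_sum_K0_rels[OF mp_exact[OF assms(1)] assms(2)])

text \<open>A representative with the fewest simple terms contains no two isomorphic ones. Were it
  nonempty, one of its terms, isolated in a degree where it is nonzero, would contribute a nonzero
  integer to a pairing that is zero.\<close>

lemma K0_pairing_nondegenerate:
 assumes u: "keys u <= fm n" and ann: "!!P. P : pm n ==> frag_sum (mp n P) u = 0"
 shows "u : K0_rels (Al n) (fm n)"
proof -
 let ?R = "K0_rels (Al n) (fm n)" and ?S = "{S \<in> fm n. gr_simple (Al n) S}"
 obtain v0 where "keys v0 <= ?S \<and> u - v0 : ?R" using G.simple_representative[OF u] by blast
 from ex_has_least_nat[of "%v. keys v <= ?S \<and> u - v : ?R", OF this, of "%v. card (keys v)"]
 obtain v where v: "keys v <= ?S" "u - v : ?R"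
  and min: "!!w. [|keys w <= ?S; u - w : ?R|] ==> card (keys v) \<le> card (keys w)"
  by blast
 have "v = 0"
 proof (rule ccontr)
  assume "v ~= 0"
  then obtain S where Sv: "S : keys v" by (metis all_not_in_conv keys_eq_empty)
  have Sf: "S : fm n" and S: "gr_simple (Al n) S" using Sv v(1) by auto
  have distinct: "T = S" if T: "T : keys v" and iso: "gr_iso (Al n) S T" for T
  proof (rule ccontr)
   assume ne: "T ~= S"
   let ?c = "Poly_Mapping.lookup v S"
   \<comment> \<open>The coefficient of S is moved onto the isomorphic module T. This changes the
     formal sum by a relation and saves the term S.\<close>
   let ?w = "v - frag_cmul ?c (frag_of S - frag_of T)"
   have "frag_of S - frag_of T : ?R" by (rule G.iso_fmods_rels[OF Sf _ iso]) (use T v(1) in blast)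
   then have "frag_cmul ?c (frag_of S - frag_of T) : ?R"
    by (rule K0_rels_cmul)
   from K0_rels(2)[OF v(2) this] have w: "u - ?w : ?R" by (simp add: algebra_simps)
   have sub: "keys ?w <= keys v - {S}"
   proof
    fix x assume "x : keys ?w"
    then have "Poly_Mapping.lookup ?w x ~= 0" by (simp add: in_keys_iff)
    then show "x : keys v - {S}"
     using ne T by (auto simp: lookup_minus in_keys_iff split: if_splits)
   qed
   then have "card (keys ?w) < card (keys v)"
    using Sv by (intro psubset_card_mono) auto
   moreover have "keys ?w <= ?S" using sub v(1) by blast
   ultimately show False using min[OF _ w] by simp
  qed
  have Sg: "gr_left_module (Al n) S" using S by (simp add: gr_simple_def)
  interpret Sg: graded S by (rule gr_graded[OF Sg])
  obtain x where x: "x : carrier S" "x ~= \<zero>\<^bsub>S\<^esub>"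
   using S additive_subgroupD(2)[OF Sg.gr_sub] Sg.zero_closed unfolding gr_simple_def by blast
  obtain i where i: "hcomp S i x ~= \<zero>\<^bsub>S\<^esub>" using Sg.hcomp_eq_zeroD[OF x(1)] x(2) by blast
  obtain e y where e: "e : gr (Al n) 0" "e \<otimes>\<^bsub>Al n\<^esub> e = e" and y: "y : gr S i" "y ~= \<zero>\<^bsub>S\<^esub>" "e \<odot>\<^bsub>S\<^esub> y = y"
   and iso: "!!(T :: ('a, 'a list) gr_module) x. [|gr_simple (Al n) T; x : gr T i; e \<odot>\<^bsub>T\<^esub> x ~= \<zero>\<^bsub>T\<^esub>|] ==> gr_iso (Al n) S T"
   by (rule G.isolating_idempotent[OF G.nice_degree_zero[OF nice_Al] S Sg.hcomp_gr[OF x(1)] i]) blast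
  obtain P :: "('a, 'a) gr_module" where P: "pmod (Al n) P"
   and zero: "!!(M :: ('a, 'a list) gr_module) i. [|fmod K (Al n) M; !!x. x : gr M i ==> e \<odot>\<^bsub>M\<^esub> x = \<zero>\<^bsub>M\<^esub>|]
    ==> Poly_Mapping.lookup (gdim K (W.PM n P M)) i = 0"
   and nonzero: "!!(M :: ('a, 'a list) gr_module) i x. [|fmod K (Al n) M; x : gr M i; e \<odot>\<^bsub>M\<^esub> x ~= \<zero>\<^bsub>M\<^esub>|]
    ==> Poly_Mapping.lookup (gdim K (W.PM n P M)) i ~= 0"
   by (rule W.projective_of_idempotent[OF e]) blast
  let ?P = "copy (Al n) P"
  note cP = G.copy_pmod[OF P]
  have Pm: "?P : pm n" using cP(1) by (simp add: pmods_def)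
  have eq: "mp n ?P M = gdim K (W.PM n P M)" if "M : fm n" for M
   using W.PM_iso[OF cP(1) P cP(2) _ _ gr_iso_refl, of M] that by (simp add: mp_def fmods_def)
  \<comment> \<open>The pairing with u vanishes by assumption, and u and v differ by relations,
    which pair to zero.\<close>
  have "frag_sum (mp n ?P) v = 0"
   using frag_sum_mp_rels[OF Pm v(2)] ann[OF Pm] by (simp add: frag_sum_diff)
  then have "0 = frag_sum (%M. Poly_Mapping.lookup (mp n ?P M) i) v"
   using lookup_frag_sum[of "mp n ?P" v i] by simp
  also have "\<dots> = (\<Sum>M\<in>keys v. Poly_Mapping.lookup v M * Poly_Mapping.lookup (mp n ?P M) i)"
   by (simp add: frag_sum_def)
  \<comment> \<open>On each other term e acts as zero in degree i, since a nonzero action would make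
    that term isomorphic to S and hence equal to S.\<close>
  also have "\<dots> = (\<Sum>M\<in>{S}. Poly_Mapping.lookup v M * Poly_Mapping.lookup (mp n ?P M) i)"
  proof (rule sum.mono_neutral_right)
   show "\<forall>M\<in>keys v - {S}. Poly_Mapping.lookup v M * Poly_Mapping.lookup (mp n ?P M) i = 0"
   proof
    fix T assume T: "T : keys v - {S}"
    then have Tf: "T : fm n" "gr_simple (Al n) T" using v(1) by auto
    have "e \<odot>\<^bsub>T\<^esub> x = \<zero>\<^bsub>T\<^esub>" if "x : gr T i" for x
     using distinct[of T] iso[OF Tf(2) that] T by blast
    then have "Poly_Mapping.lookup (mp n ?P T) i = 0"
     using zero[of T i] Tf(1) eq[OF Tf(1)] by (simp add: fmods_def)
    then show "Poly_Mapping.lookup v T * Poly_Mapping.lookup (mp n ?P T) i = 0" by simp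
   qed
  qed (use Sv in auto)
  also have "\<dots> ~= 0"
   using nonzero[of S y i] Sf y eq[OF Sf] Sv by (simp add: fmods_def in_keys_iff)
  finally show False by simp
 qed
 then show ?thesis using v(2) by simp
qed

text \<open>Pairing with the class of a single projective module in degree n reads only the
  component in degree n, so the components are separated one at a time.\<close>

lemma pairing_nondegenerate:
 assumes z: "z : carrier (GF K \<A>)" and z': "z' : carrier (GF K \<A>)"
  and eq: "!!x. x : carrier (KP \<A>) ==> pairing K \<A> x z = pairing K \<A> x z'"
 shows "z = z'"
proof -
 obtain v v' where v: "v : fam fm" "z = fcl v" and v': "v' : fam fm" "z' = fcl v'" using z z' by (auto simp: GF_carrier)
 have kv: "keys (v n) <= fm n" "keys (v' n) <= fm n" for n
  using v(1) v'(1) by (simp_all add: fam_def)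
 have "v n - v' n : K0_rels (Al n) (fm n)" for n
 proof (rule K0_pairing_nondegenerate)
  show "keys (v n - v' n) <= fm n" using keys_diff[of "v n" "v' n"] kv[of n] by blast
  fix P assume P: "P : pm n"
  let ?u = "(%_. 0)(n := frag_of P)"
  have u: "?u : fam pm" by (rule fam_single[of P pm n, OF P])
  have "pairing K \<A> (pcl ?u) (fcl w) = frag_sum (mp n P) (w n)" if "w : fam fm" for w
   using pairing_classes[OF u that, of "{n}"] by (simp add: mpf_def)
  then show "frag_sum (mp n P) (v n - v' n) = 0"
   using eq[of "pcl ?u"] u v v' by (simp add: KP_carrier frag_sum_diff)
 qed
 then show ?thesis unfolding v(2) v'(2) fcl_def K0_class_eq_iff[symmetric] by simp
qed

text \<open>The definite description denotes: \<open>adj\<close> supplies a value for every class,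
  and nondegeneracy leaves no other. Nondegeneracy then also identifies the value at y with any z
  that has the right pairings.\<close>

lemma right_mult_adjoint_eqI:
 assumes P: "pmod (Al p) P" and y: "y : carrier (GF K \<A>)" and z: "z : carrier (GF K \<A>)"
  and eq: "!!x. x : carrier (KP \<A>) ==> pairing K \<A> x z = pairing K \<A> (KP_mult K \<A> x (pclass \<A> p P)) y"
 shows "right_mult_adjoint K \<A> (pclass \<A> p P) y = z"
proof -
 let ?a = "pclass \<A> p P" and ?GF = "carrier (GF K \<A>)" and ?KP = "carrier (KP \<A>)"
 let ?adj = "%r. r : ?GF \<rightarrow>\<^sub>E ?GF \<and> (\<forall>x \<in> ?KP. \<forall>y \<in> ?GF. pairing K \<A> x (r y) = pairing K \<A> (KP_mult K \<A> x ?a) y)"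
 have Pc: "copy (Al p) P : pm p" using G.copy_pmod(1)[OF P] by (simp add: pmods_def)
 \<comment> \<open>\<open>adj\<close> operates on families of formal sums and not on classes; an
   operator on classes is obtained by choosing a value for each class.\<close>
 have "\<forall>y \<in> ?GF. \<exists>z. z : ?GF \<and> (\<forall>x \<in> ?KP. pairing K \<A> x z = pairing K \<A> (KP_mult K \<A> x ?a) y)"
 proof
  fix y assume "y : ?GF"
  then obtain v where v: "v : fam fm" "y = fcl v" by (auto simp: GF_carrier)
  show "\<exists>z. z : ?GF \<and> (\<forall>x \<in> ?KP. pairing K \<A> x z = pairing K \<A> (KP_mult K \<A> x ?a) y)"
   using pairing_adj[OF _ v(1) Pc] adj_fam[OF v(1) Pc] v(2)
   by (intro exI[of _ "fcl (adj p (copy (Al p) P) v)"]) (auto simp: GF_carrier KP_carrier pclass_pcl)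
 qed
 from bchoice[OF this] obtain f where f: "!!y. y : ?GF ==> f y : ?GF"
  "!!x y. [|y : ?GF; x : ?KP|] ==> pairing K \<A> x (f y) = pairing K \<A> (KP_mult K \<A> x ?a) y" by blast
 \<comment> \<open>The description ranges over extensional functions, whose values outside the
   carrier are fixed; hence the restriction.\<close>
 have ex: "?adj (restrict f ?GF)" using f by auto
 have uniq: "r = r'" if r: "?adj r" and r': "?adj r'" for r r'
 proof (rule PiE_ext[of _ ?GF "%_. ?GF"])
  fix y assume y: "y : ?GF"
  show "r y = r' y"
   by (rule pairing_nondegenerate) (use r r' y in \<open>auto simp: PiE_iff\<close>)
 qed (use r r' in auto)
 have "?adj (THE r. ?adj r)" by (rule theI[of ?adj, OF ex uniq[OF _ ex]])
 then have "?adj (right_mult_adjoint K \<A> ?a)" unfolding right_mult_adjoint_def .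
 then show ?thesis
  by (intro pairing_nondegenerate[OF _ z]) (use y eq in \<open>auto simp: PiE_iff\<close>)
qed

end

theorem proposition2p4p3:
  fixes K :: "'k ring" and \<A> :: "('k, 'a) tower"
    and P :: "('a, 'p) gr_module" and N :: "('a, 'n) gr_module"
    and p n :: nat
  assumes "field K" and "nice_tower K \<A>"
    and "pmod (alg \<A> p) P" and "fmod K (alg \<A> n) N"
  shows "(p \<le> n \<longrightarrow> fmod K (alg \<A> (n - p)) (TR K \<A> p n P N)) \<and>
    right_mult_adjoint K \<A> (pclass \<A> p P) (fclass K \<A> n N) =
      (if p > n then \<one>\<^bsub>GF K \<A>\<^esub> else fclass K \<A> (n - p) (TR K \<A> p n P N))"
proof -
 interpret nice_tower_alg K \<A> by (rule nice_tower_alg.intro) fact+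
 let ?P = "copy (alg \<A> p) P" and ?N = "copy (alg \<A> n) N"
 let ?v = "(%_. 0)(n := frag_of ?N)"
 note P = assms(3) and N = assms(4)
 note cP = G.copy_pmod[OF P] and cN = G.copy_fmod[OF N]
 have Pm: "?P : pm p" and Nm: "?N : fm n" using cP(1) cN(1) by (simp_all add: pmods_def fmods_def)
 note v = fam_single[of ?N fm n, OF Nm]
 have "right_mult_adjoint K \<A> (pclass \<A> p P) (fclass K \<A> n N) = fcl (adj p ?P ?v)"
  by (rule right_mult_adjoint_eqI[OF P])
   (use v adj_fam[OF v Pm] pairing_adj[OF _ v Pm] in \<open>auto simp: GF_carrier KP_carrier fclass_fcl pclass_pcl simp del: fun_upd_apply\<close>)
 \<comment> \<open>The family \<open>adj\<close> reads the components of its argument in degrees m +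
   p, and for p > n none of these equals n.\<close>
 moreover have "fcl (adj p ?P ?v) = \<one>\<^bsub>GF K \<A>\<^esub>" if "p > n"
  using that by (simp add: adj_def GF_one)
 moreover have "fmod K (alg \<A> (n - p)) (TR K \<A> p n P N) \<and>
   fcl (adj p ?P ?v) = fclass K \<A> (n - p) (TR K \<A> p n P N)" if le: "p \<le> n"
 proof -
  let ?m = "n - p"
  have n: "?m + p = n" using le by simp
  have T: "TR K \<A> p n P N = TRm ?m p P N" using n by (simp add: TRm_def)
  have fN: "fmod K (Al (?m + p)) N" "fmod K (Al (?m + p)) ?N" using N cN(1) n by simp_all
  note tf = TR_fmod[OF P fN(1)] and tf' = TR_fmod[OF cP(1) fN(2)]
  \<comment> \<open>The adjoint is computed from the copies of P and N on lists, whereas the claim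
    is about P and N; TR respects the isomorphisms between them, and isomorphic modules have the
    same class.\<close>
  have "gr_iso (Al ?m) (TRm ?m p ?P ?N) (TRm ?m p P N)"
   by (rule TR_iso[OF cP(1) P cP(2) fN(2,1)]) (use cN(2) n in simp)
  then have iso: "gr_iso (Al ?m) (copy (Al ?m) (TRm ?m p ?P ?N)) (copy (Al ?m) (TRm ?m p P N))"
   using G.copy_fmod[OF tf] G.copy_fmod[OF tf'] tf tf' unfolding fmod_def
   by (meson gr_iso_trans gr_iso_sym)
  \<comment> \<open>The argument is concentrated in degree n, which m + p meets exactly for m = n -
    p.\<close>
  have "adj p ?P ?v = (%_. 0)(?m := frag_of (copy (Al ?m) (TRm ?m p ?P ?N)))"
   using le by (auto simp: adj_def fun_eq_iff)
  moreover have "K0_class (Al ?m) (fm ?m) (frag_of (copy (Al ?m) (TRm ?m p ?P ?N))) =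
    K0_class (Al ?m) (fm ?m) (frag_of (copy (Al ?m) (TRm ?m p P N)))"
   unfolding K0_class_eq_iff
   by (rule G.iso_fmods_rels[OF _ _ iso]) (use G.copy_fmod(1)[OF tf] G.copy_fmod(1)[OF tf'] in \<open>simp_all add: fmods_def\<close>)
  ultimately show ?thesis using tf unfolding T by (simp add: fclass_fcl fcl_def fun_eq_iff)
 qed
 ultimately show ?thesis by auto
qed

end
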